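(* Let $X$ be a complex affine irreducible variety of dimension $n$ and let $G$ be a finite group of automorphisms of $X$. Suppose that $X/G$ is rational. Then $(\mathrm{Frac}(D(X)))^G\simeq F_n(\mathbb C)$.
   Context: For a complex affine variety $X$ with coordinate ring $\mathcal O(X)$, the ring of differential operators is $D(X)=\bigcup_{j\ge 0}D(X)_j$, where $D(X)_0=\mathcal O(X)$ and $D(X)_j=\{d\in \mathrm{End}_{\mathbb C}(\mathcal O(X)) : db-bd\in D(X)_{j-1}\text{ for all } b\in\mathcal O(X)\}$. For irreducible affine $X$ it is an Ore domain; $\mathrm{Frac}$ denotes the skew field of fractions. $G$ acts on $\mathcal O(X)$ by algebra automorphisms, on $D(X)$ by $g*d=g\circ d\circ g^{-1}$, and hence on $\mathrm{Frac}(D(X))$. $X/G$ is the quotient variety, with coordinate ring $\mathcal O(X)^G$; it is rational if it is birational to an affine space. $F_n(\mathbb C)$ is the skew field of fractions of the $n$-th Weyl algebra $A_n(\mathbb C)$, the algebra generated by $x_1,\dots,x_n,\partial_1,\dots,\partial_n$ with $\partial_i x_j-x_j\partial_i=\delta_{ij}$, $x_ix_j=x_jx_i$, $\partial_i\partial_j=\partial_j\partial_i$. *)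

theory Defs
  imports Complex_Main "HOL-Algebra.QuotRing" "HOL-Algebra.Module" "HOL-Algebra.Bij"
begin

section \<open>Algebras over the complex numbers\<close>

text \<open>
  A (not necessarily commutative) complex algebra is a record of type
  \<^typ>\<open>(complex, 'a) module\<close>: a ring together with scalar multiplication by complex numbers.
\<close>

definition algebra_iso ::
  "(complex, 'a) module \<Rightarrow> (complex, 'b) module \<Rightarrow> ('a \<Rightarrow> 'b) set" where
  "algebra_iso A B =
     {h \<in> ring_iso A B. \<forall>c. \<forall>x\<in>carrier A. h (c \<odot>\<^bsub>A\<^esub> x) = c \<odot>\<^bsub>B\<^esub> h x}"

definition algebra_isomorphic ::
  "(complex, 'a) module \<Rightarrow> (complex, 'b) module \<Rightarrow> bool" where
  "algebra_isomorphic A B \<longleftrightarrow> algebra_iso A B \<noteq> {}"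

definition invariants ::
  "(complex, 'a) module \<Rightarrow> ('a \<Rightarrow> 'a) set \<Rightarrow> (complex, 'a) module" where
  "invariants A \<Phi> = A\<lparr>carrier := {x \<in> carrier A. \<forall>\<phi>\<in>\<Phi>. \<phi> x = x}\<rparr>"


section \<open>Skew field of fractions of an Ore domain\<close>

text \<open>
  The pair \<open>(a, s)\<close> with \<open>s \<noteq> 0\<close> stands for the right fraction \<open>a s\<^sup>-\<^sup>1\<close>.  Two right fractions
  are equal if they agree after being brought to a common denominator \<open>s u = t v \<noteq> 0\<close>.
  Multiplication rewrites \<open>s\<^sup>-\<^sup>1 b\<close> as \<open>c u\<^sup>-\<^sup>1\<close> where \<open>s c = b u\<close>, so that
  \<open>a s\<^sup>-\<^sup>1 b t\<^sup>-\<^sup>1 = (a c) (t u)\<^sup>-\<^sup>1\<close>.  In the operations the unions range over all admissible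
  choices; for an Ore domain all choices give the same class.
\<close>

definition frac_class :: "(complex, 'a) module \<Rightarrow> 'a \<Rightarrow> 'a \<Rightarrow> ('a \<times> 'a) set" where
  "frac_class R a s =
     {(b, t). b \<in> carrier R \<and> t \<in> carrier R - {\<zero>\<^bsub>R\<^esub>} \<and>
        (\<exists>u\<in>carrier R. \<exists>v\<in>carrier R.
           s \<otimes>\<^bsub>R\<^esub> u = t \<otimes>\<^bsub>R\<^esub> v \<and> s \<otimes>\<^bsub>R\<^esub> u \<noteq> \<zero>\<^bsub>R\<^esub> \<and> a \<otimes>\<^bsub>R\<^esub> u = b \<otimes>\<^bsub>R\<^esub> v)}"

definition frac_mult ::
  "(complex, 'a) module \<Rightarrow> ('a \<times> 'a) set \<Rightarrow> ('a \<times> 'a) set \<Rightarrow> ('a \<times> 'a) set" where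
  "frac_mult R P Q =
     (\<Union>(a, s)\<in>P. \<Union>(b, t)\<in>Q.
        \<Union>(c, u)\<in>{(c, u). c \<in> carrier R \<and> u \<in> carrier R - {\<zero>\<^bsub>R\<^esub>} \<and>
                         s \<otimes>\<^bsub>R\<^esub> c = b \<otimes>\<^bsub>R\<^esub> u}.
          frac_class R (a \<otimes>\<^bsub>R\<^esub> c) (t \<otimes>\<^bsub>R\<^esub> u))"

definition frac_add ::
  "(complex, 'a) module \<Rightarrow> ('a \<times> 'a) set \<Rightarrow> ('a \<times> 'a) set \<Rightarrow> ('a \<times> 'a) set" where
  "frac_add R P Q =
     (\<Union>(a, s)\<in>P. \<Union>(b, t)\<in>Q.
        \<Union>(u, v)\<in>{(u, v). u \<in> carrier R \<and> v \<in> carrier R \<and>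
                         s \<otimes>\<^bsub>R\<^esub> u = t \<otimes>\<^bsub>R\<^esub> v \<and> s \<otimes>\<^bsub>R\<^esub> u \<noteq> \<zero>\<^bsub>R\<^esub>}.
          frac_class R (a \<otimes>\<^bsub>R\<^esub> u \<oplus>\<^bsub>R\<^esub> b \<otimes>\<^bsub>R\<^esub> v) (s \<otimes>\<^bsub>R\<^esub> u))"

definition frac_algebra :: "(complex, 'a) module \<Rightarrow> (complex, ('a \<times> 'a) set) module" where
  "frac_algebra R =
     \<lparr>carrier = {frac_class R a s | a s. a \<in> carrier R \<and> s \<in> carrier R - {\<zero>\<^bsub>R\<^esub>}},
      mult = frac_mult R,
      one = frac_class R \<one>\<^bsub>R\<^esub> \<one>\<^bsub>R\<^esub>,
      zero = frac_class R \<zero>\<^bsub>R\<^esub> \<one>\<^bsub>R\<^esub>,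
      add = frac_add R,
      smult = \<lambda>c P. \<Union>(a, s)\<in>P. frac_class R (c \<odot>\<^bsub>R\<^esub> a) s\<rparr>"

text \<open>The automorphism \<open>a s\<^sup>-\<^sup>1 \<mapsto> \<sigma>(a) \<sigma>(s)\<^sup>-\<^sup>1\<close> of the fractions induced by an automorphism \<open>\<sigma>\<close>.\<close>

definition frac_action :: "('a \<Rightarrow> 'a) \<Rightarrow> ('a \<times> 'a) set \<Rightarrow> ('a \<times> 'a) set" where
  "frac_action \<sigma> P = map_prod \<sigma> \<sigma> ` P"


section \<open>Weyl algebras\<close>

definition free_algebra :: "'g set \<Rightarrow> (complex, 'g list \<Rightarrow> complex) module" where
  "free_algebra S =
     \<lparr>carrier = {f. finite {w. f w \<noteq> 0} \<and> {w. f w \<noteq> 0} \<subseteq> lists S},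
      mult = \<lambda>f g w. \<Sum>i\<le>length w. f (take i w) * g (drop i w),
      one = \<lambda>w. if w = [] then 1 else 0,
      zero = \<lambda>w. 0,
      add = \<lambda>f g w. f w + g w,
      smult = \<lambda>c f w. c * f w\<rparr>"

definition generator :: "'g \<Rightarrow> 'g list \<Rightarrow> complex" where
  "generator g = (\<lambda>w. if w = [g] then 1 else 0)"

definition quotient_algebra ::
  "(complex, 'a) module \<Rightarrow> 'a set \<Rightarrow> (complex, 'a set) module" where
  "quotient_algebra A I =
     \<lparr>carrier = carrier (A Quot I),
      mult = mult (A Quot I),
      one = one (A Quot I),
      zero = zero (A Quot I),
      add = add (A Quot I),
      smult = \<lambda>c P. \<Union>x\<in>P. I +>\<^bsub>A\<^esub> (c \<odot>\<^bsub>A\<^esub> x)\<rparr>"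

datatype weyl_gen = Var nat | Der nat

definition weyl_gens :: "nat \<Rightarrow> weyl_gen set" where
  "weyl_gens n = Var ` {..<n} \<union> Der ` {..<n}"

definition weyl_relations :: "nat \<Rightarrow> (weyl_gen list \<Rightarrow> complex) set" where
  "weyl_relations n =
     (let F = free_algebra (weyl_gens n);
          x = (\<lambda>i. generator (Var i)); d = (\<lambda>i. generator (Der i))
      in {(d i \<otimes>\<^bsub>F\<^esub> x j \<ominus>\<^bsub>F\<^esub> x j \<otimes>\<^bsub>F\<^esub> d i) \<ominus>\<^bsub>F\<^esub> (if i = j then \<one>\<^bsub>F\<^esub> else \<zero>\<^bsub>F\<^esub>) |
            i j. i < n \<and> j < n}
       \<union> {x i \<otimes>\<^bsub>F\<^esub> x j \<ominus>\<^bsub>F\<^esub> x j \<otimes>\<^bsub>F\<^esub> x i | i j. i < n \<and> j < n}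
       \<union> {d i \<otimes>\<^bsub>F\<^esub> d j \<ominus>\<^bsub>F\<^esub> d j \<otimes>\<^bsub>F\<^esub> d i | i j. i < n \<and> j < n})"

text \<open>Ideals of \<open>HOL-Algebra\<close> are two-sided, also in noncommutative rings.\<close>

definition weyl_algebra :: "nat \<Rightarrow> (complex, (weyl_gen list \<Rightarrow> complex) set) module" where
  "weyl_algebra n =
     (let F = free_algebra (weyl_gens n) in quotient_algebra F (Idl\<^bsub>F\<^esub> (weyl_relations n)))"

definition weyl_field ::
  "nat \<Rightarrow> (complex, ((weyl_gen list \<Rightarrow> complex) set \<times> (weyl_gen list \<Rightarrow> complex) set) set) module"
  where "weyl_field n = frac_algebra (weyl_algebra n)"


section \<open>Differential operators\<close>

definition linear_endos :: "(complex, 'a) module \<Rightarrow> ('a \<Rightarrow> 'a) set" where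
  "linear_endos R =
     {d \<in> carrier R \<rightarrow>\<^sub>E carrier R.
        (\<forall>f\<in>carrier R. \<forall>g\<in>carrier R. d (f \<oplus>\<^bsub>R\<^esub> g) = d f \<oplus>\<^bsub>R\<^esub> d g) \<and>
        (\<forall>c. \<forall>f\<in>carrier R. d (c \<odot>\<^bsub>R\<^esub> f) = c \<odot>\<^bsub>R\<^esub> d f)}"

definition mult_operator :: "(complex, 'a) module \<Rightarrow> 'a \<Rightarrow> 'a \<Rightarrow> 'a" where
  "mult_operator R b = (\<lambda>f\<in>carrier R. b \<otimes>\<^bsub>R\<^esub> f)"

primrec diffops :: "(complex, 'a) module \<Rightarrow> nat \<Rightarrow> ('a \<Rightarrow> 'a) set" where
  "diffops R 0 = mult_operator R ` carrier R"
| "diffops R (Suc j) =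
     {d \<in> linear_endos R. \<forall>b\<in>carrier R.
        (\<lambda>f\<in>carrier R. d (b \<otimes>\<^bsub>R\<^esub> f) \<ominus>\<^bsub>R\<^esub> b \<otimes>\<^bsub>R\<^esub> d f) \<in> diffops R j}"

definition diffop_algebra :: "(complex, 'a) module \<Rightarrow> (complex, 'a \<Rightarrow> 'a) module" where
  "diffop_algebra R =
     \<lparr>carrier = (\<Union>j. diffops R j),
      mult = \<lambda>d e. compose (carrier R) d e,
      one = (\<lambda>f\<in>carrier R. f),
      zero = (\<lambda>f\<in>carrier R. \<zero>\<^bsub>R\<^esub>),
      add = \<lambda>d e. (\<lambda>f\<in>carrier R. d f \<oplus>\<^bsub>R\<^esub> e f),
      smult = \<lambda>c d. (\<lambda>f\<in>carrier R. c \<odot>\<^bsub>R\<^esub> d f)\<rparr>"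

definition diffop_action ::
  "(complex, 'a) module \<Rightarrow> ('a \<Rightarrow> 'a) \<Rightarrow> ('a \<Rightarrow> 'a) \<Rightarrow> ('a \<Rightarrow> 'a)" where
  "diffop_action R \<sigma> d = (\<lambda>f\<in>carrier R. \<sigma> (d (inv_into (carrier R) \<sigma> f)))"


section \<open>Complex affine varieties\<close>

type_synonym point = "nat \<Rightarrow> complex"

definition affine_space :: "nat \<Rightarrow> point set" where
  "affine_space m = {..<m} \<rightarrow>\<^sub>E UNIV"

inductive_set poly_functions :: "nat \<Rightarrow> (point \<Rightarrow> complex) set" for m :: nat where
  const: "(\<lambda>p. c) \<in> poly_functions m"
| coord: "i < m \<Longrightarrow> (\<lambda>p. p i) \<in> poly_functions m"
| add: "f \<in> poly_functions m \<Longrightarrow> g \<in> poly_functions m \<Longrightarrow> (\<lambda>p. f p + g p) \<in> poly_functions m"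
| mult: "f \<in> poly_functions m \<Longrightarrow> g \<in> poly_functions m \<Longrightarrow> (\<lambda>p. f p * g p) \<in> poly_functions m"

definition zariski_closed :: "nat \<Rightarrow> point set \<Rightarrow> bool" where
  "zariski_closed m Z \<longleftrightarrow>
     (\<exists>S\<subseteq>poly_functions m. Z = {p \<in> affine_space m. \<forall>f\<in>S. f p = 0})"

definition zariski_open_in :: "nat \<Rightarrow> point set \<Rightarrow> point set \<Rightarrow> bool" where
  "zariski_open_in m X U \<longleftrightarrow> (\<exists>Z. zariski_closed m Z \<and> U = X - Z)"

definition zariski_irreducible :: "nat \<Rightarrow> point set \<Rightarrow> bool" where
  "zariski_irreducible m X \<longleftrightarrow> X \<noteq> {} \<and>
     (\<forall>A B. zariski_closed m A \<and> zariski_closed m B \<and> X \<subseteq> A \<union> B \<longrightarrow> X \<subseteq> A \<or> X \<subseteq> B)"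

definition irreducible_affine_variety :: "nat \<Rightarrow> point set \<Rightarrow> bool" where
  "irreducible_affine_variety m X \<longleftrightarrow> zariski_closed m X \<and> zariski_irreducible m X"

definition coordinate_ring :: "nat \<Rightarrow> point set \<Rightarrow> (complex, point \<Rightarrow> complex) module" where
  "coordinate_ring m X =
     \<lparr>carrier = (\<lambda>f. restrict f X) ` poly_functions m,
      mult = \<lambda>f g. (\<lambda>p\<in>X. f p * g p),
      one = (\<lambda>p\<in>X. 1),
      zero = (\<lambda>p\<in>X. 0),
      add = \<lambda>f g. (\<lambda>p\<in>X. f p + g p),
      smult = \<lambda>c f. (\<lambda>p\<in>X. c * f p)\<rparr>"


subsection \<open>Dimension\<close>

text \<open>
  The dimension of an irreducible variety is the transcendence degree of its function field
  over the complex numbers.  A finite set \<open>B\<close> is algebraically independent if no nonzero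
  polynomial in the elements of \<open>B\<close> vanishes; \<open>E\<close> is the set of exponents of the monomials of
  such a polynomial and \<open>c\<close> gives its coefficients.
\<close>

definition function_field ::
  "nat \<Rightarrow> point set \<Rightarrow> (complex, ((point \<Rightarrow> complex) \<times> (point \<Rightarrow> complex)) set) module" where
  "function_field m X = frac_algebra (coordinate_ring m X)"

definition alg_independent :: "(complex, 'a) module \<Rightarrow> 'a set \<Rightarrow> bool" where
  "alg_independent K B \<longleftrightarrow> finite B \<and> B \<subseteq> carrier K \<and>
     (\<forall>(E :: ('a \<Rightarrow> nat) set) c. finite E \<and> E \<subseteq> (B \<rightarrow>\<^sub>E UNIV) \<and>
        (\<Oplus>\<^bsub>K\<^esub>e\<in>E. c e \<odot>\<^bsub>K\<^esub> (\<Otimes>\<^bsub>K\<^esub>b\<in>B. b [^]\<^bsub>K\<^esub> e b)) = \<zero>\<^bsub>K\<^esub> \<longrightarrow> (\<forall>e\<in>E. c e = 0))"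

definition transcendence_basis :: "(complex, 'a) module \<Rightarrow> 'a set \<Rightarrow> bool" where
  "transcendence_basis K B \<longleftrightarrow> alg_independent K B \<and>
     (\<forall>x\<in>carrier K - B. \<not> alg_independent K (insert x B))"

definition has_dimension :: "nat \<Rightarrow> point set \<Rightarrow> nat \<Rightarrow> bool" where
  "has_dimension m X n \<longleftrightarrow> (\<exists>B. transcendence_basis (function_field m X) B \<and> card B = n)"


subsection \<open>Morphisms, group actions and quotients\<close>

definition polynomial_map ::
  "nat \<Rightarrow> point set \<Rightarrow> nat \<Rightarrow> point set \<Rightarrow> (point \<Rightarrow> point) \<Rightarrow> bool" where
  "polynomial_map m X k Y \<phi> \<longleftrightarrow> \<phi> \<in> X \<rightarrow> Y \<and>
     (\<forall>i<k. \<exists>f\<in>poly_functions m. \<forall>p\<in>X. \<phi> p i = f p)"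

definition variety_automorphisms :: "nat \<Rightarrow> point set \<Rightarrow> (point \<Rightarrow> point) set" where
  "variety_automorphisms m X =
     {g \<in> Bij X. polynomial_map m X m X g \<and> polynomial_map m X m X (inv_into X g)}"

definition function_action ::
  "point set \<Rightarrow> (point \<Rightarrow> point) \<Rightarrow> (point \<Rightarrow> complex) \<Rightarrow> (point \<Rightarrow> complex)" where
  "function_action X g f = compose X f (inv_into X g)"

text \<open>
  \<open>Y\<close> is a model of \<open>X/G\<close>: pulling back along the quotient map \<open>\<pi>\<close> identifies the coordinate ring of
  \<open>Y\<close> with the ring of \<open>G\<close>-invariant functions on \<open>X\<close>.
\<close>

definition is_quotient_variety ::
  "nat \<Rightarrow> point set \<Rightarrow> (point \<Rightarrow> point) set \<Rightarrow> nat \<Rightarrow> point set \<Rightarrow> bool" where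
  "is_quotient_variety m X G k Y \<longleftrightarrow> irreducible_affine_variety k Y \<and>
     (\<exists>\<pi>. polynomial_map m X k Y \<pi> \<and>
        (\<lambda>f. compose X f \<pi>) \<in>
          algebra_iso (coordinate_ring k Y)
            (invariants (coordinate_ring m X) (function_action X ` G)))"

definition frac_diffop_action ::
  "nat \<Rightarrow> point set \<Rightarrow> (point \<Rightarrow> point)
     \<Rightarrow> (((point \<Rightarrow> complex) \<Rightarrow> (point \<Rightarrow> complex)) \<times> ((point \<Rightarrow> complex) \<Rightarrow> (point \<Rightarrow> complex))) set
     \<Rightarrow> (((point \<Rightarrow> complex) \<Rightarrow> (point \<Rightarrow> complex)) \<times> ((point \<Rightarrow> complex) \<Rightarrow> (point \<Rightarrow> complex))) set"
  where
  "frac_diffop_action m X g =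
     frac_action (diffop_action (coordinate_ring m X) (function_action X g))"


subsection \<open>Rationality\<close>

definition regular_on :: "nat \<Rightarrow> point set \<Rightarrow> (point \<Rightarrow> complex) \<Rightarrow> bool" where
  "regular_on m U h \<longleftrightarrow>
     (\<forall>p\<in>U. \<exists>W. zariski_open_in m U W \<and> p \<in> W \<and>
        (\<exists>f\<in>poly_functions m. \<exists>g\<in>poly_functions m. \<forall>q\<in>W. g q \<noteq> 0 \<and> h q = f q / g q))"

definition regular_map ::
  "nat \<Rightarrow> point set \<Rightarrow> nat \<Rightarrow> point set \<Rightarrow> (point \<Rightarrow> point) \<Rightarrow> bool" where
  "regular_map m U k V \<phi> \<longleftrightarrow> \<phi> \<in> U \<rightarrow> V \<and> (\<forall>i<k. regular_on m U (\<lambda>p. \<phi> p i))"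

definition birational :: "nat \<Rightarrow> point set \<Rightarrow> nat \<Rightarrow> point set \<Rightarrow> bool" where
  "birational m X k Y \<longleftrightarrow>
     (\<exists>U V \<phi> \<psi>. zariski_open_in m X U \<and> U \<noteq> {} \<and> zariski_open_in k Y V \<and> V \<noteq> {} \<and>
        regular_map m U k V \<phi> \<and> regular_map k V m U \<psi> \<and>
        (\<forall>p\<in>U. \<psi> (\<phi> p) = p) \<and> (\<forall>q\<in>V. \<phi> (\<psi> q) = q))"

definition rational_variety :: "nat \<Rightarrow> point set \<Rightarrow> bool" where
  "rational_variety m X \<longleftrightarrow> (\<exists>k. birational m X k (affine_space k))"

end

theory Submission
 imports Defs "HOL-Algebra.Multiplicative_Group" "HOL-Library.Multiset" "HOL-Library.FuncSet"
begin

notation monoid.mult (infixl "**\<index>" 70) and ring.add (infixl "+.\<index>" 65)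

text \<open>
 Write A for the coordinate ring of X.  Rationality of X/G gives coordinates u/w and commuting derivations of
 the ring of invariants dual to them; elements a, b of A with (sum of a g(b)) = s for g = 1 and 0 otherwise
 extend these derivations to A.  In Q = Frac D(A) the coordinates and the rescaled derivations satisfy the Weyl
 relations, which embeds the Weyl field with image F fixed by G.  The elements of Q preserving the finite
 dimensional right F-space spanned by A form a skew field containing A and the derivations, hence, integrating
 commutators with the coordinates, all of D(A); so Q is spanned by A over F, and averaging over G shows that
 the invariants are F.  Transcendence degree is compared by derivations and by counting monomials.
\<close>

text \<open>\<open>X\<close> and \<open>X/G\<close> may be singular and the quotient map may ramify,
  so D(X) need not be finitely generated or noetherian, and dual bases over the invariants and
  extensions of derivations exist only up to an invariant factor. This shapes the proof: the Ore
  property is a consequence of growth, and the elements \<open>s\<close>, \<open>w\<close>,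
  \<open>f\<close> keep all identities free of fractions until they become invertible in Frac D(A).
  The step from operators to fractions is the delicate one, since an inverse is not a finite sum of
  known terms. The stabilizer of a finite dimensional right space settles it: such a stabilizer is
  closed under inverses for reasons of dimension, so it is all of Q as soon as it contains D(A).
  Commutators with the coordinates lower the order of an operator, and characteristic 0 permits
  integrating them back. Rationality supplies an affine space of some dimension \<open>d\<close>, a
  priori unrelated to \<open>n\<close>; the equality \<open>d = n\<close> is proved on the function
  field of \<open>X\<close>, where derivations give \<open>d <= n\<close> and counting monomials
  gives \<open>n <= d\<close>.\<close>

section \<open>Complex algebras, Ore domains and division algebras\<close>

locale calgebra = ring A for A :: "(complex, 'a) module" (structure) +
 assumes smult_closed [simp, intro]: "x : carrier A ==> c \<odot> x : carrier A"
 and smult_add_left: "x : carrier A ==> (c + d) \<odot> x = c \<odot> x +. d \<odot> x"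
 and smult_add_right: "[|x : carrier A; y : carrier A|] ==> c \<odot> (x +. y) = c \<odot> x +. c \<odot> y"
 and smult_assoc: "x : carrier A ==> (c * d) \<odot> x = c \<odot> (d \<odot> x)"
 and smult_one [simp]: "x : carrier A ==> 1 \<odot> x = x"
 and smult_mult_left: "[|x : carrier A; y : carrier A|] ==> c \<odot> (x ** y) = (c \<odot> x) ** y"
 and smult_mult_right: "[|x : carrier A; y : carrier A|] ==> c \<odot> (x ** y) = x ** (c \<odot> y)"
begin

lemma smult_zero_left [simp]: "x : carrier A ==> 0 \<odot> x = \<zero>"
proof -
 assume x: "x : carrier A"
 have "0 \<odot> x +. 0 \<odot> x = 0 \<odot> x"
 using smult_add_left[OF x, of 0 0] by simp
 then show ?thesis using x by (metis add.l_cancel_one smult_closed)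
qed

lemma smult_zero_right [simp]: "c \<odot> \<zero> = \<zero>"
 by (metis mult_zero_right smult_assoc smult_zero_left zero_closed)

lemma smult_minus_left: "x : carrier A ==> (- c) \<odot> x = \<ominus> (c \<odot> x)"
proof -
 assume x: "x : carrier A"
 have "(- c) \<odot> x +. c \<odot> x = \<zero>"
 using smult_add_left[OF x, of "- c" c] x by simp
 then show ?thesis using x by (metis minus_equality smult_closed)
qed

lemma smult_minus_right: "x : carrier A ==> c \<odot> (\<ominus> x) = \<ominus> (c \<odot> x)"
proof -
 assume x: "x : carrier A"
 have "c \<odot> (\<ominus> x) +. c \<odot> x = \<zero>"
 using smult_add_right[of "\<ominus> x" x c] x by (simp add: l_neg)
 then show ?thesis using x by (metis minus_equality smult_closed a_inv_closed)
qed

lemma smult_eq_zero: "[|x : carrier A; c \<odot> x = \<zero>; c ~= 0|] ==> x = \<zero>"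
 by (metis left_inverse smult_assoc smult_one smult_zero_right)

lemma smult_smult [simp]: "x : carrier A ==> c \<odot> (d \<odot> x) = (c * d) \<odot> x"
 by (simp add: smult_assoc)

lemma mult_smult_left [simp]: "[|x : carrier A; y : carrier A|] ==> (c \<odot> x) ** y = c \<odot> (x ** y)"
 by (simp add: smult_mult_left)

lemma mult_smult_right [simp]: "[|x : carrier A; y : carrier A|] ==> x ** (c \<odot> y) = c \<odot> (x ** y)"
 by (simp add: smult_mult_right)

lemma smult_finsum:
 "[|finite I; f : I \<rightarrow> carrier A|] ==> c \<odot> (\<Oplus>i\<in>I. f i) = (\<Oplus>i\<in>I. c \<odot> f i)"
proof (induct set: finite)
 case (insert i I)
 then show ?case
 by (simp add: smult_add_right Pi_def)
qed simp

end

text \<open>Only common right multiples are required: fractions have their denominators on the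
  right, and equality, sum and product of such fractions need nothing else.\<close>

locale ore_domain = calgebra A for A :: "(complex, 'a) module" (structure) +
 assumes one_neq_zero [simp]: "\<one> ~= \<zero>"
 and no_zero_div: "[|x : carrier A; y : carrier A; x ** y = \<zero>|] ==> x = \<zero> \<or> y = \<zero>"
 and ore: "[|a : carrier A; b : carrier A; a ~= \<zero>; b ~= \<zero>|] ==>
 \<exists>u\<in>carrier A. \<exists>v\<in>carrier A. a ** u = b ** v & a ** u ~= \<zero>"

locale division_algebra = calgebra A for A :: "(complex, 'a) module" (structure) +
 assumes one_neq_zero [simp]: "\<one> ~= \<zero>"
 and nonzero_Units: "[|x : carrier A; x ~= \<zero>|] ==> x : Units A"
begin

lemma inv_closed' [simp, intro]: "[|x : carrier A; x ~= \<zero>|] ==> inv x : carrier A"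
 by (simp add: nonzero_Units)

lemma r_inv' [simp]: "[|x : carrier A; x ~= \<zero>|] ==> x ** inv x = \<one>"
 by (simp add: nonzero_Units)

lemma l_inv' [simp]: "[|x : carrier A; x ~= \<zero>|] ==> inv x ** x = \<one>"
 by (simp add: nonzero_Units)

lemma no_zero_div:
 assumes "x : carrier A" "y : carrier A" "x ** y = \<zero>"
 shows "x = \<zero> \<or> y = \<zero>"
proof (rule ccontr)
 assume "\<not> ?thesis"
 then have x: "x ~= \<zero>" "y ~= \<zero>" by auto
 have "y = inv x ** x ** y" using assms(1,2) x by simp
 also have "... = inv x ** (x ** y)" using assms(1,2) x by (intro m_assoc) auto
 also have "... = \<zero>" using assms x by simp
 finally show False using x by blast
qed

lemma inv_nonzero [simp]: "[|x : carrier A; x ~= \<zero>|] ==> inv x ~= \<zero>"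
 by (metis inv_closed' l_inv' l_null one_neq_zero)

lemma mult_nonzero: "[|x : carrier A; y : carrier A; x ~= \<zero>; y ~= \<zero>|] ==> x ** y ~= \<zero>"
 using no_zero_div by blast

lemma inv_mult': "[|x : carrier A; y : carrier A; x ~= \<zero>; y ~= \<zero>|] ==> inv (x ** y) = inv y ** inv x"
 by (rule inv_char) (simp_all add: m_assoc[symmetric], simp_all add: m_assoc)

lemma mult_left_cancel:
 "[|x : carrier A; y : carrier A; z : carrier A; x ~= \<zero>; x ** y = x ** z|] ==> y = z"
 by (metis Units_l_cancel nonzero_Units)

lemma mult_right_cancel:
 assumes "x : carrier A" "y : carrier A" "z : carrier A" "x ~= \<zero>" "y ** x = z ** x"
 shows "y = z"
proof -
 have "y ** x ** inv x = z ** x ** inv x" using assms by simp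
 then show ?thesis using assms(1-4) by (simp add: m_assoc)
qed

lemma mult_inv_cancel [simp]: "[|x : carrier A; y : carrier A; x ~= \<zero>|] ==> y ** x ** inv x = y"
 by (simp add: m_assoc)

lemma mult_inv_cancel2 [simp]: "[|x : carrier A; y : carrier A; x ~= \<zero>|] ==> y ** inv x ** x = y"
 by (simp add: m_assoc)

lemma mult_inv_cancel3 [simp]: "[|x : carrier A; y : carrier A; x ~= \<zero>|] ==> x ** (inv x ** y) = y"
 by (simp add: m_assoc[symmetric])

lemma mult_inv_cancel4 [simp]: "[|x : carrier A; y : carrier A; x ~= \<zero>|] ==> inv x ** (x ** y) = y"
 by (simp add: m_assoc[symmetric])

end

section \<open>Homomorphisms of algebras\<close>

definition algebra_hom :: "(complex, 'a) module => (complex, 'b) module => ('a => 'b) set" where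
 "algebra_hom A B = {h : ring_hom A B. ALL c. \<forall>x\<in>carrier A. h (c \<odot>\<^bsub>A\<^esub> x) = c \<odot>\<^bsub>B\<^esub> h x}"

lemma algebra_homI:
 assumes "!!x. x : carrier A ==> h x : carrier B"
 and "!!x y. [|x : carrier A; y : carrier A|] ==> h (x **\<^bsub>A\<^esub> y) = h x **\<^bsub>B\<^esub> h y"
 and "!!x y. [|x : carrier A; y : carrier A|] ==> h (x +.\<^bsub>A\<^esub> y) = h x +.\<^bsub>B\<^esub> h y"
 and "h \<one>\<^bsub>A\<^esub> = \<one>\<^bsub>B\<^esub>"
 and "!!c x. x : carrier A ==> h (c \<odot>\<^bsub>A\<^esub> x) = c \<odot>\<^bsub>B\<^esub> h x"
 shows "h : algebra_hom A B"
 using assms by (auto simp: algebra_hom_def ring_hom_def)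

lemma algebra_homD:
 assumes "h : algebra_hom A B"
 shows "x : carrier A ==> h x : carrier B"
 and "[|x : carrier A; y : carrier A|] ==> h (x **\<^bsub>A\<^esub> y) = h x **\<^bsub>B\<^esub> h y"
 and "[|x : carrier A; y : carrier A|] ==> h (x +.\<^bsub>A\<^esub> y) = h x +.\<^bsub>B\<^esub> h y"
 and "h \<one>\<^bsub>A\<^esub> = \<one>\<^bsub>B\<^esub>"
 and "x : carrier A ==> h (c \<odot>\<^bsub>A\<^esub> x) = c \<odot>\<^bsub>B\<^esub> h x"
 using assms by (auto simp: algebra_hom_def ring_hom_def)

lemma algebra_hom_compose:
 "[|f : algebra_hom A B; g : algebra_hom B C|] ==> (%x. g (f x)) : algebra_hom A C"
 by (auto simp: algebra_hom_def ring_hom_def Pi_def)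

context
 fixes A :: "(complex, 'a) module" and B :: "(complex, 'b) module" and h
 assumes A: "calgebra A" and B: "calgebra B" and h: "h : algebra_hom A B"
begin

interpretation A: calgebra A by (rule A)
interpretation B: calgebra B by (rule B)

lemma algebra_hom_zero: "h \<zero>\<^bsub>A\<^esub> = \<zero>\<^bsub>B\<^esub>"
proof -
 have "h (0 \<odot>\<^bsub>A\<^esub> \<zero>\<^bsub>A\<^esub>) = 0 \<odot>\<^bsub>B\<^esub> h \<zero>\<^bsub>A\<^esub>" by (rule algebra_homD(5)[OF h A.zero_closed])
 also have "... = \<zero>\<^bsub>B\<^esub>" by (rule B.smult_zero_left[OF algebra_homD(1)[OF h A.zero_closed]])
 finally show ?thesis by (simp only: A.smult_zero_right)
qed

lemma algebra_hom_a_inv: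
 assumes x: "x : carrier A" shows "h (\<ominus>\<^bsub>A\<^esub> x) = \<ominus>\<^bsub>B\<^esub> h x"
proof -
 have "h (\<ominus>\<^bsub>A\<^esub> x) +.\<^bsub>B\<^esub> h x = \<zero>\<^bsub>B\<^esub>"
 using x by (simp only: algebra_homD(3)[OF h, symmetric] A.l_neg A.a_inv_closed algebra_hom_zero)
 then show ?thesis using x B.minus_equality algebra_homD(1)[OF h] by simp
qed

lemma algebra_hom_minus:
 assumes "x : carrier A" "y : carrier A" shows "h (x \<ominus>\<^bsub>A\<^esub> y) = h x \<ominus>\<^bsub>B\<^esub> h y"
 using assms by (simp add: a_minus_def algebra_homD[OF h] algebra_hom_a_inv)

lemma algebra_hom_finsum:
 assumes "finite I" "f : I \<rightarrow> carrier A"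
 shows "h (finsum A f I) = finsum B (%i. h (f i)) I"
 using assms
proof (induct set: finite)
 case empty then show ?case by (simp add: algebra_hom_zero)
next
 case (insert i I)
 then show ?case
 by (simp add: algebra_homD[OF h] Pi_def)
qed

lemma algebra_hom_inj_on:
 assumes "!!x. [|x : carrier A; h x = \<zero>\<^bsub>B\<^esub>|] ==> x = \<zero>\<^bsub>A\<^esub>"
 shows "inj_on h (carrier A)"
proof (rule inj_onI)
 fix x y assume xy: "x : carrier A" "y : carrier A" "h x = h y"
 then have "h (x \<ominus>\<^bsub>A\<^esub> y) = \<zero>\<^bsub>B\<^esub>"
 by (simp add: algebra_hom_minus algebra_homD[OF h])
 then have "x \<ominus>\<^bsub>A\<^esub> y = \<zero>\<^bsub>A\<^esub>" using assms xy by simp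
 then show "x = y" using xy by simp
qed

lemma algebra_hom_inv:
 assumes "division_algebra A" "division_algebra B" "x : carrier A" "x ~= \<zero>\<^bsub>A\<^esub>"
 shows "h x ~= \<zero>\<^bsub>B\<^esub>" "h (inv\<^bsub>A\<^esub> x) = inv\<^bsub>B\<^esub> h x"
proof -
 interpret A: division_algebra A by fact
 interpret B: division_algebra B by fact
 have 1: "h x **\<^bsub>B\<^esub> h (inv\<^bsub>A\<^esub> x) = \<one>\<^bsub>B\<^esub>" "h (inv\<^bsub>A\<^esub> x) **\<^bsub>B\<^esub> h x = \<one>\<^bsub>B\<^esub>"
 using assms by (simp_all add: algebra_homD(2)[OF h, symmetric] algebra_homD(4)[OF h])
 show "h x ~= \<zero>\<^bsub>B\<^esub>" using 1(1) algebra_homD(1)[OF h, of "inv\<^bsub>A\<^esub> x"] assms(3,4)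
 by (metis A.inv_closed' B.l_null B.one_neq_zero)
 show "h (inv\<^bsub>A\<^esub> x) = inv\<^bsub>B\<^esub> h x"
 by (rule B.inv_char[symmetric]) (use 1 assms algebra_homD(1)[OF h] in auto)
qed

end

section \<open>The skew field of right fractions\<close>

context ore_domain
begin

abbreviation "Nz == carrier A - {\<zero>}"

lemma mult_nonzero: "[|x : carrier A; y : carrier A; x ~= \<zero>; y ~= \<zero>|] ==> x ** y ~= \<zero>"
 using no_zero_div by blast

lemma mult_left_cancel:
 assumes "x : carrier A" "y : carrier A" "z : carrier A" "x ~= \<zero>" "x ** y = x ** z"
 shows "y = z"
proof -
 have "x ** (y \<ominus> z) = x ** y \<ominus> x ** z" using assms by algebra
 also have "... = \<zero>" using assms by simp
 finally show ?thesis using assms no_zero_div[of x "y \<ominus> z"] by simp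
qed

lemma mult_right_cancel:
 assumes "x : carrier A" "y : carrier A" "z : carrier A" "x ~= \<zero>" "y ** x = z ** x"
 shows "y = z"
proof -
 have "(y \<ominus> z) ** x = y ** x \<ominus> z ** x" using assms by algebra
 also have "... = \<zero>" using assms by simp
 finally show ?thesis using assms no_zero_div[of "y \<ominus> z" x] by simp
qed

lemma oreE:
 assumes "a : Nz" "b : Nz"
 obtains u v where "u : Nz" "v : Nz" "a ** u = b ** v" "a ** u : Nz"
proof -
 obtain u v where "u : carrier A" "v : carrier A" "a ** u = b ** v" "a ** u ~= \<zero>"
 using ore assms by blast
 with assms show ?thesis by (intro that[of u v]) auto
qed

lemma mem_frac_class:
 "(b, t) : frac_class A a s \<longleftrightarrow> b : carrier A & t : Nz &
 (\<exists>u\<in>carrier A. \<exists>v\<in>carrier A. s ** u = t ** v & s ** u ~= \<zero> & a ** u = b ** v)"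
 by (simp add: frac_class_def)

lemma frac_class_self:
 assumes "a : carrier A" "s : Nz"
 shows "(a, s) : frac_class A a s"
 using assms by (auto simp: mem_frac_class intro!: bexI[of _ \<one>])

text \<open>Membership in a class provides one pair of multipliers; by the Ore condition any other
  pair is compared with it at a common multiple of \<open>s ** u\<close> and \<open>s ** u'\<close>,
  and cancellation on both sides finishes. All independence of choices below rests on this.\<close>

lemma frac_class_agree:
 assumes "(b, t) : frac_class A a s" "a : carrier A" "s : Nz"
 and "u : carrier A" "v : carrier A" "s ** u = t ** v"
 shows "a ** u = b ** v"
proof (cases "u = \<zero>")
 case True
 then have "v = \<zero>" using assms no_zero_div[of t v] by (auto simp: mem_frac_class)
 then show ?thesis using True assms by (simp add: mem_frac_class)
next
 case False
 from assms(1) obtain u' v' where b: "b : carrier A" "t : Nz" and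
 uv: "u' : carrier A" "v' : carrier A" "s ** u' = t ** v'" "s ** u' ~= \<zero>" "a ** u' = b ** v'"
 by (auto simp: mem_frac_class)
 have "s ** u : Nz" using False assms(3,4) mult_nonzero[of s u] by auto
 moreover have "s ** u' : Nz" using assms(3) uv(1,4) by auto
 ultimately obtain x x' where x: "x : Nz" "x' : Nz" "s ** u ** x = s ** u' ** x'"
 by (rule oreE)
 have 1: "u ** x = u' ** x'"
 by (rule mult_left_cancel[of s])
 (use assms(3,4) x uv(1) m_assoc[of s u x] m_assoc[of s u' x'] in auto)
 have "t ** v ** x = t ** v' ** x'" using x(3) assms(6) uv(3) by simp
 then have 2: "v ** x = v' ** x'"
 using mult_left_cancel[of t "v ** x" "v' ** x'"] b(2) assms(5) x(1,2) uv(2)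
 by (simp add: m_assoc)
 have "a ** u ** x = a ** u' ** x'" using 1 assms(2,4) uv(1) x(1,2) by (simp add: m_assoc)
 also have "... = b ** v' ** x'" using uv(5) by simp
 also have "... = b ** (v ** x)" using 2 uv(2) x(2) b(1) by (simp add: m_assoc)
 also have "... = b ** v ** x" using assms(5) x(1) b(1) by (simp add: m_assoc)
 finally show ?thesis using mult_right_cancel[of x "a ** u" "b ** v"] x(1) assms(2,4,5) b(1) by blast
qed

text \<open>This is the transitivity of equality of fractions: the witness is enlarged to a common
  multiple with the denominator of the third fraction. The inclusion is used twice, with the roles
  exchanged.\<close>

lemma frac_class_eqI:
 assumes "a : carrier A" "s : Nz" "b : carrier A" "t : Nz"
 and "u : carrier A" "v : Nz" "s ** u = t ** v" "a ** u = b ** v"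
 shows "frac_class A a s = frac_class A b t"
proof -
 have sub: "frac_class A a s <= frac_class A b t"
 if *: "a : carrier A" "s : Nz" "b : carrier A" "t : Nz"
 "u : carrier A" "v : carrier A" "s ** u = t ** v" "s ** u ~= \<zero>" "a ** u = b ** v" for a s b t u v
 proof
 fix p assume p: "p : frac_class A a s"
 obtain c r where [simp]: "p = (c, r)" by force
 have c: "c : carrier A" "r : Nz" using p by (auto simp: mem_frac_class)
 have "s ** u : Nz" using * by auto
 from oreE[OF this c(2)] obtain x w where x: "x : Nz" "w : Nz" "s ** u ** x = r ** w" "s ** u ** x : Nz"
 by metis
 have 1: "a ** (u ** x) = c ** w"
 using frac_class_agree[of c r a s "u ** x" w] p x *(1,2,5) m_assoc[of s u x] by auto
 have "t ** (v ** x) = r ** w" using x * by (simp add: m_assoc[symmetric])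
 moreover have "b ** (v ** x) = c ** w" using 1 x * by (simp add: m_assoc[symmetric])
 moreover have "t ** (v ** x) ~= \<zero>" using x * by (simp add: m_assoc[symmetric])
 ultimately show "p : frac_class A b t" using c x(1,2) *(3,4,6)
 unfolding \<open>p = (c, r)\<close> mem_frac_class by blast
 qed
 have nz: "s ** u ~= \<zero>" using assms mult_nonzero by auto
 show ?thesis
 using sub[of a s b t u v] sub[of b t a s v u] assms nz by auto
qed

lemma frac_class_mult_right:
 assumes "a : carrier A" "s : Nz" "u : Nz"
 shows "frac_class A (a ** u) (s ** u) = frac_class A a s"
 using assms mult_nonzero by (intro frac_class_eqI[of _ _ _ _ \<one> u]) auto

text \<open>The operation is a union over all representatives and all multipliers. Every choice
  contributes the same class and at least one choice exists, so the union collapses to that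
  class.\<close>

lemma frac_add_general:
 assumes "a : carrier A" "s : Nz" "b : carrier A" "t : Nz"
 and uv: "u : carrier A" "v : carrier A" "s ** u = t ** v" "s ** u ~= \<zero>"
 shows "frac_add A (frac_class A a s) (frac_class A b t) = frac_class A (a ** u +. b ** v) (s ** u)"
proof -
 have "frac_class A (a' ** u' +. b' ** v') (s' ** u') = frac_class A (a ** u +. b ** v) (s ** u)"
 if *: "(a', s') : frac_class A a s" "(b', t') : frac_class A b t"
 "u' : carrier A" "v' : carrier A" "s' ** u' = t' ** v'" "s' ** u' ~= \<zero>" for a' s' b' t' u' v'
 proof -
 have c: "a' : carrier A" "s' : Nz" "b' : carrier A" "t' : Nz" using * by (auto simp: mem_frac_class)
 have "s' ** u' : Nz" "s ** u : Nz" using * c assms by auto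
 then obtain x' x where x: "x' : Nz" "x : Nz" "s' ** u' ** x' = s ** u ** x" by (rule oreE)
 have 1: "a ** (u ** x) = a' ** (u' ** x')"
 using frac_class_agree[of a' s' a s "u ** x" "u' ** x'"] x *(1,3) c assms(1,2,5) m_assoc[of s u x] m_assoc[of s' u' x'] by auto
 have "t ** v ** x = t' ** v' ** x'" using x *(5) assms(7) by simp
 then have 2: "b ** (v ** x) = b' ** (v' ** x')"
 by (intro frac_class_agree[of b' t' b t]) (use x * c assms in \<open>auto simp: m_assoc\<close>)
 have "(a' ** u' +. b' ** v') ** x' = (a ** u +. b ** v) ** x"
 using 1 2 x c * assms by (simp add: l_distr m_assoc)
 then show ?thesis using x c * assms by (intro frac_class_eqI[of _ _ _ _ x' x]) auto
 qed
 moreover have "(a, s) : frac_class A a s" "(b, t) : frac_class A b t"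
 using assms by (auto intro: frac_class_self)
 ultimately show ?thesis using uv unfolding frac_add_def
 by (intro equalityI subsetI) (blast, (rule UN_I, assumption, clarify)+, blast)
qed

lemma frac_add_class:
 assumes "a : carrier A" "b : carrier A" "s : Nz"
 shows "frac_add A (frac_class A a s) (frac_class A b s) = frac_class A (a +. b) s"
 using frac_add_general[of a s b s \<one> \<one>] assms by simp

text \<open>Independence of choices uses \<open>frac_class_agree\<close> twice: for the second
  factor it compares \<open>b ** u\<close> with \<open>b' ** u'\<close>, the defining equations
  carry this over to \<open>s ** c\<close> and \<open>s' ** c'\<close>, and for the first factor it
  then compares the numerators.\<close>

lemma frac_mult_general:
 assumes "a : carrier A" "s : Nz" "b : carrier A" "t : Nz"
 and uv: "c : carrier A" "u : Nz" "s ** c = b ** u"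
 shows "frac_mult A (frac_class A a s) (frac_class A b t) = frac_class A (a ** c) (t ** u)"
proof -
 have "frac_class A (a' ** c') (t' ** u') = frac_class A (a ** c) (t ** u)"
 if *: "(a', s') : frac_class A a s" "(b', t') : frac_class A b t"
 "c' : carrier A" "u' : Nz" "s' ** c' = b' ** u'" for a' s' b' t' c' u'
 proof -
 have c: "a' : carrier A" "s' : Nz" "b' : carrier A" "t' : Nz" using * by (auto simp: mem_frac_class)
 have tu: "t' ** u' : Nz" "t ** u : Nz" using * c assms mult_nonzero by auto
 then obtain x' x where x: "x' : Nz" "x : Nz" "t' ** u' ** x' = t ** u ** x" by (rule oreE)
 have "b ** (u ** x) = b' ** (u' ** x')"
 by (rule frac_class_agree[of b' t' b t]) (use x * c assms in \<open>auto simp: m_assoc\<close>)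
 then have "s ** (c ** x) = s' ** (c' ** x')"
 using x * c assms by (simp add: m_assoc[symmetric])
 then have "a ** (c ** x) = a' ** (c' ** x')"
 by (intro frac_class_agree[of a' s' a s]) (use x * c assms in auto)
 then show ?thesis using x c * assms tu
 by (intro frac_class_eqI[of _ _ _ _ x' x]) (auto simp: m_assoc)
 qed
 moreover have "(a, s) : frac_class A a s" "(b, t) : frac_class A b t"
 using assms by (auto intro: frac_class_self)
 ultimately have *: "(a, s) : frac_class A a s" "(b, t) : frac_class A b t"
 "!!a' s' b' t' c' u'. [|(a', s') : frac_class A a s; (b', t') : frac_class A b t;
 c' : carrier A; u' : Nz; s' ** c' = b' ** u'|] ==>
 frac_class A (a' ** c') (t' ** u') = frac_class A (a ** c) (t ** u)" by blast+
 show ?thesis unfolding frac_mult_def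
 proof (rule equalityI; rule subsetI)
 fix p assume "p : frac_class A (a ** c) (t ** u)"
 then show "p : (\<Union>(a, s)\<in>frac_class A a s. \<Union>(b, t)\<in>frac_class A b t.
 \<Union>(c, u)\<in>{(c, u). c : carrier A & u : carrier A - {\<zero>} & s ** c = b ** u}.
 frac_class A (a ** c) (t ** u))"
 using uv by (rule_tac UN_I[OF *(1)], simp only: prod.case, rule_tac UN_I[OF *(2)],
 simp only: prod.case, rule_tac UN_I[of "(c, u)"]) auto
 next
 fix p assume "p : (\<Union>(a, s)\<in>frac_class A a s. \<Union>(b, t)\<in>frac_class A b t.
 \<Union>(c, u)\<in>{(c, u). c : carrier A & u : carrier A - {\<zero>} & s ** c = b ** u}.
 frac_class A (a ** c) (t ** u))"
 then obtain a' s' b' t' c' u' where **: "(a', s') : frac_class A a s" "(b', t') : frac_class A b t"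
 "c' : carrier A" "u' : Nz" "s' ** c' = b' ** u'" "p : frac_class A (a' ** c') (t' ** u')"
 by (simp only: UN_iff Bex_def split_paired_Ex prod.case mem_Collect_eq) blast
 show "p : frac_class A (a ** c) (t ** u)" using *(3)[OF **(1-5)] **(6) by simp
 qed
qed

lemma frac_mult_class:
 assumes "a : carrier A" "s : Nz" "c : carrier A" "t : Nz"
 shows "frac_mult A (frac_class A a s) (frac_class A (s ** c) t) = frac_class A (a ** c) t"
 using frac_mult_general[of a s "s ** c" t c \<one>] assms by simp

abbreviation "Fr == frac_algebra A"

lemma frac_carrierE:
 assumes "P : carrier Fr"
 obtains a s where "a : carrier A" "s : Nz" "P = frac_class A a s"
 using assms by (auto simp: frac_algebra_def)

lemma frac_class_closed [simp, intro]:
 "[|a : carrier A; s : Nz|] ==> frac_class A a s : carrier Fr"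
 by (auto simp: frac_algebra_def)

lemma frac_common2:
 assumes "P : carrier Fr" "R : carrier Fr"
 obtains a b s where "a : carrier A" "b : carrier A" "s : Nz"
 "P = frac_class A a s" "R = frac_class A b s"
proof -
 obtain a s where a: "a : carrier A" "s : Nz" "P = frac_class A a s" using assms by (elim frac_carrierE)
 obtain b t where b: "b : carrier A" "t : Nz" "R = frac_class A b t" using assms by (elim frac_carrierE)
 obtain u v where uv: "u : Nz" "v : Nz" "s ** u = t ** v" "s ** u : Nz" using oreE a b by metis
 show ?thesis
 by (rule that[of "a ** u" "b ** v" "s ** u"])
 (use a b uv frac_class_mult_right[of a s u] frac_class_mult_right[of b t v] in auto)
qed

lemma frac_common3:
 assumes "P : carrier Fr" "R : carrier Fr" "S : carrier Fr"
 obtains a b c s where "a : carrier A" "b : carrier A" "c : carrier A" "s : Nz"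
 "P = frac_class A a s" "R = frac_class A b s" "S = frac_class A c s"
proof -
 obtain a b s where a: "a : carrier A" "b : carrier A" "s : Nz"
 "P = frac_class A a s" "R = frac_class A b s" using assms frac_common2 by metis
 obtain c t where b: "c : carrier A" "t : Nz" "S = frac_class A c t" using assms by (elim frac_carrierE)
 obtain u v where uv: "u : Nz" "v : Nz" "s ** u = t ** v" "s ** u : Nz" using oreE a b by metis
 show ?thesis
 by (rule that[of "a ** u" "b ** u" "c ** v" "s ** u"])
 (use a b uv frac_class_mult_right[of a s u] frac_class_mult_right[of b s u] frac_class_mult_right[of c t v] in auto)
qed

text \<open>Writing the second factor with a numerator divisible by the denominator of the first
  makes the product cancel in the middle. Associativity and distributivity then reduce to the laws
  of the ring.\<close>

lemma frac_chain:
 assumes "s : Nz" "R : carrier Fr"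
 obtains c t where "c : carrier A" "t : Nz" "R = frac_class A (s ** c) t"
proof -
 obtain b t where b: "b : carrier A" "t : Nz" "R = frac_class A b t" using assms by (elim frac_carrierE)
 show ?thesis
 \<comment> \<open>The Ore condition speaks about nonzero elements only; a zero numerator is
   divisible by \<open>s\<close> with quotient zero.\<close>
 proof (cases "b = \<zero>")
 case True
 then show ?thesis using b assms by (intro that[of \<zero> t]) auto
 next
 case False
 then have "b : Nz" using b by blast
 then obtain c u where "c : Nz" "u : Nz" "s ** c = b ** u"
 by (rule oreE[OF assms(1)])
 then show ?thesis
 using b mult_nonzero[of t u] frac_class_mult_right[of b t u] by (intro that[of c "t ** u"]) auto
 qed
qed

lemma frac_chain2:
 assumes "s : Nz" "R : carrier Fr" "S : carrier Fr"
 obtains c d t where "c : carrier A" "d : carrier A" "t : Nz"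
 "R = frac_class A (s ** c) t" "S = frac_class A (s ** d) t"
proof -
 obtain c t where c: "c : carrier A" "t : Nz" "R = frac_class A (s ** c) t" using frac_chain assms by metis
 obtain d r where d: "d : carrier A" "r : Nz" "S = frac_class A (s ** d) r" using frac_chain assms by metis
 obtain u v where uv: "u : Nz" "v : Nz" "t ** u = r ** v" "t ** u : Nz" using oreE c d by metis
 show ?thesis
 by (rule that[of "c ** u" "d ** v" "t ** u"])
 (use c d uv assms frac_class_mult_right[of "s ** c" t u] frac_class_mult_right[of "s ** d" r v]
 in \<open>auto simp: m_assoc\<close>)
qed

lemma frac_simps:
 "monoid.mult Fr = frac_mult A" "add Fr = frac_add A"
 "one Fr = frac_class A \<one> \<one>" "zero Fr = frac_class A \<zero> \<one>"
 by (auto simp: frac_algebra_def)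

lemma frac_smult_class:
 assumes "a : carrier A" "s : Nz"
 shows "c \<odot>\<^bsub>Fr\<^esub> frac_class A a s = frac_class A (c \<odot> a) s"
proof -
 have "frac_class A (c \<odot> b) t = frac_class A (c \<odot> a) s" if bt: "(b, t) : frac_class A a s" for b t
 proof -
 obtain u v where b: "b : carrier A" "t : Nz" and
 uv: "u : carrier A" "v : carrier A" "s ** u = t ** v" "s ** u ~= \<zero>" "a ** u = b ** v"
 using bt by (auto simp: mem_frac_class)
 then show ?thesis using assms by (intro frac_class_eqI[of _ _ _ _ v u]) auto
 qed
 with frac_class_self[OF assms] have "(\<Union>(a, s)\<in>frac_class A a s. frac_class A (c \<odot> a) s) = frac_class A (c \<odot> a) s"
 by blast
 then show ?thesis by (simp add: frac_algebra_def)
qed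

lemma frac_zero_class: "s : Nz ==> frac_class A \<zero> s = \<zero>\<^bsub>Fr\<^esub>"
 using frac_class_mult_right[of \<zero> \<one> s] by (simp add: frac_simps)

lemma frac_one_class: "s : Nz ==> frac_class A s s = \<one>\<^bsub>Fr\<^esub>"
 using frac_class_mult_right[of \<one> \<one> s] by (simp add: frac_simps)

lemma frac_class_eq_zero:
 assumes "a : carrier A" "s : Nz" "frac_class A a s = \<zero>\<^bsub>Fr\<^esub>"
 shows "a = \<zero>"
proof -
 have "(\<zero>, s) : frac_class A a s" using assms frac_zero_class[of s] frac_class_self[of \<zero> s] by simp
 from frac_class_agree[OF this, of \<one> \<one>] assms show ?thesis by simp
qed

lemma frac_class_add [simp]:
 "[|a : carrier A; b : carrier A; s : Nz|] ==>
 frac_class A a s +.\<^bsub>Fr\<^esub> frac_class A b s = frac_class A (a +. b) s"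
 by (simp add: frac_simps frac_add_class)

lemma frac_class_mult [simp]:
 "[|a : carrier A; s : Nz; c : carrier A; t : Nz|] ==>
 frac_class A a s **\<^bsub>Fr\<^esub> frac_class A (s ** c) t = frac_class A (a ** c) t"
 by (simp add: frac_simps frac_mult_class)

lemma frac_abelian_group: "abelian_group Fr"
proof (rule abelian_groupI)
 fix P R assume "P : carrier Fr" "R : carrier Fr"
 then obtain a b s where *: "a : carrier A" "b : carrier A" "s : Nz"
 "P = frac_class A a s" "R = frac_class A b s" by (rule frac_common2)
 then show "P +.\<^bsub>Fr\<^esub> R : carrier Fr" by simp
 show "P +.\<^bsub>Fr\<^esub> R = R +.\<^bsub>Fr\<^esub> P" using * by (simp add: a_comm)
next
 fix P R S assume "P : carrier Fr" "R : carrier Fr" "S : carrier Fr"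
 then obtain a b c s where *: "a : carrier A" "b : carrier A" "c : carrier A" "s : Nz"
 "P = frac_class A a s" "R = frac_class A b s" "S = frac_class A c s" by (rule frac_common3)
 then show "P +.\<^bsub>Fr\<^esub> R +.\<^bsub>Fr\<^esub> S = P +.\<^bsub>Fr\<^esub> (R +.\<^bsub>Fr\<^esub> S)" by (simp add: a_assoc)
next
 fix P assume "P : carrier Fr"
 then obtain a s where *: "a : carrier A" "s : Nz" "P = frac_class A a s" by (rule frac_carrierE)
 then show "\<zero>\<^bsub>Fr\<^esub> +.\<^bsub>Fr\<^esub> P = P" by (simp add: frac_zero_class[of s, symmetric])
 have "frac_class A (\<ominus> a) s +.\<^bsub>Fr\<^esub> P = \<zero>\<^bsub>Fr\<^esub>" using * by (simp add: frac_zero_class l_neg)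
 then show "\<exists>R\<in>carrier Fr. R +.\<^bsub>Fr\<^esub> P = \<zero>\<^bsub>Fr\<^esub>" using * by (intro bexI[of _ "frac_class A (\<ominus> a) s"]) auto
qed (auto simp: frac_simps)

lemma frac_monoid: "monoid Fr"
proof (rule monoidI)
 fix P R assume PR: "P : carrier Fr" "R : carrier Fr"
 obtain a s where *: "a : carrier A" "s : Nz" "P = frac_class A a s" using PR by (elim frac_carrierE)
 obtain c t where 2: "c : carrier A" "t : Nz" "R = frac_class A (s ** c) t" using frac_chain * PR by metis
 show "P **\<^bsub>Fr\<^esub> R : carrier Fr" using * 2 by simp
 fix S assume "S : carrier Fr"
 then obtain d r where 3: "d : carrier A" "r : Nz" "S = frac_class A (t ** d) r" using frac_chain 2 by metis
 have "R **\<^bsub>Fr\<^esub> S = frac_class A (s ** (c ** d)) r" using * 2 3 by (simp add: m_assoc)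
 then show "P **\<^bsub>Fr\<^esub> R **\<^bsub>Fr\<^esub> S = P **\<^bsub>Fr\<^esub> (R **\<^bsub>Fr\<^esub> S)" using * 2 3 by (simp add: m_assoc)
next
 fix P assume PR: "P : carrier Fr"
 obtain a s where *: "a : carrier A" "s : Nz" "P = frac_class A a s" using PR by (elim frac_carrierE)
 show "\<one>\<^bsub>Fr\<^esub> **\<^bsub>Fr\<^esub> P = P" using * frac_class_mult[of \<one> \<one> a s] by (simp add: frac_simps)
 show "P **\<^bsub>Fr\<^esub> \<one>\<^bsub>Fr\<^esub> = P" using * frac_class_mult[of a s \<one> s] by (simp add: frac_one_class[of s, symmetric])
qed (auto simp: frac_simps)

lemma frac_ring: "ring Fr"
proof (rule ringI[OF frac_abelian_group frac_monoid])
 fix P R S assume PRS: "P : carrier Fr" "R : carrier Fr" "S : carrier Fr"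
 show "(P +.\<^bsub>Fr\<^esub> R) **\<^bsub>Fr\<^esub> S = P **\<^bsub>Fr\<^esub> S +.\<^bsub>Fr\<^esub> R **\<^bsub>Fr\<^esub> S"
 proof -
 obtain a b s where *: "a : carrier A" "b : carrier A" "s : Nz"
 "P = frac_class A a s" "R = frac_class A b s" using frac_common2 PRS by metis
 obtain c t where 2: "c : carrier A" "t : Nz" "S = frac_class A (s ** c) t" using frac_chain * PRS by metis
 show ?thesis using * 2 by (simp add: l_distr)
 qed
 show "S **\<^bsub>Fr\<^esub> (P +.\<^bsub>Fr\<^esub> R) = S **\<^bsub>Fr\<^esub> P +.\<^bsub>Fr\<^esub> S **\<^bsub>Fr\<^esub> R"
 proof -
 obtain a s where *: "a : carrier A" "s : Nz" "S = frac_class A a s" using PRS by (elim frac_carrierE)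
 obtain c d t where 2: "c : carrier A" "d : carrier A" "t : Nz"
 "P = frac_class A (s ** c) t" "R = frac_class A (s ** d) t" using frac_chain2 * PRS by metis
 have "P +.\<^bsub>Fr\<^esub> R = frac_class A (s ** (c +. d)) t" using * 2 by (simp add: r_distr)
 then have "S **\<^bsub>Fr\<^esub> (P +.\<^bsub>Fr\<^esub> R) = frac_class A (a ** (c +. d)) t" using * 2 by simp
 then show ?thesis using * 2 by (simp add: r_distr)
 qed
qed

lemma frac_calgebra: "calgebra Fr"
proof (intro calgebra.intro[OF frac_ring] calgebra_axioms.intro)
 fix P c d assume "P : carrier Fr"
 then obtain a s where *: "a : carrier A" "s : Nz" "P = frac_class A a s" by (rule frac_carrierE)
 show "c \<odot>\<^bsub>Fr\<^esub> P : carrier Fr" "(c + d) \<odot>\<^bsub>Fr\<^esub> P = c \<odot>\<^bsub>Fr\<^esub> P +.\<^bsub>Fr\<^esub> d \<odot>\<^bsub>Fr\<^esub> P"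
 "(c * d) \<odot>\<^bsub>Fr\<^esub> P = c \<odot>\<^bsub>Fr\<^esub> (d \<odot>\<^bsub>Fr\<^esub> P)" "1 \<odot>\<^bsub>Fr\<^esub> P = P"
 using * by (simp_all add: frac_smult_class smult_add_left)
next
 fix P R c assume PR: "P : carrier Fr" "R : carrier Fr"
 then obtain a b s where *: "a : carrier A" "b : carrier A" "s : Nz"
 "P = frac_class A a s" "R = frac_class A b s" by (rule frac_common2)
 show "c \<odot>\<^bsub>Fr\<^esub> (P +.\<^bsub>Fr\<^esub> R) = c \<odot>\<^bsub>Fr\<^esub> P +.\<^bsub>Fr\<^esub> c \<odot>\<^bsub>Fr\<^esub> R"
 using * by (simp add: frac_smult_class smult_add_right)
 obtain d t where 2: "d : carrier A" "t : Nz" "R = frac_class A (s ** d) t" using frac_chain * PR by metis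
 have 3: "c \<odot>\<^bsub>Fr\<^esub> R = frac_class A (s ** (c \<odot> d)) t"
 using *(3) 2 frac_smult_class[of "s ** d" t c] by simp
 show "c \<odot>\<^bsub>Fr\<^esub> (P **\<^bsub>Fr\<^esub> R) = (c \<odot>\<^bsub>Fr\<^esub> P) **\<^bsub>Fr\<^esub> R"
 using *(1,3,4) 2 by (simp add: frac_smult_class)
 show "c \<odot>\<^bsub>Fr\<^esub> (P **\<^bsub>Fr\<^esub> R) = P **\<^bsub>Fr\<^esub> (c \<odot>\<^bsub>Fr\<^esub> R)"
 unfolding 3 using *(1,3,4) 2 frac_class_mult[of a s "c \<odot> d" t] frac_smult_class[of "a ** d" t c]
 by simp
qed

lemma frac_class_inverse:
 assumes "a : Nz" "s : Nz"
 shows "frac_class A a s **\<^bsub>Fr\<^esub> frac_class A s a = \<one>\<^bsub>Fr\<^esub>"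
 using assms frac_class_mult[of a s \<one> a] by (simp add: frac_one_class)

lemma frac_division_algebra: "division_algebra Fr"
proof (intro division_algebra.intro[OF frac_calgebra] division_algebra_axioms.intro)
 show "\<one>\<^bsub>Fr\<^esub> ~= \<zero>\<^bsub>Fr\<^esub>" using frac_class_eq_zero[of \<one> \<one>] by (auto simp: frac_one_class)
 fix P assume P: "P : carrier Fr" "P ~= \<zero>\<^bsub>Fr\<^esub>"
 then obtain a s where *: "a : carrier A" "s : Nz" "P = frac_class A a s" by (elim frac_carrierE)
 then have "a : Nz" using P frac_zero_class by auto
 then show "P : Units Fr" using * frac_class_inverse[of a s] frac_class_inverse[of s a]
 unfolding Units_def by auto
qed

definition frac_embed :: "'a => ('a \<times> 'a) set" where
 "frac_embed a = frac_class A a \<one>"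

lemma frac_embed_hom: "frac_embed : algebra_hom A Fr"
proof (rule algebra_homI)
 fix x y assume "x : carrier A" "y : carrier A"
 then show "frac_embed (x ** y) = frac_embed x **\<^bsub>Fr\<^esub> frac_embed y"
 using frac_class_mult[of x \<one> y \<one>] by (simp add: frac_embed_def)
qed (auto simp: frac_embed_def frac_smult_class frac_one_class)

lemma frac_embed_eq_zero: "[|a : carrier A; frac_embed a = \<zero>\<^bsub>Fr\<^esub>|] ==> a = \<zero>"
 using frac_class_eq_zero[of a \<one>] by (simp add: frac_embed_def)

lemma frac_embed_inj: "inj_on frac_embed (carrier A)"
 by (rule algebra_hom_inj_on[OF calgebra_axioms frac_calgebra frac_embed_hom frac_embed_eq_zero])

lemma frac_class_as_quotient:
 assumes "a : carrier A" "s : Nz"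
 shows "frac_class A a s = frac_embed a **\<^bsub>Fr\<^esub> inv\<^bsub>Fr\<^esub> (frac_embed s)"
proof -
 interpret F: division_algebra Fr by (rule frac_division_algebra)
 have "inv\<^bsub>Fr\<^esub> (frac_embed s) = frac_class A \<one> s"
 by (rule F.inv_char) (use assms frac_class_inverse[of s \<one>] frac_class_inverse[of \<one> s] in \<open>auto simp: frac_embed_def\<close>)
 then show ?thesis using assms frac_class_mult[of a \<one> \<one> s] by (simp add: frac_embed_def)
qed

lemma frac_quotientE:
 assumes "P : carrier Fr"
 obtains a s where "a : carrier A" "s : Nz" "P = frac_embed a **\<^bsub>Fr\<^esub> inv\<^bsub>Fr\<^esub> (frac_embed s)"
 using assms frac_class_as_quotient by (metis frac_carrierE)

end

section \<open>Extending homomorphisms and automorphisms to fractions\<close>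

definition frac_lift :: "('a => 'b) => (complex, 'b) module => ('a \<times> 'a) set => 'b" where
 "frac_lift h B P = (let (a, s) = SOME p. p : P in h a **\<^bsub>B\<^esub> inv\<^bsub>B\<^esub> (h s))"

context ore_domain
begin

context
 fixes B :: "(complex, 'b) module" and h
 assumes B: "division_algebra B" and h: "h : algebra_hom A B"
 and h_inj: "!!x. [|x : carrier A; h x = \<zero>\<^bsub>B\<^esub>|] ==> x = \<zero>"
begin

interpretation B: division_algebra B by (rule B)

text \<open>A common factor on the right cancels in \<open>h (x ** w)\<close> times the inverse of
  \<open>h (r ** w)\<close>, so the chosen representative does not matter. Triviality of the kernel
  keeps all denominators invertible.\<close>

lemma frac_lift_class:
 assumes "a : carrier A" "s : Nz"
 shows "frac_lift h B (frac_class A a s) = h a **\<^bsub>B\<^esub> inv\<^bsub>B\<^esub> (h s)"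
proof -
 have "(SOME p. p : frac_class A a s) : frac_class A a s"
 using frac_class_self[OF assms] by (rule someI)
 then obtain b t where bt: "(SOME p. p : frac_class A a s) = (b, t)" "(b, t) : frac_class A a s"
 by (metis surj_pair)
 obtain u v where b: "b : carrier A" "t : Nz" and
 uv: "u : carrier A" "v : carrier A" "s ** u = t ** v" "s ** u ~= \<zero>" "a ** u = b ** v"
 using bt by (auto simp: mem_frac_class)
 have uvn: "u : Nz" "v : Nz" using uv b assms by auto
 have nz: "h u ~= \<zero>\<^bsub>B\<^esub>" "h v ~= \<zero>\<^bsub>B\<^esub>" "h s ~= \<zero>\<^bsub>B\<^esub>" "h t ~= \<zero>\<^bsub>B\<^esub>" using h_inj uvn assms b by auto
 note c = algebra_homD(1)[OF h]
 have key: "h (x ** w) **\<^bsub>B\<^esub> inv\<^bsub>B\<^esub> (h (r ** w)) = h x **\<^bsub>B\<^esub> inv\<^bsub>B\<^esub> (h r)"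
 if "x : carrier A" "r : carrier A" "w : carrier A" "h w ~= \<zero>\<^bsub>B\<^esub>" "h r ~= \<zero>\<^bsub>B\<^esub>" for x w r
 using that c by (simp add: algebra_homD(2)[OF h] B.inv_mult' B.m_assoc)
 have "h b **\<^bsub>B\<^esub> inv\<^bsub>B\<^esub> (h t) = h a **\<^bsub>B\<^esub> inv\<^bsub>B\<^esub> (h s)"
 using key[of b t v] key[of a s u] uv uvn nz assms b by simp
 then show ?thesis by (simp add: frac_lift_def bt)
qed

lemma frac_lift_embed: "a : carrier A ==> frac_lift h B (frac_embed a) = h a"
 using frac_lift_class[of a \<one>] algebra_homD[OF h] by (simp add: frac_embed_def)

lemma frac_lift_hom: "frac_lift h B : algebra_hom Fr B"
proof (rule algebra_homI)
 note c = algebra_homD(1)[OF h]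
 have nz: "h s ~= \<zero>\<^bsub>B\<^esub>" if "s : Nz" for s using h_inj that by auto
 fix P assume PR: "P : carrier Fr"
 obtain a s where *: "a : carrier A" "s : Nz" "P = frac_class A a s" using PR by (elim frac_carrierE)
 show "frac_lift h B P : carrier B" using * c nz by (simp add: frac_lift_class)
 show "frac_lift h B (k \<odot>\<^bsub>Fr\<^esub> P) = k \<odot>\<^bsub>B\<^esub> frac_lift h B P" for k
 using * c nz by (simp add: frac_lift_class frac_smult_class algebra_homD[OF h])
 fix R assume R: "R : carrier Fr"
 obtain d t where 2: "d : carrier A" "t : Nz" "R = frac_class A (s ** d) t" using frac_chain * R by metis
 show "frac_lift h B (P **\<^bsub>Fr\<^esub> R) = frac_lift h B P **\<^bsub>B\<^esub> frac_lift h B R"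
 using * 2 c nz by (simp add: frac_lift_class algebra_homD[OF h] B.m_assoc)
next
 note c = algebra_homD(1)[OF h]
 have nz: "h s ~= \<zero>\<^bsub>B\<^esub>" if "s : Nz" for s using h_inj that by auto
 fix P R assume PR: "P : carrier Fr" "R : carrier Fr"
 then obtain a b s where *: "a : carrier A" "b : carrier A" "s : Nz"
 "P = frac_class A a s" "R = frac_class A b s" by (rule frac_common2)
 then show "frac_lift h B (P +.\<^bsub>Fr\<^esub> R) = frac_lift h B P +.\<^bsub>B\<^esub> frac_lift h B R"
 using * c nz by (simp add: frac_lift_class algebra_homD[OF h] B.l_distr)
next
 show "frac_lift h B \<one>\<^bsub>Fr\<^esub> = \<one>\<^bsub>B\<^esub>" using frac_lift_class[of \<one> \<one>] by (simp add: frac_simps algebra_homD[OF h])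
qed

lemma frac_lift_eq_zero:
 assumes "P : carrier Fr" "frac_lift h B P = \<zero>\<^bsub>B\<^esub>" shows "P = \<zero>\<^bsub>Fr\<^esub>"
 using algebra_hom_inv(1)[OF frac_calgebra B.calgebra_axioms frac_lift_hom frac_division_algebra B] assms
 by blast

end

text \<open>The action is the image of a class as a set of pairs. One inclusion uses that
  \<open>h\<close> preserves the witnessing equations, the other pulls them back and needs
  \<open>h\<close> to be bijective.\<close>

lemma frac_action_class:
 assumes h: "h : algebra_hom A A" "bij_betw h (carrier A) (carrier A)" "a : carrier A" "s : Nz"
 shows "frac_action h (frac_class A a s) = frac_class A (h a) (h s)"
proof -
 have inj: "inj_on h (carrier A)" using h by (simp add: bij_betw_def)
 have h0: "h \<zero> = \<zero>" using algebra_hom_zero[OF calgebra_axioms calgebra_axioms h(1)] .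
 have nz: "h x = \<zero> \<longleftrightarrow> x = \<zero>" if "x : carrier A" for x
 using that inj h0 by (metis inj_onD zero_closed)
 have eq: "h x = h y \<longleftrightarrow> x = y" if "x : carrier A" "y : carrier A" for x y
 using that inj by (metis inj_onD)
 have surj: "\<exists>y\<in>carrier A. x = h y" if "x : carrier A" for x using h that by (metis bij_betw_def imageE)
 note H = algebra_homD[OF h(1)]
 show ?thesis
 proof (rule equalityI; rule subsetI)
 fix p assume "p : frac_action h (frac_class A a s)"
 then obtain b t where p: "p = (h b, h t)" "(b, t) : frac_class A a s" by (auto simp: frac_action_def)
 obtain u v where b: "b : carrier A" "t : Nz" and
 uv: "u : carrier A" "v : carrier A" "s ** u = t ** v" "s ** u ~= \<zero>" "a ** u = b ** v"
 using p by (auto simp: mem_frac_class)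
 have "h s ** h u = h t ** h v" "h s ** h u ~= \<zero>" "h a ** h u = h b ** h v"
 using uv b assms H(2)[symmetric] by (auto simp: nz)
 moreover have "h u : carrier A" "h v : carrier A" "h b : carrier A" "h t : Nz" using b uv H nz by auto
 ultimately show "p : frac_class A (h a) (h s)" unfolding p(1) mem_frac_class by blast
 next
 fix p assume pp: "p : frac_class A (h a) (h s)"
 obtain b' t' where p: "p = (b', t')" by force
 obtain u' v' where b': "b' : carrier A" "t' : Nz" and
 uv': "u' : carrier A" "v' : carrier A" "h s ** u' = t' ** v'" "h s ** u' ~= \<zero>" "h a ** u' = b' ** v'"
 using p pp by (auto simp: mem_frac_class)
 obtain b t u v where b: "b : carrier A" "t : carrier A" "u : carrier A" "v : carrier A"
 "b' = h b" "t' = h t" "u' = h u" "v' = h v"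
 using surj[OF b'(1)] surj[of t'] surj[OF uv'(1)] surj[OF uv'(2)] b'(2) by blast
 have "h (s ** u) = h (t ** v)" "h (s ** u) ~= \<zero>" "h (a ** u) = h (b ** v)"
 using uv' b assms H(2) by auto
 then have "s ** u = t ** v" "s ** u ~= \<zero>" "a ** u = b ** v" using eq nz b assms by auto
 moreover have "t : Nz" using b b' nz by auto
 ultimately have "(b, t) : frac_class A a s" using b(1,3,4) unfolding mem_frac_class by blast
 then show "p : frac_action h (frac_class A a s)" using p b by (force simp: frac_action_def)
 qed
qed

lemma frac_action_hom:
 assumes h: "h : algebra_hom A A" "bij_betw h (carrier A) (carrier A)"
 shows "frac_action h : algebra_hom Fr Fr"
 and "a : carrier A ==> frac_action h (frac_embed a) = frac_embed (h a)"
proof -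
 have inj: "inj_on h (carrier A)" using h by (simp add: bij_betw_def)
 have h0: "h \<zero> = \<zero>" using algebra_hom_zero[OF calgebra_axioms calgebra_axioms h(1)] .
 have nz: "h x = \<zero> \<longleftrightarrow> x = \<zero>" if "x : carrier A" for x
 using that inj h0 by (metis inj_onD zero_closed)
 have h': "(%x. frac_embed (h x)) : algebra_hom A Fr"
 using algebra_hom_compose[OF h(1) frac_embed_hom] .
 have inj': "x = \<zero>" if "x : carrier A" "frac_embed (h x) = \<zero>\<^bsub>Fr\<^esub>" for x
 using that nz frac_embed_eq_zero algebra_homD(1)[OF h(1)] by blast
 \<comment> \<open>On the carrier the action coincides with the lift of \<open>h\<close> followed by
   the embedding, which is already known to be a homomorphism.\<close>
 have eq: "frac_action h P = frac_lift (%x. frac_embed (h x)) Fr P" if P: "P : carrier Fr" for P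
 proof -
 obtain a s where *: "a : carrier A" "s : Nz" "P = frac_class A a s" using P by (elim frac_carrierE)
 have "frac_action h P = frac_class A (h a) (h s)" using * frac_action_class[OF h] by simp
 also have "... = frac_embed (h a) **\<^bsub>Fr\<^esub> inv\<^bsub>Fr\<^esub> (frac_embed (h s))"
 using * algebra_homD(1)[OF h(1)] nz by (intro frac_class_as_quotient) auto
 finally show ?thesis using * frac_lift_class[OF frac_division_algebra h' inj'] by simp
 qed
 interpret F: calgebra Fr by (rule frac_calgebra)
 have L: "frac_lift (%x. frac_embed (h x)) Fr : algebra_hom Fr Fr"
 using frac_lift_hom[OF frac_division_algebra h' inj'] .
 show "frac_action h : algebra_hom Fr Fr"
 using algebra_homD[OF L] by (intro algebra_homI) (auto simp: eq)
 show "frac_action h (frac_embed a) = frac_embed (h a)" if "a : carrier A"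
 using that frac_action_class[OF h that, of \<one>] algebra_homD(4)[OF h(1)] by (simp add: frac_embed_def)
qed

end

section \<open>Linear algebra over skew subfields\<close>

context ring
begin

lemma minus_self [simp]: "x : carrier R ==> x \<ominus> x = \<zero>"
 by simp

text \<open>The ambient ring is arbitrary, so one elimination argument serves skew subfields of Frac
  D(A) as well as the complex numbers packaged as a ring.\<close>

definition div_subring :: "'a set => bool" where
 "div_subring F \<longleftrightarrow> F <= carrier R & \<zero> : F & \<one> : F & (\<forall>x\<in>F. \<forall>y\<in>F. x +. y : F & x ** y : F) &
 (\<forall>x\<in>F. \<ominus> x : F) & (\<forall>x\<in>F. x ~= \<zero> --> (\<exists>y\<in>F. x ** y = \<one> & y ** x = \<one>))"

lemma div_subring_finsum:
 assumes "div_subring F" "finite J" "!!j. j : J ==> f j : F"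
 shows "(\<Oplus>j\<in>J. f j) : F"
 using assms(2,3)
proof (induct set: finite)
 case empty then show ?case using assms(1) by (simp add: div_subring_def)
next
 case (insert j J)
 then show ?case using assms(1) by (subst finsum_insert) (auto simp: div_subring_def Pi_def)
qed

text \<open>Gaussian elimination with coefficients on the left and unknowns on the right, by
  induction on the number of equations. This sidedness fits right vector spaces over
  \<open>F\<close>.\<close>

lemma underdetermined_system:
 assumes F: "div_subring F" and nz: "\<one> ~= \<zero>" and "finite I" and "finite J" "card I < card J"
 and "!!i j. [|i : I; j : J|] ==> c i j : F"
 shows "EX f. (\<forall>j\<in>J. f j : F) & (\<exists>j\<in>J. f j ~= \<zero>) & (\<forall>i\<in>I. (\<Oplus>j\<in>J. c i j ** f j) = \<zero>)"
 using assms(3-)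
proof (induct I arbitrary: J c)
 case empty
 then have "J ~= {}" by auto
 then show ?case using F nz by (intro exI[of _ "%_. \<one>"]) (auto simp: div_subring_def)
next
 case (insert i0 I)
 have Fc: "x : carrier R" if "x : F" for x using F that by (auto simp: div_subring_def)
 have F_ops: "x +. y : F" "x ** y : F" "\<ominus> x : F" if "x : F" "y : F" for x y
 using F that by (auto simp: div_subring_def)
 show ?case
 proof (cases "\<forall>j\<in>J. c i0 j = \<zero>")
 case True
 have "card I < card J" using insert by simp
 then obtain f where f: "\<forall>j\<in>J. f j : F" "\<exists>j\<in>J. f j ~= \<zero>" "\<forall>i\<in>I. (\<Oplus>j\<in>J. c i j ** f j) = \<zero>"
 using insert(3)[of J c] insert.prems by auto
 have "(\<Oplus>j\<in>J. c i0 j ** f j) = (\<Oplus>j\<in>J. \<zero>)"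
 using True f Fc by (intro finsum_cong') auto
 then have "(\<Oplus>j\<in>J. c i0 j ** f j) = \<zero>" by simp
 then show ?thesis using f by blast
 next
 case False
 then obtain p where p: "p : J" "c i0 p ~= \<zero>" by auto
 have cF: "c i j : F" if "i : insert i0 I" "j : J" for i j using insert.prems that by auto
 obtain y where y: "y : F" "c i0 p ** y = \<one>" using F p cF[of i0 p] by (auto simp: div_subring_def)
 define J' where "J' = J - {p}"
 have J': "finite J'" "J = insert p J'" "p \<notin> J'" "card I < card J'"
 using insert p by (auto simp: J'_def)
 \<comment> \<open>The pivot \<open>c i0 p\<close> has inverse \<open>y\<close>; subtracting
   \<open>c i p ** y\<close> times equation \<open>i0\<close> on the left removes the unknown
   \<open>p\<close> from equation \<open>i\<close>.\<close>
 define c' where "c' i j = c i j +. \<ominus> (c i p ** (y ** c i0 j))" for i j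
 have c'F: "c' i j : F" if "i : I" "j : J'" for i j
 unfolding c'_def using that J' p y cF by (auto intro!: F_ops)
 obtain g where g: "\<forall>j\<in>J'. g j : F" "\<exists>j\<in>J'. g j ~= \<zero>" "\<forall>i\<in>I. (\<Oplus>j\<in>J'. c' i j ** g j) = \<zero>"
 using insert(3)[of J' c', OF J'(1,4) c'F] by auto
 have gF: "g j : F" if "j : J'" for j using g that by auto
 define s where "s = (\<Oplus>j\<in>J'. c i0 j ** g j)"
 have sF: "s : F" unfolding s_def using J' gF cF F by (intro div_subring_finsum) (auto intro!: F_ops)
 \<comment> \<open>Back substitution: equation \<open>i0\<close> determines the unknown
   \<open>p\<close> from the others. Nontriviality survives because \<open>g\<close> is nonzero
   somewhere away from \<open>p\<close>.\<close>
 define f where "f j = (if j = p then \<ominus> (y ** s) else g j)" for j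
 have fF: "f j : F" if "j : J" for j using that J' gF sF y by (auto simp: f_def intro!: F_ops)
 have sum: "(\<Oplus>j\<in>J. c i j ** f j) = c i p ** \<ominus> (y ** s) +. (\<Oplus>j\<in>J'. c i j ** g j)" if i: "i : insert i0 I" for i
 proof -
 have "(\<Oplus>j\<in>J. c i j ** f j) = c i p ** f p +. (\<Oplus>j\<in>J'. c i j ** f j)"
 unfolding J'(2) using J' cF[OF i] fF Fc by (intro finsum_insert) auto
 moreover have "(\<Oplus>j\<in>J'. c i j ** f j) = (\<Oplus>j\<in>J'. c i j ** g j)"
 using J' cF[OF i] gF Fc by (intro finsum_cong') (auto simp: f_def)
 ultimately show ?thesis by (simp add: f_def)
 qed
 have 0: "(\<Oplus>j\<in>J. c i0 j ** f j) = \<zero>"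
 proof -
 have "c i0 p ** \<ominus> (y ** s) = \<ominus> (c i0 p ** y ** s)"
 using Fc[OF cF[of i0 p]] Fc[OF y(1)] Fc[OF sF] p by (simp add: r_minus m_assoc)
 then show ?thesis using sum[of i0] y Fc[OF sF] by (simp add: s_def[symmetric] l_neg)
 qed
 have "(\<Oplus>j\<in>J. c i j ** f j) = \<zero>" if i: "i : I" for i
 proof -
 have ci: "c i j : carrier R" "c i0 j : carrier R" "g j : carrier R" if "j : J'" for j
 using that i cF J' Fc gF by auto
 have cp: "c i p : carrier R" using i cF p Fc by auto
 have yc: "y : carrier R" using y Fc by auto
 have "(\<Oplus>j\<in>J'. c' i j ** g j) = (\<Oplus>j\<in>J'. c i j ** g j +. (\<ominus> (c i p ** y)) ** (c i0 j ** g j))"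
 using ci cp yc by (intro finsum_cong') (auto simp: c'_def l_distr m_assoc l_minus r_minus)
 also have "... = (\<Oplus>j\<in>J'. c i j ** g j) +. (\<Oplus>j\<in>J'. (\<ominus> (c i p ** y)) ** (c i0 j ** g j))"
 using ci cp yc by (intro finsum_addf) auto
 also have "(\<Oplus>j\<in>J'. (\<ominus> (c i p ** y)) ** (c i0 j ** g j)) = (\<ominus> (c i p ** y)) ** s"
 unfolding s_def using ci cp yc J' by (intro finsum_rdistr[symmetric]) auto
 also have "... = c i p ** \<ominus> (y ** s)" using cp yc Fc[OF sF] by (simp add: l_minus r_minus m_assoc)
 finally have "(\<Oplus>j\<in>J. c i j ** f j) = (\<Oplus>j\<in>J'. c' i j ** g j)"
 using sum[of i] i cp yc ci Fc[OF sF] a_comm[of "c i p ** \<ominus> (y ** s)" "\<Oplus>j\<in>J'. c i j ** g j"] by auto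
 then show ?thesis using g i by simp
 qed
 moreover obtain j0 where "j0 : J'" "g j0 ~= \<zero>" using g by blast
 then have "j0 : J" "f j0 ~= \<zero>" using J' by (auto simp: f_def)
 ultimately show ?thesis using fF 0 by blast
 qed
qed

lemma finsum_swap_mult:
 assumes "finite I" "finite J" "!!i. i : I ==> e i : carrier R" "!!i j. [|i : I; j : J|] ==> c i j : carrier R"
 "!!j. j : J ==> f j : carrier R"
 shows "(\<Oplus>j\<in>J. (\<Oplus>i\<in>I. e i ** c i j) ** f j) = (\<Oplus>i\<in>I. e i ** (\<Oplus>j\<in>J. c i j ** f j))"
 using assms(1,3,4)
proof (induct set: finite)
 case empty
 have "(\<Oplus>j\<in>J. (\<Oplus>i\<in>{}. e i ** c i j) ** f j) = (\<Oplus>j\<in>J. \<zero>)" using assms(5) by (intro finsum_cong') auto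
 then show ?case by simp
next
 case (insert i0 I)
 have "(\<Oplus>j\<in>J. (\<Oplus>i\<in>insert i0 I. e i ** c i j) ** f j) =
 (\<Oplus>j\<in>J. e i0 ** (c i0 j ** f j) +. (\<Oplus>i\<in>I. e i ** c i j) ** f j)"
 using insert assms(5) by (intro finsum_cong') (auto simp: l_distr m_assoc intro!: finsum_closed)
 also have "... = (\<Oplus>j\<in>J. e i0 ** (c i0 j ** f j)) +. (\<Oplus>j\<in>J. (\<Oplus>i\<in>I. e i ** c i j) ** f j)"
 using insert assms(5) by (intro finsum_addf) (auto intro!: finsum_closed m_closed)
 also have "(\<Oplus>j\<in>J. e i0 ** (c i0 j ** f j)) = e i0 ** (\<Oplus>j\<in>J. c i0 j ** f j)"
 using insert assms(2,5) by (intro finsum_rdistr[symmetric]) auto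
 finally show ?case using insert assms(5) by (subst finsum_insert) (auto intro!: finsum_closed)
qed

text \<open>The coordinates of the vectors form a homogeneous system with more unknowns than
  equations; a solution, multiplied on the right, is a relation between the vectors.\<close>

lemma right_dependent:
 assumes F: "div_subring F" and nz: "\<one> ~= \<zero>" and "finite I" "finite J" "card I < card J"
 and "!!i. i : I ==> e i : carrier R"
 and "!!j. j : J ==> EX c. (\<forall>i\<in>I. c i : F) & v j = (\<Oplus>i\<in>I. e i ** c i)"
 shows "EX f. (\<forall>j\<in>J. f j : F) & (\<exists>j\<in>J. f j ~= \<zero>) & (\<Oplus>j\<in>J. v j ** f j) = \<zero>"
proof -
 have "EX c. \<forall>j\<in>J. (\<forall>i\<in>I. c j i : F) & v j = (\<Oplus>i\<in>I. e i ** c j i)"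
 using assms(7) by (intro bchoice) auto
 then obtain c where c: "!!i j. [|i : I; j : J|] ==> c j i : F" "!!j. j : J ==> v j = (\<Oplus>i\<in>I. e i ** c j i)"
 by metis
 have Fc: "x : carrier R" if "x : F" for x using F that by (auto simp: div_subring_def)
 obtain f where f: "\<forall>j\<in>J. f j : F" "\<exists>j\<in>J. f j ~= \<zero>" "\<forall>i\<in>I. (\<Oplus>j\<in>J. c j i ** f j) = \<zero>"
 using underdetermined_system[OF F nz assms(3-5), of "%i j. c j i"] c by auto
 have "(\<Oplus>j\<in>J. v j ** f j) = (\<Oplus>j\<in>J. (\<Oplus>i\<in>I. e i ** c j i) ** f j)"
 using c f assms Fc by (intro finsum_cong') (auto intro!: finsum_closed m_closed)
 also have "... = (\<Oplus>i\<in>I. e i ** (\<Oplus>j\<in>J. c j i ** f j))"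
 using c f assms Fc by (intro finsum_swap_mult) auto
 also have "... = (\<Oplus>i\<in>I. \<zero>)" using f assms by (intro finsum_cong') auto
 finally show ?thesis using f by auto
qed

end

lemma complex_underdetermined:
 fixes c :: "'i => 'j => complex"
 assumes "finite I" "finite J" "card I < card J"
 shows "EX f. (\<exists>j\<in>J. f j ~= 0) & (\<forall>i\<in>I. (\<Sum>j\<in>J. c i j * f j) = 0)"
proof -
 \<comment> \<open>The complex numbers as a ring record, so that the elimination over skew fields
   applies to them with \<open>F = UNIV\<close>.\<close>
 define C :: "complex ring" where "C = \<lparr>carrier = UNIV, monoid.mult = (*), one = 1, zero = 0, add = (+)\<rparr>"
 have "abelian_group C" by (rule abelian_groupI) (auto simp: C_def add.assoc add.commute intro: exI[of _ "- _"])
 moreover have "monoid C" by (rule monoidI) (auto simp: C_def mult.assoc)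
 ultimately interpret C: ring C by (rule ringI) (auto simp: C_def algebra_simps)
 have sum: "finsum C f J = sum f J" for f
 using assms(2)
 proof (induct set: finite)
 case empty show ?case using C.finsum_empty by (simp add: C_def)
 next
 case (insert j J)
 have "finsum C f (insert j J) = f j +.\<^bsub>C\<^esub> finsum C f J"
 using insert by (intro C.finsum_insert) (auto simp: C_def)
 then show ?case using insert by (simp add: C_def)
 qed
 have inv: "\<ominus>\<^bsub>C\<^esub> x = - x" for x by (rule C.minus_equality) (auto simp: C_def)
 have "C.div_subring UNIV"
 unfolding C.div_subring_def
 proof (intro conjI ballI impI)
 fix x :: complex assume "x ~= \<zero>\<^bsub>C\<^esub>"
 then show "\<exists>y\<in>UNIV. x **\<^bsub>C\<^esub> y = \<one>\<^bsub>C\<^esub> & y **\<^bsub>C\<^esub> x = \<one>\<^bsub>C\<^esub>"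
 by (intro bexI[of _ "inverse x"]) (auto simp: C_def)
 qed (auto simp: C_def)
 from C.underdetermined_system[OF this _ assms, of c] show ?thesis
 unfolding sum by (auto simp: C_def)
qed

section \<open>Linear spans and the filtration by word length\<close>

context calgebra
begin

text \<open>Linear combinations are built one term at a time and may repeat an element. Closure
  properties are then plain inductions; coefficients indexed by \<open>S\<close> are recovered in
  \<open>lspan_finiteE\<close> only for finite \<open>S\<close>.\<close>

inductive_set lspan :: "'a set => 'a set" for S where
 lspan_zero: "\<zero> : lspan S"
| lspan_step: "s : S ==> x : lspan S ==> c \<odot> s +. x : lspan S"

lemma lspan_closed: "[|x : lspan S; S <= carrier A|] ==> x : carrier A"
 by (induct rule: lspan.induct) auto

lemma lspan_incl: "[|s : S; S <= carrier A|] ==> s : lspan S"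
 using lspan_step[OF _ lspan_zero, of s S 1] by (auto simp: subset_iff)

lemma lspan_add:
 assumes "x : lspan S" "y : lspan S" "S <= carrier A" shows "x +. y : lspan S"
 using assms
proof (induct rule: lspan.induct)
 case lspan_zero then show ?case using lspan_closed by auto
next
 case (lspan_step s x c)
 then have "c \<odot> s +. x +. y = c \<odot> s +. (x +. y)" using lspan_closed by (simp add: a_assoc subset_iff)
 then show ?case using lspan_step lspan.lspan_step by simp
qed

lemma lspan_smult:
 assumes "x : lspan S" "S <= carrier A" shows "c \<odot> x : lspan S"
 using assms
proof (induct rule: lspan.induct)
 case lspan_zero then show ?case by (simp add: lspan.lspan_zero)
next
 case (lspan_step s x d)
 then have "c \<odot> (d \<odot> s +. x) = (c * d) \<odot> s +. c \<odot> x"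
 using lspan_closed by (simp add: smult_add_right subset_iff)
 then show ?case using lspan_step lspan.lspan_step by simp
qed

lemma lspan_minus:
 assumes "x : lspan S" "S <= carrier A" shows "\<ominus> x : lspan S"
 using lspan_smult[OF assms, of "- 1"] lspan_closed[OF assms] by (simp add: smult_minus_left)

lemma lspan_diff: "[|x : lspan S; y : lspan S; S <= carrier A|] ==> x \<ominus> y : lspan S"
 by (simp add: a_minus_def lspan_add lspan_minus)

lemma lspan_least:
 assumes "x : lspan S" "!!s. s : S ==> s : lspan T" "T <= carrier A" shows "x : lspan T"
 using assms by (induct rule: lspan.induct) (auto intro: lspan_zero lspan_add lspan_smult)

lemma lspan_mono: "[|x : lspan S; S <= T; T <= carrier A|] ==> x : lspan T"
 by (rule lspan_least[of x S T]) (auto intro: lspan_incl)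

lemma lspan_mult_left:
 assumes "x : lspan S" "S <= carrier A" "T <= carrier A" "y : carrier A"
 "!!s. s : S ==> y ** s : lspan T"
 shows "y ** x : lspan T"
 using assms
proof (induct rule: lspan.induct)
 case lspan_zero then show ?case by (auto intro: lspan.lspan_zero)
next
 case (lspan_step s x c)
 then have "y ** (c \<odot> s +. x) = c \<odot> (y ** s) +. y ** x" using lspan_closed by (simp add: r_distr subset_iff)
 moreover have "T <= carrier A" using lspan_step by simp
 ultimately show ?case using lspan_step lspan_add[of _ T] lspan_smult[of _ T] by simp
qed

lemma lspan_mult_right:
 assumes "x : lspan S" "S <= carrier A" "T <= carrier A" "y : carrier A"
 "!!s. s : S ==> s ** y : lspan T"
 shows "x ** y : lspan T"
 using assms
proof (induct rule: lspan.induct)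
 case lspan_zero then show ?case by (auto intro: lspan.lspan_zero)
next
 case (lspan_step s x c)
 then have "(c \<odot> s +. x) ** y = c \<odot> (s ** y) +. x ** y" using lspan_closed by (simp add: l_distr subset_iff)
 moreover have "T <= carrier A" using lspan_step by simp
 ultimately show ?case using lspan_step lspan_add[of _ T] lspan_smult[of _ T] by simp
qed

lemma lspan_mult:
 assumes "x : lspan S" "y : lspan T" "S <= carrier A" "T <= carrier A" "V <= carrier A"
 "!!s t. [|s : S; t : T|] ==> s ** t : lspan V"
 shows "x ** y : lspan V"
 using assms lspan_closed by (intro lspan_mult_right[OF assms(1)] lspan_mult_left[OF assms(2)]) auto

lemma lspan_finiteE:
 assumes "x : lspan S" "finite S" "S <= carrier A"
 shows "EX c. x = (\<Oplus>s\<in>S. c s \<odot> s)"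
 using assms(1)
proof (induct rule: lspan.induct)
 case lspan_zero
 have "(\<Oplus>s\<in>S. 0 \<odot> s) = (\<Oplus>s\<in>S. \<zero>)" using assms by (intro finsum_cong') auto
 then show ?case by (intro exI[of _ "%_. 0"]) simp
next
 case (lspan_step t x d)
 then obtain c where c: "x = (\<Oplus>s\<in>S. c s \<odot> s)" by blast
 have S: "S = insert t (S - {t})" "finite (S - {t})" "t \<notin> S - {t}" "t : carrier A"
 "!!s. s : S - {t} ==> s : carrier A"
 using lspan_step assms by auto
 have ins: "(\<Oplus>s\<in>S. b s \<odot> s) = b t \<odot> t +. (\<Oplus>s\<in>S - {t}. b s \<odot> s)" for b
 using S by (subst S(1), intro finsum_insert) auto
 have "(\<Oplus>s\<in>S - {t}. (c(t := d + c t)) s \<odot> s) = (\<Oplus>s\<in>S - {t}. c s \<odot> s)"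
 using S by (intro finsum_cong') auto
 then have "d \<odot> t +. x = (\<Oplus>s\<in>S. (c(t := d + c t)) s \<odot> s)"
 using S by (subst ins, subst c, subst ins) (simp add: smult_add_left a_assoc finsum_closed)
 then show ?case by blast
qed

lemma finsum_smult_left:
 assumes "finite J" "x : carrier A" shows "(\<Oplus>j\<in>J. f j \<odot> x) = sum f J \<odot> x"
 using assms(1)
proof (induct set: finite)
 case (insert j J)
 then show ?case using assms(2) by (subst finsum_insert) (auto simp: smult_add_left)
qed (use assms in simp)

lemma finsum_finsum_smult:
 assumes "finite I" "finite J" "!!i. i : I ==> e i : carrier A"
 shows "(\<Oplus>j\<in>J. f j \<odot> (\<Oplus>i\<in>I. c i j \<odot> e i)) = (\<Oplus>i\<in>I. (\<Sum>j\<in>J. c i j * f j) \<odot> e i)"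
 using assms(1,3)
proof (induct set: finite)
 case empty then show ?case by simp
next
 case (insert i0 I)
 have "(\<Oplus>j\<in>J. f j \<odot> (\<Oplus>i\<in>insert i0 I. c i j \<odot> e i)) =
 (\<Oplus>j\<in>J. (c i0 j * f j) \<odot> e i0 +. f j \<odot> (\<Oplus>i\<in>I. c i j \<odot> e i))"
 using insert by (intro finsum_cong') (auto simp: smult_add_right finsum_closed Pi_def mult.commute)
 also have "... = (\<Oplus>j\<in>J. (c i0 j * f j) \<odot> e i0) +. (\<Oplus>j\<in>J. f j \<odot> (\<Oplus>i\<in>I. c i j \<odot> e i))"
 using insert by (intro finsum_addf) (auto simp: finsum_closed Pi_def)
 also have "(\<Oplus>j\<in>J. (c i0 j * f j) \<odot> e i0) = (\<Sum>j\<in>J. c i0 j * f j) \<odot> e i0"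
 using insert assms(2) by (intro finsum_smult_left) auto
 finally show ?case using insert by (subst finsum_insert) auto
qed

text \<open>The vectors form an indexed family, so repeated members count. Applied to the words in
  two elements, this permits equal products of different words.\<close>

lemma linear_dependence:
 assumes "finite S" "S <= carrier A" "finite J" "card S < card J" "!!j. j : J ==> v j : lspan S"
 shows "EX f. (\<exists>j\<in>J. f j ~= 0) & (\<Oplus>j\<in>J. f j \<odot> v j) = \<zero>"
proof -
 have "EX c. \<forall>j\<in>J. v j = (\<Oplus>s\<in>S. c j s \<odot> s)"
 using assms(5) lspan_finiteE[OF _ assms(1,2)] by (intro bchoice) auto
 then obtain c where c: "!!j. j : J ==> v j = (\<Oplus>s\<in>S. c j s \<odot> s)"
 by metis
 obtain f where f: "\<exists>j\<in>J. f j ~= 0" "\<forall>s\<in>S. (\<Sum>j\<in>J. c j s * f j) = 0"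
 using complex_underdetermined[OF assms(1,3,4), of "%s j. c j s"] by auto
 have "(\<Oplus>j\<in>J. f j \<odot> v j) = (\<Oplus>j\<in>J. f j \<odot> (\<Oplus>s\<in>S. c j s \<odot> s))"
 using c assms by (intro finsum_cong') (auto intro!: finsum_closed simp: subset_iff)
 also have "... = (\<Oplus>s\<in>S. (\<Sum>j\<in>J. c j s * f j) \<odot> s)"
 using assms by (intro finsum_finsum_smult) auto
 also have "... = (\<Oplus>s\<in>S. \<zero>)" using assms f by (intro finsum_cong') (auto simp: subset_iff)
 finally show ?thesis using f by auto
qed

definition wprod :: "'a list => 'a" where "wprod ws = foldr (**) ws \<one>"

lemma wprod_Nil [simp]: "wprod [] = \<one>" and wprod_Cons [simp]: "wprod (x # ws) = x ** wprod ws"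
 by (auto simp: wprod_def)

lemma wprod_closed [simp]: "set ws <= carrier A ==> wprod ws : carrier A"
 by (induct ws) auto

lemma wprod_append: "[|set ws <= carrier A; set ws' <= carrier A|] ==> wprod (ws @ ws') = wprod ws ** wprod ws'"
 by (induct ws) (auto simp: m_assoc)

definition words :: "'a set => nat => 'a set" where
 "words Gam N = {wprod ws | ws. set ws <= Gam & length ws <= N}"

text \<open>Words of length at most \<open>N\<close> are allowed, so the filtration is increasing
  and degree 0 consists of the scalars, coming from the empty word.\<close>

definition filt :: "'a set => nat => 'a set" where
 "filt Gam N = lspan (words Gam N)"

context
 fixes Gam assumes Gam: "Gam <= carrier A"
begin

lemma words_closed: "words Gam N <= carrier A"
 using Gam by (auto simp: words_def intro!: wprod_closed)

lemma filt_closed: "x : filt Gam N ==> x : carrier A"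
 unfolding filt_def using words_closed lspan_closed by blast

lemma filt_add: "[|x : filt Gam N; y : filt Gam N|] ==> x +. y : filt Gam N"
 unfolding filt_def using words_closed lspan_add by blast

lemma filt_diff: "[|x : filt Gam N; y : filt Gam N|] ==> x \<ominus> y : filt Gam N"
 unfolding filt_def using words_closed lspan_diff by blast

lemma filt_minus: "x : filt Gam N ==> \<ominus> x : filt Gam N"
 unfolding filt_def using words_closed lspan_minus by blast

lemma filt_smult: "x : filt Gam N ==> c \<odot> x : filt Gam N"
 unfolding filt_def using words_closed lspan_smult by blast

lemma filt_zero: "\<zero> : filt Gam N"
 unfolding filt_def by (rule lspan_zero)

lemma filt_word: "[|set ws <= Gam; length ws <= N|] ==> wprod ws : filt Gam N"
 unfolding filt_def using words_closed[of N] by (intro lspan_incl) (auto simp: words_def)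

lemma filt_one: "\<one> : filt Gam N"
 using filt_word[of "[]" N] by simp

lemma filt_gen: "x : Gam ==> x : filt Gam (Suc N)"
 using filt_word[of "[x]" "Suc N"] Gam by auto

lemma filt_mono: "[|x : filt Gam N; N <= M|] ==> x : filt Gam M"
 unfolding filt_def by (rule lspan_mono[OF _ _ words_closed]) (auto simp: words_def)

lemma filt_mult:
 assumes "x : filt Gam N" "y : filt Gam M" shows "x ** y : filt Gam (N + M)"
 unfolding filt_def
proof (rule lspan_mult[OF assms[unfolded filt_def] words_closed words_closed words_closed])
 fix s t assume "s : words Gam N" "t : words Gam M"
 then obtain ws ws' where w: "set ws <= Gam" "length ws <= N" "s = wprod ws" "set ws' <= Gam" "length ws' <= M" "t = wprod ws'"
 by (auto simp: words_def)
 then have "s ** t = wprod (ws @ ws')" using Gam by (subst wprod_append) auto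
 then show "s ** t : lspan (words Gam (N + M))" using w filt_word[of "ws @ ws'" "N + M"] by (simp add: filt_def)
qed

lemma filt_gen_mult: "[|x : Gam; y : filt Gam N|] ==> x ** y : filt Gam (Suc N)"
 using filt_mult[OF filt_gen[of x 0], of y N] by simp

lemma filt_induct [consumes 1, case_names zero step]:
 assumes "x : filt Gam N" "P \<zero>"
 "!!ws x c. [|set ws <= Gam; length ws <= N; x : filt Gam N; P x|] ==> P (c \<odot> wprod ws +. x)"
 shows "P x"
 using assms(1) unfolding filt_def
proof (induct rule: lspan.induct)
 case (lspan_step s x c)
 then show ?case using assms(3) by (auto simp: words_def filt_def)
qed (use assms in auto)

context
 assumes acomm: "!!x y. [|x : Gam; y : Gam|] ==> x ** y \<ominus> y ** x : filt Gam 0"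
begin

text \<open>Generators are assumed to commute up to scalars. By the Leibniz rule each term of the
  commutator loses one letter of the word; for the empty word the commutator is zero, which agrees
  with the truncated subtraction.\<close>

lemma filt_commutator_word:
 assumes "x : Gam" "set ws <= Gam" shows "x ** wprod ws \<ominus> wprod ws ** x : filt Gam (length ws - 1)"
 using assms(2)
proof (induct ws)
 case Nil
 then show ?case using assms(1) Gam filt_zero by (auto simp: subset_iff)
next
 case (Cons g ws)
 have c: "x : carrier A" "g : carrier A" "wprod ws : carrier A" using Cons assms Gam by auto
 have eq: "x ** wprod (g # ws) \<ominus> wprod (g # ws) ** x =
 (x ** g \<ominus> g ** x) ** wprod ws +. g ** (x ** wprod ws \<ominus> wprod ws ** x)"
 using c unfolding wprod_Cons by algebra
 have 1: "(x ** g \<ominus> g ** x) ** wprod ws : filt Gam (length ws)"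
 using filt_mult[OF acomm[of x g] filt_word[of ws "length ws"]] Cons assms by simp
 have 2: "g ** (x ** wprod ws \<ominus> wprod ws ** x) : filt Gam (length ws)"
 proof (cases ws)
 case Nil
 then show ?thesis using c filt_zero by simp
 next
 case (Cons a list)
 then show ?thesis using filt_gen_mult[of g, OF _ Cons.hyps] Cons.prems by simp
 qed
 show ?case unfolding eq using filt_add[OF 1 2] by simp
qed

lemma filt_commutator:
 assumes "x : Gam" "u : filt Gam N" shows "x ** u \<ominus> u ** x : filt Gam (N - 1)"
 using assms(2)
proof (induct rule: filt_induct)
 case zero
 then show ?case using assms(1) Gam filt_zero by (auto simp: subset_iff)
next
 case (step ws u c)
 have c: "x : carrier A" "u : carrier A" "wprod ws : carrier A" using step assms Gam filt_closed by auto
 have "x ** (c \<odot> wprod ws +. u) \<ominus> (c \<odot> wprod ws +. u) ** x =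
 (x ** (c \<odot> wprod ws) \<ominus> (c \<odot> wprod ws) ** x) +. (x ** u \<ominus> u ** x)"
 using c smult_closed[OF c(3), of c] by algebra
 also have "x ** (c \<odot> wprod ws) \<ominus> (c \<odot> wprod ws) ** x = c \<odot> (x ** wprod ws \<ominus> wprod ws ** x)"
 using c by (simp add: a_minus_def smult_add_right smult_minus_right)
 finally show ?case
 using step filt_smult[OF filt_mono[OF filt_commutator_word[OF assms(1), of ws], of "N - 1"]]
 by (auto intro!: filt_add)
qed

text \<open>The first letter \<open>g\<close> is moved to its place in the other word
  \<open>a @ g # b\<close>. The cost is a commutator of \<open>g\<close> with \<open>a\<close>, one
  degree lower, and induction compares the remaining letters.\<close>

lemma filt_permute:
 assumes "set ws <= Gam" "mset ws = mset ws'" shows "wprod ws \<ominus> wprod ws' : filt Gam (length ws - 1)"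
 using assms
proof (induct ws arbitrary: ws')
 case Nil
 then show ?case using filt_zero by simp
next
 case (Cons g ws)
 then have "g : set ws'" using mset_eq_setD by fastforce
 then obtain a b where ab: "ws' = a @ g # b" by (meson split_list)
 have m: "mset ws = mset (a @ b)" using Cons ab by simp
 then have sab: "set a <= Gam" "set b <= Gam" "length ws = length a + length b" "g : Gam" "set ws <= Gam"
 using Cons mset_eq_setD[OF m] mset_eq_length[OF m] by auto
 have c: "g : carrier A" "wprod ws : carrier A" "wprod a : carrier A" "wprod b : carrier A"
 using sab Gam by auto
 have e: "wprod ws' = wprod a ** (g ** wprod b)" "wprod (a @ b) = wprod a ** wprod b"
 using sab Gam unfolding ab by (subst wprod_append; auto)+
 have eq: "wprod (g # ws) \<ominus> wprod ws' =
 g ** (wprod ws \<ominus> wprod a ** wprod b) +. (g ** wprod a \<ominus> wprod a ** g) ** wprod b"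
 unfolding e wprod_Cons using c by algebra
 have 1: "(g ** wprod a \<ominus> wprod a ** g) ** wprod b : filt Gam (length ws)"
 using filt_mono[OF filt_mult[OF filt_commutator_word[of g a] filt_word[of b "length b"]], of "length ws"] sab by simp
 have 2: "g ** (wprod ws \<ominus> wprod a ** wprod b) : filt Gam (length ws)"
 proof (cases ws)
 case Nil
 then show ?thesis using c filt_zero sab by simp
 next
 case (Cons a' list)
 then show ?thesis using filt_gen_mult[of g, OF _ Cons.hyps[OF sab(5) m]] sab unfolding e by simp
 qed
 show ?case unfolding eq using filt_add[OF 2 1] by simp
qed

text \<open>Modulo lower degree a word depends only on the multiset of its letters. A multiset of
  size at most \<open>N\<close> has multiplicities at most \<open>N\<close>, whence the count
  \<open>(N + 1) ^ card Gam\<close>: growth is polynomial.\<close>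

lemma filt_finite_span:
 assumes "finite Gam"
 shows "EX S. finite S & S <= filt Gam N & card S <= (N + 1) ^ card Gam & filt Gam N <= lspan S"
proof -
 \<comment> \<open>An arbitrary arrangement of each multiset serves as its normal form.\<close>
 define rep where "rep M = (SOME ws. mset ws = M)" for M :: "'a multiset"
 have rep: "mset (rep M) = M" for M unfolding rep_def by (rule someI_ex) (rule ex_mset)
 have rep_set: "set (rep M) = set_mset M" "length (rep M) = size M" for M
 using rep[of M] by (metis set_mset_mset, metis size_mset)
 define Ms where "Ms N = {M. set_mset M <= Gam & size M <= N}" for N
 define S where "S N = (%M. wprod (rep M)) ` Ms N" for N
 have inj: "inj_on (%M. restrict (count M) Gam) (Ms N)" for N
 proof (rule inj_onI)
 fix M M' assume *: "M : Ms N" "M' : Ms N" "restrict (count M) Gam = restrict (count M') Gam"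
 have "count M a = count M' a" for a
 proof (cases "a : Gam")
 case True then show ?thesis using fun_cong[OF *(3), of a] by simp
 next
 case False then show ?thesis using * by (metis (no_types, lifting) Ms_def mem_Collect_eq not_in_iff subsetD)
 qed
 then show "M = M'" by (simp add: multiset_eq_iff)
 qed
 have sub: "(%M. restrict (count M) Gam) ` Ms N <= Gam \<rightarrow>\<^sub>E {..N}" for N
 by (auto simp: Ms_def intro: order_trans[OF count_le_size])
 have fin: "finite (Gam \<rightarrow>\<^sub>E {..N})" "card (Gam \<rightarrow>\<^sub>E {..N}) = (N + 1) ^ card Gam" for N
 using assms by (auto simp: finite_PiE card_PiE)
 have finM: "finite (Ms N)" for N using inj sub fin by (metis finite_imageD finite_subset)
 have card: "card (Ms N) <= (N + 1) ^ card Gam" for N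
 using card_inj_on_le[OF inj sub fin(1)] fin(2) by simp
 have Sc: "S N <= carrier A" for N using rep_set Gam by (auto simp: S_def Ms_def)
 have Smono: "S N <= S M" if "N <= M" for N M using that by (auto simp: S_def Ms_def)
 have "filt Gam N <= lspan (S N)" for N
 proof (induct N rule: less_induct)
 case (less N)
 have w: "wprod ws : lspan (S N)" if ws: "set ws <= Gam" "length ws <= N" for ws
 proof -
 have c: "wprod ws : carrier A" "wprod (rep (mset ws)) : carrier A" using ws rep_set Gam by auto
 have M: "wprod (rep (mset ws)) : S N" using ws by (auto simp: S_def Ms_def)
 \<comment> \<open>The difference to the normal form has smaller degree, where the spanning set is
   known by induction; the sets \<open>S N\<close> increase with \<open>N\<close>.\<close>
 have d: "wprod ws \<ominus> wprod (rep (mset ws)) : lspan (S N)"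
 proof (cases ws)
 case Nil
 then show ?thesis using rep_set[of "{#}"] lspan_zero by simp
 next
 case (Cons a list)
 then have "length ws - 1 < N" using ws by auto
 then have "wprod ws \<ominus> wprod (rep (mset ws)) : lspan (S (length ws - 1))"
 using less filt_permute[OF ws(1), of "rep (mset ws)"] rep by auto
 then show ?thesis using lspan_mono[OF _ Smono Sc] \<open>length ws - 1 < N\<close> by simp
 qed
 have "wprod ws = (wprod ws \<ominus> wprod (rep (mset ws))) +. wprod (rep (mset ws))"
 using c by algebra
 then show ?thesis using lspan_add[OF d lspan_incl[OF M Sc] Sc] by simp
 qed
 show ?case
 proof
 fix x assume "x : filt Gam N"
 then show "x : lspan (S N)" unfolding filt_def
 by (rule lspan_least) (use w Sc in \<open>auto simp: words_def\<close>)
 qed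
 qed
 moreover have "card (S N) <= (N + 1) ^ card Gam"
 using card_image_le[OF finM, of "%M. wprod (rep M)" N] card[of N] by (simp add: S_def)
 moreover have "S N <= filt Gam N" using rep_set by (auto simp: S_def Ms_def intro!: filt_word)
 ultimately show ?thesis using finM by (intro exI[of _ "S N"]) (auto simp: S_def)
qed

end
end

end

section \<open>Polynomial growth and the Ore condition\<close>

text \<open>There are \<open>2 ^ j\<close> words of length \<open>j\<close> in two elements of
  degree \<open>k\<close>; they lie in degree \<open>j * k\<close>, where the dimension is bounded
  by the left side.\<close>

lemma exists_exp_greater_power:
 fixes k e :: nat shows "EX j. (2 * (j * k) + 1) ^ e < 2 ^ j"
proof -
 have sq: "(s + 6)^2 <= (2::nat) ^ (s + 6)" for s
 proof (induct s)
 case (Suc s)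
 have "(Suc s + 6)^2 <= 2 * (s + 6)^2" by (simp add: power2_eq_square algebra_simps)
 also have "... <= 2 * 2 ^ (s + 6)" using Suc by (intro mult_left_mono) auto
 also have "... = 2 ^ (Suc s + 6)" by (simp only: add_Suc power_Suc)
 finally show ?case .
 qed simp
 \<comment> \<open>The witness is \<open>j = 2 ^ t\<close>. The base is then at most
   \<open>2 ^ (t + 1 + k)\<close>, so its power has exponent \<open>e * t + b\<close>, linear in
   \<open>t\<close>, against the exponent \<open>2 ^ t\<close> on the right. The summand 6 in
   \<open>t\<close> brings the estimate \<open>sq\<close> into range.\<close>
 define b where "b = e * (k + 1)"
 define t where "t = e + b + 6"
 have "e * t + b < t ^ 2" unfolding t_def by (simp add: power2_eq_square algebra_simps)
 also have "t ^ 2 <= 2 ^ t" unfolding t_def using sq[of "e + b"] by simp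
 finally have lin: "e * t + b < 2 ^ t" .
 have k: "k + 1 <= 2 ^ k" by (induct k) auto
 have "2 * (2 ^ t * k) + 1 <= 2 ^ (t + 1) * (k + 1)" by simp
 also have "... <= 2 ^ (t + 1) * 2 ^ k" using k by (intro mult_left_mono) auto
 finally have "(2 * (2 ^ t * k) + 1) ^ e <= (2 ^ (t + 1 + k)) ^ e"
 by (intro power_mono) (auto simp: power_add)
 also have "... = 2 ^ ((t + 1 + k) * e)" by (simp only: power_mult)
 also have "(t + 1 + k) * e = e * t + b" by (simp add: b_def algebra_simps)
 also have "(2::nat) ^ (e * t + b) < 2 ^ (2 ^ t)" using lin by simp
 finally show ?thesis by blast
qed

text \<open>
 If two nonzero right ideals \<^term>\<open>a R\<close> and \<^term>\<open>b R\<close> of a domain meet trivially, then the words in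
 \<^term>\<open>a\<close> and \<^term>\<open>b\<close> of a given length are linearly independent.  This contradicts polynomial growth.
\<close>

lemma (in calgebra) ore_domain_of_growth:
 assumes one: "\<one> ~= \<zero>"
 and dom: "!!x y. [|x : carrier A; y : carrier A; x ** y = \<zero>|] ==> x = \<zero> \<or> y = \<zero>"
 and W: "!!N. W N <= carrier A" "!!x. x : carrier A ==> EX N. x : W N"
 "!!x N M. [|x : W N; N <= M|] ==> x : W M" "\<one> : W 0"
 "!!x y N M. [|x : W N; y : W M|] ==> x ** y : W (N + M)"
 and dep: "!!N (J :: bool list set) v. [|finite J; (2 * N + 1) ^ e < card J; !!j. j : J ==> v j : W N|] ==>
 EX f. (\<exists>j\<in>J. f j ~= 0) & (\<Oplus>j\<in>J. f j \<odot> v j) = \<zero>"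
 shows "ore_domain A"
proof (intro ore_domain.intro calgebra_axioms ore_domain_axioms.intro one dom, assumption+)
 fix a b assume ab: "a : carrier A" "b : carrier A" "a ~= \<zero>" "b ~= \<zero>"
 show "\<exists>u\<in>carrier A. \<exists>v\<in>carrier A. a ** u = b ** v & a ** u ~= \<zero>"
 proof (rule ccontr)
 assume "\<not> ?thesis"
 then have no: "a ** u = \<zero>" if "u : carrier A" "v : carrier A" "a ** u = b ** v" for u v
 using that by blast
 define g where "g c = (if c then a else b)" for c
 have gc: "g c : carrier A" for c using ab by (simp add: g_def)
 define v where "v w = wprod (map g w)" for w
 have vc: "v w : carrier A" for w using gc by (auto simp: v_def intro!: wprod_closed)
 define L where "L j = {w :: bool list. length w = j}" for j
 have L: "finite (L j)" "card (L j) = 2 ^ j" for j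
 using finite_lists_length_eq[of "UNIV :: bool set" j] card_lists_length_eq[of "UNIV :: bool set" j]
 by (auto simp: L_def)
 \<comment> \<open>Splitting words by their first letter turns a relation into
   \<open>a ** p True +. b ** p False = \<zero>\<close>. Trivial intersection makes both terms
   vanish, cancellation makes both coefficients vanish, and these are relations between shorter
   words.\<close>
 have ind: "\<forall>w\<in>L j. f w = 0" if "(\<Oplus>w\<in>L j. f w \<odot> v w) = \<zero>" for f j
 using that
 proof (induct j arbitrary: f)
 case 0
 have "L 0 = {[]}" by (auto simp: L_def)
 then have "f [] \<odot> \<one> = \<zero>" using 0 by (simp add: v_def)
 then show ?case using \<open>L 0 = {[]}\<close> smult_eq_zero one by auto
 next
 case (Suc j)
 have LS: "L (Suc j) = Cons True ` L j \<union> Cons False ` L j"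
 by (auto simp: L_def length_Suc_conv image_iff)
 have part: "(\<Oplus>w\<in>Cons c ` L j. f w \<odot> v w) = g c ** (\<Oplus>w\<in>L j. f (c # w) \<odot> v w)" for c
 proof -
 have "(\<Oplus>w\<in>Cons c ` L j. f w \<odot> v w) = (\<Oplus>w\<in>L j. f (c # w) \<odot> v (c # w))"
 using vc by (intro finsum_reindex) (auto simp: inj_on_def)
 also have "... = (\<Oplus>w\<in>L j. g c ** (f (c # w) \<odot> v w))"
 using vc gc by (intro finsum_cong') (auto simp: v_def[of "_ # _"]  v_def[symmetric])
 also have "... = g c ** (\<Oplus>w\<in>L j. f (c # w) \<odot> v w)"
 using vc gc L by (intro finsum_rdistr[symmetric]) auto
 finally show ?thesis .
 qed
 define p where "p c = (\<Oplus>w\<in>L j. f (c # w) \<odot> v w)" for c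
 have pc: "p c : carrier A" for c unfolding p_def using vc by (intro finsum_closed) auto
 have "(\<Oplus>w\<in>L (Suc j). f w \<odot> v w) = (\<Oplus>w\<in>Cons True ` L j. f w \<odot> v w) +. (\<Oplus>w\<in>Cons False ` L j. f w \<odot> v w)"
 unfolding LS using L vc by (intro finsum_Un_disjoint) auto
 then have z: "a ** p True +. b ** p False = \<zero>"
 using Suc part by (simp add: p_def g_def)
 have "\<ominus> (b ** p False) = a ** p True" by (rule minus_equality[OF z]) (use ab pc in auto)
 then have "a ** p True = b ** (\<ominus> p False)"
 using ab pc by (simp add: r_minus)
 then have "a ** p True = \<zero>" using no pc by blast
 then have "p True = \<zero>" using dom[of a "p True"] ab pc by auto
 then have "b ** p False = \<zero>" using z ab pc by simp
 then have "p False = \<zero>" using dom[of b "p False"] ab pc by blast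
 with \<open>p True = \<zero>\<close> have "\<forall>w\<in>L j. f (c # w) = 0" for c
 using Suc(1)[of "%w. f (c # w)"] by (cases c) (auto simp: p_def)
 then show ?case by (auto simp: LS)
 qed
 obtain N1 N2 where "a : W N1" "b : W N2" using W(2) ab by meson
 define k where "k = max N1 N2"
 have gk: "g c : W k" for c
 using W(3)[OF \<open>a : W N1\<close>, of k] W(3)[OF \<open>b : W N2\<close>, of k] by (simp add: g_def k_def)
 have vW: "v w : W (length w * k)" for w
 using W(4) W(5)[OF gk] by (induct w) (auto simp: v_def)
 \<comment> \<open>For this length the number of words exceeds the dimension bound at their degree,
   so a nontrivial relation must exist, against \<open>ind\<close>.\<close>
 obtain j where j: "(2 * (j * k) + 1) ^ e < 2 ^ j" using exists_exp_greater_power by blast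
 have "EX f. (\<exists>w\<in>L j. f w ~= 0) & (\<Oplus>w\<in>L j. f w \<odot> v w) = \<zero>"
 using vW by (intro dep[of "L j" "j * k"]) (use L j in \<open>auto simp: L_def\<close>)
 then show False using ind by blast
 qed
qed

section \<open>Differential operators on a commutative domain\<close>

locale domain_algebra = calgebra A for A :: "(complex, 'a) module" (structure) +
 assumes m_comm: "[|x : carrier A; y : carrier A|] ==> x ** y = y ** x"
 and one_not_zero [simp]: "\<one> ~= \<zero>"
 and no_zero_divisors: "[|x : carrier A; y : carrier A; x ** y = \<zero>|] ==> x = \<zero> \<or> y = \<zero>"
begin

sublocale cring A
 by unfold_locales (rule m_comm)

lemma ore_domain: "ore_domain A"
proof (unfold_locales)
 fix a b assume "a : carrier A" "b : carrier A" "a ~= \<zero>" "b ~= \<zero>"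
 then show "\<exists>u\<in>carrier A. \<exists>v\<in>carrier A. a ** u = b ** v & a ** u ~= \<zero>"
 using no_zero_divisors by (intro bexI[of _ b] bexI[of _ a]) (auto simp: m_comm)
qed (auto dest: no_zero_divisors)

abbreviation "D == diffop_algebra A"
abbreviation "mu == mult_operator A"

text \<open>The commutator of \<open>d\<close> with multiplication by \<open>b\<close>, written out
  on elements so that it is literally the function in the recursive clause of
  \<open>diffops\<close>.\<close>

definition brk :: "('a => 'a) => 'a => 'a => 'a" where
 "brk d b = (\<lambda>f\<in>carrier A. d (b ** f) \<ominus> b ** d f)"

lemma linear_endosD:
 assumes "d : linear_endos A"
 shows "f : carrier A ==> d f : carrier A"
 and "[|f : carrier A; g : carrier A|] ==> d (f +. g) = d f +. d g"
 and "f : carrier A ==> d (c \<odot> f) = c \<odot> d f"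
 and "d : extensional (carrier A)"
 using assms by (auto simp: linear_endos_def PiE_def)

lemma linear_endos_zero:
 assumes "d : linear_endos A" shows "d \<zero> = \<zero>"
 using linear_endosD(3)[OF assms zero_closed, of 0] linear_endosD(1)[OF assms zero_closed] by simp

lemma linear_endos_minus:
 assumes "d : linear_endos A" "f : carrier A" shows "d (\<ominus> f) = \<ominus> d f"
 using linear_endosD(3)[OF assms, of "-1"] linear_endosD(1)[OF assms] assms(2) by (simp add: smult_minus_left)

lemma linear_endos_diff:
 assumes "d : linear_endos A" "f : carrier A" "g : carrier A" shows "d (f \<ominus> g) = d f \<ominus> d g"
 using assms by (simp add: a_minus_def linear_endosD linear_endos_minus)

lemma linear_endosI:
 assumes "!!f. f : carrier A ==> d f : carrier A"
 and "!!f g. [|f : carrier A; g : carrier A|] ==> d (f +. g) = d f +. d g"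
 and "!!f c. f : carrier A ==> d (c \<odot> f) = c \<odot> d f"
 and "d : extensional (carrier A)"
 shows "d : linear_endos A"
 using assms by (auto simp: linear_endos_def PiE_def)

lemma linear_endos_eqI:
 assumes "d : linear_endos A" "e : linear_endos A" "!!f. f : carrier A ==> d f = e f"
 shows "d = e"
 using assms linear_endosD(4) by (metis extensionalityI)

lemma D_simps:
 "monoid.mult D = (%d e. compose (carrier A) d e)" "one D = (\<lambda>f\<in>carrier A. f)"
 "zero D = (\<lambda>f\<in>carrier A. \<zero>)" "add D = (%d e. \<lambda>f\<in>carrier A. d f +. e f)"
 "smult D = (%c d. \<lambda>f\<in>carrier A. c \<odot> d f)" "carrier D = (\<Union>j. diffops A j)"
 by (auto simp: diffop_algebra_def)

lemma D_apply [simp]: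
 "f : carrier A ==> (d **\<^bsub>D\<^esub> e) f = d (e f)"
 "f : carrier A ==> \<one>\<^bsub>D\<^esub> f = f"
 "f : carrier A ==> \<zero>\<^bsub>D\<^esub> f = \<zero>"
 "f : carrier A ==> (d +.\<^bsub>D\<^esub> e) f = d f +. e f"
 "f : carrier A ==> (c \<odot>\<^bsub>D\<^esub> d) f = c \<odot> d f"
 by (auto simp: D_simps compose_def)

lemma linear_endos_ops:
 assumes "d : linear_endos A" "e : linear_endos A"
 shows "d **\<^bsub>D\<^esub> e : linear_endos A" "d +.\<^bsub>D\<^esub> e : linear_endos A" "c \<odot>\<^bsub>D\<^esub> d : linear_endos A"
 "\<one>\<^bsub>D\<^esub> : linear_endos A" "\<zero>\<^bsub>D\<^esub> : linear_endos A"
proof -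
 note d = linear_endosD[OF assms(1)] and e = linear_endosD[OF assms(2)]
 show "d **\<^bsub>D\<^esub> e : linear_endos A"
 by (rule linear_endosI) (auto simp: d e, auto simp: D_simps)
 show "d +.\<^bsub>D\<^esub> e : linear_endos A"
 by (rule linear_endosI) (auto simp: d e smult_add_right, auto simp: D_simps d e a_ac)
 show "c \<odot>\<^bsub>D\<^esub> d : linear_endos A"
 by (rule linear_endosI) (auto simp: d e smult_add_right mult.commute, auto simp: D_simps)
 show "\<one>\<^bsub>D\<^esub> : linear_endos A"
 by (rule linear_endosI) (auto, auto simp: D_simps)
 show "\<zero>\<^bsub>D\<^esub> : linear_endos A"
 by (rule linear_endosI) (auto, auto simp: D_simps)
qed

lemma mult_operator_apply [simp]: "f : carrier A ==> mu b f = b ** f"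
 by (simp add: mult_operator_def)

lemma mult_operator_linear: "b : carrier A ==> mu b : linear_endos A"
 by (rule linear_endosI) (auto simp: r_distr, auto simp: mult_operator_def)

lemma brk_linear:
 assumes "d : linear_endos A" "b : carrier A" shows "brk d b : linear_endos A"
proof (rule linear_endosI)
 note d = linear_endosD[OF assms(1)]
 fix f g assume f: "f : carrier A" "g : carrier A"
 have c: "d (b ** f) : carrier A" "d (b ** g) : carrier A" "d f : carrier A" "d g : carrier A" using f d assms by auto
 show "brk d b (f +. g) = brk d b f +. brk d b g"
 using c f assms by (simp add: brk_def d r_distr a_minus_def minus_add a_ac)
next
 note d = linear_endosD[OF assms(1)]
 fix f c assume f: "f : carrier A"
 then show "brk d b f : carrier A" using assms d by (simp add: brk_def)
 show "brk d b (c \<odot> f) = c \<odot> brk d b f"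
 using f assms by (simp add: brk_def d a_minus_def smult_add_right smult_minus_right)
qed (simp add: brk_def)

lemma diffops_linear: "d : diffops A j ==> d : linear_endos A"
 by (cases j) (auto simp: mult_operator_linear)

lemma diffops_Suc_iff: "d : diffops A (Suc j) \<longleftrightarrow> d : linear_endos A & (\<forall>b\<in>carrier A. brk d b : diffops A j)"
 by (simp add: brk_def)

declare diffops.simps(2) [simp del]

lemma zero_diffop: "\<zero>\<^bsub>D\<^esub> : diffops A j"
proof (induct j)
 case 0
 have "\<zero>\<^bsub>D\<^esub> = mu \<zero>" by (auto simp: D_simps mult_operator_def fun_eq_iff)
 then show ?case by auto
next
 case (Suc j)
 have "brk \<zero>\<^bsub>D\<^esub> b = \<zero>\<^bsub>D\<^esub>" if "b : carrier A" for b
 using that by (auto simp: brk_def D_simps fun_eq_iff)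
 then show ?case using Suc linear_endos_ops(5) mult_operator_linear[of \<one>] by (auto simp: diffops_Suc_iff)
qed

lemma brk_mult_operator: "[|a : carrier A; b : carrier A|] ==> brk (mu a) b = \<zero>\<^bsub>D\<^esub>"
 by (rule ext) (auto simp: brk_def D_simps m_lcomm)

lemma brk_diffop: "[|d : diffops A j; b : carrier A|] ==> brk d b : diffops A (j - 1)"
 by (cases j) (auto simp: diffops_Suc_iff brk_mult_operator zero_diffop simp del: diffops.simps(1),
 auto simp: brk_mult_operator zero_diffop[of 0, simplified])

lemma diffops_mono_Suc: "d : diffops A j ==> d : diffops A (Suc j)"
proof (induct j arbitrary: d)
 case 0
 then show ?case using brk_mult_operator mult_operator_linear zero_diffop[of 0] by (auto simp: diffops_Suc_iff)
next
 case (Suc j)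
 then show ?case unfolding diffops_Suc_iff[of _ "Suc j"] using diffops_Suc_iff[of d j] by blast
qed

lemma diffops_mono: "[|d : diffops A j; j <= k|] ==> d : diffops A k"
 by (induct k) (auto simp: le_Suc_eq diffops_mono_Suc)

lemma brk_add:
 assumes "d : linear_endos A" "e : linear_endos A" "b : carrier A"
 shows "brk (d +.\<^bsub>D\<^esub> e) b = brk d b +.\<^bsub>D\<^esub> brk e b"
proof (rule linear_endos_eqI)
 fix f assume f: "f : carrier A"
 have c: "d (b ** f) : carrier A" "e (b ** f) : carrier A" "d f : carrier A" "e f : carrier A"
 using f assms linear_endosD by auto
 show "brk (d +.\<^bsub>D\<^esub> e) b f = (brk d b +.\<^bsub>D\<^esub> brk e b) f"
 using f assms(3) c by (simp add: brk_def) algebra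
qed (use assms brk_linear linear_endos_ops in auto)

lemma brk_smult:
 assumes "d : linear_endos A" "b : carrier A"
 shows "brk (c \<odot>\<^bsub>D\<^esub> d) b = c \<odot>\<^bsub>D\<^esub> brk d b"
proof (rule linear_endos_eqI)
 fix f assume f: "f : carrier A"
 have c: "d (b ** f) : carrier A" "d f : carrier A"
 using f assms linear_endosD by auto
 show "brk (c \<odot>\<^bsub>D\<^esub> d) b f = (c \<odot>\<^bsub>D\<^esub> brk d b) f"
 using f assms(2) c by (simp add: brk_def a_minus_def smult_add_right smult_minus_right)
qed (use assms brk_linear linear_endos_ops in auto)

lemma brk_mult:
 assumes "d : linear_endos A" "e : linear_endos A" "b : carrier A"
 shows "brk (d **\<^bsub>D\<^esub> e) b = d **\<^bsub>D\<^esub> brk e b +.\<^bsub>D\<^esub> brk d b **\<^bsub>D\<^esub> e"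
proof (rule linear_endos_eqI)
 fix f assume f: "f : carrier A"
 have ec: "e (b ** f) : carrier A" "e f : carrier A" using f assms linear_endosD by auto
 have c: "d (e (b ** f)) : carrier A" "d (b ** e f) : carrier A" "d (e f) : carrier A"
 using f assms ec linear_endosD by auto
 show "brk (d **\<^bsub>D\<^esub> e) b f = (d **\<^bsub>D\<^esub> brk e b +.\<^bsub>D\<^esub> brk d b **\<^bsub>D\<^esub> e) f"
 using f assms(3) c ec by (simp add: brk_def linear_endos_diff[OF assms(1)]) algebra
qed (use assms brk_linear linear_endos_ops in auto)

lemma diffops_add: "[|d : diffops A j; e : diffops A j|] ==> d +.\<^bsub>D\<^esub> e : diffops A j"
proof (induct j arbitrary: d e)
 case 0
 then obtain a b where "a : carrier A" "b : carrier A" "d = mu a" "e = mu b" by auto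
 then have "d +.\<^bsub>D\<^esub> e = mu (a +. b)" by (auto simp: D_simps mult_operator_def fun_eq_iff l_distr)
 then show ?case using \<open>a : carrier A\<close> \<open>b : carrier A\<close> by simp
next
 case (Suc j)
 then show ?case unfolding diffops_Suc_iff by (auto simp: linear_endos_ops brk_add)
qed

lemma diffops_smult: "d : diffops A j ==> c \<odot>\<^bsub>D\<^esub> d : diffops A j"
proof (induct j arbitrary: d)
 case 0
 then obtain a where "a : carrier A" "d = mu a" by auto
 then have "c \<odot>\<^bsub>D\<^esub> d = mu (c \<odot> a)" by (auto simp: D_simps mult_operator_def fun_eq_iff)
 then show ?case using \<open>a : carrier A\<close> by simp
next
 case (Suc j)
 then show ?case unfolding diffops_Suc_iff
 using linear_endos_ops(3)[of d d c] brk_smult by auto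
qed

lemma linear_endos_zero_mult:
 "d : linear_endos A ==> d **\<^bsub>D\<^esub> \<zero>\<^bsub>D\<^esub> = \<zero>\<^bsub>D\<^esub>"  "d : linear_endos A ==> \<zero>\<^bsub>D\<^esub> **\<^bsub>D\<^esub> d = \<zero>\<^bsub>D\<^esub>"
 by (rule linear_endos_eqI, auto simp: linear_endos_zero linear_endosD intro: linear_endos_ops)+

text \<open>Induction on the total order: by the Leibniz rule \<open>brk_mult\<close> the commutator
  of a product is a sum of products of total order one less.\<close>

lemma diffops_mult:
 "[|d : diffops A r; e : diffops A s|] ==> d **\<^bsub>D\<^esub> e : diffops A (r + s)"
proof (induct "r + s" arbitrary: r s d e)
 case 0
 then obtain a b where ab: "a : carrier A" "b : carrier A" "d = mu a" "e = mu b" by auto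
 have "d **\<^bsub>D\<^esub> e = mu (a ** b)" unfolding ab
 by (rule linear_endos_eqI) (use ab mult_operator_linear linear_endos_ops in \<open>auto simp: m_assoc\<close>)
 then show ?case using 0 ab by simp
next
 case (Suc n)
 note lin = diffops_linear[OF Suc(3)] diffops_linear[OF Suc(4)]
 have 1: "d **\<^bsub>D\<^esub> brk e b : diffops A n" if b: "b : carrier A" for b
 \<comment> \<open>In order zero there is no smaller order to pass to; the commutator is zero, and
   zero has every order.\<close>
 proof (cases s)
 case 0
 then have "brk e b = \<zero>\<^bsub>D\<^esub>" using Suc(4) b brk_mult_operator by auto
 then show ?thesis using lin by (simp add: linear_endos_zero_mult zero_diffop)
 next
 case (Suc s')
 then show ?thesis using Suc.hyps(1)[of r s' d "brk e b"] brk_diffop[OF Suc.prems(2) b] Suc.prems Suc.hyps(2) by simp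
 qed
 have 2: "brk d b **\<^bsub>D\<^esub> e : diffops A n" if b: "b : carrier A" for b
 proof (cases r)
 case 0
 then have "brk d b = \<zero>\<^bsub>D\<^esub>" using Suc(3) b brk_mult_operator by auto
 then show ?thesis using lin by (simp add: linear_endos_zero_mult zero_diffop)
 next
 case (Suc r')
 then show ?thesis using Suc.hyps(1)[of r' s "brk d b" e] brk_diffop[OF Suc.prems(1) b] Suc.prems Suc.hyps(2) by simp
 qed
 have "d **\<^bsub>D\<^esub> e : diffops A (Suc n)" unfolding diffops_Suc_iff
 using lin 1 2 by (auto simp: linear_endos_ops brk_mult intro: diffops_add)
 then show ?case using Suc by simp
qed

lemma D_carrierE:
 assumes "d : carrier D" obtains j where "d : diffops A j"
 using assms by (auto simp: D_simps)

lemma D_carrierI: "d : diffops A j ==> d : carrier D"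
 by (auto simp: D_simps)

lemma D_linear: "d : carrier D ==> d : linear_endos A"
 using diffops_linear by (auto simp: D_simps)

lemma D_common:
 assumes "d : carrier D" "e : carrier D"
 obtains j where "d : diffops A j" "e : diffops A j"
proof -
 obtain i j where "d : diffops A i" "e : diffops A j" using assms by (metis D_carrierE)
 then show ?thesis using that[of "max i j"] diffops_mono by auto
qed

lemma D_closed:
 assumes "d : carrier D" "e : carrier D"
 shows "d **\<^bsub>D\<^esub> e : carrier D" "d +.\<^bsub>D\<^esub> e : carrier D" "c \<odot>\<^bsub>D\<^esub> d : carrier D"
 using D_common[OF assms] diffops_mult diffops_add diffops_smult D_carrierI by metis+

lemma mult_operator_diffop: "a : carrier A ==> mu a : diffops A j"
 using diffops_mono[of "mu a" 0 j] by simp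

lemma mult_operator_one: "mu \<one> = \<one>\<^bsub>D\<^esub>"
 by (auto simp: mult_operator_def D_simps fun_eq_iff)

lemma D_one_closed: "\<one>\<^bsub>D\<^esub> : carrier D" "\<zero>\<^bsub>D\<^esub> : carrier D"
 using D_carrierI[OF mult_operator_diffop[of \<one> 0]] D_carrierI[OF zero_diffop[of 0]]
 by (auto simp: mult_operator_one)

lemma D_eqI: "[|d : carrier D; e : carrier D; !!f. f : carrier A ==> d f = e f|] ==> d = e"
 using linear_endos_eqI D_linear by blast

lemma D_apply_closed [simp]: "[|d : carrier D; f : carrier A|] ==> d f : carrier A"
 using D_linear linear_endosD by blast

lemmas D_lin = linear_endosD(2,3)[OF D_linear]

lemma D_calgebra: "calgebra D"
proof -
 have "abelian_group D"
 proof (rule abelian_groupI)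
 fix d assume d: "d : carrier D"
 have "((- 1) \<odot>\<^bsub>D\<^esub> d) +.\<^bsub>D\<^esub> d = \<zero>\<^bsub>D\<^esub>"
 using d by (intro D_eqI) (auto intro!: D_closed D_one_closed simp: smult_minus_left l_neg)
 then show "\<exists>e\<in>carrier D. e +.\<^bsub>D\<^esub> d = \<zero>\<^bsub>D\<^esub>" using D_closed(3)[OF d d] by blast
 qed (auto intro!: D_closed D_one_closed D_eqI simp: a_ac)
 moreover have "monoid D"
 by (rule monoidI) (auto intro!: D_closed D_one_closed D_eqI)
 ultimately have "ring D"
 by (rule ringI) (auto intro!: D_closed D_one_closed D_eqI simp: D_lin)
 then show ?thesis
 by (rule calgebra.intro)
 (unfold_locales, auto intro!: D_closed D_one_closed D_eqI simp: D_lin smult_add_left smult_add_right)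
qed

sublocale D: calgebra D by (rule D_calgebra)

lemma D_minus_apply:
 assumes "d : carrier D" "f : carrier A" shows "(\<ominus>\<^bsub>D\<^esub> d) f = \<ominus> d f"
proof -
 have "\<ominus>\<^bsub>D\<^esub> d = (- 1) \<odot>\<^bsub>D\<^esub> d" using assms D.smult_minus_left[of d 1] by simp
 then show ?thesis using assms by (simp add: smult_minus_left)
qed

lemma D_diff_apply:
 "[|d : carrier D; e : carrier D; f : carrier A|] ==> (d \<ominus>\<^bsub>D\<^esub> e) f = d f \<ominus> e f"
 by (simp add: a_minus_def D_minus_apply)

lemma mult_operator_hom: "mu : algebra_hom A D"
 by (rule algebra_homI)
 (auto intro!: D_carrierI[OF mult_operator_diffop] D_eqI D.add.m_closed simp: m_assoc l_distr mult_operator_one)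

lemma mult_operator_closed [simp]: "a : carrier A ==> mu a : carrier D"
 by (rule D_carrierI[OF mult_operator_diffop])

lemma mult_operator_eq_zero: "[|a : carrier A; mu a = \<zero>\<^bsub>D\<^esub>|] ==> a = \<zero>"
 using D_apply(3)[of \<one>] mult_operator_apply[of \<one> a] by simp

lemma brk_commutator:
 assumes "d : carrier D" "b : carrier A"
 shows "brk d b = d **\<^bsub>D\<^esub> mu b \<ominus>\<^bsub>D\<^esub> mu b **\<^bsub>D\<^esub> d"
proof (rule linear_endos_eqI)
 show "brk d b : linear_endos A" using assms brk_linear D_linear by blast
 show "d **\<^bsub>D\<^esub> mu b \<ominus>\<^bsub>D\<^esub> mu b **\<^bsub>D\<^esub> d : linear_endos A" using assms D_linear by auto
qed (use assms in \<open>auto simp: D_diff_apply brk_def\<close>)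

lemma commutator_diffop:
 assumes "d : diffops A j" "b : carrier A"
 shows "d **\<^bsub>D\<^esub> mu b \<ominus>\<^bsub>D\<^esub> mu b **\<^bsub>D\<^esub> d : diffops A (j - 1)"
 using brk_diffop[OF assms] brk_commutator[OF D_carrierI[OF assms(1)] assms(2)] by simp

lemma commutator_diffop_zero:
 assumes "d : diffops A 0" "b : carrier A"
 shows "d **\<^bsub>D\<^esub> mu b = mu b **\<^bsub>D\<^esub> d"
proof -
 obtain a where "a : carrier A" "d = mu a" using assms by auto
 then show ?thesis using assms algebra_homD(2)[OF mult_operator_hom, symmetric] by (simp add: m_comm)
qed

text \<open>Evaluating \<open>d\<close> composed with multiplication by \<open>f\<close> at the unit
  gives \<open>d f\<close> on one side and \<open>f ** d \<one>\<close> on the other.\<close>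

lemma commuting_eq_mult_operator:
 assumes "d : carrier D" "!!b. b : carrier A ==> d **\<^bsub>D\<^esub> mu b = mu b **\<^bsub>D\<^esub> d"
 shows "d = mu (d \<one>)"
proof (rule D_eqI)
 fix f assume f: "f : carrier A"
 have "(d **\<^bsub>D\<^esub> mu f) \<one> = (mu f **\<^bsub>D\<^esub> d) \<one>" using assms(2)[OF f] by simp
 then show "d f = mu (d \<one>) f" using f assms(1) by (simp add: m_comm)
qed (use assms in auto)

end

section \<open>Iterated commutators\<close>

context calgebra
begin

text \<open>The sign is chosen so that \<open>ad (mu b) d\<close> is \<open>brk d b\<close>, and so
  that a partial derivative has commutator 1 with its own coordinate. As a function of
  \<open>d\<close> it is a derivation.\<close>

definition ad :: "'a => 'a => 'a" where "ad x d = d ** x \<ominus> x ** d"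

lemma ad_closed [simp]: "[|x : carrier A; d : carrier A|] ==> ad x d : carrier A"
 by (simp add: ad_def)

lemma ad_mult: "[|x : carrier A; d : carrier A; e : carrier A|] ==> ad x (d ** e) = ad x d ** e +. d ** ad x e"
 unfolding ad_def by algebra

lemma ad_add: "[|x : carrier A; d : carrier A; e : carrier A|] ==> ad x (d +. e) = ad x d +. ad x e"
 unfolding ad_def by algebra

lemma ad_diff: "[|x : carrier A; d : carrier A; e : carrier A|] ==> ad x (d \<ominus> e) = ad x d \<ominus> ad x e"
 unfolding ad_def by algebra

lemma ad_smult: "[|x : carrier A; d : carrier A|] ==> ad x (c \<odot> d) = c \<odot> ad x d"
 unfolding ad_def by (simp add: a_minus_def smult_add_right smult_minus_right)

lemma ad_eq_zero_iff: "[|x : carrier A; d : carrier A|] ==> ad x d = \<zero> \<longleftrightarrow> d ** x = x ** d"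
 by (simp add: ad_def)

lemma ad_comm:
 "[|x : carrier A; y : carrier A; d : carrier A; x ** y = y ** x|] ==> ad x (ad y d) = ad y (ad x d)"
proof -
 assume c: "x : carrier A" "y : carrier A" "d : carrier A" and xy: "x ** y = y ** x"
 have "ad x (ad y d) \<ominus> ad y (ad x d) = d ** (y ** x \<ominus> x ** y) \<ominus> (y ** x \<ominus> x ** y) ** d"
 unfolding ad_def using c by algebra
 then show ?thesis using c xy by simp
qed

lemma ad_funpow_closed [simp]: "[|x : carrier A; d : carrier A|] ==> (ad x ^^ k) d : carrier A"
 by (induct k) auto

lemma ad_funpow_add: "[|x : carrier A; d : carrier A; e : carrier A|] ==> (ad x ^^ k) (d +. e) = (ad x ^^ k) d +. (ad x ^^ k) e"
 by (induct k) (auto simp: ad_add)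

lemma ad_funpow_zero [simp]: "x : carrier A ==> (ad x ^^ k) \<zero> = \<zero>"
 by (induct k) (auto simp: ad_def)

text \<open>In the Leibniz formula for \<open>p + q\<close> commutators every term but one contains
  more than \<open>p\<close> on \<open>d\<close> or more than \<open>q\<close> on \<open>e\<close>
  and vanishes. The surviving binomial coefficient is invertible in characteristic 0, so exact
  nilpotency degrees add up on products.\<close>

lemma ad_leibniz_top:
 assumes x: "x : carrier A"
 shows "[|d : carrier A; e : carrier A; (ad x ^^ Suc p) d = \<zero>; (ad x ^^ Suc q) e = \<zero>|] ==>
 (ad x ^^ (p + q)) (d ** e) = of_nat ((p + q) choose p) \<odot> ((ad x ^^ p) d ** (ad x ^^ q) e)"
proof (induct "p + q" arbitrary: p q d e)
 case 0 then show ?case by simp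
next
 case (Suc n)
 note c = Suc.prems(1,2)
 have sw: "(ad x ^^ k) (ad x u) = (ad x ^^ Suc k) u" for k u by (simp only: funpow_Suc_right o_apply)
 have 1: "(ad x ^^ n) (ad x d ** e) = of_nat (if p = 0 then 0 else n choose (p - 1)) \<odot> ((ad x ^^ p) d ** (ad x ^^ q) e)"
 proof (cases p)
 case 0
 then show ?thesis using Suc.prems x by simp
 next
 case (Suc p')
 then have "(ad x ^^ (p' + q)) (ad x d ** e) = of_nat ((p' + q) choose p') \<odot> ((ad x ^^ p') (ad x d) ** (ad x ^^ q) e)"
 using Suc.hyps Suc.prems x by (intro Suc.hyps(1)) (auto simp: sw simp del: funpow.simps)
 then show ?thesis using Suc Suc.hyps(2) unfolding sw by simp
 qed
 have 2: "(ad x ^^ n) (d ** ad x e) = of_nat (n choose p) \<odot> ((ad x ^^ p) d ** (ad x ^^ q) e)"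
 proof (cases q)
 case 0
 \<comment> \<open>Here \<open>p = Suc n\<close>, so the coefficient is zero, matching
   \<open>ad x e = \<zero>\<close>.\<close>
 then have "n choose p = 0" using Suc.hyps(2) by (intro binomial_eq_0) simp
 then show ?thesis using 0 Suc.prems x by (simp add: binomial_eq_0)
 next
 case (Suc q')
 then have "(ad x ^^ (p + q')) (d ** ad x e) = of_nat ((p + q') choose p) \<odot> ((ad x ^^ p) d ** (ad x ^^ q') (ad x e))"
 using Suc.hyps Suc.prems x by (intro Suc.hyps(1)) (auto simp: sw simp del: funpow.simps)
 then show ?thesis using Suc Suc.hyps(2) unfolding sw by simp
 qed
 have ch: "(if p = 0 then 0 else n choose (p - 1)) + (n choose p) = (p + q) choose p"
 using Suc.hyps(2)[symmetric] by (cases p) auto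
 have "(ad x ^^ (p + q)) (d ** e) = (ad x ^^ n) (ad x (d ** e))"
 unfolding sw using Suc.hyps(2) by simp
 also have "... = (ad x ^^ n) (ad x d ** e) +. (ad x ^^ n) (d ** ad x e)"
 using c x by (simp add: ad_mult ad_funpow_add)
 also have "... = of_nat ((p + q) choose p) \<odot> ((ad x ^^ p) d ** (ad x ^^ q) e)"
 unfolding 1 2 ch[symmetric] of_nat_add using c x by (subst smult_add_left) auto
 finally show ?case .
qed

end

context domain_algebra
begin

lemma ad_diffop:
 assumes "b : carrier A" "d : diffops A r"
 shows "D.ad (mu b) d : diffops A (r - 1)"
 using commutator_diffop[OF assms(2,1)] by (simp add: D.ad_def)

lemma ad_funpow_diffop:
 assumes "b : carrier A" "d : diffops A r"
 shows "(D.ad (mu b) ^^ k) d : diffops A (r - k)"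
proof (induct k)
 case (Suc k)
 then show ?case using ad_diffop[OF assms(1) Suc] by simp
qed (use assms in simp)

lemma ad_funpow_diffop_zero:
 assumes "b : carrier A" "d : diffops A r"
 shows "(D.ad (mu b) ^^ Suc r) d = \<zero>\<^bsub>D\<^esub>"
proof -
 have "(D.ad (mu b) ^^ r) d : diffops A 0" using ad_funpow_diffop[OF assms, of r] by simp
 then show ?thesis using commutator_diffop_zero[OF _ assms(1)] assms D_carrierI by (auto simp: D.ad_eq_zero_iff simp del: diffops.simps)
qed

text \<open>In a counterexample of minimal total order, iterated commutators with any function
  \<open>b\<close> again give nonzero factors with product zero. Minimality means that both factors
  commute with \<open>b\<close>; as \<open>b\<close> is arbitrary they are multiplications, and the
  coordinate ring is a domain.\<close>

lemma D_no_zero_divisors: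
 assumes "d : carrier D" "e : carrier D" "d **\<^bsub>D\<^esub> e = \<zero>\<^bsub>D\<^esub>"
 shows "d = \<zero>\<^bsub>D\<^esub> \<or> e = \<zero>\<^bsub>D\<^esub>"
proof -
 have "[|d : diffops A r; e : diffops A s; d **\<^bsub>D\<^esub> e = \<zero>\<^bsub>D\<^esub>|] ==> d = \<zero>\<^bsub>D\<^esub> \<or> e = \<zero>\<^bsub>D\<^esub>" for r s d e
 proof (induct "r + s" arbitrary: r s d e rule: less_induct)
 case less
 show ?case
 proof (rule ccontr)
 assume nz: "\<not> ?thesis"
 have c: "d : carrier D" "e : carrier D" using less D_carrierI by blast+
 have comm: "D.ad (mu b) d = \<zero>\<^bsub>D\<^esub> & D.ad (mu b) e = \<zero>\<^bsub>D\<^esub>" if b: "b : carrier A" for b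
 proof -
 \<comment> \<open>\<open>T u p\<close> says that \<open>p\<close> is the last number of commutators
   that does not annihilate \<open>u\<close>; it is at most the order of \<open>u\<close>.\<close>
 define T where "T u p \<longleftrightarrow> (D.ad (mu b) ^^ p) u ~= \<zero>\<^bsub>D\<^esub> & (D.ad (mu b) ^^ Suc p) u = \<zero>\<^bsub>D\<^esub>" for u p
 have ex: "\<exists>p\<le>t. T u p" if "u : diffops A t" "u ~= \<zero>\<^bsub>D\<^esub>" for u t
 proof -
 define m where "m = (LEAST k. (D.ad (mu b) ^^ k) u = \<zero>\<^bsub>D\<^esub>)"
 have m: "(D.ad (mu b) ^^ m) u = \<zero>\<^bsub>D\<^esub>" "m <= Suc t"
 unfolding m_def using ad_funpow_diffop_zero[OF b that(1)] by (auto intro: LeastI Least_le simp del: funpow.simps)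
 have "m ~= 0" using m that by (intro notI) simp
 then obtain p where p: "m = Suc p" by (cases m) auto
 have "(D.ad (mu b) ^^ p) u ~= \<zero>\<^bsub>D\<^esub>" using not_less_Least[of p "%k. (D.ad (mu b) ^^ k) u = \<zero>\<^bsub>D\<^esub>"] p by (auto simp: m_def)
 then show ?thesis using m p by (intro exI[of _ p]) (auto simp: T_def simp del: funpow.simps)
 qed
 have "d ~= \<zero>\<^bsub>D\<^esub>" "e ~= \<zero>\<^bsub>D\<^esub>" using nz by auto
 then obtain p q where pq: "p <= r" "T d p" "q <= s" "T e q" using ex[OF less(2)] ex[OF less(3)] by blast
 have "of_nat ((p + q) choose p) \<odot>\<^bsub>D\<^esub> ((D.ad (mu b) ^^ p) d **\<^bsub>D\<^esub> (D.ad (mu b) ^^ q) e) = \<zero>\<^bsub>D\<^esub>"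
 using D.ad_leibniz_top[of "mu b" d e p q] b c pq less(4) by (simp add: T_def del: funpow.simps)
 then have "(D.ad (mu b) ^^ p) d **\<^bsub>D\<^esub> (D.ad (mu b) ^^ q) e = \<zero>\<^bsub>D\<^esub>"
 using b c D.smult_eq_zero by (metis D.ad_funpow_closed D.m_closed binomial_eq_0_iff le_add1 mult_operator_closed not_less of_nat_eq_0_iff)
 \<comment> \<open>The top commutators are nonzero with product zero and have orders
   \<open>r - p\<close> and \<open>s - q\<close>, so the induction hypothesis forbids a smaller
   sum.\<close>
 then have "\<not> (r - p) + (s - q) < r + s"
 using less(1)[of "r - p" "s - q" "(D.ad (mu b) ^^ p) d" "(D.ad (mu b) ^^ q) e"] pq
 ad_funpow_diffop[OF b less(2)] ad_funpow_diffop[OF b less(3)] by (auto simp: T_def simp del: funpow.simps)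
 then have "p = 0" "q = 0" using pq by auto
 then show ?thesis using pq by (simp add: T_def)
 qed
 have "d = mu (d \<one>)" "e = mu (e \<one>)"
 using comm c D.ad_eq_zero_iff by (auto intro!: commuting_eq_mult_operator)
 moreover have "d \<one> ** e \<one> = \<zero>"
 proof -
 have "(d **\<^bsub>D\<^esub> e) \<one> = \<zero>" using less(4) by simp
 then show ?thesis using c \<open>d = mu (d \<one>)\<close> mult_operator_apply[of "e \<one>" "d \<one>"] by simp
 qed
 ultimately show False using no_zero_divisors[of "d \<one>" "e \<one>"] nz c
 by (metis D_apply_closed algebra_hom_zero[OF calgebra_axioms D_calgebra mult_operator_hom] one_closed)
 qed
 qed
 then show ?thesis using assms by (metis D_carrierE)
qed

lemma D_finsum_apply:
 assumes "finite J" "!!j. j : J ==> v j : carrier D" "f : carrier A"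
 shows "(finsum D v J) f = (\<Oplus>j\<in>J. v j f)"
 using assms(1,2)
proof (induct set: finite)
 case (insert j J)
 then have "finsum D v (insert j J) f = (v j +.\<^bsub>D\<^esub> finsum D v J) f" by (subst D.finsum_insert) auto
 also have "... = v j f +. (\<Oplus>j\<in>J. v j f)" using insert assms(3) by simp
 also have "... = (\<Oplus>j\<in>insert j J. v j f)" using insert assms(3) by (intro finsum_insert[symmetric]) auto
 finally show ?case .
qed (use assms in simp)

section \<open>Growth of the ring of differential operators\<close>

context
 fixes Gam assumes Gam: "finite Gam" "Gam <= carrier A" "!!x. x : carrier A ==> EX N. x : filt Gam N"
begin

text \<open>An operator of order \<open>N\<close> is determined by its values on polynomials of
  degree \<open>N\<close> in the generators: its commutators with the generators have order one less
  and vanish in one degree less, so by induction they are zero. Then \<open>d\<close> is linear over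
  the generators and kills the unit.\<close>

lemma diffop_eq_zero_of_filt:
 "[|d : diffops A N; !!f. f : filt Gam N ==> d f = \<zero>|] ==> d = \<zero>\<^bsub>D\<^esub>"
proof (induct N arbitrary: d)
 case 0
 then obtain a where a: "a : carrier A" "d = mu a" by auto
 then have "a = \<zero>" using 0(2)[OF filt_one[OF Gam(2)]] by simp
 then show ?case using a algebra_hom_zero[OF calgebra_axioms D_calgebra mult_operator_hom] by simp
next
 case (Suc N)
 have c: "d : carrier D" using Suc D_carrierI by blast
 have comm: "brk d x = \<zero>\<^bsub>D\<^esub>" if x: "x : Gam" for x
 proof (rule Suc(1))
 show "brk d x : diffops A N" using brk_diffop[OF Suc(2), of x] x Gam by auto
 fix f assume f: "f : filt Gam N"
 then have fc: "f : carrier A" using filt_closed[OF Gam(2)] by blast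
 have "d (x ** f) = \<zero>" "d f = \<zero>"
 using Suc(3) filt_gen_mult[OF Gam(2) x f] filt_mono[OF Gam(2) f, of "Suc N"] by auto
 then show "brk d x f = \<zero>" using fc x Gam by (auto simp: brk_def subset_iff)
 qed
 have cw: "d (x ** f) = x ** d f" if "x : Gam" "f : carrier A" for x f
 using fun_cong[OF comm[OF that(1)], of f] that Gam(2) c by (auto simp: brk_def subset_iff)
 have w: "d (wprod ws) = \<zero>" if "set ws <= Gam" for ws
 using that
 proof (induct ws)
 case Nil
 then show ?case using Suc(3)[OF filt_one[OF Gam(2)]] by simp
 next
 case (Cons x ws)
 then show ?case using cw[of x "wprod ws"] Gam by (auto simp: subset_iff)
 qed
 show ?case
 proof (rule D_eqI[OF c D_one_closed(2)])
 fix f assume f: "f : carrier A"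
 then obtain M where "f : filt Gam M" using Gam by blast
 then have "d f = \<zero>"
 proof (induct rule: filt_induct[OF Gam(2), consumes 1, case_names zero step])
 case zero then show ?case using linear_endos_zero D_linear c by blast
 next
 case (step ws x k)
 then have "wprod ws : carrier A" "x : carrier A" using Gam(2) filt_closed[OF Gam(2)] by auto
 then show ?case using D_lin[OF c] w step by simp
 qed
 then show "d f = \<zero>\<^bsub>D\<^esub> f" using f by simp
 qed
qed

text \<open>The values on words are controlled by the value at the unit and by the commutators with
  the finitely many generators, which shift the filtration boundedly by induction on the
  order.\<close>

lemma diffop_filt_bound:
 "d : diffops A r ==> EX c. ALL j. \<forall>f\<in>filt Gam j. d f : filt Gam (j + c)"
proof (induct r arbitrary: d)
 case 0
 then obtain a where a: "a : carrier A" "d = mu a" by auto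
 obtain c where "a : filt Gam c" using a Gam by blast
 then have "d f : filt Gam (j + c)" if "f : filt Gam j" for j f
 using filt_mult[OF Gam(2) _ that, of a c] filt_closed[OF Gam(2) that] a by (simp add: add.commute)
 then show ?case by blast
next
 case (Suc r)
 have c: "d : carrier D" using Suc D_carrierI by blast
 have "\<forall>x\<in>Gam. EX c. ALL j. \<forall>f\<in>filt Gam j. brk d x f : filt Gam (j + c)"
 using Suc(1) brk_diffop[OF Suc(2)] Gam(2) by auto
 then obtain k where k: "!!x j f. [|x : Gam; f : filt Gam j|] ==> brk d x f : filt Gam (j + k x)"
 by (metis bchoice)
 obtain c0 where c0: "d \<one> : filt Gam c0" using c Gam(3) by (metis D_apply_closed one_closed)
 \<comment> \<open>One constant dominating the degree of \<open>d \<one>\<close> and the shifts of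
   all commutators.\<close>
 define C where "C = c0 + sum k Gam"
 have kC: "k x <= C" if "x : Gam" for x using member_le_sum[of x Gam k] that Gam(1) by (simp add: C_def)
 have w: "d (wprod ws) : filt Gam (length ws + C)" if "set ws <= Gam" for ws
 using that
 proof (induct ws)
 case Nil
 then show ?case using filt_mono[OF Gam(2) c0, of C] by (simp add: C_def)
 next
 case (Cons x ws)
 have cc: "x : carrier A" "wprod ws : carrier A" using Cons Gam(2) by auto
 have "d (wprod (x # ws)) = x ** d (wprod ws) +. brk d x (wprod ws)"
 proof -
 have "d (x ** wprod ws) : carrier A" "d (wprod ws) : carrier A" using cc c by auto
 then show ?thesis using cc unfolding brk_def wprod_Cons restrict_apply by simp algebra
 qed
 moreover have "x ** d (wprod ws) : filt Gam (length (x # ws) + C)"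
 using filt_gen_mult[OF Gam(2), of x, OF _ Cons.hyps] Cons.prems by simp
 moreover have "brk d x (wprod ws) : filt Gam (length (x # ws) + C)"
 using filt_mono[OF Gam(2) k[of x "wprod ws" "length ws"]] filt_word[OF Gam(2), of ws "length ws"] Cons.prems kC[of x] by auto
 ultimately show ?case using filt_add[OF Gam(2)] by simp
 qed
 have "d f : filt Gam (j + C)" if "f : filt Gam j" for f j
 using that
 proof (induct rule: filt_induct[OF Gam(2), consumes 1, case_names zero step])
 case zero then show ?case using linear_endos_zero[OF D_linear[OF c]] filt_zero[OF Gam(2)] by simp
 next
 case (step ws x k)
 then have "wprod ws : carrier A" "x : carrier A" using Gam(2) filt_closed[OF Gam(2)] by auto
 then show ?case using D_lin[OF c] filt_mono[OF Gam(2) w[OF step(1)], of "j + C"] step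
 by (auto intro!: filt_add[OF Gam(2)] filt_smult[OF Gam(2)])
 qed
 then show ?case by blast
qed

text \<open>An operator in \<open>W N\<close> is determined by its values on a spanning set of
  degree \<open>N\<close>, and these values have degree at most \<open>2 * N\<close>. The dimension
  of \<open>W N\<close> is thus at most a product of two counts, each bounded by
  \<open>(2 * N + 1) ^ card Gam\<close>, which explains the exponent
  \<open>2 * card Gam\<close>.\<close>

theorem diffop_algebra_ore_domain: "ore_domain D"
proof -
 \<comment> \<open>Order and shift of degree are bounded by the same number. Either bound alone
   would not make these spaces finite dimensional and exhausting at once.\<close>
 define W where "W N = {d : diffops A N. ALL j. \<forall>f\<in>filt Gam j. d f : filt Gam (j + N)}" for N
 have Wc: "W N <= carrier D" for N using D_carrierI by (auto simp: W_def)
 have acomm: "x ** y \<ominus> y ** x : filt Gam 0" if "x : Gam" "y : Gam" for x y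
 using that Gam(2) filt_zero[OF Gam(2)] m_comm[of x y] by (auto simp: subset_iff)
 show ?thesis
 proof (rule D.ore_domain_of_growth[where W = W and e = "2 * card Gam"])
 show "\<one>\<^bsub>D\<^esub> ~= \<zero>\<^bsub>D\<^esub>"
 proof
 assume "\<one>\<^bsub>D\<^esub> = \<zero>\<^bsub>D\<^esub>" then have "\<one>\<^bsub>D\<^esub> \<one> = \<zero>\<^bsub>D\<^esub> \<one>" by simp
 then show False by simp
 qed
 show "W N <= carrier D" for N by (rule Wc)
 show "EX N. d : W N" if d: "d : carrier D" for d
 proof -
 obtain r where r: "d : diffops A r" using d by (rule D_carrierE)
 then obtain c where c: "ALL j. \<forall>f\<in>filt Gam j. d f : filt Gam (j + c)" using diffop_filt_bound by blast
 have "d : W (max r c)" unfolding W_def using diffops_mono[OF r, of "max r c"] c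
 by (fastforce intro: filt_mono[OF Gam(2)])
 then show ?thesis by blast
 qed
 show "d : W M" if "d : W N" "N <= M" for d N M
 using that diffops_mono[of d N M] by (fastforce simp: W_def intro: filt_mono[OF Gam(2)])
 show "\<one>\<^bsub>D\<^esub> : W 0"
 using mult_operator_diffop[of \<one> 0] filt_closed[OF Gam(2)]
 by (auto simp: W_def mult_operator_one simp del: diffops.simps)
 show "d **\<^bsub>D\<^esub> e : W (N + M)" if de: "d : W N" "e : W M" for d e N M
 proof -
 have "(d **\<^bsub>D\<^esub> e) f : filt Gam (j + (N + M))" if f: "f : filt Gam j" for j f
 proof -
 have "e f : filt Gam (j + M)" using f de by (auto simp: W_def)
 then have "d (e f) : filt Gam (j + M + N)" using de by (auto simp: W_def)
 then show ?thesis using filt_closed[OF Gam(2) f] by (simp add: ac_simps)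
 qed
 then show ?thesis using de diffops_mult by (auto simp: W_def)
 qed
 fix N and J :: "bool list set" and v
 assume J: "finite J" "(2 * N + 1) ^ (2 * card Gam) < card J" and v: "!!j. j : J ==> v j : W N"
 obtain S where S: "finite S" "S <= filt Gam N" "card S <= (N + 1) ^ card Gam" "filt Gam N <= lspan S"
 using filt_finite_span[OF Gam(2) acomm Gam(1), of N] by auto
 obtain T where T: "finite T" "T <= filt Gam (N + N)" "card T <= (N + N + 1) ^ card Gam" "filt Gam (N + N) <= lspan T"
 using filt_finite_span[OF Gam(2) acomm Gam(1), of "N + N"] by auto
 have Sc: "S <= carrier A" and Tc: "T <= carrier A" using S T filt_closed[OF Gam(2)] by auto
 have vT: "v j s : lspan T" if "j : J" "s : S" for j s
 proof -
 have "v j s : filt Gam (N + N)" using v[OF that(1)] S(2) that(2) by (auto simp: W_def)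
 then show ?thesis using T(4) by blast
 qed
 have vc: "v j : carrier D" if "j : J" for j using v[OF that] Wc by blast
 have "EX c. v j s = (\<Oplus>t\<in>T. c t \<odot> t)" if "j : J" "s : S" for j s
 using lspan_finiteE[OF vT[OF that] T(1) Tc] .
 then obtain c where c: "!!j s. [|j : J; s : S|] ==> v j s = (\<Oplus>t\<in>T. c j s t \<odot> t)"
 by metis
 have "card (S \<times> T) <= (N + 1) ^ card Gam * (N + N + 1) ^ card Gam"
 unfolding card_cartesian_product using S T by (intro mult_mono) auto
 also have "... <= (2 * N + 1) ^ card Gam * (2 * N + 1) ^ card Gam"
 by (intro mult_mono power_mono) auto
 also have "... = (2 * N + 1) ^ (2 * card Gam)" by (simp add: power_add[symmetric] mult_2)
 finally have "card (S \<times> T) < card J" using J by simp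
 \<comment> \<open>The unknowns are the coefficients of the operators \<open>v j\<close>, and there
   is one equation for each pair of an argument in \<open>S\<close> and a basis coefficient in
   \<open>T\<close>. The resulting combination vanishes on \<open>S\<close>, hence on degree
   \<open>N\<close>, hence identically.\<close>
 then obtain f where f: "\<exists>j\<in>J. f j ~= 0" "\<forall>i\<in>S \<times> T. (\<Sum>j\<in>J. c j (fst i) (snd i) * f j) = 0"
 using complex_underdetermined[of "S \<times> T" J "%i j. c j (fst i) (snd i)"] S T J by auto
 define u where "u = (\<Oplus>\<^bsub>D\<^esub>j\<in>J. f j \<odot>\<^bsub>D\<^esub> v j)"
 have uN: "u : diffops A N"
 unfolding u_def using J(1) v
 proof (induct set: finite)
 case empty then show ?case by (simp add: zero_diffop)
 next
 case (insert j J)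
 then have "v j : diffops A N" "!!j. j : J ==> v j : carrier D" "v j : carrier D"
 using Wc by (auto simp: W_def intro!: D_carrierI)
 then show ?case using insert by (subst D.finsum_insert) (auto intro: diffops_add diffops_smult)
 qed
 have us: "u s = \<zero>" if s: "s : S" for s
 proof -
 have sc: "s : carrier A" using s Sc by auto
 have "u s = (\<Oplus>j\<in>J. f j \<odot> v j s)"
 unfolding u_def using J vc sc by (subst D_finsum_apply) (auto intro!: finsum_cong')
 also have "... = (\<Oplus>j\<in>J. f j \<odot> (\<Oplus>t\<in>T. c j s t \<odot> t))"
 using c s Tc by (intro finsum_cong') (auto intro!: finsum_closed smult_closed)
 also have "... = (\<Oplus>t\<in>T. (\<Sum>j\<in>J. c j s t * f j) \<odot> t)"
 using J T Tc by (intro finsum_finsum_smult) auto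
 also have "... = (\<Oplus>t\<in>T. \<zero>)" using f s Tc by (intro finsum_cong') auto
 finally show ?thesis by simp
 qed
 have lin: "u : linear_endos A" using uN diffops_linear by blast
 have "u g = \<zero>" if "g : lspan S" for g
 using that
 proof (induct rule: lspan.induct)
 case lspan_zero then show ?case using linear_endos_zero lin by blast
 next
 case (lspan_step s x k)
 then show ?case using us linear_endosD[OF lin] Sc lspan_closed[OF _ Sc] by (auto simp: subset_iff)
 qed
 then have "u = \<zero>\<^bsub>D\<^esub>" using diffop_eq_zero_of_filt[OF uN] S by blast
 then show "EX f. (\<exists>j\<in>J. f j ~= 0) & (\<Oplus>\<^bsub>D\<^esub>j\<in>J. f j \<odot>\<^bsub>D\<^esub> v j) = \<zero>\<^bsub>D\<^esub>"
 using f(1) unfolding u_def by (intro exI[of _ f] conjI)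
 qed (rule D_no_zero_divisors)
qed

end

section \<open>Automorphisms acting on differential operators\<close>

context
 fixes sig assumes sig: "sig : algebra_hom A A" "bij_betw sig (carrier A) (carrier A)"
begin

abbreviation "sigi == inv_into (carrier A) sig"
abbreviation "act == diffop_action A sig"

lemma auto_inverse:
 "a : carrier A ==> sigi a : carrier A" "a : carrier A ==> sig (sigi a) = a" "a : carrier A ==> sigi (sig a) = a"
 using sig(2) by (auto simp: bij_betw_def inv_into_into f_inv_into_f)

lemma auto_inverse_hom: "sigi : algebra_hom A A"
proof (rule algebra_homI)
 note H = algebra_homD[OF sig(1)]
 have inj: "x = y" if "sig x = sig y" "x : carrier A" "y : carrier A" for x y
 using that auto_inverse(3) by metis
 show "sigi (x ** y) = sigi x ** sigi y" if "x : carrier A" "y : carrier A" for x y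
 by (rule inj) (use that in \<open>simp_all add: auto_inverse H\<close>)
 show "sigi (x +. y) = sigi x +. sigi y" if "x : carrier A" "y : carrier A" for x y
 by (rule inj) (use that in \<open>simp_all add: auto_inverse H\<close>)
 show "sigi \<one> = \<one>" using auto_inverse(3)[OF one_closed] unfolding H(4) .
 show "sigi (c \<odot> x) = c \<odot> sigi x" if "x : carrier A" for c x
 by (rule inj) (use that in \<open>simp_all add: auto_inverse H\<close>)
qed (simp add: auto_inverse)

lemma act_apply [simp]: "f : carrier A ==> act d f = sig (d (sigi f))"
 by (simp add: diffop_action_def)

lemma act_linear:
 assumes "d : linear_endos A" shows "act d : linear_endos A"
proof (rule linear_endosI)
 note H = algebra_homD[OF sig(1)] algebra_homD[OF auto_inverse_hom] linear_endosD[OF assms]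
 show "act d f : carrier A" "act d (c \<odot> f) = c \<odot> act d f" if "f : carrier A" for f c using that H by auto
 show "act d (f +. g) = act d f +. act d g" if "f : carrier A" "g : carrier A" for f g using that H by auto
qed (simp add: diffop_action_def)

lemma act_mult_operator: "a : carrier A ==> act (mu a) = mu (sig a)"
 using algebra_homD[OF sig(1)] auto_inverse
 by (intro linear_endos_eqI act_linear mult_operator_linear) auto

text \<open>Conjugation turns multiplication by \<open>b\<close> into multiplication by the image of
  \<open>b\<close>. This is why conjugation preserves the order of operators.\<close>

lemma act_brk:
 assumes "d : linear_endos A" "b : carrier A" shows "brk (act d) b = act (brk d (sigi b))"
proof (rule linear_endos_eqI)
 note H = algebra_homD[OF sig(1)] algebra_homD[OF auto_inverse_hom] linear_endosD[OF assms(1)]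
 fix f assume f: "f : carrier A"
 show "brk (act d) b f = act (brk d (sigi b)) f"
 using f assms(2) H auto_inverse algebra_hom_minus[OF calgebra_axioms calgebra_axioms sig(1)] by (simp add: brk_def)
qed (use assms act_linear brk_linear auto_inverse in auto)

lemma act_diffop: "d : diffops A j ==> act d : diffops A j"
proof (induct j arbitrary: d)
 case 0
 then show ?case using act_mult_operator algebra_homD(1)[OF sig(1)] by auto
next
 case (Suc j)
 then show ?case using auto_inverse(1) by (auto simp: diffops_Suc_iff act_linear act_brk)
qed

lemma act_hom: "act : algebra_hom D D"
proof (rule algebra_homI)
 note H = algebra_homD[OF sig(1)] algebra_homD[OF auto_inverse_hom]
 show cl: "act d : carrier D" if "d : carrier D" for d using that act_diffop by (auto simp: D_simps)
 show "act (d **\<^bsub>D\<^esub> e) = act d **\<^bsub>D\<^esub> act e" "act (d +.\<^bsub>D\<^esub> e) = act d +.\<^bsub>D\<^esub> act e"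
 if "d : carrier D" "e : carrier D" for d e
 using that H auto_inverse by (auto intro!: D_eqI cl D.add.m_closed)
 show "act (c \<odot>\<^bsub>D\<^esub> d) = c \<odot>\<^bsub>D\<^esub> act d" if "d : carrier D" for c d
 using that H auto_inverse by (auto intro!: D_eqI cl)
 show "act \<one>\<^bsub>D\<^esub> = \<one>\<^bsub>D\<^esub>" using H auto_inverse by (auto intro!: D_eqI cl)
qed

end

lemma act_bij:
 assumes sig: "sig : algebra_hom A A" "bij_betw sig (carrier A) (carrier A)"
 shows "bij_betw (diffop_action A sig) (carrier D) (carrier D)"
proof (rule bij_betwI)
 let ?i = "inv_into (carrier A) sig"
 have tau: "?i : algebra_hom A A" "bij_betw ?i (carrier A) (carrier A)"
 using auto_inverse_hom[OF sig] bij_betw_inv_into[OF sig(2)] by auto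
 have ii: "inv_into (carrier A) ?i a = sig a" if "a : carrier A" for a
 using inv_into_inv_into_eq[OF sig(2) that] .
 show "diffop_action A sig : carrier D \<rightarrow> carrier D" "diffop_action A ?i : carrier D \<rightarrow> carrier D"
 using algebra_homD(1)[OF act_hom[OF sig]] algebra_homD(1)[OF act_hom[OF tau]] by auto
 show "diffop_action A ?i (diffop_action A sig d) = d" "diffop_action A sig (diffop_action A ?i d) = d"
 if d: "d : carrier D" for d
 proof -
 show "diffop_action A ?i (diffop_action A sig d) = d"
 by (rule D_eqI) (use d algebra_homD(1)[OF act_hom[OF sig]] algebra_homD(1)[OF act_hom[OF tau]]
 algebra_homD(1)[OF sig(1)] ii auto_inverse[OF sig] in \<open>auto simp: act_apply[OF sig] act_apply[OF tau]\<close>)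
 show "diffop_action A sig (diffop_action A ?i d) = d"
 by (rule D_eqI) (use d algebra_homD(1)[OF act_hom[OF sig]] algebra_homD(1)[OF act_hom[OF tau]]
 algebra_homD(1)[OF sig(1)] ii auto_inverse[OF sig] in \<open>auto simp: act_apply[OF sig] act_apply[OF tau]\<close>)
 qed
qed

end

lemma (in ring) eq_of_minus:
 assumes "x \<ominus> y = z" "x : carrier R" "y : carrier R" shows "x = y +. z"
proof -
 have "y +. (x \<ominus> y) = x" using assms(2,3) by algebra
 then show ?thesis using assms(1) by simp
qed

section \<open>Finite groups of automorphisms, trace and norm\<close>

text \<open>The automorphisms are extensional, so distinct members of \<open>G\<close> differ at
  some element of the carrier, and sums over the set \<open>G\<close> are sums over the group acting
  on \<open>A\<close>.\<close>

locale galois_algebra = domain_algebra A for A :: "(complex, 'a) module" (structure) +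
 fixes G :: "('a => 'a) set"
 assumes G_finite: "finite G"
 and G_hom: "sig : G ==> sig : algebra_hom A A"
 and G_ext: "sig : G ==> sig : extensional (carrier A)"
 and G_id: "(\<lambda>x\<in>carrier A. x) : G"
 and G_compose: "[|sig : G; tau : G|] ==> compose (carrier A) sig tau : G"
 and G_inverse: "sig : G ==> \<exists>tau\<in>G. \<forall>x\<in>carrier A. tau (sig x) = x"
begin

abbreviation "idG == (\<lambda>x\<in>carrier A. x)"

definition fixed :: "'a set" where "fixed = {a : carrier A. \<forall>sig\<in>G. sig a = a}"

definition trace :: "'a => 'a" where "trace a = (\<Oplus>sig\<in>G. sig a)"

lemmas G_simps = algebra_homD[OF G_hom]

lemma G_zero: "sig : G ==> sig \<zero> = \<zero>"
 by (rule algebra_hom_zero[OF calgebra_axioms calgebra_axioms G_hom])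

lemma G_minus: "[|sig : G; x : carrier A|] ==> sig (\<ominus> x) = \<ominus> sig x"
 by (rule algebra_hom_a_inv[OF calgebra_axioms calgebra_axioms G_hom])

lemma G_finsum: "[|sig : G; finite I; f : I \<rightarrow> carrier A|] ==> sig (finsum A f I) = (\<Oplus>i\<in>I. sig (f i))"
 by (rule algebra_hom_finsum[OF calgebra_axioms calgebra_axioms G_hom])

lemma G_two_sided_inverse:
 assumes "sig : G"
 shows "EX tau. tau : G & (ALL x. x : carrier A --> tau (sig x) = x) & (ALL x. x : carrier A --> sig (tau x) = x)"
proof -
 obtain tau where t: "tau : G" "!!x. x : carrier A ==> tau (sig x) = x" using G_inverse assms by blast
 obtain rho where r: "rho : G" "!!x. x : carrier A ==> rho (tau x) = x" using G_inverse t by blast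
 have "sig (tau x) = x" if x: "x : carrier A" for x
 proof -
 have "sig (tau x) = rho (tau (sig (tau x)))" using r(2) G_simps(1) x assms t(1) by simp
 also have "... = x" using t(2) r(2) x G_simps(1)[OF t(1)] by simp
 finally show ?thesis .
 qed
 then show ?thesis using t by blast
qed

lemma G_bij: assumes "sig : G" shows "bij_betw sig (carrier A) (carrier A)"
proof -
 obtain tau where "tau : G" "!!x. x : carrier A ==> tau (sig x) = x" "!!x. x : carrier A ==> sig (tau x) = x"
 using G_two_sided_inverse[OF assms] by blast
 then show ?thesis using assms G_simps(1) by (intro bij_betwI[of _ _ _ tau]) auto
qed

lemma G_eq_zero: assumes "sig : G" "x : carrier A" "sig x = \<zero>" shows "x = \<zero>"
 by (metis G_inverse G_zero assms)

text \<open>Left translation permutes \<open>G\<close>; invariance of the trace and of the norm is a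
  reindexing along it.\<close>

lemma G_compose_bij:
 assumes "sig : G" shows "bij_betw (compose (carrier A) sig) G G"
proof -
 obtain tau where t: "tau : G" "!!x. x : carrier A ==> tau (sig x) = x" using G_inverse assms by blast
 have "inj_on (compose (carrier A) sig) G"
 proof (rule inj_onI)
 fix rho rho' assume r: "rho : G" "rho' : G" "compose (carrier A) sig rho = compose (carrier A) sig rho'"
 have "rho x = rho' x" if x: "x : carrier A" for x
 proof -
 have "sig (rho x) = sig (rho' x)" using fun_cong[OF r(3), of x] x by (simp add: compose_def)
 then show ?thesis using t(2) G_simps(1)[OF r(1) x] G_simps(1)[OF r(2) x] by metis
 qed
 then show "rho = rho'" using G_ext r by (intro extensionalityI[of _ "carrier A"]) auto
 qed
 then show ?thesis using G_finite G_compose[OF assms] by (auto simp: bij_betw_def endo_inj_surj image_subset_iff)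
qed

lemma fixedD: "a : fixed ==> a : carrier A" "[|a : fixed; sig : G|] ==> sig a = a"
 by (auto simp: fixed_def)

lemma fixed_ops:
 assumes "a : fixed" "b : fixed"
 shows "a +. b : fixed" "a ** b : fixed" "c \<odot> a : fixed" "\<ominus> a : fixed" "\<one> : fixed" "\<zero> : fixed"
proof -
 have ab: "sig a = a" "sig b = b" if "sig : G" for sig using assms that fixedD(2) by auto
 have c: "a : carrier A" "b : carrier A" using assms fixedD(1) by auto
 show "a +. b : fixed" "a ** b : fixed" "c \<odot> a : fixed" "\<ominus> a : fixed" "\<one> : fixed" "\<zero> : fixed"
 unfolding fixed_def using c by (simp_all add: G_simps G_minus G_zero) (simp_all add: ab)
qed

lemma trace_closed [simp]: "a : carrier A ==> trace a : carrier A"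
 unfolding trace_def using G_simps by (intro finsum_closed) auto

lemma trace_fixed: assumes a: "a : carrier A" shows "trace a : fixed"
proof -
 have "sig (trace a) = trace a" if s: "sig : G" for sig
 proof -
 have "sig (trace a) = (\<Oplus>tau\<in>G. sig (tau a))" unfolding trace_def using a s G_finite G_simps(1) by (intro G_finsum) auto
 also have "... = (\<Oplus>tau\<in>G. (compose (carrier A) sig tau) a)"
 using a s G_simps(1) by (intro finsum_cong') (auto simp: compose_def)
 also have "... = (\<Oplus>rho\<in>compose (carrier A) sig ` G. rho a)"
 using a s G_simps(1) G_compose_bij[OF s] by (intro finsum_reindex[symmetric]) (auto simp: bij_betw_def)
 also have "... = trace a" using G_compose_bij[OF s] by (simp add: bij_betw_def trace_def)
 finally show ?thesis .
 qed
 then show ?thesis using a by (simp add: fixed_def)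
qed

lemma trace_add: "[|a : carrier A; b : carrier A|] ==> trace (a +. b) = trace a +. trace b"
proof -
 assume c: "a : carrier A" "b : carrier A"
 have "(\<Oplus>sig\<in>G. sig (a +. b)) = (\<Oplus>sig\<in>G. sig a +. sig b)" using c G_simps by (intro finsum_cong') auto
 also have "... = (\<Oplus>sig\<in>G. sig a) +. (\<Oplus>sig\<in>G. sig b)" using c G_simps by (intro finsum_addf) auto
 finally show ?thesis by (simp add: trace_def)
qed

lemma trace_mult_fixed: "[|c : fixed; a : carrier A|] ==> trace (c ** a) = c ** trace a"
 unfolding trace_def using G_simps(1) G_finite
 by (subst finsum_rdistr) (auto intro!: finsum_cong' simp: G_simps(2) fixedD)

lemma trace_smult: "a : carrier A ==> trace (c \<odot> a) = c \<odot> trace a"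
 unfolding trace_def using G_simps(1) G_finite
 by (subst smult_finsum) (auto intro!: finsum_cong' simp: G_simps(5))

lemma card_G_pos: "card G > 0"
 using G_finite G_id card_gt_0_iff by blast

text \<open>Every nonzero element has a nonzero multiple in the fixed ring, namely its norm.\<close>

lemma norm_exists:
 assumes a: "a : carrier A" "a ~= \<zero>"
 obtains b where "b : carrier A" "a ** b : fixed" "a ** b ~= \<zero>"
proof -
 have cl: "(\<Otimes>sig\<in>H. sig a) : carrier A" if "H <= G" for H
 using that a G_simps(1) by (intro finprod_closed) auto
 define N where "N = (\<Otimes>sig\<in>G. sig a)"
 have "sig N = N" if s: "sig : G" for sig
 proof -
 have push: "sig (\<Otimes>tau\<in>H. tau a) = (\<Otimes>tau\<in>H. sig (tau a))" if "finite H" "H <= G" for H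
 using that
 proof (induct set: finite)
 case empty then show ?case using G_simps(4)[OF s] by simp
 next
 case (insert tau H)
 then have H: "!!rho. rho : H ==> rho a : carrier A" "tau a : carrier A" using a G_simps(1) by auto
 have X: "(\<Otimes>tau\<in>H. tau a) : carrier A" using cl[of H] insert by simp
 have "sig (\<Otimes>tau\<in>insert tau H. tau a) = sig (tau a ** (\<Otimes>tau\<in>H. tau a))"
 using H insert(1,2) by (subst finprod_insert) auto
 also have "... = sig (tau a) ** (\<Otimes>tau\<in>H. sig (tau a))"
 using G_simps(2)[OF s H(2) X] insert by simp
 also have "... = (\<Otimes>tau\<in>insert tau H. sig (tau a))"
 using H insert(1,2) s G_simps(1) by (subst finprod_insert) auto
 finally show ?case .
 qed
 have "sig N = (\<Otimes>tau\<in>G. (compose (carrier A) sig tau) a)"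
 unfolding N_def push[OF G_finite subset_refl] using a s G_simps(1) by (intro finprod_cong') (auto simp: compose_def)
 also have "... = (\<Otimes>rho\<in>compose (carrier A) sig ` G. rho a)"
 using a s G_simps(1) G_compose_bij[OF s] by (intro finprod_reindex[symmetric]) (auto simp: bij_betw_def)
 also have "... = N" using G_compose_bij[OF s] by (simp add: bij_betw_def N_def)
 finally show ?thesis .
 qed
 then have Nf: "N : fixed" using cl[of G] by (simp add: fixed_def N_def)
 have nz: "(\<Otimes>sig\<in>H. sig a) ~= \<zero>" if "finite H" "H <= G" for H
 using that
 proof (induct set: finite)
 case (insert tau H)
 then have t: "tau : G" "H <= G" by auto
 have H: "!!rho. rho : H ==> rho a : carrier A" "tau a : carrier A" "tau a ~= \<zero>"
 using t a(1) G_simps(1) G_eq_zero[OF t(1) a(1)] a(2) by blast+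
 have "(\<Otimes>sig\<in>insert tau H. sig a) = tau a ** (\<Otimes>sig\<in>H. sig a)" using H insert(1,2) by (intro finprod_insert) auto
 moreover have "(\<Otimes>sig\<in>H. sig a) : carrier A" "(\<Otimes>sig\<in>H. sig a) ~= \<zero>" using cl[of H] insert by auto
 ultimately show ?case using no_zero_divisors[OF H(2), of "\<Otimes>sig\<in>H. sig a"] H(3) by auto
 qed simp
 \<comment> \<open>Splitting off the factor of the identity from the norm exhibits the remaining
   product as the cofactor of \<open>a\<close>.\<close>
 have eqG: "insert idG (G - {idG}) = G" using G_id by auto
 have "N = (\<Otimes>sig\<in>insert idG (G - {idG}). sig a)" unfolding N_def eqG ..
 also have "... = idG a ** (\<Otimes>sig\<in>G - {idG}. sig a)"
 by (rule finprod_insert) (use G_finite a G_simps(1) in auto)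
 finally have "N = idG a ** (\<Otimes>sig\<in>G - {idG}. sig a)" .
 moreover have "idG a = a" using a by simp
 ultimately have Na: "N = a ** (\<Otimes>sig\<in>G - {idG}. sig a)" by (simp only:)
 moreover have "N ~= \<zero>" using nz[OF G_finite] by (simp add: N_def)
 moreover have "(\<Otimes>sig\<in>G - {idG}. sig a) : carrier A" by (rule cl) auto
 ultimately show ?thesis using that[of "\<Otimes>sig\<in>G - {idG}. sig a"] Nf unfolding Na by blast
qed

text \<open>The list encodes a sum of tensors, and the value is its image under the map that sends
  the tensor of \<open>a\<close> and \<open>b\<close> to \<open>a ** sig b\<close>. Appending lists
  adds tensors, and \<open>pairing_scale\<close> multiplies by a pure tensor.\<close>

definition pairing :: "('a \<times> 'a) list => ('a => 'a) => 'a" where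
 "pairing ps sig = foldr (%p z. fst p ** sig (snd p) +. z) ps \<zero>"

lemma pairing_closed: "[|set ps <= carrier A \<times> carrier A; sig : G|] ==> pairing ps sig : carrier A"
 by (induct ps) (auto simp: pairing_def G_simps)

lemma pairing_append:
 "[|set ps <= carrier A \<times> carrier A; set qs <= carrier A \<times> carrier A; sig : G|] ==>
 pairing (ps @ qs) sig = pairing ps sig +. pairing qs sig"
proof (induct ps)
 case Nil then show ?case using pairing_closed[of qs sig] by (simp add: pairing_def)
next
 case (Cons p ps)
 then have "fst p : carrier A" "sig (snd p) : carrier A" "pairing ps sig : carrier A" "pairing qs sig : carrier A"
 using pairing_closed G_simps by auto
 then show ?case using Cons by (simp add: pairing_def a_assoc)
qed

lemma pairing_scale:
 "[|set ps <= carrier A \<times> carrier A; x : carrier A; y : carrier A; sig : G|] ==>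
 pairing (map (%p. (x ** fst p, snd p ** y)) ps) sig = (x ** sig y) ** pairing ps sig"
proof (induct ps)
 case Nil then show ?case by (simp add: pairing_def G_simps)
next
 case (Cons p ps)
 then have "fst p : carrier A" "snd p : carrier A" "sig (snd p) : carrier A" "sig y : carrier A" "pairing ps sig : carrier A"
 using pairing_closed G_simps by auto
 then show ?case using Cons by (simp add: pairing_def G_simps r_distr m_ac)
qed

text \<open>
 The pairs stand for an element of the tensor square of \<open>A\<close> that separates the identity from the other
 automorphisms: a product of factors \<open>g y ** 1 - 1 ** y\<close>, one for each \<open>g ~= 1\<close>.
\<close>

lemma separating_pairs:
 assumes "finite H" "H <= G - {idG}"
 shows "EX ps. set ps <= carrier A \<times> carrier A & pairing ps idG ~= \<zero> & (\<forall>sig\<in>H. pairing ps sig = \<zero>)"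
 using assms
proof (induct set: finite)
 case empty
 show ?case by (intro exI[of _ "[(\<one>, \<one>)]"]) (auto simp: pairing_def)
next
 case (insert g H)
 then obtain ps where ps: "set ps <= carrier A \<times> carrier A" "pairing ps idG ~= \<zero>" "\<forall>sig\<in>H. pairing ps sig = \<zero>"
 by (metis insert_subset)
 have g: "g : G" "g ~= idG" using insert by auto
 have "\<exists>y\<in>carrier A. g y ~= y"
 proof (rule ccontr)
 assume "\<not> ?thesis"
 then have "g = idG" using G_ext[OF g(1)] by (intro extensionalityI[of _ "carrier A"]) auto
 then show False using g by simp
 qed
 then obtain y where y: "y : carrier A" "g y ~= y" by blast
 have gy: "g y : carrier A" using g y G_simps by blast
 \<comment> \<open>Multiplication of the tensor by the factor for \<open>g\<close>; at
   \<open>sig\<close> the factor becomes \<open>g y \<ominus> sig y\<close>, zero for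
   \<open>sig = g\<close> and nonzero for the identity by the choice of \<open>y\<close>.\<close>
 define qs where "qs = map (%p. (g y ** fst p, snd p ** \<one>)) ps @ map (%p. (\<ominus> \<one> ** fst p, snd p ** y)) ps"
 have qc: "set qs <= carrier A \<times> carrier A" using ps y gy by (auto simp: qs_def)
 have q: "pairing qs sig = (g y \<ominus> sig y) ** pairing ps sig" if s: "sig : G" for sig
 proof -
 have c: "pairing ps sig : carrier A" "sig y : carrier A" using pairing_closed ps s y G_simps by auto
 have "pairing qs sig = (g y ** sig \<one>) ** pairing ps sig +. (\<ominus> \<one> ** sig y) ** pairing ps sig"
 unfolding qs_def using ps s y gy by (subst pairing_append) (auto simp: pairing_scale)
 also have "... = (g y \<ominus> sig y) ** pairing ps sig"
 using c gy s by (simp add: G_simps a_minus_def l_distr l_minus)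
 finally show ?thesis .
 qed
 have "pairing qs idG ~= \<zero>"
 proof
 assume "pairing qs idG = \<zero>"
 then have "(g y \<ominus> y) ** pairing ps idG = \<zero>" using q[OF G_id] y by simp
 then have "g y \<ominus> y = \<zero>"
 using no_zero_divisors[OF minus_closed[OF gy y(1)] pairing_closed[OF ps(1) G_id]] ps(2) by blast
 then show False using y gy by simp
 qed
 moreover have "pairing qs sig = \<zero>" if "sig : insert g H" for sig
 using that q[of sig] insert ps y gy G_simps(1)[of sig y] pairing_closed[OF ps(1), of sig] by auto
 ultimately show ?case using qc by blast
qed

lemma pairing_finsum:
 assumes "set ps <= carrier A \<times> carrier A" "sig : G"
 shows "pairing ps sig = (\<Oplus>i\<in>{..<length ps}. fst (ps ! i) ** sig (snd (ps ! i)))"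
 using assms(1)
proof (induct ps)
 case Nil then show ?case by (simp add: pairing_def)
next
 case (Cons p ps)
 have c: "fst (q) ** sig (snd q) : carrier A" if "q : set (p # ps)" for q
 using that Cons assms(2) G_simps by auto
 have cc: "fst ((p # ps) ! i) ** sig (snd ((p # ps) ! i)) : carrier A" if "i < Suc (length ps)" for i
 by (rule c) (use that nth_mem[of i "p # ps"] in auto)
 define h where "h i = fst ((p # ps) ! i) ** sig (snd ((p # ps) ! i))" for i
 have hc: "h i : carrier A" if "i < Suc (length ps)" for i using cc[OF that] by (simp only: h_def)
 have set: "{..<length (p # ps)} = insert 0 (Suc ` {..<length ps})" by (auto simp: lessThan_Suc_eq_insert_0)
 have "(\<Oplus>i\<in>{..<length (p # ps)}. h i) = h 0 +. (\<Oplus>i\<in>Suc ` {..<length ps}. h i)"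
 unfolding set by (rule finsum_insert) (use hc in auto)
 also have "(\<Oplus>i\<in>Suc ` {..<length ps}. h i) = (\<Oplus>i\<in>{..<length ps}. h (Suc i))"
 by (rule finsum_reindex) (use hc in auto)
 also have "... = pairing ps sig" using Cons by (simp add: h_def)
 also have "h 0 +. pairing ps sig = pairing (p # ps) sig" by (simp add: h_def pairing_def)
 finally show ?case by (simp only: h_def)
qed

text \<open>These are dual bases of \<open>A\<close> over the invariants before division by
  \<open>s\<close>; ramification prevents \<open>s\<close> from being 1 in general. The value of the
  separating tensor at the identity is made invariant by multiplying with the cofactor of its
  norm.\<close>

lemma galois_coordinates_exist:
 "EX m al be s. al : {..<m::nat} \<rightarrow> carrier A & be : {..<m} \<rightarrow> carrier A & s : fixed & s ~= \<zero> &
 (\<forall>sig\<in>G. (\<Oplus>i\<in>{..<m}. al i ** sig (be i)) = (if sig = idG then s else \<zero>))"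
proof -
 obtain ps where ps: "set ps <= carrier A \<times> carrier A" "pairing ps idG ~= \<zero>" "\<forall>sig\<in>G - {idG}. pairing ps sig = \<zero>"
 using separating_pairs[of "G - {idG}"] G_finite by auto
 have pc: "pairing ps idG : carrier A" using ps pairing_closed G_id by blast
 obtain b where b: "b : carrier A" "pairing ps idG ** b : fixed" "pairing ps idG ** b ~= \<zero>"
 using norm_exists[OF pc ps(2)] .
 define al where "al i = b ** fst (ps ! i)" for i
 define be where "be i = snd (ps ! i)" for i
 have c: "fst (ps ! i) : carrier A" "snd (ps ! i) : carrier A" if "i < length ps" for i
 using ps(1) nth_mem[OF that] by auto
 have "(\<Oplus>i\<in>{..<length ps}. al i ** sig (be i)) = b ** pairing ps sig" if s: "sig : G" for sig
 proof -
 have "(\<Oplus>i\<in>{..<length ps}. al i ** sig (be i)) = (\<Oplus>i\<in>{..<length ps}. b ** (fst (ps ! i) ** sig (snd (ps ! i))))"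
 using c b s G_simps(1) by (intro finsum_cong') (auto simp: al_def be_def m_assoc)
 also have "... = b ** pairing ps sig"
 unfolding pairing_finsum[OF ps(1) s] using c b s G_simps(1) by (intro finsum_rdistr[symmetric]) auto
 finally show ?thesis .
 qed
 moreover have "b ** pairing ps sig = (if sig = idG then pairing ps idG ** b else \<zero>)" if "sig : G" for sig
 using that ps b pc by (auto simp: m_comm)
 ultimately show ?thesis using b c
 by (intro exI[of _ "length ps"] exI[of _ al] exI[of _ be] exI[of _ "pairing ps idG ** b"]) (auto simp: al_def be_def)
qed

end

section \<open>Coordinates over the invariants and extension of derivations\<close>

locale galois_coordinates = galois_algebra A G for A :: "(complex, 'a) module" (structure) and G +
 fixes m :: nat and al be :: "nat => 'a" and s :: 'a
 assumes alc: "i < m ==> al i : carrier A" and bec: "i < m ==> be i : carrier A"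
 and s_fixed: "s : fixed" and s_nz: "s ~= \<zero>"
 and coord: "sig : G ==> (\<Oplus>i\<in>{..<m}. al i ** sig (be i)) = (if sig = idG then s else \<zero>)"
begin

lemma sc [simp]: "s : carrier A"
 using s_fixed fixedD by blast

lemma cancel_s:
 assumes "x : carrier A" "y : carrier A" "s ** x = s ** y" shows "x = y"
proof -
 have "s ** (x \<ominus> y) = s ** x \<ominus> s ** y" using assms sc by algebra
 then have "s ** (x \<ominus> y) = \<zero>" using assms by simp
 then show ?thesis using no_zero_divisors[of s "x \<ominus> y"] s_nz assms by auto
qed

text \<open>Apply \<open>sig\<close> to the relation for the inverse of \<open>sig\<close>, using
  that \<open>s\<close> is invariant: the two families are interchangeable.\<close>

lemma coord':
 assumes "sig : G" shows "(\<Oplus>i\<in>{..<m}. be i ** sig (al i)) = (if sig = idG then s else \<zero>)"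
proof -
 obtain tau where t: "tau : G" "!!x. x : carrier A ==> tau (sig x) = x" "!!x. x : carrier A ==> sig (tau x) = x"
 using G_two_sided_inverse[OF assms] by blast
 have "(\<Oplus>i\<in>{..<m}. be i ** sig (al i)) = (\<Oplus>i\<in>{..<m}. sig (al i ** tau (be i)))"
 proof (intro finsum_cong' refl)
 fix i assume "i : {..<m}"
 then have i: "al i : carrier A" "be i : carrier A" "tau (be i) : carrier A" using alc bec G_simps(1)[OF t(1)] by auto
 then have "sig (al i ** tau (be i)) = sig (al i) ** be i" using t(3) G_simps(2)[OF assms] by simp
 then show "be i ** sig (al i) = sig (al i ** tau (be i))" using i G_simps(1)[OF assms] m_comm by simp
 qed (use alc bec G_simps(1)[OF t(1)] G_simps(1)[OF assms] in auto)
 also have "... = sig (\<Oplus>i\<in>{..<m}. al i ** tau (be i))"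
 using alc bec t(1) assms G_simps by (intro G_finsum[symmetric]) auto
 also have "... = (if tau = idG then s else \<zero>)" using coord[OF t(1)] assms s_fixed fixedD G_zero by auto
 also have "tau = idG \<longleftrightarrow> sig = idG"
 proof
 assume "tau = idG"
 then have "sig x = idG x" if "x : carrier A" for x using t(3)[OF that] that by simp
 then show "sig = idG" using G_ext[OF assms] by (intro extensionalityI[of _ "carrier A"]) auto
 next
 assume "sig = idG"
 then have "tau x = idG x" if "x : carrier A" for x using t(2)[OF that] that by simp
 then show "tau = idG" using G_ext[OF t(1)] by (intro extensionalityI[of _ "carrier A"]) auto
 qed
 finally show ?thesis .
qed

text \<open>After exchanging the sums over \<open>i\<close> and over \<open>G\<close> only the
  identity contributes. Hence, up to division by \<open>s\<close>, the elements \<open>u i\<close>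
  span \<open>A\<close> over the invariants, with traces as coefficients.\<close>

lemma expand_gen:
 assumes u: "!!i. i < m ==> u i : carrier A" and v: "!!i. i < m ==> v i : carrier A"
 and uv: "!!sig. sig : G ==> (\<Oplus>i\<in>{..<m}. u i ** sig (v i)) = (if sig = idG then s else \<zero>)"
 and a: "a : carrier A"
 shows "(\<Oplus>i\<in>{..<m}. u i ** trace (v i ** a)) = s ** a"
proof -
 have "(\<Oplus>i\<in>{..<m}. u i ** trace (v i ** a)) = (\<Oplus>i\<in>{..<m}. u i ** (\<Oplus>sig\<in>G. sig (v i) ** sig a))"
 using u v a G_simps by (intro finsum_cong') (auto simp: trace_def intro!: arg_cong2[of _ _ _ _ "(**)"] finsum_cong')
 also have "... = (\<Oplus>sig\<in>G. (\<Oplus>i\<in>{..<m}. u i ** sig (v i)) ** sig a)"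
 using u v a G_simps G_finite by (intro finsum_swap_mult[symmetric]) auto
 also have "... = (\<Oplus>sig\<in>G. if sig = idG then s ** a else \<zero>)"
 using uv a G_simps by (intro finsum_cong') auto
 also have "... = s ** a"
 using finsum_singleton[OF G_id G_finite, of "%_. s ** a"] a by (simp add: eq_commute cong: if_cong)
 finally show ?thesis .
qed

lemma expand: "a : carrier A ==> (\<Oplus>i\<in>{..<m}. al i ** trace (be i ** a)) = s ** a"
 using expand_gen[of al be a] alc bec coord by blast

lemma expand': "a : carrier A ==> (\<Oplus>i\<in>{..<m}. be i ** trace (al i ** a)) = s ** a"
 using expand_gen[of be al a] alc bec coord' by blast

text \<open>
 A differential operator that is linear over the fixed ring is a multiplication operator: in
 characteristic zero the function field is a separable extension of the field of invariants.
\<close>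

lemma commutes_with_fixed:
 "[|e : diffops A r; !!c f. [|c : fixed; f : carrier A|] ==> e (c ** f) = c ** e f|] ==> e = mu (e \<one>)"
proof (induct r arbitrary: e)
 case 0
 then show ?case by auto
next
 case (Suc r)
 have ec: "e : carrier D" using Suc D_carrierI by blast
 note lin = D_linear[OF ec]
 \<comment> \<open>Commutators of \<open>e\<close> are again linear over the invariants and of
   smaller order, so by induction they are multiplications.\<close>
 have br: "brk e b = mu (brk e b \<one>)" if b: "b : carrier A" for b
 proof (rule Suc(1))
 show "brk e b : diffops A r" using brk_diffop[OF Suc(2) b] by simp
 fix c f assume c: "c : fixed" and f: "f : carrier A"
 then have cc: "c : carrier A" "e f : carrier A" "e (b ** f) : carrier A" using fixedD ec b by auto
 have "b ** (c ** f) = c ** (b ** f)" using b cc f by algebra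
 then have "brk e b (c ** f) = c ** e (b ** f) \<ominus> b ** (c ** e f)"
 using cc b f Suc(3)[OF c, of f] Suc(3)[OF c, of "b ** f"] by (simp add: brk_def)
 also have "... = c ** brk e b f" using cc b f by (simp add: brk_def) algebra
 finally show "brk e b (c ** f) = c ** brk e b f" .
 qed
 define k where "k i = brk e (be i) \<one>" for i
 have kc: "k i : carrier A" if "i < m" for i
 using that bec ec linear_endosD(1)[OF brk_linear[OF lin]] by (simp add: k_def)
 have eb: "e (be i ** f) = be i ** e f +. k i ** f" if "i < m" "f : carrier A" for i f
 proof -
 have "e (be i ** f) \<ominus> be i ** e f = k i ** f"
 using fun_cong[OF br[OF bec[OF that(1)]], of f] that kc[OF that(1)] by (simp add: brk_def k_def)
 moreover have "e (be i ** f) : carrier A" "be i ** e f : carrier A" using that bec ec by auto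
 ultimately show ?thesis using that kc bec by (intro eq_of_minus) auto
 qed
 define \<kappa> where "\<kappa> = (\<Oplus>k\<in>{..<m}. e (al k) ** be k)"
 define c where "c = (\<Oplus>i\<in>{..<m}. al i ** k i)"
 have \<kappa>c: "\<kappa> : carrier A" and cc: "c : carrier A"
 unfolding \<kappa>_def c_def using alc bec kc ec by (auto intro!: finsum_closed)
 have key: "s ** e f = (\<kappa> \<ominus> c) ** f" if f: "f : carrier A" for f
 proof -
 have ef: "e f : carrier A" using ec f by auto
 \<comment> \<open>\<open>P\<close> is computed in two ways. Moving \<open>e\<close> past
   \<open>be i\<close> gives \<open>s ** e f +. c ** f\<close>; expanding the values of
   \<open>e\<close> in coordinates gives \<open>\<kappa> ** f\<close>. The comparison shows that
   \<open>s ** e f\<close> is a multiple of \<open>f\<close>.\<close>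
 define P where "P = (\<Oplus>i\<in>{..<m}. al i ** e (be i ** f))"
 have Pc: "P : carrier A" unfolding P_def using alc bec ec f by (auto intro!: finsum_closed)
 have "P = (\<Oplus>i\<in>{..<m}. (al i ** be i) ** e f +. (al i ** k i) ** f)"
 unfolding P_def using alc bec kc ec f ef by (intro finsum_cong') (auto simp: eb r_distr m_assoc)
 also have "... = (\<Oplus>i\<in>{..<m}. (al i ** be i) ** e f) +. (\<Oplus>i\<in>{..<m}. (al i ** k i) ** f)"
 using alc bec kc ec f ef by (intro finsum_addf) auto
 also have "(\<Oplus>i\<in>{..<m}. (al i ** be i) ** e f) = (\<Oplus>i\<in>{..<m}. al i ** be i) ** e f"
 using alc bec ef by (intro finsum_ldistr[symmetric]) auto
 also have "(\<Oplus>i\<in>{..<m}. al i ** be i) = (\<Oplus>i\<in>{..<m}. al i ** idG (be i))"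
 using alc bec by (intro finsum_cong') auto
 also have "... = s" using coord[OF G_id] by simp
 also have "(\<Oplus>i\<in>{..<m}. (al i ** k i) ** f) = c ** f"
 unfolding c_def using alc kc f by (intro finsum_ldistr[symmetric]) auto
 finally have P1: "P = s ** e f +. c ** f" .
 \<comment> \<open>Linearity over the invariants determines \<open>e\<close>, up to
   \<open>s\<close>, by its values on the elements \<open>al k\<close>.\<close>
 have se: "s ** e g = (\<Oplus>k\<in>{..<m}. e (al k) ** trace (be k ** g))" if g: "g : carrier A" for g
 proof -
 have "s ** e g = e (s ** g)" using Suc(3)[OF s_fixed g] by simp
 also have "... = e (\<Oplus>k\<in>{..<m}. al k ** trace (be k ** g))" using expand[OF g] by simp
 also have "... = (\<Oplus>k\<in>{..<m}. e (al k ** trace (be k ** g)))"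
 proof -
 have "e (finsum A h J) = (\<Oplus>k\<in>J. e (h k))" if "finite J" "h : J \<rightarrow> carrier A" for h and J :: "nat set"
 using that
 proof (induct set: finite)
 case empty then show ?case using linear_endos_zero[OF lin] by simp
 next
 case (insert j J)
 then show ?case using ec D_lin[OF ec] by (subst (1 2) finsum_insert) (auto intro!: finsum_closed simp: Pi_iff)
 qed
 then show ?thesis using alc bec g by auto
 qed
 also have "... = (\<Oplus>k\<in>{..<m}. e (al k) ** trace (be k ** g))"
 proof (intro finsum_cong' refl)
 fix k assume "k : {..<m}"
 then have k: "al k : carrier A" "trace (be k ** g) : fixed" "trace (be k ** g) : carrier A"
 using alc bec g trace_fixed by auto
 then show "e (al k ** trace (be k ** g)) = e (al k) ** trace (be k ** g)"
 using Suc(3)[OF k(2,1)] ec by (simp add: m_comm)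
 qed (use alc bec g ec in auto)
 finally show ?thesis .
 qed
 have "s ** P = (\<Oplus>i\<in>{..<m}. s ** (al i ** e (be i ** f)))"
 unfolding P_def using alc bec ec f by (intro finsum_rdistr) auto
 also have "... = (\<Oplus>i\<in>{..<m}. (\<Oplus>k\<in>{..<m}. e (al k) ** trace (be k ** (be i ** f))) ** al i)"
 proof (intro finsum_cong' refl)
 fix i assume i: "i : {..<m}"
 have "s ** (al i ** e (be i ** f)) = (s ** e (be i ** f)) ** al i"
 using i alc bec ec f by (simp add: m_ac)
 then show "s ** (al i ** e (be i ** f)) = (\<Oplus>k\<in>{..<m}. e (al k) ** trace (be k ** (be i ** f))) ** al i"
 using se[of "be i ** f"] i bec f by simp
 qed (use alc bec ec f in \<open>auto intro!: finsum_closed\<close>)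
 also have "... = (\<Oplus>k\<in>{..<m}. e (al k) ** (\<Oplus>i\<in>{..<m}. trace (be k ** (be i ** f)) ** al i))"
 using alc bec ec f by (intro finsum_swap_mult) auto
 also have "... = (\<Oplus>k\<in>{..<m}. e (al k) ** (s ** (be k ** f)))"
 proof (intro finsum_cong' refl)
 fix k assume k: "k : {..<m}"
 have "(\<Oplus>i\<in>{..<m}. trace (be k ** (be i ** f)) ** al i) = (\<Oplus>i\<in>{..<m}. al i ** trace (be i ** (be k ** f)))"
 using k alc bec f by (intro finsum_cong') (auto simp: m_comm m_lcomm)
 also have "... = s ** (be k ** f)" using expand k bec f by auto
 finally show "e (al k) ** (\<Oplus>i\<in>{..<m}. trace (be k ** (be i ** f)) ** al i) = e (al k) ** (s ** (be k ** f))" by simp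
 qed (use alc bec ec f in auto)
 also have "... = (\<Oplus>k\<in>{..<m}. (e (al k) ** be k) ** (s ** f))"
 using alc bec ec f by (intro finsum_cong') (auto simp: m_ac)
 also have "... = \<kappa> ** (s ** f)" unfolding \<kappa>_def using alc bec ec f by (intro finsum_ldistr[symmetric]) auto
 finally have "s ** P = s ** (\<kappa> ** f)" using \<kappa>c f by (simp add: m_lcomm)
 then have "P = \<kappa> ** f" using cancel_s Pc \<kappa>c f by auto
 then have "\<kappa> ** f = s ** e f +. c ** f" using P1 by simp
 moreover have "(\<kappa> \<ominus> c) ** f = \<kappa> ** f \<ominus> c ** f" using \<kappa>c cc f by algebra
 moreover have "s ** e f +. c ** f \<ominus> c ** f = s ** e f" using cc f ef sc by algebra
 ultimately show ?thesis by simp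
 qed
 have ef: "e f = e \<one> ** f" if f: "f : carrier A" for f
 proof (rule cancel_s)
 have "s ** (e \<one> ** f) = (\<kappa> \<ominus> c) ** f" using key[of \<one>] f ec \<kappa>c cc by (simp add: m_assoc[symmetric])
 then show "s ** e f = s ** (e \<one> ** f)" using key[OF f] by simp
 qed (use f ec in auto)
 show ?case
 proof (rule D_eqI[OF ec])
 show "e f = mu (e \<one>) f" if "f : carrier A" for f using ef[OF that] that by (simp only: mult_operator_apply)
 qed (use ec in auto)
qed

text \<open>
 The extension \<open>\<partial>'\<close> of a derivation \<open>\<partial>\<close> of the fixed ring is the part of order at most one, without constant
 term, of the additive map \<open>\<partial>0\<close> that applies \<open>\<partial>\<close> to the coordinates.
\<close>

context
 fixes dd :: "'a => 'a"
 assumes dd_closed: "a : fixed ==> dd a : fixed"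
 and dd_add: "[|a : fixed; b : fixed|] ==> dd (a +. b) = dd a +. dd b"
 and dd_smult: "a : fixed ==> dd (c \<odot> a) = c \<odot> dd a"
 and dd_mult: "[|a : fixed; b : fixed|] ==> dd (a ** b) = a ** dd b +. b ** dd a"
begin

definition dd0 where "dd0 b = (\<Oplus>j\<in>{..<m}. al j ** dd (trace (be j ** b)))"
text \<open>Over the function field \<open>dd0\<close> is a derivation up to a factor, plus
  multiples of the automorphisms in \<open>G\<close>. Inserting \<open>be i\<close> inside and
  \<open>al i\<close> outside multiplies a multiple of \<open>sig\<close> by the value of
  \<open>coord\<close> at \<open>sig\<close>, so all automorphisms other than the identity disappear
  and an operator of order at most one remains.\<close>

definition ddE where "ddE a = (\<Oplus>i\<in>{..<m}. al i ** dd0 (be i ** a))"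
definition dd1 where "dd1 = (\<lambda>a\<in>carrier A. ddE a \<ominus> a ** ddE \<one>)"

lemma ddc [simp]: "a : fixed ==> dd a : carrier A"
 using dd_closed fixedD by blast

lemma dd0_closed [simp]: "b : carrier A ==> dd0 b : carrier A"
 unfolding dd0_def using alc bec trace_fixed by (auto intro!: finsum_closed)

lemma ddE_closed [simp]: "b : carrier A ==> ddE b : carrier A"
 unfolding ddE_def using alc bec by (auto intro!: finsum_closed)

lemma dd0_add: "[|a : carrier A; b : carrier A|] ==> dd0 (a +. b) = dd0 a +. dd0 b"
proof -
 assume c: "a : carrier A" "b : carrier A"
 have "dd0 (a +. b) = (\<Oplus>j\<in>{..<m}. al j ** dd (trace (be j ** a)) +. al j ** dd (trace (be j ** b)))"
 unfolding dd0_def using c alc bec trace_fixed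
 by (intro finsum_cong') (auto simp: r_distr trace_add dd_add)
 also have "... = dd0 a +. dd0 b" unfolding dd0_def using c alc bec trace_fixed by (intro finsum_addf) auto
 finally show ?thesis .
qed

lemma dd0_smult: "a : carrier A ==> dd0 (c \<odot> a) = c \<odot> dd0 a"
 unfolding dd0_def using alc bec trace_fixed
 by (subst smult_finsum) (auto intro!: finsum_cong' simp: trace_smult dd_smult)

lemma ddE_add: "[|a : carrier A; b : carrier A|] ==> ddE (a +. b) = ddE a +. ddE b"
proof -
 assume c: "a : carrier A" "b : carrier A"
 have "ddE (a +. b) = (\<Oplus>j\<in>{..<m}. al j ** dd0 (be j ** a) +. al j ** dd0 (be j ** b))"
 unfolding ddE_def using c alc bec by (intro finsum_cong') (auto simp: r_distr dd0_add)
 also have "... = ddE a +. ddE b" unfolding ddE_def using c alc bec by (intro finsum_addf) auto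
 finally show ?thesis .
qed

lemma ddE_smult: "a : carrier A ==> ddE (c \<odot> a) = c \<odot> ddE a"
 unfolding ddE_def using alc bec
 by (subst smult_finsum) (auto intro!: finsum_cong' simp: dd0_smult)

lemma dd0_finsum:
 "[|finite J; !!j. j : J ==> h j : carrier A|] ==> dd0 (finsum A h J) = (\<Oplus>j\<in>J. dd0 (h j))"
proof (induct set: finite)
 case empty then show ?case using dd0_smult[of \<zero> 0] by simp
next
 case (insert j J)
 then show ?case by (subst (1 2) finsum_insert) (auto intro!: finsum_closed simp: dd0_add)
qed

lemma dd0_mult_fixed:
 assumes c: "c : fixed" and a: "a : carrier A"
 shows "dd0 (c ** a) = c ** dd0 a +. (s ** a) ** dd c"
proof -
 have cc: "c : carrier A" using c fixedD by blast
 have "dd0 (c ** a) = (\<Oplus>j\<in>{..<m}. c ** (al j ** dd (trace (be j ** a))) +. (al j ** trace (be j ** a)) ** dd c)"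
 unfolding dd0_def
 proof (intro finsum_cong' refl)
 fix j assume "j : {..<m}"
 then have j: "al j : carrier A" "be j : carrier A" "trace (be j ** a) : fixed" "trace (be j ** a) : carrier A"
 "dd (trace (be j ** a)) : carrier A"
 using alc bec a trace_fixed by auto
 have "trace (be j ** (c ** a)) = c ** trace (be j ** a)"
 using trace_mult_fixed[OF c, of "be j ** a"] j a cc by (simp add: m_lcomm)
 then show "al j ** dd (trace (be j ** (c ** a))) = c ** (al j ** dd (trace (be j ** a))) +. (al j ** trace (be j ** a)) ** dd c"
 using j cc c by (simp add: dd_mult r_distr m_ac)
 qed (use alc bec a cc c trace_fixed in auto)
 also have "... = (\<Oplus>j\<in>{..<m}. c ** (al j ** dd (trace (be j ** a)))) +. (\<Oplus>j\<in>{..<m}. (al j ** trace (be j ** a)) ** dd c)"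
 using alc bec a cc c trace_fixed by (intro finsum_addf) auto
 also have "(\<Oplus>j\<in>{..<m}. c ** (al j ** dd (trace (be j ** a)))) = c ** dd0 a"
 unfolding dd0_def using alc bec a cc c trace_fixed by (intro finsum_rdistr[symmetric]) auto
 also have "(\<Oplus>j\<in>{..<m}. (al j ** trace (be j ** a)) ** dd c) = (s ** a) ** dd c"
 unfolding expand[OF a, symmetric] using alc bec a cc c by (intro finsum_ldistr[symmetric]) auto
 finally show ?thesis .
qed

text \<open>Multiplication by \<open>x\<close> has the matrix \<open>c\<close> with respect to
  \<open>al\<close> and its transpose with respect to \<open>be\<close>. The terms in which no
  matrix entry is differentiated agree on both sides, and the rest is a multiple of
  \<open>y\<close>.\<close>

lemma ddE_commutator:
 assumes x: "x : carrier A"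
 shows "\<exists>h\<in>carrier A. \<forall>y\<in>carrier A. s ** ddE (x ** y) = s ** (x ** ddE y) +. h ** y"
proof -
 \<comment> \<open>By \<open>expand\<close> these are the coefficients of
   \<open>s ** (x ** al i)\<close> in the \<open>al k\<close>, and by \<open>expand'\<close>, with
   the indices exchanged, those of \<open>s ** (x ** be i)\<close> in the
   \<open>be k\<close>.\<close>
 define c where "c k i = trace (be k ** (x ** al i))" for k i
 have cf: "c k i : fixed" and cc: "c k i : carrier A" if "k < m" "i < m" for k i
 unfolding c_def using that alc bec x trace_fixed by auto
 define u where "u i = (\<Oplus>k\<in>{..<m}. be k ** dd (c i k))" for i
 have uc: "u i : carrier A" if "i < m" for i
 unfolding u_def using bec cf that by (auto intro!: finsum_closed)
 define w where "w = (\<Oplus>i\<in>{..<m}. al i ** u i)"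
 have wc: "w : carrier A" unfolding w_def using alc uc by (auto intro!: finsum_closed)
 define h where "h = s ** w \<ominus> (s ** s) ** (x ** dd s)"
 have ds: "dd s : carrier A" using s_fixed by simp
 have hc: "h : carrier A" using wc x ds by (simp add: h_def)
 have "s ** ddE (x ** y) = s ** (x ** ddE y) +. h ** y" if y: "y : carrier A" for y
 proof -
 define t where "t i = dd0 (be i ** y)" for i
 have tc: "t i : carrier A" if "i < m" for i unfolding t_def using that bec y by simp
 define S where "S = (\<Oplus>i\<in>{..<m}. al i ** (\<Oplus>k\<in>{..<m}. c i k ** t k))"
 have Sc: "S : carrier A" unfolding S_def using alc cc tc by (auto intro!: finsum_closed)
 have 1: "s ** (x ** ddE y) = S"
 proof -
 have "s ** (x ** ddE y) = (s ** x) ** ddE y" using x y by (simp add: m_assoc)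
 also have "... = (\<Oplus>i\<in>{..<m}. (s ** x) ** (al i ** t i))"
 unfolding ddE_def t_def[symmetric] using x alc tc by (intro finsum_rdistr) auto
 also have "... = (\<Oplus>i\<in>{..<m}. (\<Oplus>k\<in>{..<m}. al k ** c k i) ** t i)"
 proof (intro finsum_cong' refl)
 fix i assume i: "i : {..<m}"
 have "(\<Oplus>k\<in>{..<m}. al k ** c k i) = s ** (x ** al i)"
 unfolding c_def using i expand[of "x ** al i"] alc x by auto
 then show "(s ** x) ** (al i ** t i) = (\<Oplus>k\<in>{..<m}. al k ** c k i) ** t i" using i alc tc x by (simp add: m_assoc)
 qed (use alc cc tc in \<open>auto intro!: finsum_closed\<close>)
 also have "... = S" unfolding S_def using alc cc tc by (intro finsum_swap_mult) auto
 finally show ?thesis .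
 qed
 have e: "s ** dd0 (be i ** (x ** y)) = (\<Oplus>k\<in>{..<m}. c i k ** t k) +. (u i ** s) ** y \<ominus> ((s ** be i) ** (x ** y)) ** dd s"
 if i: "i < m" for i
 proof -
 define z where "z = be i ** (x ** y)"
 have zc: "z : carrier A" using i bec x y by (simp add: z_def)
 have b: "be i : carrier A" using i bec by simp
 have "s ** z = (s ** (x ** be i)) ** y" unfolding z_def using i bec x y by (simp add: m_ac)
 also have "s ** (x ** be i) = (\<Oplus>k\<in>{..<m}. be k ** c i k)"
 unfolding expand'[of "x ** be i", symmetric, OF m_closed[OF x b]]
 by (intro finsum_cong' refl) (use i alc bec x in \<open>auto simp: c_def m_ac intro!: arg_cong[of _ _ trace] arg_cong2[of _ _ _ _ "(**)"]\<close>)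
 also have "... ** y = (\<Oplus>k\<in>{..<m}. c i k ** (be k ** y))"
 using bec cc i y by (subst finsum_ldistr) (auto intro!: finsum_cong' simp: m_ac)
 finally have sz: "s ** z = (\<Oplus>k\<in>{..<m}. c i k ** (be k ** y))" .
 \<comment> \<open>The value at \<open>s ** z\<close> is computed from the expansion of
   \<open>s ** z\<close> with invariant coefficients, and once more in \<open>d2\<close> from the
   product rule for the invariant \<open>s\<close>; together they isolate
   \<open>s ** dd0 z\<close>.\<close>
 have "dd0 (s ** z) = (\<Oplus>k\<in>{..<m}. dd0 (c i k ** (be k ** y)))"
 unfolding sz using bec cc i y by (intro dd0_finsum) auto
 also have "... = (\<Oplus>k\<in>{..<m}. c i k ** t k +. (be k ** dd (c i k)) ** (s ** y))"
 proof (intro finsum_cong' refl)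
 fix k assume "k : {..<m}"
 then have k: "be k : carrier A" "c i k : carrier A" "c i k : fixed" "dd (c i k) : carrier A"
 using bec cc cf i by auto
 show "dd0 (c i k ** (be k ** y)) = c i k ** t k +. (be k ** dd (c i k)) ** (s ** y)"
 using dd0_mult_fixed[OF k(3), of "be k ** y"] k y by (simp add: t_def m_ac)
 qed (use bec cc cf i y tc in auto)
 also have "... = (\<Oplus>k\<in>{..<m}. c i k ** t k) +. (\<Oplus>k\<in>{..<m}. (be k ** dd (c i k)) ** (s ** y))"
 using bec cc cf i y tc by (intro finsum_addf) auto
 also have "(\<Oplus>k\<in>{..<m}. (be k ** dd (c i k)) ** (s ** y)) = u i ** (s ** y)"
 unfolding u_def using bec cf i y by (intro finsum_ldistr[symmetric]) auto
 finally have d1: "dd0 (s ** z) = (\<Oplus>k\<in>{..<m}. c i k ** t k) +. u i ** (s ** y)" .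
 have d2: "dd0 (s ** z) = s ** dd0 z +. (s ** z) ** dd s" using dd0_mult_fixed[OF s_fixed zc] .
 have cl: "(\<Oplus>k\<in>{..<m}. c i k ** t k) : carrier A" "u i : carrier A" "dd0 z : carrier A"
 using cc tc uc i zc by (auto intro!: finsum_closed)
 have "s ** dd0 z = dd0 (s ** z) \<ominus> (s ** z) ** dd s" using d2 cl zc ds sc by algebra
 also have "... = (\<Oplus>k\<in>{..<m}. c i k ** t k) +. (u i ** s) ** y \<ominus> ((s ** be i) ** (x ** y)) ** dd s"
 unfolding d1 using cl b x y by (simp add: z_def m_assoc)
 finally show ?thesis unfolding z_def .
 qed
 have "s ** ddE (x ** y) = (\<Oplus>i\<in>{..<m}. s ** (al i ** dd0 (be i ** (x ** y))))"
 unfolding ddE_def using alc bec x y by (intro finsum_rdistr) auto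
 also have "... = (\<Oplus>i\<in>{..<m}. al i ** (\<Oplus>k\<in>{..<m}. c i k ** t k) +. ((al i ** u i) ** (s ** y) +. (al i ** be i) ** (\<ominus> (s ** (x ** y) ** dd s))))"
 proof (intro finsum_cong' refl)
 fix i assume i: "i : {..<m}"
 have cl: "(\<Oplus>k\<in>{..<m}. c i k ** t k) : carrier A" "u i : carrier A" "al i : carrier A" "be i : carrier A"
 "dd0 (be i ** (x ** y)) : carrier A"
 using cc tc uc i alc bec x y by (auto intro!: finsum_closed)
 define X where "X = (\<Oplus>k\<in>{..<m}. c i k ** t k)"
 define Y where "Y = dd s"
 define U where "U = u i"
 define a where "a = al i"
 define b where "b = be i"
 have cl': "X : carrier A" "U : carrier A" "a : carrier A" "b : carrier A" "Y : carrier A"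
 using cl ds by (auto simp: X_def U_def a_def b_def Y_def)
 have "s ** (al i ** dd0 (be i ** (x ** y))) = al i ** (s ** dd0 (be i ** (x ** y)))" using cl by (simp add: m_lcomm)
 also have "... = al i ** ((\<Oplus>k\<in>{..<m}. c i k ** t k) +. (u i ** s) ** y \<ominus> ((s ** be i) ** (x ** y)) ** dd s)"
 using e i by simp
 also have "... = al i ** (\<Oplus>k\<in>{..<m}. c i k ** t k) +. ((al i ** u i) ** (s ** y) +. (al i ** be i) ** (\<ominus> (s ** (x ** y) ** dd s)))"
 unfolding X_def[symmetric] U_def[symmetric] a_def[symmetric] b_def[symmetric] Y_def[symmetric]
 using cl' x y sc by algebra
 finally show "s ** (al i ** dd0 (be i ** (x ** y))) = al i ** (\<Oplus>k\<in>{..<m}. c i k ** t k) +. ((al i ** u i) ** (s ** y) +. (al i ** be i) ** (\<ominus> (s ** (x ** y) ** dd s)))" .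
 qed (use alc bec cc tc uc x y ds in \<open>auto intro!: finsum_closed\<close>)
 also have "... = S +. ((\<Oplus>i\<in>{..<m}. (al i ** u i) ** (s ** y)) +. (\<Oplus>i\<in>{..<m}. (al i ** be i) ** (\<ominus> (s ** (x ** y) ** dd s))))"
 unfolding S_def using alc bec cc tc uc x y ds
 by (subst finsum_addf, (auto intro!: finsum_closed)[2])+ simp
 also have "(\<Oplus>i\<in>{..<m}. (al i ** u i) ** (s ** y)) = w ** (s ** y)"
 unfolding w_def using alc uc y by (intro finsum_ldistr[symmetric]) auto
 also have "(\<Oplus>i\<in>{..<m}. (al i ** be i) ** (\<ominus> (s ** (x ** y) ** dd s))) = (\<Oplus>i\<in>{..<m}. al i ** be i) ** (\<ominus> (s ** (x ** y) ** dd s))"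
 using alc bec x y ds by (intro finsum_ldistr[symmetric]) auto
 also have "(\<Oplus>i\<in>{..<m}. al i ** be i) = (\<Oplus>i\<in>{..<m}. al i ** idG (be i))"
 using alc bec by (intro finsum_cong') auto
 also have "... = s" using coord[OF G_id] by simp
 finally show ?thesis unfolding 1 h_def using Sc wc x y ds sc by algebra
 qed
 then show ?thesis using hc by blast
qed

lemma dd1_mult:
 assumes x: "x : carrier A" and y: "y : carrier A"
 shows "dd1 (x ** y) = x ** dd1 y +. y ** dd1 x"
proof -
 obtain h where h: "h : carrier A" "!!y. y : carrier A ==> s ** ddE (x ** y) = s ** (x ** ddE y) +. h ** y"
 using ddE_commutator[OF x] by blast
 have c: "ddE x : carrier A" "ddE y : carrier A" "ddE \<one> : carrier A" "ddE (x ** y) : carrier A" using x y by auto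
 have "s ** ddE x = s ** (x ** ddE \<one>) +. h" using h(2)[of \<one>] x h(1) by simp
 then have h': "h = s ** (ddE x \<ominus> x ** ddE \<one>)" using c h(1) x sc by algebra
 have "ddE (x ** y) = x ** ddE y +. (ddE x \<ominus> x ** ddE \<one>) ** y"
 proof (rule cancel_s)
 show "s ** ddE (x ** y) = s ** (x ** ddE y +. (ddE x \<ominus> x ** ddE \<one>) ** y)"
 unfolding h(2)[OF y] h' using c x y sc by algebra
 qed (use c x y in auto)
 then have "dd1 (x ** y) = (x ** ddE y +. (ddE x \<ominus> x ** ddE \<one>) ** y) \<ominus> (x ** y) ** ddE \<one>"
 using x y by (simp add: dd1_def)
 also have "... = x ** (ddE y \<ominus> y ** ddE \<one>) +. y ** (ddE x \<ominus> x ** ddE \<one>)" using c x y by algebra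
 finally show ?thesis using x y by (simp add: dd1_def)
qed

text \<open>One factor \<open>s\<close> arises in \<open>dd0\<close> from expanding the argument,
  the other in \<open>ddE\<close> from the sum of the products of \<open>al i\<close> and
  \<open>be i\<close>. What is extended to \<open>A\<close> is therefore the multiple of
  \<open>dd\<close> by the square of \<open>s\<close>.\<close>

lemma dd1_fixed:
 assumes c: "c : fixed" shows "dd1 c = (s ** s) ** dd c"
proof -
 have cc: "c : carrier A" "dd c : carrier A" using c fixedD by auto
 have "ddE c = (\<Oplus>i\<in>{..<m}. c ** (al i ** dd0 (be i)) +. (al i ** be i) ** (s ** dd c))"
 unfolding ddE_def
 proof (intro finsum_cong' refl)
 fix i assume "i : {..<m}"
 then have i: "al i : carrier A" "be i : carrier A" "dd0 (be i) : carrier A" using alc bec by auto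
 show "al i ** dd0 (be i ** c) = c ** (al i ** dd0 (be i)) +. (al i ** be i) ** (s ** dd c)"
 using i cc dd0_mult_fixed[OF c, of "be i"] m_comm[of "be i" c] by (simp add: r_distr m_ac)
 qed (use alc bec cc in auto)
 also have "... = (\<Oplus>i\<in>{..<m}. c ** (al i ** dd0 (be i))) +. (\<Oplus>i\<in>{..<m}. (al i ** be i) ** (s ** dd c))"
 using alc bec cc by (intro finsum_addf) auto
 also have "(\<Oplus>i\<in>{..<m}. c ** (al i ** dd0 (be i))) = c ** (\<Oplus>i\<in>{..<m}. al i ** dd0 (be i))"
 using alc bec cc by (intro finsum_rdistr[symmetric]) auto
 also have "(\<Oplus>i\<in>{..<m}. al i ** dd0 (be i)) = ddE \<one>"
 unfolding ddE_def using alc bec by (intro finsum_cong') auto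
 also have "(\<Oplus>i\<in>{..<m}. (al i ** be i) ** (s ** dd c)) = (\<Oplus>i\<in>{..<m}. al i ** be i) ** (s ** dd c)"
 using alc bec cc by (intro finsum_ldistr[symmetric]) auto
 also have "(\<Oplus>i\<in>{..<m}. al i ** be i) = (\<Oplus>i\<in>{..<m}. al i ** idG (be i))"
 using alc bec by (intro finsum_cong') auto
 also have "... = s" using coord[OF G_id] by simp
 finally have "ddE c = c ** ddE \<one> +. s ** (s ** dd c)" .
 moreover have "c ** ddE \<one> +. s ** (s ** dd c) \<ominus> c ** ddE \<one> = (s ** s) ** dd c"
 using cc sc ddE_closed[OF one_closed] by algebra
 ultimately show ?thesis using cc by (simp add: dd1_def)
qed

lemma dd1_linear: "dd1 : linear_endos A"
proof (rule linear_endosI)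
 show "dd1 f : carrier A" if "f : carrier A" for f using that by (simp add: dd1_def)
 show "dd1 (f +. g) = dd1 f +. dd1 g" if "f : carrier A" "g : carrier A" for f g
 proof -
 have "ddE f +. ddE g \<ominus> (f +. g) ** ddE \<one> = (ddE f \<ominus> f ** ddE \<one>) +. (ddE g \<ominus> g ** ddE \<one>)"
 using that ddE_closed[OF one_closed] ddE_closed[OF that(1)] ddE_closed[OF that(2)] by algebra
 then show ?thesis using that by (simp add: dd1_def ddE_add)
 qed
 show "dd1 (c \<odot> f) = c \<odot> dd1 f" if "f : carrier A" for f c
 using that by (simp add: dd1_def ddE_smult a_minus_def smult_add_right smult_minus_right)
qed (simp add: dd1_def)

lemma dd1_brk: "b : carrier A ==> brk dd1 b = mu (dd1 b)"
proof (rule linear_endos_eqI)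
 fix f assume b: "b : carrier A" and f: "f : carrier A"
 have c: "dd1 b : carrier A" "dd1 f : carrier A" using b f linear_endosD(1)[OF dd1_linear] by auto
 show "brk dd1 b f = mu (dd1 b) f"
 using b f c by (simp add: brk_def dd1_mult) algebra
qed (use linear_endosD(1)[OF dd1_linear] in \<open>auto intro: brk_linear dd1_linear mult_operator_linear\<close>)

lemma dd1_diffop: "dd1 : diffops A 1"
 using dd1_linear dd1_brk linear_endosD(1)[OF dd1_linear] diffops_Suc_iff[of dd1 0] by auto

lemma dd1_one: "dd1 \<one> = \<zero>"
 by (simp add: dd1_def)

text \<open>Conjugation does not change the commutators with invariants, since these are invariant
  multiplications. The difference of the two operators is thus linear over the invariants, hence a
  multiplication, and it kills the unit.\<close>

lemma dd1_equivariant: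
 assumes "sig : G" shows "diffop_action A sig dd1 = dd1"
proof -
 note H = G_hom[OF assms] G_bij[OF assms]
 let ?a = "diffop_action A sig dd1"
 have ac: "?a : diffops A 1" using act_diffop[OF H dd1_diffop] .
 note lin = diffops_linear[OF ac]
 have dc: "dd1 : carrier D" "?a : carrier D" using ac dd1_diffop D_carrierI by blast+
 define e where "e = ?a \<ominus>\<^bsub>D\<^esub> dd1"
 have "\<ominus>\<^bsub>D\<^esub> dd1 = (- 1) \<odot>\<^bsub>D\<^esub> dd1" using dc D.smult_minus_left[of dd1 1] by simp
 then have ed: "e : diffops A 1" unfolding e_def a_minus_def
 using diffops_add[OF ac] diffops_smult[OF dd1_diffop] by simp
 have "e (c ** f) = c ** e f" if c: "c : fixed" and f: "f : carrier A" for c f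
 proof -
 have cc: "c : carrier A" using c fixedD by blast
 have si: "inv_into (carrier A) sig c = c"
 using auto_inverse(3)[OF H cc] fixedD(2)[OF c assms] by simp
 have "brk ?a c = diffop_action A sig (brk dd1 c)"
 using act_brk[OF H dd1_linear cc] si by simp
 also have "... = diffop_action A sig (mu ((s ** s) ** dd c))" using dd1_brk[OF cc] dd1_fixed[OF c] by simp
 also have "... = mu ((s ** s) ** dd c)"
 using act_mult_operator[OF H, of "(s ** s) ** dd c"] c s_fixed dd_closed
 fixedD(2)[OF fixed_ops(2)[OF fixed_ops(2)[OF s_fixed s_fixed] dd_closed[OF c]] assms] by simp
 finally have "brk ?a c = brk dd1 c" using dd1_brk[OF cc] dd1_fixed[OF c] by simp
 then have "brk ?a c f = brk dd1 c f" by simp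
 then have "?a (c ** f) \<ominus> c ** ?a f = dd1 (c ** f) \<ominus> c ** dd1 f" using f by (simp only: brk_def restrict_apply')
 moreover have "?a (c ** f) : carrier A" "?a f : carrier A" "dd1 (c ** f) : carrier A" "dd1 f : carrier A"
 using f cc dc D_apply_closed by blast+
 ultimately have *: "?a (c ** f) = c ** ?a f +. (dd1 (c ** f) \<ominus> c ** dd1 f)"
 using cc by (intro eq_of_minus) auto
 have "?a (c ** f) \<ominus> dd1 (c ** f) = c ** (?a f \<ominus> dd1 f)" unfolding *
 using cc \<open>?a f : carrier A\<close> \<open>dd1 (c ** f) : carrier A\<close> \<open>dd1 f : carrier A\<close> by algebra
 then show ?thesis unfolding e_def using D_diff_apply[OF dc(2,1)] f cc by simp
 qed
 then have "e = mu (e \<one>)" using commutes_with_fixed[OF ed] by blast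
 moreover have "e \<one> = \<zero>"
 unfolding e_def using dc auto_inverse(3)[OF H one_closed]
 by (simp add: D_diff_apply act_apply[OF H] G_simps(4)[OF assms] dd1_one G_zero[OF assms])
 ultimately have "e = \<zero>\<^bsub>D\<^esub>" using algebra_hom_zero[OF calgebra_axioms D_calgebra mult_operator_hom] by simp
 then show ?thesis unfolding e_def using dc by simp
qed

end

end

section \<open>Free algebras and their universal property\<close>

context
 fixes S :: "'g set"
begin

abbreviation "FA == free_algebra S"

definition mono :: "complex => 'g list => 'g list => complex" where
 "mono c w = (%v. if v = w then c else 0)"

lemma free_carrier: "f : carrier FA \<longleftrightarrow> finite {w. f w ~= 0} & {w. f w ~= 0} <= lists S"
 by (simp add: free_algebra_def)

lemma free_simps:
 "(f **\<^bsub>FA\<^esub> g) = (%w. \<Sum>i\<le>length w. f (take i w) * g (drop i w))"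
 "\<one>\<^bsub>FA\<^esub> = (%w. if w = [] then 1 else 0)" "\<zero>\<^bsub>FA\<^esub> = (%w. 0)"
 "(f +.\<^bsub>FA\<^esub> g) = (%w. f w + g w)" "(c \<odot>\<^bsub>FA\<^esub> f) = (%w. c * f w)"
 by (simp_all add: free_algebra_def)

lemma free_mult_closed:
 assumes "f : carrier FA" "g : carrier FA" shows "f **\<^bsub>FA\<^esub> g : carrier FA"
proof -
 let ?P = "(%(u, v). u @ v) ` ({w. f w ~= 0} \<times> {w. g w ~= 0})"
 have sub: "{w. (f **\<^bsub>FA\<^esub> g) w ~= 0} <= ?P"
 proof
 fix w assume "w : {w. (f **\<^bsub>FA\<^esub> g) w ~= 0}"
 then obtain i where "f (take i w) * g (drop i w) ~= 0"
 unfolding free_simps using sum.neutral[of "{..length w}"] by (metis (mono_tags, lifting) mem_Collect_eq)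
 then show "w : ?P" by (intro image_eqI[of _ _ "(take i w, drop i w)"]) auto
 qed
 have "finite ?P" using assms by (auto simp: free_carrier)
 moreover have "u @ v : lists S" if "f u ~= 0" "g v ~= 0" for u v
 using that assms unfolding free_carrier by (simp only: append_in_lists_conv) blast
 then have "?P <= lists S" by (intro image_subsetI) (simp only: split_beta mem_Times_iff mem_Collect_eq, blast)
 ultimately have "finite ?P" "?P <= lists S" .
 with sub show ?thesis unfolding free_carrier by (meson finite_subset order_trans)
qed

lemma free_mult_assoc: "(f **\<^bsub>FA\<^esub> g) **\<^bsub>FA\<^esub> h = f **\<^bsub>FA\<^esub> (g **\<^bsub>FA\<^esub> h)"
proof (rule ext)
 fix w :: "'g list"
 define P where "P a b = f (take a w) * g (take b (drop a w)) * h (drop (a + b) w)" for a b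
 have "((f **\<^bsub>FA\<^esub> g) **\<^bsub>FA\<^esub> h) w = (\<Sum>i\<le>length w. \<Sum>j\<le>i. P j (i - j))"
 proof -
 have "((f **\<^bsub>FA\<^esub> g) **\<^bsub>FA\<^esub> h) w =
 (\<Sum>i\<le>length w. (\<Sum>j\<le>i. f (take j (take i w)) * g (drop j (take i w))) * h (drop i w))"
 unfolding free_simps by (intro sum.cong) auto
 also have "... = (\<Sum>i\<le>length w. \<Sum>j\<le>i. P j (i - j))"
 unfolding P_def sum_distrib_right by (intro sum.cong refl) (auto simp: drop_take min_def)
 finally show ?thesis .
 qed
 \<comment> \<open>Both bracketings sum over the ways to cut a word twice; the triangle is reindexed
   by the lengths of the first two pieces.\<close>
 also have "... = (\<Sum>(i,j)\<in>{(i,j). i + j <= length w}. P i j)"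
 by (simp add: sum.triangle_reindex_eq)
 also have "{(i,j). i + j <= length w} = Sigma {..length w} (%j. {..length w - j})" by auto
 also have "(\<Sum>(i,j)\<in>.... P i j) = (\<Sum>j\<le>length w. \<Sum>b\<le>length w - j. P j b)"
 by (simp add: sum.Sigma)
 also have "... = (f **\<^bsub>FA\<^esub> (g **\<^bsub>FA\<^esub> h)) w"
 unfolding free_simps P_def sum_distrib_left by (intro sum.cong refl) (auto simp: mult.assoc add.commute)
 finally show "((f **\<^bsub>FA\<^esub> g) **\<^bsub>FA\<^esub> h) w = (f **\<^bsub>FA\<^esub> (g **\<^bsub>FA\<^esub> h)) w" .
qed

lemma free_one_mult: "\<one>\<^bsub>FA\<^esub> **\<^bsub>FA\<^esub> f = f" "f **\<^bsub>FA\<^esub> \<one>\<^bsub>FA\<^esub> = f"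
proof -
 have "(\<Sum>i\<le>length w. (if take i w = [] then 1 else 0) * f (drop i w)) = f w" for w
 proof -
 have "(\<Sum>i\<le>length w. (if take i w = [] then 1 else 0) * f (drop i w)) = (\<Sum>i\<in>{0}. (if take i w = [] then 1 else 0) * f (drop i w))"
 by (intro sum.mono_neutral_right) auto
 then show ?thesis by simp
 qed
 then show "\<one>\<^bsub>FA\<^esub> **\<^bsub>FA\<^esub> f = f" unfolding free_simps by auto
 have "(\<Sum>i\<le>length w. f (take i w) * (if drop i w = [] then 1 else 0)) = f w" for w
 proof -
 have "(\<Sum>i\<le>length w. f (take i w) * (if drop i w = [] then 1 else 0)) = (\<Sum>i\<in>{length w}. f (take i w) * (if drop i w = [] then 1 else 0))"
 by (intro sum.mono_neutral_right) auto
 then show ?thesis by simp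
 qed
 then show "f **\<^bsub>FA\<^esub> \<one>\<^bsub>FA\<^esub> = f" unfolding free_simps by auto
qed

lemma free_lin_closed:
 assumes "f : carrier FA" "g : carrier FA"
 shows "f +.\<^bsub>FA\<^esub> g : carrier FA" "c \<odot>\<^bsub>FA\<^esub> f : carrier FA" "\<one>\<^bsub>FA\<^esub> : carrier FA" "\<zero>\<^bsub>FA\<^esub> : carrier FA"
proof -
 have "{w. (f +.\<^bsub>FA\<^esub> g) w ~= 0} <= {w. f w ~= 0} \<union> {w. g w ~= 0}" unfolding free_simps by auto
 then show "f +.\<^bsub>FA\<^esub> g : carrier FA" using assms unfolding free_carrier
 by (meson Un_least finite_UnI finite_subset order_trans)
 have "{w. (c \<odot>\<^bsub>FA\<^esub> f) w ~= 0} <= {w. f w ~= 0}" unfolding free_simps by auto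
 then show "c \<odot>\<^bsub>FA\<^esub> f : carrier FA" using assms unfolding free_carrier
 by (meson finite_subset order_trans)
qed (auto simp: free_carrier free_simps)

lemma free_calgebra: "calgebra FA"
proof -
 have z: "(%w. 0) : carrier FA" "\<one>\<^bsub>FA\<^esub> : carrier FA" by (auto simp: free_carrier free_simps)
 have "abelian_group FA"
 proof (rule abelian_groupI)
 fix f assume "f : carrier FA"
 then show "\<exists>g\<in>carrier FA. g +.\<^bsub>FA\<^esub> f = \<zero>\<^bsub>FA\<^esub>"
 by (intro bexI[of _ "(-1) \<odot>\<^bsub>FA\<^esub> f"] free_lin_closed) (auto simp: free_simps)
 qed (simp_all add: free_lin_closed, simp_all add: free_simps algebra_simps z)
 moreover have "monoid FA"
 by (rule monoidI) (auto simp: free_mult_closed free_mult_assoc free_one_mult z)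
 ultimately have "ring FA"
 by (rule ringI) (auto simp: free_simps algebra_simps sum.distrib)
 then show ?thesis
 by (rule calgebra.intro)
 (unfold_locales, auto simp: free_lin_closed, auto simp: free_simps algebra_simps sum_distrib_left)
qed

interpretation FA: calgebra FA by (rule free_calgebra)

lemma mono_closed: "w : lists S ==> mono c w : carrier FA"
 by (auto simp: free_carrier mono_def)

lemma mono_mult: "mono c u **\<^bsub>FA\<^esub> mono d v = mono (c * d) (u @ v)"
proof (rule ext)
 fix w
 have "(mono c u **\<^bsub>FA\<^esub> mono d v) w = (\<Sum>i\<le>length w. (if take i w = u & drop i w = v then c * d else 0))"
 unfolding free_simps mono_def by (intro sum.cong) auto
 also have "... = mono (c * d) (u @ v) w"
 proof (cases "w = u @ v")
 case True
 then have "(\<Sum>i\<le>length w. (if take i w = u & drop i w = v then c * d else 0)) =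
 (\<Sum>i\<in>{length u}. (if take i w = u & drop i w = v then c * d else 0))"
 by (intro sum.mono_neutral_right) (auto dest!: arg_cong[of _ _ length])
 then show ?thesis using True by (simp add: mono_def)
 next
 case False
 then have no: "(take i w = u & drop i w = v) = False" for i by (metis append_take_drop_id)
 have "(\<Sum>i\<le>length w. (if take i w = u & drop i w = v then c * d else 0)) = 0"
 unfolding no by simp
 then show ?thesis using False by (simp add: mono_def)
 qed
 finally show "(mono c u **\<^bsub>FA\<^esub> mono d v) w = mono (c * d) (u @ v) w" .
qed

lemma free_induct [consumes 1, case_names zero step]:
 assumes "f : carrier FA" "P \<zero>\<^bsub>FA\<^esub>"
 "!!w c f. [|w : lists S; f : carrier FA; P f|] ==> P (mono c w +.\<^bsub>FA\<^esub> f)"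
 shows "P f"
proof -
 have "finite W ==> ALL f. {w. f w ~= 0} = W --> f : carrier FA --> P f" for W
 proof (induct set: finite)
 case empty
 have "f = \<zero>\<^bsub>FA\<^esub>" if "{w. f w ~= 0} = {}" for f using that by (auto simp: free_simps fun_eq_iff)
 then show ?case using assms(2) by blast
 next
 case (insert v W)
 show ?case
 proof (intro allI impI)
 fix f assume f: "{w. f w ~= 0} = insert v W" "f : carrier FA"
 define g where "g = f(v := 0)"
 have g: "{w. g w ~= 0} = W" using f(1) insert(2) by (auto simp: g_def)
 then have gc: "g : carrier FA" using insert(1) f by (auto simp: free_carrier)
 have "f = mono (f v) v +.\<^bsub>FA\<^esub> g" by (auto simp: g_def mono_def free_simps)
 moreover have "v : lists S" using f by (auto simp: free_carrier)
 ultimately show "P f" using assms(3)[of v g "f v"] insert(3) g gc by metis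
 qed
 qed
 moreover have "finite {w. f w ~= 0}" using assms(1) by (simp add: free_carrier)
 ultimately show ?thesis using assms(1) by blast
qed

lemma mono_eq_wprod:
 "w : lists S ==> mono c w = c \<odot>\<^bsub>FA\<^esub> FA.wprod (map generator w)"
proof (induct w arbitrary: c)
 case Nil
 then show ?case by (auto simp: mono_def free_simps)
next
 case (Cons g w)
 have "generator g = mono 1 [g]" by (auto simp: generator_def mono_def)
 moreover have "FA.wprod (map generator w) = mono 1 w" using Cons(1)[of 1] Cons(2) by (simp add: free_simps)
 ultimately have "FA.wprod (map generator (g # w)) = mono 1 (g # w)" by (simp add: mono_mult)
 then show ?case by (auto simp: free_simps mono_def)
qed

lemma generator_closed: "g : S ==> generator g : carrier FA"
 by (auto simp: free_carrier generator_def)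

context
 fixes B :: "(complex, 'b) module" and \<gamma> :: "'g => 'b"
 assumes B: "calgebra B" and \<gamma>: "!!g. g : S ==> \<gamma> g : carrier B"
begin

interpretation B: calgebra B by (rule B)

definition free_eval :: "('g list => complex) => 'b" where
 "free_eval f = (\<Oplus>\<^bsub>B\<^esub>w\<in>{w. f w ~= 0}. f w \<odot>\<^bsub>B\<^esub> B.wprod (map \<gamma> w))"

lemma word_closed: "w : lists S ==> B.wprod (map \<gamma> w) : carrier B"
 using \<gamma> by (intro B.wprod_closed) auto

text \<open>Supports shrink when terms cancel, so additivity is checked over a common finite set of
  words containing all the supports involved.\<close>

lemma free_eval_superset:
 assumes "finite W" "{w. f w ~= 0} <= W" "W <= lists S"
 shows "free_eval f = (\<Oplus>\<^bsub>B\<^esub>w\<in>W. f w \<odot>\<^bsub>B\<^esub> B.wprod (map \<gamma> w))"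
proof -
 let ?t = "%w. f w \<odot>\<^bsub>B\<^esub> B.wprod (map \<gamma> w)"
 have fin: "finite {w. f w ~= 0}" using assms finite_subset by blast
 have c: "?t w : carrier B" if "w : W" for w using word_closed[of w] that assms(3) by blast
 have "(\<Oplus>\<^bsub>B\<^esub>w\<in>W. ?t w) = (\<Oplus>\<^bsub>B\<^esub>w\<in>{w. f w ~= 0} \<union> (W - {w. f w ~= 0}). ?t w)"
 using assms(2) by (intro arg_cong[of _ _ "finsum B ?t"]) auto
 also have "... = (\<Oplus>\<^bsub>B\<^esub>w\<in>{w. f w ~= 0}. ?t w) +.\<^bsub>B\<^esub> (\<Oplus>\<^bsub>B\<^esub>w\<in>W - {w. f w ~= 0}. ?t w)"
 by (rule B.finsum_Un_disjoint) (use fin assms c in auto)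
 also have "(\<Oplus>\<^bsub>B\<^esub>w\<in>W - {w. f w ~= 0}. ?t w) = (\<Oplus>\<^bsub>B\<^esub>w\<in>W - {w. f w ~= 0}. \<zero>\<^bsub>B\<^esub>)"
 using word_closed assms(3) by (intro B.finsum_cong') (auto intro!: B.smult_zero_left word_closed)
 also have "(\<Oplus>\<^bsub>B\<^esub>w\<in>{w. f w ~= 0}. ?t w) +.\<^bsub>B\<^esub> ... = (\<Oplus>\<^bsub>B\<^esub>w\<in>{w. f w ~= 0}. ?t w)"
 unfolding B.finsum_zero by (intro B.r_zero B.finsum_closed) (use c assms(2) in auto)
 finally show ?thesis by (simp add: free_eval_def)
qed

lemma free_eval_closed: "f : carrier FA ==> free_eval f : carrier B"
 unfolding free_eval_def using word_closed by (intro B.finsum_closed) (auto simp: free_carrier)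

lemma free_eval_add:
 assumes "f : carrier FA" "g : carrier FA"
 shows "free_eval (f +.\<^bsub>FA\<^esub> g) = free_eval f +.\<^bsub>B\<^esub> free_eval g"
proof -
 define W where "W = {w. f w ~= 0} \<union> {w. g w ~= 0}"
 have W: "finite W" "W <= lists S" using assms by (auto simp: W_def free_carrier)
 have wc: "B.wprod (map \<gamma> w) : carrier B" if "w : W" for w using word_closed that W by blast
 have "free_eval (f +.\<^bsub>FA\<^esub> g) = (\<Oplus>\<^bsub>B\<^esub>w\<in>W. (f +.\<^bsub>FA\<^esub> g) w \<odot>\<^bsub>B\<^esub> B.wprod (map \<gamma> w))"
 by (rule free_eval_superset) (use W in \<open>auto simp: W_def free_simps\<close>)
 also have "... = (\<Oplus>\<^bsub>B\<^esub>w\<in>W. f w \<odot>\<^bsub>B\<^esub> B.wprod (map \<gamma> w) +.\<^bsub>B\<^esub> g w \<odot>\<^bsub>B\<^esub> B.wprod (map \<gamma> w))"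
 using wc by (intro B.finsum_cong') (auto simp: free_simps B.smult_add_left)
 also have "... = (\<Oplus>\<^bsub>B\<^esub>w\<in>W. f w \<odot>\<^bsub>B\<^esub> B.wprod (map \<gamma> w)) +.\<^bsub>B\<^esub> (\<Oplus>\<^bsub>B\<^esub>w\<in>W. g w \<odot>\<^bsub>B\<^esub> B.wprod (map \<gamma> w))"
 using wc by (intro B.finsum_addf) auto
 also have "(\<Oplus>\<^bsub>B\<^esub>w\<in>W. f w \<odot>\<^bsub>B\<^esub> B.wprod (map \<gamma> w)) = free_eval f"
 by (rule free_eval_superset[symmetric]) (use W in \<open>auto simp: W_def\<close>)
 also have "(\<Oplus>\<^bsub>B\<^esub>w\<in>W. g w \<odot>\<^bsub>B\<^esub> B.wprod (map \<gamma> w)) = free_eval g"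
 by (rule free_eval_superset[symmetric]) (use W in \<open>auto simp: W_def\<close>)
 finally show ?thesis .
qed

lemma free_eval_mono: assumes "w : lists S" shows "free_eval (mono c w) = c \<odot>\<^bsub>B\<^esub> B.wprod (map \<gamma> w)"
proof -
 have "free_eval (mono c w) = (\<Oplus>\<^bsub>B\<^esub>v\<in>{w}. mono c w v \<odot>\<^bsub>B\<^esub> B.wprod (map \<gamma> v))"
 by (rule free_eval_superset) (use assms in \<open>auto simp: mono_def\<close>)
 then show ?thesis using word_closed[OF assms] by (simp add: mono_def)
qed

lemma free_eval_zero: "free_eval \<zero>\<^bsub>FA\<^esub> = \<zero>\<^bsub>B\<^esub>"
 by (simp add: free_eval_def free_simps)

lemma free_eval_smult:
 assumes "f : carrier FA" shows "free_eval (c \<odot>\<^bsub>FA\<^esub> f) = c \<odot>\<^bsub>B\<^esub> free_eval f"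
 using assms
proof (induct rule: free_induct)
 case zero show ?case by (simp add: free_eval_zero)
next
 case (step w d f)
 have "c \<odot>\<^bsub>FA\<^esub> (mono d w +.\<^bsub>FA\<^esub> f) = mono (c * d) w +.\<^bsub>FA\<^esub> (c \<odot>\<^bsub>FA\<^esub> f)"
 by (auto simp: free_simps mono_def algebra_simps)
 then show ?case using step word_closed[OF step(1)] free_eval_closed mono_closed
 by (simp add: free_eval_add free_eval_mono B.smult_add_right)
qed

lemma free_eval_hom: "free_eval : algebra_hom FA B"
proof (rule algebra_homI)
 have wapp: "B.wprod (map \<gamma> (u @ v)) = B.wprod (map \<gamma> u) **\<^bsub>B\<^esub> B.wprod (map \<gamma> v)"
 if "u : lists S" "v : lists S" for u v
 unfolding map_append using that \<gamma> by (intro B.wprod_append) auto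
 have 1: "free_eval (mono c w **\<^bsub>FA\<^esub> g) = free_eval (mono c w) **\<^bsub>B\<^esub> free_eval g"
 if w: "w : lists S" and g: "g : carrier FA" for c w g
 using g
 proof (induct rule: free_induct)
 case zero
 then show ?case using w mono_closed free_eval_closed by (simp add: free_eval_zero)
 next
 case (step v d g)
 have m: "mono c w : carrier FA" "mono d v : carrier FA" "mono (c * d) (w @ v) : carrier FA"
 "mono c w **\<^bsub>FA\<^esub> g : carrier FA"
 using w step mono_closed by auto
 have "mono c w **\<^bsub>FA\<^esub> (mono d v +.\<^bsub>FA\<^esub> g) = mono (c * d) (w @ v) +.\<^bsub>FA\<^esub> mono c w **\<^bsub>FA\<^esub> g"
 using m step by (simp add: FA.r_distr mono_mult)
 moreover have "free_eval (mono (c * d) (w @ v)) = free_eval (mono c w) **\<^bsub>B\<^esub> free_eval (mono d v)"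
 using w step(1) word_closed[of w] word_closed[of v] by (simp add: free_eval_mono wapp mult.commute del: map_append)
 ultimately show ?case using m step free_eval_closed by (simp add: free_eval_add B.r_distr)
 qed
 show "free_eval (f **\<^bsub>FA\<^esub> g) = free_eval f **\<^bsub>B\<^esub> free_eval g" if f: "f : carrier FA" and g: "g : carrier FA" for f g
 using f
 proof (induct rule: free_induct)
 case zero
 then show ?case using g free_eval_closed by (simp add: free_eval_zero)
 next
 case (step w c f)
 then show ?case using 1[OF step(1) g, of c] mono_closed[OF step(1), of c] g free_eval_closed
 by (simp add: FA.l_distr free_eval_add B.l_distr)
 qed
 have "\<one>\<^bsub>FA\<^esub> = mono 1 []" by (auto simp: free_simps mono_def)
 then show "free_eval \<one>\<^bsub>FA\<^esub> = \<one>\<^bsub>B\<^esub>" by (simp add: free_eval_mono)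
qed (auto simp: free_eval_closed free_eval_add free_eval_smult)

lemma free_eval_generator: assumes "g : S" shows "free_eval (generator g) = \<gamma> g"
proof -
 have "generator g = mono 1 [g]" by (auto simp: generator_def mono_def)
 then show ?thesis using assms \<gamma> by (simp add: free_eval_mono)
qed

end

end

section \<open>Quotient algebras by two-sided ideals\<close>

lemma (in calgebra) smult_diff_left: "x : carrier A ==> (c - d) \<odot> x = c \<odot> x \<ominus> d \<odot> x"
 using smult_add_left[of x c "- d"] smult_minus_left[of x d] by (simp add: a_minus_def)

text \<open>A scalar multiple is a product with \<open>c \<odot> \<one>\<close>, so an ideal of the
  ring is an ideal of the algebra, and the scalar action descends to the quotient.\<close>

lemma (in calgebra) ideal_smult:
 assumes "ideal I A" "x : I" shows "c \<odot> x : I"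
proof -
 interpret ideal I A by fact
 have "x : carrier A" using assms(2) a_subset by blast
 then show ?thesis using I_l_closed[OF assms(2), of "c \<odot> \<one>"] by simp
qed

context calgebra
begin

context
 fixes I assumes I: "ideal I A"
begin

interpretation I: ideal I A by (rule I)

abbreviation "QA == quotient_algebra A I"

lemma coset_eq_iff:
 "[|x : carrier A; y : carrier A|] ==> I +> x = I +> y \<longleftrightarrow> x \<ominus> y : I"
 using quotient_eq_iff_same_a_r_cos[OF I] by auto

lemma quotient_carrierE:
 assumes "P : carrier QA" obtains x where "x : carrier A" "P = I +> x"
 using assms by (auto simp: quotient_algebra_def FactRing_def A_RCOSETS_def' )

lemma coset_closed: "x : carrier A ==> I +> x : carrier QA"
 by (auto simp: quotient_algebra_def FactRing_def A_RCOSETS_def')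

lemma coset_smult:
 assumes "x : carrier A" shows "c \<odot>\<^bsub>QA\<^esub> (I +> x) = I +> (c \<odot> x)"
proof -
 have "I +> (c \<odot> y) = I +> (c \<odot> x)" if y: "y : I +> x" for y
 proof -
 have yc: "y : carrier A" using y assms I.a_subset a_r_coset_subset_G by blast
 have "I +> y = I +> x" using I.a_repr_independence'[OF y assms] by simp
 then have "y \<ominus> x : I" using coset_eq_iff yc assms by blast
 then have "c \<odot> (y \<ominus> x) : I" by (rule ideal_smult[OF I])
 then show ?thesis using coset_eq_iff yc assms
 by (simp add: a_minus_def smult_add_right smult_minus_right)
 qed
 moreover have "x : I +> x" using I.a_rcos_self[OF assms] .
 ultimately have "(\<Union>y\<in>I +> x. I +> (c \<odot> y)) = I +> (c \<odot> x)" by blast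
 then show ?thesis by (simp add: quotient_algebra_def)
qed

lemma coset_ops:
 "[|x : carrier A; y : carrier A|] ==> (I +> x) **\<^bsub>QA\<^esub> (I +> y) = I +> (x ** y)"
 "[|x : carrier A; y : carrier A|] ==> (I +> x) +.\<^bsub>QA\<^esub> (I +> y) = I +> (x +. y)"
 "\<one>\<^bsub>QA\<^esub> = I +> \<one>"
 using ring_hom_mult[OF I.rcos_ring_hom] ring_hom_add[OF I.rcos_ring_hom] ring_hom_one[OF I.rcos_ring_hom]
 by (simp_all add: quotient_algebra_def)

lemma quotient_calgebra: "calgebra QA"
proof -
 interpret R: ring "A Quot I" by (rule I.quotient_is_ring)
 have "abelian_group QA"
 proof (rule abelian_groupI)
 fix P assume "P : carrier QA"
 then show "\<exists>R\<in>carrier QA. R +.\<^bsub>QA\<^esub> P = \<zero>\<^bsub>QA\<^esub>"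
 using R.l_neg by (auto simp: quotient_algebra_def intro!: bexI[of _ "\<ominus>\<^bsub>A Quot I\<^esub> P"])
 qed (auto simp: quotient_algebra_def R.a_ac)
 moreover have "monoid QA"
 by (rule monoidI) (auto simp: quotient_algebra_def R.m_assoc)
 ultimately have "ring QA"
 by (rule ringI) (auto simp: quotient_algebra_def R.l_distr R.r_distr)
 then show ?thesis
 proof (rule calgebra.intro, intro calgebra_axioms.intro)
 fix P c d assume "P : carrier QA"
 then obtain x where x: "x : carrier A" "P = I +> x" by (rule quotient_carrierE)
 show "c \<odot>\<^bsub>QA\<^esub> P : carrier QA" "(c + d) \<odot>\<^bsub>QA\<^esub> P = c \<odot>\<^bsub>QA\<^esub> P +.\<^bsub>QA\<^esub> d \<odot>\<^bsub>QA\<^esub> P"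
 "(c * d) \<odot>\<^bsub>QA\<^esub> P = c \<odot>\<^bsub>QA\<^esub> (d \<odot>\<^bsub>QA\<^esub> P)" "1 \<odot>\<^bsub>QA\<^esub> P = P"
 using x by (simp_all add: coset_smult coset_ops coset_closed smult_add_left)
 fix R assume "R : carrier QA"
 then obtain y where y: "y : carrier A" "R = I +> y" by (rule quotient_carrierE)
 show "c \<odot>\<^bsub>QA\<^esub> (P +.\<^bsub>QA\<^esub> R) = c \<odot>\<^bsub>QA\<^esub> P +.\<^bsub>QA\<^esub> c \<odot>\<^bsub>QA\<^esub> R" "c \<odot>\<^bsub>QA\<^esub> (P **\<^bsub>QA\<^esub> R) = (c \<odot>\<^bsub>QA\<^esub> P) **\<^bsub>QA\<^esub> R"
 "c \<odot>\<^bsub>QA\<^esub> (P **\<^bsub>QA\<^esub> R) = P **\<^bsub>QA\<^esub> (c \<odot>\<^bsub>QA\<^esub> R)"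
 using x y by (simp_all add: coset_smult coset_ops smult_add_right)
 qed
qed

lemma coset_hom: "(%x. I +> x) : algebra_hom A QA"
 by (rule algebra_homI) (auto simp: coset_closed coset_ops coset_smult)

lemma quotient_lift:
 assumes "phi : algebra_hom A B" "calgebra B" "!!x. x : I ==> phi x = \<zero>\<^bsub>B\<^esub>"
 shows "EX psi. psi : algebra_hom QA B & (\<forall>x\<in>carrier A. psi (I +> x) = phi x)"
proof -
 interpret B: calgebra B by fact
 define psi where "psi P = phi (SOME x. x : P)" for P
 have psi: "psi (I +> x) = phi x" if x: "x : carrier A" for x
 proof -
 define y where "y = (SOME y. y : I +> x)"
 have y: "y : I +> x" unfolding y_def using I.a_rcos_self[OF x] by (rule someI)
 have yc: "y : carrier A" using y x I.a_subset a_r_coset_subset_G by blast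
 have "I +> y = I +> x" using I.a_repr_independence'[OF y x] by simp
 then have "y \<ominus> x : I" using coset_eq_iff yc x by blast
 then have "phi (y \<ominus> x) = \<zero>\<^bsub>B\<^esub>" by (rule assms(3))
 then have "phi y \<ominus>\<^bsub>B\<^esub> phi x = \<zero>\<^bsub>B\<^esub>" using algebra_hom_minus[OF calgebra_axioms assms(2,1) yc x] by simp
 then have "phi y = phi x" using algebra_homD(1)[OF assms(1)] yc x by simp
 then show ?thesis by (simp add: psi_def y_def)
 qed
 have "psi : algebra_hom QA B"
 by (rule algebra_homI)
 (auto elim!: quotient_carrierE simp: coset_ops coset_smult psi algebra_homD[OF assms(1)])
 then show ?thesis using psi by blast
qed

end

lemma genideal_kernel:
 assumes "phi : algebra_hom A B" "calgebra B" "R <= carrier A" "!!r. r : R ==> phi r = \<zero>\<^bsub>B\<^esub>" "x : Idl R"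
 shows "phi x = \<zero>\<^bsub>B\<^esub>"
proof -
 interpret B: calgebra B by fact
 interpret h: ring_hom_ring A B phi
 by (rule ring_hom_ringI2[OF ring_axioms B.ring_axioms]) (use assms(1) in \<open>simp add: algebra_hom_def\<close>)
 have "Idl R <= a_kernel A B phi"
 proof (rule genideal_minimal[OF h.kernel_is_ideal])
 show "R <= a_kernel A B phi" using assms(3,4) unfolding a_kernel_def' by blast
 qed
 then show ?thesis using assms(5) unfolding a_kernel_def' by blast
qed

end

section \<open>The Weyl relations and the Euler operator\<close>

locale weyl_system = calgebra A for A :: "(complex, 'a) module" (structure) +
 fixes n :: nat and x d :: "nat => 'a"
 assumes xc: "i < n ==> x i : carrier A" and dc: "i < n ==> d i : carrier A"
 and dx: "[|i < n; j < n|] ==> d i ** x j \<ominus> x j ** d i = (if i = j then \<one> else \<zero>)"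
 and xx: "[|i < n; j < n|] ==> x i ** x j = x j ** x i"
 and dd: "[|i < n; j < n|] ==> d i ** d j = d j ** d i"
begin

definition gens :: "'a set" where "gens = x ` {..<n} \<union> d ` {..<n}"

lemma gens_closed: "gens <= carrier A"
 using xc dc by (auto simp: gens_def)

lemma xd: "[|i < n; j < n|] ==> x i ** d j \<ominus> d j ** x i = (if i = j then \<ominus> \<one> else \<zero>)"
proof -
 assume ij: "i < n" "j < n"
 have "x i ** d j \<ominus> d j ** x i = \<ominus> (d j ** x i \<ominus> x i ** d j)"
 using xc[OF ij(1)] dc[OF ij(2)] by algebra
 then show ?thesis using dx[OF ij(2,1)] by auto
qed

lemma gens_comm: assumes "g : gens" "h : gens" shows "g ** h \<ominus> h ** g : filt gens 0"
proof -
 note f = filt_zero[OF gens_closed, of 0] filt_one[OF gens_closed, of 0] filt_minus[OF gens_closed, of \<one> 0]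
 consider i j where "i < n" "j < n" "g = x i" "h = x j" | i j where "i < n" "j < n" "g = x i" "h = d j"
 | i j where "i < n" "j < n" "g = d i" "h = x j" | i j where "i < n" "j < n" "g = d i" "h = d j"
 using assms by (auto simp: gens_def)
 then show ?thesis
 proof cases
 case 1 then show ?thesis using xx[of i j] xc f by simp
 next
 case 2 then show ?thesis using xd[of i j] f by simp
 next
 case 3 then show ?thesis using dx[of i j] f by simp
 next
 case 4 then show ?thesis using dd[of i j] dc f by simp
 qed
qed

text \<open>Brackets with \<open>d i\<close> and \<open>x i\<close> act as the partial derivatives
  by \<open>x i\<close> and \<open>d i\<close>. Up to lower terms this is the Euler vector field in
  all generators, which multiplies the leading part of degree \<open>N\<close> by
  \<open>N\<close>.\<close>

definition euler :: "'a => 'a" where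
 "euler w = (\<Oplus>i\<in>{..<n}. x i ** (d i ** w \<ominus> w ** d i) +. (w ** x i \<ominus> x i ** w) ** d i)"

lemma euler_closed [simp]: "w : carrier A ==> euler w : carrier A"
 unfolding euler_def using xc dc by (intro finsum_closed) auto

lemma euler_gen: assumes "g : gens" shows "euler g = g"
proof -
 have gc: "g : carrier A" using assms gens_closed by auto
 consider j where "j < n" "g = x j" | j where "j < n" "g = d j" using assms by (auto simp: gens_def)
 then show ?thesis
 proof cases
 case 1
 have "euler g = (\<Oplus>i\<in>{..<n}. if j = i then x i else \<zero>)"
 unfolding euler_def 1 using 1 xc dc dx xx by (intro finsum_cong') (auto simp: xx[of j])
 also have "... = x j" using finsum_singleton[of j "{..<n}" x] 1 xc by auto
 finally show ?thesis using 1 by simp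
 next
 case 2
 have "euler g = (\<Oplus>i\<in>{..<n}. if j = i then d i else \<zero>)"
 unfolding euler_def 2
 proof (intro finsum_cong' refl)
 fix i assume "i : {..<n}"
 then have i: "i < n" "x i : carrier A" "d i : carrier A" using xc dc by auto
 have "d i ** d j \<ominus> d j ** d i = \<zero>" using dd[OF i(1) 2(1)] i dc[OF 2(1)] by simp
 then show "x i ** (d i ** d j \<ominus> d j ** d i) +. (d j ** x i \<ominus> x i ** d j) ** d i = (if j = i then d i else \<zero>)"
 unfolding dx[OF 2(1) i(1)] using i by simp
 qed (use dc in auto)
 also have "... = d j" using finsum_singleton[of j "{..<n}" d] 2 dc by auto
 finally show ?thesis using 2 by simp
 qed
qed

lemma euler_add: "[|u : carrier A; v : carrier A|] ==> euler (u +. v) = euler u +. euler v"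
proof -
 assume c: "u : carrier A" "v : carrier A"
 have "euler (u +. v) = (\<Oplus>i\<in>{..<n}. (x i ** (d i ** u \<ominus> u ** d i) +. (u ** x i \<ominus> x i ** u) ** d i) +.
 (x i ** (d i ** v \<ominus> v ** d i) +. (v ** x i \<ominus> x i ** v) ** d i))"
 unfolding euler_def
 proof (intro finsum_cong' refl)
 fix i assume "i : {..<n}"
 then have "x i : carrier A" "d i : carrier A" using xc dc by auto
 then show "x i ** (d i ** (u +. v) \<ominus> (u +. v) ** d i) +. ((u +. v) ** x i \<ominus> x i ** (u +. v)) ** d i =
 (x i ** (d i ** u \<ominus> u ** d i) +. (u ** x i \<ominus> x i ** u) ** d i) +.
 (x i ** (d i ** v \<ominus> v ** d i) +. (v ** x i \<ominus> x i ** v) ** d i)"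
 using c by algebra
 qed (use c xc dc in auto)
 also have "... = euler u +. euler v" unfolding euler_def using c xc dc by (intro finsum_addf) auto
 finally show ?thesis .
qed

lemma euler_smult: assumes "u : carrier A" shows "euler (c \<odot> u) = c \<odot> euler u"
proof -
 have "euler (c \<odot> u) = (\<Oplus>i\<in>{..<n}. c \<odot> (x i ** (d i ** u \<ominus> u ** d i) +. (u ** x i \<ominus> x i ** u) ** d i))"
 unfolding euler_def
 proof (intro finsum_cong' refl)
 fix i assume "i : {..<n}"
 then have "x i : carrier A" "d i : carrier A" using xc dc by auto
 moreover have "c \<odot> v \<ominus> c \<odot> w = c \<odot> (v \<ominus> w)" if "v : carrier A" "w : carrier A" for v w
 using that by (simp add: a_minus_def smult_add_right smult_minus_right)
 ultimately show "x i ** (d i ** (c \<odot> u) \<ominus> c \<odot> u ** d i) +. (c \<odot> u ** x i \<ominus> x i ** (c \<odot> u)) ** d i =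
 c \<odot> (x i ** (d i ** u \<ominus> u ** d i) +. (u ** x i \<ominus> x i ** u) ** d i)"
 using assms by (simp add: smult_add_right)
 qed (use assms xc dc in auto)
 also have "... = c \<odot> euler u" unfolding euler_def using assms xc dc by (intro smult_finsum[symmetric]) auto
 finally show ?thesis .
qed

text \<open>The failure of the derivation rule arises equally from moving \<open>x i\<close> past
  \<open>g\<close> and from moving \<open>w\<close> past \<open>d i\<close>, hence the factor 2. The
  bracket of \<open>x i\<close> with \<open>g\<close> is a scalar and the bracket of
  \<open>d i\<close> with \<open>w\<close> has lower degree, so the defect is of lower
  degree.\<close>

lemma euler_mult_gen:
 assumes g: "g : gens" and w: "w : carrier A"
 shows "euler (g ** w) = g ** w +. g ** euler w +. (\<Oplus>i\<in>{..<n}. 2 \<odot> ((x i ** g \<ominus> g ** x i) ** (d i ** w \<ominus> w ** d i)))"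
proof -
 have gc: "g : carrier A" using g gens_closed by auto
 let ?c = "%i. (x i ** g \<ominus> g ** x i) ** (d i ** w \<ominus> w ** d i)"
 have "euler (g ** w) = (\<Oplus>i\<in>{..<n}. (x i ** (d i ** g \<ominus> g ** d i) +. (g ** x i \<ominus> x i ** g) ** d i) ** w +.
 (g ** (x i ** (d i ** w \<ominus> w ** d i) +. (w ** x i \<ominus> x i ** w) ** d i) +. 2 \<odot> ?c i))"
 unfolding euler_def
 proof (intro finsum_cong' refl)
 fix i assume "i : {..<n}"
 then have i: "x i : carrier A" "d i : carrier A" using xc dc by auto
 have "?c i : carrier A" using i gc w by simp
 then have two: "2 \<odot> ?c i = ?c i +. ?c i" using smult_add_left[of "?c i" 1 1] by simp
 define X D where "X = x i" and "D = d i"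
 define a b p q where "a = D ** g \<ominus> g ** D" and "b = D ** w \<ominus> w ** D" and "p = g ** X \<ominus> X ** g" and "q = w ** X \<ominus> X ** w"
 have c: "X : carrier A" "D : carrier A" "a : carrier A" "b : carrier A" "p : carrier A" "q : carrier A"
 using i gc w by (auto simp: X_def D_def a_def b_def p_def q_def)
 have s1: "D ** (g ** w) \<ominus> g ** w ** D = a ** w +. g ** b" unfolding a_def b_def using c(1,2) gc w by algebra
 have s2: "g ** w ** X \<ominus> X ** (g ** w) = g ** q +. p ** w" unfolding p_def q_def using c(1,2) gc w by algebra
 have s3: "X ** (g ** b) = g ** (X ** b) \<ominus> p ** b" unfolding p_def using c(1,4) gc by algebra
 have s4: "p ** (w ** D) = p ** (D ** w) \<ominus> p ** b" unfolding b_def using c(2,5) w by algebra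
 have s5: "(X ** g \<ominus> g ** X) ** b = \<ominus> (p ** b)" unfolding p_def using c(1,4) gc by algebra
 have "X ** (a ** w +. g ** b) +. (g ** q +. p ** w) ** D = X ** a ** w +. X ** (g ** b) +. g ** q ** D +. p ** (w ** D)"
 using c gc w by algebra
 also have "... = (X ** a +. p ** D) ** w +. (g ** (X ** b +. q ** D) +. (\<ominus> (p ** b) +. \<ominus> (p ** b)))"
 unfolding s3 s4 using c gc w by algebra
 finally have fin: "X ** (D ** (g ** w) \<ominus> g ** w ** D) +. (g ** w ** X \<ominus> X ** (g ** w)) ** D =
 (X ** a +. p ** D) ** w +. (g ** (X ** b +. q ** D) +. ((X ** g \<ominus> g ** X) ** b +. (X ** g \<ominus> g ** X) ** b))"
 unfolding s1 s2 s5 .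
 show "x i ** (d i ** (g ** w) \<ominus> g ** w ** d i) +. (g ** w ** x i \<ominus> x i ** (g ** w)) ** d i =
 (x i ** (d i ** g \<ominus> g ** d i) +. (g ** x i \<ominus> x i ** g) ** d i) ** w +.
 (g ** (x i ** (d i ** w \<ominus> w ** d i) +. (w ** x i \<ominus> x i ** w) ** d i) +. 2 \<odot> ?c i)"
 unfolding two using fin unfolding a_def b_def p_def q_def X_def D_def .
 qed (use gc w xc dc in auto)
 also have "... = (\<Oplus>i\<in>{..<n}. (x i ** (d i ** g \<ominus> g ** d i) +. (g ** x i \<ominus> x i ** g) ** d i) ** w) +.
 (\<Oplus>i\<in>{..<n}. g ** (x i ** (d i ** w \<ominus> w ** d i) +. (w ** x i \<ominus> x i ** w) ** d i) +. 2 \<odot> ?c i)"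
 by (rule finsum_addf) (use gc w xc dc in auto)
 also have "(\<Oplus>i\<in>{..<n}. (x i ** (d i ** g \<ominus> g ** d i) +. (g ** x i \<ominus> x i ** g) ** d i) ** w) = euler g ** w"
 unfolding euler_def using gc w xc dc by (intro finsum_ldistr[symmetric]) auto
 also have "(\<Oplus>i\<in>{..<n}. g ** (x i ** (d i ** w \<ominus> w ** d i) +. (w ** x i \<ominus> x i ** w) ** d i) +. 2 \<odot> ?c i) =
 (\<Oplus>i\<in>{..<n}. g ** (x i ** (d i ** w \<ominus> w ** d i) +. (w ** x i \<ominus> x i ** w) ** d i)) +. (\<Oplus>i\<in>{..<n}. 2 \<odot> ?c i)"
 by (rule finsum_addf) (use gc w xc dc in auto)
 also have "(\<Oplus>i\<in>{..<n}. g ** (x i ** (d i ** w \<ominus> w ** d i) +. (w ** x i \<ominus> x i ** w) ** d i)) = g ** euler w"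
 unfolding euler_def using gc w xc dc by (intro finsum_rdistr[symmetric]) auto
 finally show ?thesis using gc w xc dc by (simp add: euler_gen[OF g] a_assoc finsum_closed Pi_def)
qed

lemma filt_finsum:
 "[|finite J; !!j. j : J ==> h j : filt gens N|] ==> (\<Oplus>j\<in>J. h j) : filt gens N"
proof (induct set: finite)
 case empty then show ?case by (simp add: filt_zero[OF gens_closed])
next
 case (insert j J)
 then show ?case using filt_closed[OF gens_closed] by (subst finsum_insert) (auto intro: filt_add[OF gens_closed])
qed

lemma euler_word:
 assumes "set ws <= gens" "ws ~= []"
 shows "euler (wprod ws) \<ominus> of_nat (length ws) \<odot> wprod ws : filt gens (length ws - 1)"
 using assms
proof (induct ws)
 case (Cons g ws)
 note GC = gens_closed
 have g: "g : gens" "g : carrier A" and ws: "set ws <= gens" and wc: "wprod ws : carrier A"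
 using Cons GC by auto
 have xg: "x i : gens" "d i : gens" if "i < n" for i using that by (auto simp: gens_def)
 define r where "r = (\<Oplus>i\<in>{..<n}. 2 \<odot> ((x i ** g \<ominus> g ** x i) ** (d i ** wprod ws \<ominus> wprod ws ** d i)))"
 have r: "r : filt gens (length ws)"
 unfolding r_def
 proof (rule filt_finsum)
 fix i assume "i : {..<n}"
 then have i: "i < n" by simp
 have "(x i ** g \<ominus> g ** x i) ** (d i ** wprod ws \<ominus> wprod ws ** d i) : filt gens (0 + (length ws - 1))"
 using gens_comm xg[OF i] g ws by (intro filt_mult[OF GC] filt_commutator_word[OF GC gens_comm])
 then show "2 \<odot> ((x i ** g \<ominus> g ** x i) ** (d i ** wprod ws \<ominus> wprod ws ** d i)) : filt gens (length ws)"
 using filt_mono[OF GC] by (intro filt_smult[OF GC]) auto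
 qed simp
 have rc: "r : carrier A" using filt_closed[OF GC r] .
 define t where "t = euler (wprod ws) \<ominus> of_nat (length ws) \<odot> wprod ws"
 have tc: "t : carrier A" using wc by (simp add: t_def)
 have t: "g ** t : filt gens (length ws)"
 proof (cases ws)
 case Nil
 have "euler \<one> = \<zero>"
 proof -
 have "euler \<one> = (\<Oplus>i\<in>{..<n}. \<zero>)" unfolding euler_def using xc dc by (intro finsum_cong') auto
 then show ?thesis by simp
 qed
 then show ?thesis using Nil g filt_zero[OF GC] by (simp add: t_def)
 next
 case (Cons a list)
 then show ?thesis using filt_gen_mult[OF GC g(1) Cons.hyps[OF ws]] by (simp add: t_def)
 qed
 have "euler (wprod ws) = of_nat (length ws) \<odot> wprod ws +. t"
 using wc t_def by (intro eq_of_minus[symmetric, THEN sym]) auto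
 then have "euler (wprod (g # ws)) = g ** wprod ws +. g ** (of_nat (length ws) \<odot> wprod ws +. t) +. r"
 using euler_mult_gen[OF g(1) wc] by (simp add: r_def)
 also have "... = of_nat (length (g # ws)) \<odot> wprod (g # ws) +. (g ** t +. r)"
 using g wc tc rc by (simp add: smult_add_left r_distr a_ac)
 finally have "euler (wprod (g # ws)) \<ominus> of_nat (length (g # ws)) \<odot> wprod (g # ws) =
 (of_nat (length (g # ws)) \<odot> wprod (g # ws) +. (g ** t +. r)) \<ominus> of_nat (length (g # ws)) \<odot> wprod (g # ws)" by simp
 also have "... = g ** t +. r"
 proof -
 have "of_nat (length (g # ws)) \<odot> wprod (g # ws) : carrier A" "g ** t +. r : carrier A" using g wc tc rc by auto
 then show ?thesis by algebra
 qed
 finally show ?case using filt_add[OF GC t r] by simp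
qed simp

text \<open>On words of length exactly \<open>Suc N\<close> this is \<open>euler_word\<close>;
  everything shorter already lies in degree \<open>N\<close>.\<close>

lemma euler_filt:
 assumes "u : filt gens (Suc N)" shows "euler u \<ominus> of_nat (Suc N) \<odot> u : filt gens N"
 using assms
proof (induct rule: filt_induct[OF gens_closed, consumes 1, case_names zero step])
 case zero
 then show ?case using euler_smult[of \<zero> 0] filt_zero[OF gens_closed] by simp
next
 case (step ws u c)
 note GC = gens_closed
 have cl: "wprod ws : carrier A" "u : carrier A" using step GC filt_closed[OF GC] by auto
 have w: "euler (wprod ws) \<ominus> of_nat (Suc N) \<odot> wprod ws : filt gens N"
 proof (cases "ws = []")
 case True
 have "euler \<one> = (\<Oplus>i\<in>{..<n}. \<zero>)" unfolding euler_def using xc dc by (intro finsum_cong') auto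
 then show ?thesis using True filt_one[OF GC, of N] filt_smult[OF GC, of \<one> N]
 by (simp add: filt_diff[OF GC] filt_zero[OF GC])
 next
 case False
 have e: "euler (wprod ws) \<ominus> of_nat (length ws) \<odot> wprod ws : filt gens N"
 using filt_mono[OF GC euler_word[OF step(1) False], of N] step(2) by simp
 \<comment> \<open>Replacing the actual length by \<open>Suc N\<close> costs nothing for words of
   that length, and only an element of degree \<open>N\<close> for shorter words.\<close>
 have "(of_nat (length ws) - of_nat (Suc N)) \<odot> wprod ws : filt gens N"
 proof (cases "length ws = Suc N")
 case True then show ?thesis using cl filt_zero[OF GC] by simp
 next
 case False then show ?thesis using filt_smult[OF GC filt_word[OF GC step(1)], of N] step(2) by simp
 qed
 with e have "(euler (wprod ws) \<ominus> of_nat (length ws) \<odot> wprod ws) +. (of_nat (length ws) - of_nat (Suc N)) \<odot> wprod ws : filt gens N"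
 by (rule filt_add[OF GC])
 also have "(euler (wprod ws) \<ominus> of_nat (length ws) \<odot> wprod ws) +. (of_nat (length ws) - of_nat (Suc N)) \<odot> wprod ws =
 euler (wprod ws) \<ominus> of_nat (Suc N) \<odot> wprod ws"
 proof -
 note smult_diff_left[OF cl(1), of "of_nat (length ws)" "of_nat (Suc N)"]
 moreover have "of_nat (length ws) \<odot> wprod ws : carrier A" "of_nat (Suc N) \<odot> wprod ws : carrier A" "euler (wprod ws) : carrier A"
 using cl by auto
 moreover have "(e \<ominus> l) +. (l \<ominus> r) = e \<ominus> r" if "e : carrier A" "l : carrier A" "r : carrier A" for e l r
 using that by algebra
 ultimately show ?thesis by simp
 qed
 finally show ?thesis .
 qed
 have "euler (c \<odot> wprod ws +. u) \<ominus> of_nat (Suc N) \<odot> (c \<odot> wprod ws +. u) =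
 c \<odot> (euler (wprod ws) \<ominus> of_nat (Suc N) \<odot> wprod ws) +. (euler u \<ominus> of_nat (Suc N) \<odot> u)"
 using cl by (simp add: euler_add euler_smult a_minus_def smult_add_right smult_minus_right minus_add mult.commute a_ac)
 then show ?case using filt_add[OF GC filt_smult[OF GC w] step(4)] by simp
qed

text \<open>Simplicity of the Weyl algebra, by descent along the filtration with the Euler operator.\<close>

lemma weyl_hom_injective:
 assumes B: "calgebra B" "\<one>\<^bsub>B\<^esub> ~= \<zero>\<^bsub>B\<^esub>" and h: "h : algebra_hom A B"
 shows "[|u : filt gens N; h u = \<zero>\<^bsub>B\<^esub>|] ==> u = \<zero>"
proof (induct N arbitrary: u)
 case 0
 have "words gens 0 = {\<one>}" by (auto simp: words_def)
 then have "u : lspan {\<one>}" using 0 by (simp add: filt_def)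
 then obtain c where "u = (\<Oplus>s\<in>{\<one>}. c s \<odot> s)" using lspan_finiteE[of u "{\<one>}"] by auto
 then have c: "u = c \<one> \<odot> \<one>" by simp
 interpret B: calgebra B by (rule B)
 have "c \<one> \<odot>\<^bsub>B\<^esub> \<one>\<^bsub>B\<^esub> = \<zero>\<^bsub>B\<^esub>" using 0 c algebra_homD[OF h] by simp
 then have "c \<one> = 0" using B.smult_eq_zero[of "\<one>\<^bsub>B\<^esub>" "c \<one>"] B(2) by auto
 then show ?case using c by simp
next
 case (Suc N)
 interpret B: calgebra B by (rule B)
 note GC = gens_closed
 note H = algebra_homD[OF h] algebra_hom_minus[OF calgebra_axioms B(1) h] algebra_hom_zero[OF calgebra_axioms B(1) h]
 have uc: "u : carrier A" using Suc filt_closed[OF GC] by blast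
 have cm: "g ** u \<ominus> u ** g = \<zero>" if g: "g : gens" for g
 proof (rule Suc(1))
 have "g ** u \<ominus> u ** g : filt gens (Suc N - 1)"
 by (rule filt_commutator[OF GC]) (assumption | rule gens_comm g Suc(2))+
 then show "g ** u \<ominus> u ** g : filt gens N" by (simp only: diff_Suc_1)
 have gA: "g : carrier A" using g GC by auto
 have "h (g ** u \<ominus> u ** g) = h g **\<^bsub>B\<^esub> h u \<ominus>\<^bsub>B\<^esub> h u **\<^bsub>B\<^esub> h g"
 by (simp only: H(6)[OF m_closed[OF gA uc] m_closed[OF uc gA]] H(2)[OF gA uc] H(2)[OF uc gA])
 also have "... = \<zero>\<^bsub>B\<^esub>" unfolding Suc(3) using H(1)[OF gA] by simp
 finally show "h (g ** u \<ominus> u ** g) = \<zero>\<^bsub>B\<^esub>" .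
 qed
 \<comment> \<open>Commutators of \<open>u\<close> with generators lie one degree lower and in the
   kernel, so they vanish by induction, and the Euler operator kills \<open>u\<close>. As it acts on
   \<open>u\<close> as multiplication by \<open>Suc N\<close> modulo degree \<open>N\<close>, the
   element itself has degree \<open>N\<close>.\<close>
 have "euler u = (\<Oplus>i\<in>{..<n}. \<zero>)"
 unfolding euler_def
 proof (intro finsum_cong' refl)
 fix i assume "i : {..<n}"
 then have i: "x i : gens" "d i : gens" "x i : carrier A" "d i : carrier A" using xc dc by (auto simp: gens_def)
 have "x i ** u = u ** x i" using cm[OF i(1)] i uc by simp
 then show "x i ** (d i ** u \<ominus> u ** d i) +. (u ** x i \<ominus> x i ** u) ** d i = \<zero>" using cm[OF i(2)] i uc by simp
 qed auto
 then have "\<zero> \<ominus> of_nat (Suc N) \<odot> u : filt gens N" using euler_filt[OF Suc(2)] by simp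
 then have "of_nat (Suc N) \<odot> u : filt gens N"
 using filt_minus[OF GC, of "\<zero> \<ominus> of_nat (Suc N) \<odot> u"] uc by (simp add: a_minus_def)
 then have "of_nat (Suc N) \<odot> u = \<zero>" by (rule Suc(1)) (use H uc Suc in simp)
 then show ?case using smult_eq_zero[OF uc] by (metis Suc_neq_Zero of_nat_eq_0_iff)
qed

text \<open>Zero divisors are excluded by the injective homomorphism into the division algebra, and
  the Ore condition follows from the polynomial growth given by ordered monomials.\<close>

lemma weyl_ore_domain:
 assumes gen: "!!u. u : carrier A ==> EX N. u : filt gens N"
 and B: "division_algebra B" and h: "h : algebra_hom A B"
 shows "ore_domain A"
proof -
 interpret B: division_algebra B by (rule B)
 note H = algebra_homD[OF h]
 have inj: "u = \<zero>" if "u : carrier A" "h u = \<zero>\<^bsub>B\<^esub>" for u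
 using weyl_hom_injective[OF B.calgebra_axioms B.one_neq_zero h] gen that by blast
 note GC = gens_closed
 have fin: "finite gens" by (simp add: gens_def)
 show ?thesis
 proof (rule ore_domain_of_growth[where W = "filt gens" and e = "card gens"])
 show "\<one> ~= \<zero>" using H(4) algebra_hom_zero[OF calgebra_axioms B.calgebra_axioms h] B.one_neq_zero by metis
 show "u = \<zero> \<or> v = \<zero>" if "u : carrier A" "v : carrier A" "u ** v = \<zero>" for u v
 proof -
 have "h u **\<^bsub>B\<^esub> h v = \<zero>\<^bsub>B\<^esub>"
 using that H(2)[of u v] algebra_hom_zero[OF calgebra_axioms B.calgebra_axioms h] by simp
 then show ?thesis using B.no_zero_div[of "h u" "h v"] H(1) inj that by blast
 qed
 fix N and J :: "bool list set" and v
 assume J: "finite J" "(2 * N + 1) ^ card gens < card J" "!!j. j : J ==> v j : filt gens N"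
 obtain S where S: "finite S" "S <= filt gens N" "card S <= (N + 1) ^ card gens" "filt gens N <= lspan S"
 using filt_finite_span[OF GC gens_comm fin, of N] by auto
 have "(N + 1) ^ card gens <= (2 * N + 1) ^ card gens" by (intro power_mono) auto
 then have "card S < card J" using S J by linarith
 moreover have "S <= carrier A" using S filt_closed[OF GC] by blast
 ultimately show "EX f. (\<exists>j\<in>J. f j ~= 0) & (\<Oplus>j\<in>J. f j \<odot> v j) = \<zero>"
 using S J by (intro linear_dependence[of S J v]) auto
 qed (use gen filt_closed[OF GC] filt_mono[OF GC] filt_one[OF GC] filt_mult[OF GC] in auto)
qed

end

section \<open>The Weyl algebra and its skew field of fractions\<close>

context
 fixes n :: nat
begin

abbreviation "WF == free_algebra (weyl_gens n)"
abbreviation "WI == genideal WF (weyl_relations n)"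
abbreviation "WA == weyl_algebra n"

interpretation WF: calgebra WF by (rule free_calgebra)

lemma weyl_gens_iff: "Var i : weyl_gens n \<longleftrightarrow> i < n" "Der i : weyl_gens n \<longleftrightarrow> i < n"
 by (auto simp: weyl_gens_def)

lemma weyl_gen_closed:
 "i < n ==> generator (Var i) : carrier WF" "i < n ==> generator (Der i) : carrier WF"
 by (auto intro!: generator_closed simp: weyl_gens_iff)

lemma weyl_relations_closed: "weyl_relations n <= carrier WF"
 using weyl_gen_closed by (auto simp: weyl_relations_def Let_def)

lemma weyl_ideal: "ideal WI WF"
 by (rule WF.genideal_ideal[OF weyl_relations_closed])

lemma weyl_algebra_eq: "WA = quotient_algebra WF WI"
 by (simp add: weyl_algebra_def Let_def)

lemma weyl_calgebra: "calgebra WA"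
 unfolding weyl_algebra_eq by (rule WF.quotient_calgebra[OF weyl_ideal])

definition wx :: "nat => (weyl_gen list => complex) set" where "wx i = WI +>\<^bsub>WF\<^esub> generator (Var i)"
definition wd :: "nat => (weyl_gen list => complex) set" where "wd i = WI +>\<^bsub>WF\<^esub> generator (Der i)"

interpretation WA: calgebra WA by (rule weyl_calgebra)

lemma weyl_coset_hom: "(%f. WI +>\<^bsub>WF\<^esub> f) : algebra_hom WF WA"
 unfolding weyl_algebra_eq by (rule WF.coset_hom[OF weyl_ideal])

lemma weyl_coset_zero:
 assumes "r : weyl_relations n" shows "WI +>\<^bsub>WF\<^esub> r = \<zero>\<^bsub>WA\<^esub>"
proof -
 have rc: "r : carrier WF" using assms weyl_relations_closed by blast
 have "r : WI" using WF.genideal_self[OF weyl_relations_closed] assms by blast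
 then have "WI +>\<^bsub>WF\<^esub> r = WI +>\<^bsub>WF\<^esub> \<zero>\<^bsub>WF\<^esub>"
 using WF.coset_eq_iff[OF weyl_ideal rc WF.zero_closed] rc by (simp add: a_minus_def)
 then show ?thesis using algebra_hom_zero[OF WF.calgebra_axioms WA.calgebra_axioms weyl_coset_hom] by simp
qed

lemma weyl_system: "weyl_system WA n wx wd"
proof (intro weyl_system.intro weyl_calgebra weyl_system_axioms.intro)
 note H = algebra_homD[OF weyl_coset_hom] algebra_hom_minus[OF WF.calgebra_axioms WA.calgebra_axioms weyl_coset_hom]
 algebra_hom_zero[OF WF.calgebra_axioms WA.calgebra_axioms weyl_coset_hom]
 note G = weyl_gen_closed
 show c: "wx i : carrier WA" "wd i : carrier WA" if "i < n" for i
 using that H(1) G by (auto simp: wx_def wd_def)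
 fix i j assume ij: "i < n" "j < n"
 define b where "b = (if i = j then \<one>\<^bsub>WF\<^esub> else \<zero>\<^bsub>WF\<^esub>)"
 have bc: "b : carrier WF" by (simp add: b_def)
 have "(generator (Der i) **\<^bsub>WF\<^esub> generator (Var j) \<ominus>\<^bsub>WF\<^esub> generator (Var j) **\<^bsub>WF\<^esub> generator (Der i)) \<ominus>\<^bsub>WF\<^esub> b : weyl_relations n"
 unfolding weyl_relations_def Let_def b_def using ij by blast
 from weyl_coset_zero[OF this] have "(wd i **\<^bsub>WA\<^esub> wx j \<ominus>\<^bsub>WA\<^esub> wx j **\<^bsub>WA\<^esub> wd i) \<ominus>\<^bsub>WA\<^esub> (WI +>\<^bsub>WF\<^esub> b) = \<zero>\<^bsub>WA\<^esub>"
 using ij G bc H by (simp add: wx_def wd_def)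
 then have "wd i **\<^bsub>WA\<^esub> wx j \<ominus>\<^bsub>WA\<^esub> wx j **\<^bsub>WA\<^esub> wd i = (WI +>\<^bsub>WF\<^esub> b)"
 using c ij H(1)[OF bc] by simp
 then show "wd i **\<^bsub>WA\<^esub> wx j \<ominus>\<^bsub>WA\<^esub> wx j **\<^bsub>WA\<^esub> wd i = (if i = j then \<one>\<^bsub>WA\<^esub> else \<zero>\<^bsub>WA\<^esub>)"
 using H by (auto simp: b_def)
 have "generator (Var i) **\<^bsub>WF\<^esub> generator (Var j) \<ominus>\<^bsub>WF\<^esub> generator (Var j) **\<^bsub>WF\<^esub> generator (Var i) : weyl_relations n"
 unfolding weyl_relations_def Let_def using ij by blast
 from weyl_coset_zero[OF this] have "wx i **\<^bsub>WA\<^esub> wx j \<ominus>\<^bsub>WA\<^esub> wx j **\<^bsub>WA\<^esub> wx i = \<zero>\<^bsub>WA\<^esub>"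
 using ij G H by (simp add: wx_def)
 then show "wx i **\<^bsub>WA\<^esub> wx j = wx j **\<^bsub>WA\<^esub> wx i" using c ij by simp
 have "generator (Der i) **\<^bsub>WF\<^esub> generator (Der j) \<ominus>\<^bsub>WF\<^esub> generator (Der j) **\<^bsub>WF\<^esub> generator (Der i) : weyl_relations n"
 unfolding weyl_relations_def Let_def using ij by blast
 from weyl_coset_zero[OF this] have "wd i **\<^bsub>WA\<^esub> wd j \<ominus>\<^bsub>WA\<^esub> wd j **\<^bsub>WA\<^esub> wd i = \<zero>\<^bsub>WA\<^esub>"
 using ij G H by (simp add: wd_def)
 then show "wd i **\<^bsub>WA\<^esub> wd j = wd j **\<^bsub>WA\<^esub> wd i" using c ij by simp
qed

interpretation W: weyl_system WA n wx wd by (rule weyl_system)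

lemma weyl_carrier_induct [consumes 1, case_names zero step]:
 assumes "u : carrier WA" "P \<zero>\<^bsub>WA\<^esub>"
 "!!ws c u. [|set ws <= W.gens; u : carrier WA; P u|] ==> P (c \<odot>\<^bsub>WA\<^esub> WA.wprod ws +.\<^bsub>WA\<^esub> u)"
 shows "P u"
proof -
 note H = algebra_homD[OF weyl_coset_hom]
 obtain f where f: "f : carrier WF" "u = WI +>\<^bsub>WF\<^esub> f"
 using assms(1) WF.quotient_carrierE[OF weyl_ideal] unfolding weyl_algebra_eq by metis
 have "P (WI +>\<^bsub>WF\<^esub> f)" using f(1)
 proof (induct rule: free_induct)
 case zero
 then show ?case using assms(2) algebra_hom_zero[OF WF.calgebra_axioms WA.calgebra_axioms weyl_coset_hom] by simp
 next
 case (step w c f)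
 have cw: "WI +>\<^bsub>WF\<^esub> WF.wprod (map generator v) = WA.wprod (map (%g. WI +>\<^bsub>WF\<^esub> generator g) v)"
 if "v : lists (weyl_gens n)" for v
 using that
 proof (induct v)
 case Nil then show ?case using H by simp
 next
 case (Cons g v)
 then have "generator g : carrier WF" "WF.wprod (map generator v) : carrier WF"
 by (auto intro!: generator_closed WF.wprod_closed)
 then show ?case using Cons H by simp
 qed
 have wc: "WF.wprod (map generator w) : carrier WF" using step(1) by (auto intro!: generator_closed WF.wprod_closed)
 have "WI +>\<^bsub>WF\<^esub> (mono c w +.\<^bsub>WF\<^esub> f) = c \<odot>\<^bsub>WA\<^esub> WA.wprod (map (%g. WI +>\<^bsub>WF\<^esub> generator g) w) +.\<^bsub>WA\<^esub> (WI +>\<^bsub>WF\<^esub> f)"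
 unfolding mono_eq_wprod[OF step(1)] using H wc step(2) cw[OF step(1)] by simp
 moreover have "set (map (%g. WI +>\<^bsub>WF\<^esub> generator g) w) <= W.gens"
 using step(1) by (auto simp: W.gens_def weyl_gens_def wx_def wd_def in_lists_conv_set)
 ultimately show ?case using assms(3)[OF _ H(1)[OF step(2)] step(3)] by simp
 qed
 then show ?thesis using f by simp
qed

lemma weyl_carrier_filt: assumes "u : carrier WA" shows "EX N. u : WA.filt W.gens N"
 using assms
proof (induct rule: weyl_carrier_induct)
 case zero
 then show ?case using WA.filt_zero[OF W.gens_closed] by blast
next
 case (step ws c u)
 then obtain N where N: "u : WA.filt W.gens N" by blast
 have "c \<odot>\<^bsub>WA\<^esub> WA.wprod ws +.\<^bsub>WA\<^esub> u : WA.filt W.gens (max N (length ws))"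
 using step WA.filt_mono[OF W.gens_closed N]
 by (intro WA.filt_add[OF W.gens_closed] WA.filt_smult[OF W.gens_closed] WA.filt_word[OF W.gens_closed]) auto
 then show ?case by blast
qed

lemma weyl_universal:
 assumes B: "calgebra B" and y: "!!i. i < n ==> y i : carrier B" and e: "!!i. i < n ==> e i : carrier B"
 and ey: "!!i j. [|i < n; j < n|] ==> e i **\<^bsub>B\<^esub> y j \<ominus>\<^bsub>B\<^esub> y j **\<^bsub>B\<^esub> e i = (if i = j then \<one>\<^bsub>B\<^esub> else \<zero>\<^bsub>B\<^esub>)"
 and yy: "!!i j. [|i < n; j < n|] ==> y i **\<^bsub>B\<^esub> y j = y j **\<^bsub>B\<^esub> y i"
 and ee: "!!i j. [|i < n; j < n|] ==> e i **\<^bsub>B\<^esub> e j = e j **\<^bsub>B\<^esub> e i"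
 shows "EX phi. phi : algebra_hom WA B & (\<forall>i<n. phi (wx i) = y i & phi (wd i) = e i)"
proof -
 interpret B: calgebra B by (rule B)
 define \<gamma> where "\<gamma> g = (case g of Var i => y i | Der i => e i)" for g
 have \<gamma>: "\<gamma> g : carrier B" if "g : weyl_gens n" for g using that y e by (auto simp: weyl_gens_def \<gamma>_def)
 define phi where "phi = free_eval B \<gamma>"
 have h: "phi : algebra_hom WF B" unfolding phi_def by (rule free_eval_hom[OF B \<gamma>])
 have gen: "phi (generator g) = \<gamma> g" if "g : weyl_gens n" for g
 unfolding phi_def using free_eval_generator[OF B \<gamma> that] .
 note H = algebra_homD[OF h] algebra_hom_minus[OF WF.calgebra_axioms B h] algebra_hom_zero[OF WF.calgebra_axioms B h]
 have g: "phi (generator (Var i)) = y i" "phi (generator (Der i)) = e i" if "i < n" for i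
 using gen that by (auto simp: weyl_gens_iff \<gamma>_def)
 have "phi r = \<zero>\<^bsub>B\<^esub>" if "r : weyl_relations n" for r
 proof -
 have b: "phi (if i = j then \<one>\<^bsub>WF\<^esub> else \<zero>\<^bsub>WF\<^esub>) = (if i = j then \<one>\<^bsub>B\<^esub> else \<zero>\<^bsub>B\<^esub>)"
 "(if i = j then \<one>\<^bsub>WF\<^esub> else \<zero>\<^bsub>WF\<^esub>) : carrier WF" for i j :: nat
 using H by auto
 consider i j where "i < n" "j < n"
 "r = (generator (Der i) **\<^bsub>WF\<^esub> generator (Var j) \<ominus>\<^bsub>WF\<^esub> generator (Var j) **\<^bsub>WF\<^esub> generator (Der i)) \<ominus>\<^bsub>WF\<^esub> (if i = j then \<one>\<^bsub>WF\<^esub> else \<zero>\<^bsub>WF\<^esub>)"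
 | i j where "i < n" "j < n" "r = generator (Var i) **\<^bsub>WF\<^esub> generator (Var j) \<ominus>\<^bsub>WF\<^esub> generator (Var j) **\<^bsub>WF\<^esub> generator (Var i)"
 | i j where "i < n" "j < n" "r = generator (Der i) **\<^bsub>WF\<^esub> generator (Der j) \<ominus>\<^bsub>WF\<^esub> generator (Der j) **\<^bsub>WF\<^esub> generator (Der i)"
 using \<open>r : weyl_relations n\<close> unfolding weyl_relations_def Let_def by blast
 then show ?thesis
 proof cases
 case 1
 then have "phi r = (e i **\<^bsub>B\<^esub> y j \<ominus>\<^bsub>B\<^esub> y j **\<^bsub>B\<^esub> e i) \<ominus>\<^bsub>B\<^esub> (if i = j then \<one>\<^bsub>B\<^esub> else \<zero>\<^bsub>B\<^esub>)"
 using H(1,2,3,6) weyl_gen_closed b g by simp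
 then show ?thesis using ey[OF 1(1,2)] by simp
 next
 case 2
 then have "phi r = y i **\<^bsub>B\<^esub> y j \<ominus>\<^bsub>B\<^esub> y j **\<^bsub>B\<^esub> y i" using H(1,2,3,6) weyl_gen_closed g by simp
 then show ?thesis using yy[OF 2(1,2)] y 2 by simp
 next
 case 3
 then have "phi r = e i **\<^bsub>B\<^esub> e j \<ominus>\<^bsub>B\<^esub> e j **\<^bsub>B\<^esub> e i" using H(1,2,3,6) weyl_gen_closed g by simp
 then show ?thesis using ee[OF 3(1,2)] e 3 by simp
 qed
 qed
 then have "phi u = \<zero>\<^bsub>B\<^esub>" if "u : WI" for u
 using WF.genideal_kernel[OF h B weyl_relations_closed _ that] by blast
 then obtain psi where "psi : algebra_hom WA B" "\<forall>u\<in>carrier WF. psi (WI +>\<^bsub>WF\<^esub> u) = phi u"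
 using WF.quotient_lift[OF weyl_ideal h B] unfolding weyl_algebra_eq by blast
 then show ?thesis using g weyl_gen_closed by (intro exI[of _ psi]) (auto simp: wx_def wd_def)
qed

text \<open>
 The field generated by elements of a division algebra satisfying the Weyl relations is a copy
 of the Weyl field.
\<close>

lemma weyl_field_embedding:
 assumes B: "division_algebra B" and y: "!!i. i < n ==> y i : carrier B" and e: "!!i. i < n ==> e i : carrier B"
 and ey: "!!i j. [|i < n; j < n|] ==> e i **\<^bsub>B\<^esub> y j \<ominus>\<^bsub>B\<^esub> y j **\<^bsub>B\<^esub> e i = (if i = j then \<one>\<^bsub>B\<^esub> else \<zero>\<^bsub>B\<^esub>)"
 and yy: "!!i j. [|i < n; j < n|] ==> y i **\<^bsub>B\<^esub> y j = y j **\<^bsub>B\<^esub> y i"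
 and ee: "!!i j. [|i < n; j < n|] ==> e i **\<^bsub>B\<^esub> e j = e j **\<^bsub>B\<^esub> e i"
 shows "EX Phi. Phi : algebra_hom (weyl_field n) B & inj_on Phi (carrier (weyl_field n)) & division_algebra (weyl_field n) &
 (\<forall>i<n. y i : Phi ` carrier (weyl_field n) & e i : Phi ` carrier (weyl_field n)) &
 (ALL T. ring.div_subring B T & (ALL c. \<forall>t\<in>T. c \<odot>\<^bsub>B\<^esub> t : T) & (\<forall>i<n. y i : T & e i : T) --> Phi ` carrier (weyl_field n) <= T)"
proof -
 interpret B: division_algebra B by (rule B)
 obtain phi where phi: "phi : algebra_hom WA B" "\<forall>i<n. phi (wx i) = y i & phi (wd i) = e i"
 using weyl_universal[OF B.calgebra_axioms y e ey yy ee] by blast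
 interpret O: ore_domain WA using W.weyl_ore_domain[OF weyl_carrier_filt B phi(1)] .
 have inj: "u = \<zero>\<^bsub>WA\<^esub>" if "u : carrier WA" "phi u = \<zero>\<^bsub>B\<^esub>" for u
 using W.weyl_hom_injective[OF B.calgebra_axioms B.one_neq_zero phi(1)] weyl_carrier_filt that by blast
 have Feq: "weyl_field n = frac_algebra WA" by (simp add: weyl_field_def)
 define Phi where "Phi = frac_lift phi B"
 have Phi: "Phi : algebra_hom (frac_algebra WA) B" unfolding Phi_def by (rule O.frac_lift_hom[OF B phi(1) inj])
 have emb: "Phi (O.frac_embed u) = phi u" if "u : carrier WA" for u
 unfolding Phi_def by (rule O.frac_lift_embed[OF B phi(1) inj that])
 have "inj_on Phi (carrier (frac_algebra WA))"
 by (rule algebra_hom_inj_on[OF O.frac_calgebra B.calgebra_axioms Phi])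
 (use O.frac_lift_eq_zero[OF B phi(1) inj] in \<open>auto simp: Phi_def\<close>)
 moreover have "y i : Phi ` carrier (frac_algebra WA)" "e i : Phi ` carrier (frac_algebra WA)" if "i < n" for i
 using emb[OF W.xc[OF that]] emb[OF W.dc[OF that]] phi(2) that W.xc W.dc algebra_homD(1)[OF O.frac_embed_hom]
 by (metis image_eqI)+
 \<comment> \<open>The image is the smallest skew subfield with scalars that contains the given
   elements. This lets a property of the whole image be verified on \<open>y i\<close> and
   \<open>e i\<close> only.\<close>
 moreover have "Phi ` carrier (frac_algebra WA) <= T"
 if T: "B.div_subring T" "ALL c. \<forall>t\<in>T. c \<odot>\<^bsub>B\<^esub> t : T" "\<forall>i<n. y i : T & e i : T" for T
 proof -
 have ops: "a +.\<^bsub>B\<^esub> b : T" "a **\<^bsub>B\<^esub> b : T" if "a : T" "b : T" for a b using T that by (auto simp: B.div_subring_def)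
 have inv: "inv\<^bsub>B\<^esub> a : T" if a: "a : T" "a ~= \<zero>\<^bsub>B\<^esub>" for a
 proof -
 obtain b where b: "b : T" "a **\<^bsub>B\<^esub> b = \<one>\<^bsub>B\<^esub>" "b **\<^bsub>B\<^esub> a = \<one>\<^bsub>B\<^esub>" using T a by (auto simp: B.div_subring_def)
 then have "inv\<^bsub>B\<^esub> a = b" using T a by (intro B.inv_char) (auto simp: B.div_subring_def)
 then show ?thesis using b by simp
 qed
 have phiT: "phi u : T" if "u : carrier WA" for u
 using that
 proof (induct rule: weyl_carrier_induct)
 case zero
 then show ?case using algebra_hom_zero[OF WA.calgebra_axioms B.calgebra_axioms phi(1)] T by (simp add: B.div_subring_def)
 next
 case (step ws c u)
 have "phi (WA.wprod ws) : T" using step(1)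
 proof (induct ws)
 case Nil
 then show ?case using algebra_homD(4)[OF phi(1)] T by (simp add: B.div_subring_def)
 next
 case (Cons g ws)
 then have "set (g # ws) <= carrier WA" using W.gens_closed by blast
 moreover have "phi g : T" using Cons phi(2) T(3) by (auto simp: W.gens_def)
 ultimately have "phi g : T" "g : carrier WA" "WA.wprod ws : carrier WA" by auto
 then show ?case using Cons algebra_homD(2)[OF phi(1)] by (auto intro: ops)
 qed
 moreover have "WA.wprod ws : carrier WA" using step W.gens_closed by (auto intro!: WA.wprod_closed)
 ultimately show ?case using step T(2) algebra_homD[OF phi(1)] by (auto intro!: ops)
 qed
 show ?thesis
 proof
 fix t assume "t : Phi ` carrier (frac_algebra WA)"
 then obtain P where P: "P : carrier (frac_algebra WA)" "t = Phi P" by blast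
 obtain a s where as: "a : carrier WA" "s : carrier WA - {\<zero>\<^bsub>WA\<^esub>}" "P = frac_class WA a s"
 using P by (elim O.frac_carrierE)
 have "t = phi a **\<^bsub>B\<^esub> inv\<^bsub>B\<^esub> (phi s)"
 unfolding P Phi_def as using as by (intro O.frac_lift_class[OF B phi(1) inj]) auto
 moreover have "phi s ~= \<zero>\<^bsub>B\<^esub>" using inj as by blast
 ultimately show "t : T" using phiT as ops inv by auto
 qed
 qed
 ultimately show ?thesis unfolding Feq using Phi O.frac_division_algebra by (intro exI[of _ Phi]) blast
qed

end

section \<open>Centralizers, fixed points and images as skew subfields\<close>

context division_algebra
begin

lemma commute_inv:
 assumes "x : carrier A" "y : carrier A" "x ~= \<zero>" "x ** y = y ** x" shows "inv x ** y = y ** inv x"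
proof -
 have "inv x ** y = inv x ** (y ** x) ** inv x" using assms(1-3) by (simp add: m_assoc)
 also have "y ** x = x ** y" using assms by simp
 also have "inv x ** (x ** y) ** inv x = y ** inv x" using assms(1-3) by simp
 finally show ?thesis .
qed

lemma div_subring_inv:
 assumes "div_subring T" "a : T" "a ~= \<zero>" shows "inv a : T"
proof -
 obtain b where b: "b : T" "a ** b = \<one>" "b ** a = \<one>" using assms by (auto simp: div_subring_def)
 then have "inv a = b" using assms by (intro inv_char) (auto simp: div_subring_def)
 then show ?thesis using b by simp
qed

lemma div_subringI:
 assumes "T <= carrier A" "\<one> : T" "!!x y. [|x : T; y : T|] ==> x +. y : T" "!!x y. [|x : T; y : T|] ==> x ** y : T"
 "!!c x. x : T ==> c \<odot> x : T" "!!x. [|x : T; x ~= \<zero>|] ==> inv x : T"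
 shows "div_subring T"
proof -
 have "0 \<odot> \<one> : T" using assms by blast
 then have "\<zero> : T" by simp
 moreover have "\<ominus> x : T" if "x : T" for x
 proof -
 have "\<ominus> x = (- 1) \<odot> x" using that assms(1) smult_minus_left[of x 1] by auto
 then show ?thesis using assms(5)[OF that] by simp
 qed
 moreover have "\<exists>y\<in>T. x ** y = \<one> & y ** x = \<one>" if "x : T" "x ~= \<zero>" for x
 using that assms(1,6) by (intro bexI[of _ "inv x"]) auto
 ultimately show ?thesis unfolding div_subring_def using assms(1-4) by simp
qed

text \<open>Commuting with the generators of a skew subfield extends to the whole of it, because the
  centralizer of an element is closed under inverses and contains the scalars.\<close>

lemma centralizer_div_subring:
 assumes e: "e : carrier A"
 shows "div_subring {q : carrier A. q ** e = e ** q}" "ALL c. \<forall>q\<in>{q : carrier A. q ** e = e ** q}. c \<odot> q : {q : carrier A. q ** e = e ** q}"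
proof -
 define C where "C = {q : carrier A. q ** e = e ** q}"
 have CI: "q : C" if "q : carrier A" "q ** e = e ** q" for q using that by (simp add: C_def)
 have CD: "q : carrier A" "q ** e = e ** q" if "q : C" for q using that by (simp_all add: C_def)
 have sm: "c \<odot> q : C" if "q : C" for c q
 proof (rule CI)
 show "(c \<odot> q) ** e = e ** (c \<odot> q)" using arg_cong[OF CD(2)[OF that], of "%x. c \<odot> x"] CD(1)[OF that] e by (simp only: mult_smult_left mult_smult_right)
 qed (use CD(1)[OF that] in simp)
 then show "ALL c. \<forall>q\<in>{q : carrier A. q ** e = e ** q}. c \<odot> q : {q : carrier A. q ** e = e ** q}" unfolding C_def[symmetric] by blast
 have "div_subring C"
 proof (rule div_subringI)
 show "C <= carrier A" "\<one> : C" using CD(1) e by (auto intro: CI)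
 fix x assume x: "x : C"
 note cx = CD[OF x]
 show "c \<odot> x : C" for c by (rule sm[OF x])
 show "inv x : C" if "x ~= \<zero>" by (rule CI) (rule inv_closed'[OF cx(1) that] commute_inv[OF cx(1) e that cx(2)])+
 fix y assume y: "y : C"
 note cy = CD[OF y]
 have "(x +. y) ** e = x ** e +. y ** e" by (rule l_distr[OF cx(1) cy(1) e])
 also have "... = e ** (x +. y)" unfolding cx(2) cy(2) by (rule r_distr[OF cx(1) cy(1) e, symmetric])
 finally show "x +. y : C" using cx(1) cy(1) by (intro CI) auto
 have "x ** y ** e = x ** (y ** e)" by (rule m_assoc[OF cx(1) cy(1) e])
 also have "... = x ** e ** y" unfolding cy(2) by (rule m_assoc[OF cx(1) e cy(1), symmetric])
 also have "... = e ** (x ** y)" unfolding cx(2) by (rule m_assoc[OF e cx(1) cy(1)])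
 finally show "x ** y : C" using cx(1) cy(1) by (intro CI) auto
 qed
 then show "div_subring {q : carrier A. q ** e = e ** q}" unfolding C_def .
qed

end

lemma fixed_points_div_subring:
 assumes B: "division_algebra B" and h: "h : algebra_hom B B"
 shows "ring.div_subring B {q : carrier B. h q = q}" "ALL c. \<forall>q\<in>{q : carrier B. h q = q}. c \<odot>\<^bsub>B\<^esub> q : {q : carrier B. h q = q}"
proof -
 interpret B: division_algebra B by (rule B)
 note H = algebra_homD[OF h]
 show "ALL c. \<forall>q\<in>{q : carrier B. h q = q}. c \<odot>\<^bsub>B\<^esub> q : {q : carrier B. h q = q}" using H by auto
 show "B.div_subring {q : carrier B. h q = q}"
 by (rule B.div_subringI) (use H algebra_hom_inv(2)[OF B.calgebra_axioms B.calgebra_axioms h B B] in auto)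
qed

lemma image_div_subring:
 assumes A: "division_algebra A" and B: "division_algebra B" and h: "h : algebra_hom A B"
 shows "ring.div_subring B (h ` carrier A)" "ALL c. \<forall>q\<in>h ` carrier A. c \<odot>\<^bsub>B\<^esub> q : h ` carrier A"
proof -
 interpret A: division_algebra A by (rule A)
 interpret B: division_algebra B by (rule B)
 note H = algebra_homD[OF h]
 have z: "h \<zero>\<^bsub>A\<^esub> = \<zero>\<^bsub>B\<^esub>" by (rule algebra_hom_zero[OF A.calgebra_axioms B.calgebra_axioms h])
 show sm: "ALL c. \<forall>q\<in>h ` carrier A. c \<odot>\<^bsub>B\<^esub> q : h ` carrier A"
 using H(5) A.smult_closed by (metis (no_types, lifting) image_iff)
 show "B.div_subring (h ` carrier A)"
 proof (rule B.div_subringI)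
 fix p q assume "p : h ` carrier A" "q : h ` carrier A"
 then obtain a b where ab: "a : carrier A" "b : carrier A" "p = h a" "q = h b" by blast
 show "p +.\<^bsub>B\<^esub> q : h ` carrier A" "p **\<^bsub>B\<^esub> q : h ` carrier A"
 unfolding ab H(2)[OF ab(1,2), symmetric] H(3)[OF ab(1,2), symmetric] using ab by auto
 next
 fix p assume p: "p : h ` carrier A" "p ~= \<zero>\<^bsub>B\<^esub>"
 then obtain a where a: "a : carrier A" "p = h a" "a ~= \<zero>\<^bsub>A\<^esub>" using z by blast
 then show "inv\<^bsub>B\<^esub> p : h ` carrier A"
 using algebra_hom_inv(2)[OF A.calgebra_axioms B.calgebra_axioms h A B a(1,3)] A.inv_closed' by (metis image_eqI)
 next
 show "h ` carrier A <= carrier B" using H(1) by blast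
 show "\<one>\<^bsub>B\<^esub> : h ` carrier A" using H(4) A.one_closed by (metis imageI)
 show "c \<odot>\<^bsub>B\<^esub> p : h ` carrier A" if "p : h ` carrier A" for c p using sm that by blast
 qed
qed

section \<open>Rational coordinates and partial derivatives in Frac D(A)\<close>

text \<open>The fractions of \<open>u i\<close> by \<open>w\<close> are rational coordinates of the
  quotient, and \<open>pd i\<close> is the partial derivative by the \<open>i\<close>-th one times a
  common denominator \<open>f\<close>; \<open>pd_u\<close> is the quotient rule without fractions.
  \<open>generation_all\<close> expresses that the coordinates generate the field of invariants,
  avoiding this field: each skew subfield that contains them contains the invariants.\<close>

locale rational_galois = galois_coordinates A G m al be s for A :: "(complex, 'a) module" (structure) and G m al be s +
 fixes n :: nat and u :: "nat => 'a" and w f :: 'a and pd :: "nat => 'a => 'a"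
 assumes D_ore: "ore_domain (diffop_algebra A)"
 and u_fixed: "i < n ==> u i : fixed" and w_fixed: "w : fixed" and w_nz: "w ~= \<zero>"
 and f_fixed: "f : fixed" and f_nz: "f ~= \<zero>"
 and pd_closed: "[|i < n; a : fixed|] ==> pd i a : fixed"
 and pd_add: "[|i < n; a : fixed; b : fixed|] ==> pd i (a +. b) = pd i a +. pd i b"
 and pd_smult: "[|i < n; a : fixed|] ==> pd i (c \<odot> a) = c \<odot> pd i a"
 and pd_mult: "[|i < n; a : fixed; b : fixed|] ==> pd i (a ** b) = a ** pd i b +. b ** pd i a"
 and pd_u: "[|i < n; j < n|] ==> w ** pd i (u j) \<ominus> u j ** pd i w = (if i = j then (w ** w) ** f else \<zero>)"
 and generation_all: "a0 : fixed ==> ALL (Q :: (complex, (('a => 'a) \<times> ('a => 'a)) set) module) J T.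
 division_algebra Q & J : algebra_hom A Q & (\<forall>a\<in>carrier A. J a = \<zero>\<^bsub>Q\<^esub> --> a = \<zero>) & ring.div_subring Q T &
 (ALL k. \<forall>t\<in>T. k \<odot>\<^bsub>Q\<^esub> t : T) & (\<forall>i<n. J (u i) **\<^bsub>Q\<^esub> inv\<^bsub>Q\<^esub> (J w) : T) --> J a0 : T"
begin

lemma generation:
 fixes Q :: "(complex, (('a => 'a) \<times> ('a => 'a)) set) module"
 assumes "a0 : fixed" "division_algebra Q" "J : algebra_hom A Q" "!!a. [|a : carrier A; J a = \<zero>\<^bsub>Q\<^esub>|] ==> a = \<zero>"
 "ring.div_subring Q T" "ALL k. \<forall>t\<in>T. k \<odot>\<^bsub>Q\<^esub> t : T" "\<forall>i<n. J (u i) **\<^bsub>Q\<^esub> inv\<^bsub>Q\<^esub> (J w) : T"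
 shows "J a0 : T"
proof (rule mp[OF spec[OF spec[OF spec[OF generation_all[OF assms(1)], of Q], of J], of T]])
 show "division_algebra Q & J : algebra_hom A Q & (\<forall>a\<in>carrier A. J a = \<zero>\<^bsub>Q\<^esub> --> a = \<zero>) & ring.div_subring Q T &
 (ALL k. \<forall>t\<in>T. k \<odot>\<^bsub>Q\<^esub> t : T) & (\<forall>i<n. J (u i) **\<^bsub>Q\<^esub> inv\<^bsub>Q\<^esub> (J w) : T)"
 using assms(4) by (intro conjI assms(2,3,5-7) ballI impI)
qed

abbreviation "QQ == frac_algebra D"

sublocale D: ore_domain D
 by (rule D_ore)

sublocale Q: division_algebra QQ
 by (rule D.frac_division_algebra)

abbreviation qmult (infixl "\<cdot>" 70) where "x \<cdot> y == x **\<^bsub>QQ\<^esub> y"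
abbreviation qadd (infixl "+++" 65) where "x +++ y == x +.\<^bsub>QQ\<^esub> y"
abbreviation qminus (infixl "---" 65) where "x --- y == x \<ominus>\<^bsub>QQ\<^esub> y"
abbreviation qsmult (infixl "*." 70) where "c *. x == c \<odot>\<^bsub>QQ\<^esub> x"
abbreviation qpow (infixr "^^^" 75) where "x ^^^ (t::nat) == x [^]\<^bsub>QQ\<^esub> t"
abbreviation "zQ == \<zero>\<^bsub>QQ\<^esub>"
abbreviation "oneQ == \<one>\<^bsub>QQ\<^esub>"
abbreviation "invQ x == inv\<^bsub>QQ\<^esub> x"

abbreviation E where "E == D.frac_embed"

definition J where "J a = E (mu a)"
definition p where "p i = dd1 (pd i)"
text \<open>On invariants \<open>p i\<close> is the multiple of \<open>pd i\<close> by the square of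
  \<open>s\<close>, and \<open>pd i\<close> sends its own coordinate to \<open>f\<close>. Thus
  \<open>g\<close> is the value of \<open>p i\<close> on that coordinate, and division by
  \<open>g\<close> in \<open>dl\<close> normalizes it to 1.\<close>

definition g where "g = (s ** s) ** f"
definition y where "y i = J (u i) \<cdot> invQ (J w)"
definition dl where "dl i = invQ (J g) \<cdot> E (p i)"

lemmas E_simps = algebra_homD[OF D.frac_embed_hom]

lemma E_diff: "[|d : carrier D; e : carrier D|] ==> E (d \<ominus>\<^bsub>D\<^esub> e) = E d --- E e"
 by (rule algebra_hom_minus[OF D.calgebra_axioms Q.calgebra_axioms D.frac_embed_hom])

lemma J_hom: "J : algebra_hom A QQ"
 unfolding J_def[abs_def] by (rule algebra_hom_compose[OF mult_operator_hom D.frac_embed_hom])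

lemmas J_simps = algebra_homD[OF J_hom]

lemma J_closed [simp, intro]: "a : carrier A ==> J a : carrier QQ"
 by (rule J_simps)

lemma E_closed [simp, intro]: "d : carrier D ==> E d : carrier QQ"
 by (rule E_simps)

lemma J_eq_zero: "[|a : carrier A; J a = zQ|] ==> a = \<zero>"
 unfolding J_def using D.frac_embed_eq_zero mult_operator_eq_zero mult_operator_closed by blast

lemma J_zero: "J \<zero> = zQ"
 by (rule algebra_hom_zero[OF calgebra_axioms Q.calgebra_axioms J_hom])

lemma J_comm: "[|a : carrier A; b : carrier A|] ==> J a \<cdot> J b = J b \<cdot> J a"
 using J_simps(2) m_comm by metis

lemma J_nz: "[|a : carrier A; a ~= \<zero>|] ==> J a ~= zQ"
 using J_eq_zero by blast

lemma uc: "i < n ==> u i : carrier A" and wc: "w : carrier A" and gc: "g : carrier A" and g_nz: "g ~= \<zero>"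
 and g_fixed: "g : fixed"
proof -
 show "i < n ==> u i : carrier A" "w : carrier A" using u_fixed w_fixed fixedD(1) by auto
 have fc: "f : carrier A" using f_fixed fixedD by blast
 then show "g : carrier A" by (simp add: g_def)
 have "s ** s ~= \<zero>" using no_zero_divisors[OF sc sc] s_nz by blast
 then show "g ~= \<zero>" unfolding g_def using no_zero_divisors[OF _ fc, of "s ** s"] f_nz by auto
 show "g : fixed" unfolding g_def using fixed_ops(2) s_fixed f_fixed by blast
qed

lemma inv_J [simp]: "[|a : carrier A; a ~= \<zero>|] ==> invQ (J a) : carrier QQ"
 using J_nz by auto

lemma inv_J_comm: "[|a : carrier A; a ~= \<zero>; b : carrier A|] ==> invQ (J a) \<cdot> J b = J b \<cdot> invQ (J a)"
 by (rule Q.commute_inv) (auto simp: J_nz J_comm)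

lemma y_closed [simp, intro]: "i < n ==> y i : carrier QQ"
 unfolding y_def using uc wc w_nz by auto

lemma y_w: "i < n ==> y i \<cdot> J w = J (u i)"
 unfolding y_def using uc wc w_nz J_nz by simp

lemma p_diffop: "i < n ==> p i : diffops A 1"
 unfolding p_def by (rule dd1_diffop) (auto intro: pd_closed pd_add pd_smult pd_mult)

lemma p_closed [simp, intro]: "i < n ==> p i : carrier D"
 by (rule D_carrierI[OF p_diffop])

lemma p_apply_closed: "[|i < n; a : carrier A|] ==> p i a : carrier A"
 by auto

lemma p_fixed: "[|i < n; c : fixed|] ==> p i c = (s ** s) ** pd i c"
 unfolding p_def by (rule dd1_fixed) (auto intro: pd_closed pd_add pd_smult pd_mult)

lemma p_one: "i < n ==> p i \<one> = \<zero>"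
 unfolding p_def by (rule dd1_one) (auto intro: pd_closed pd_add pd_smult pd_mult)

lemma p_brk: "[|i < n; b : carrier A|] ==> brk (p i) b = mu (p i b)"
 unfolding p_def by (rule dd1_brk) (auto intro: pd_closed pd_add pd_smult pd_mult)

lemma p_equivariant: "[|i < n; sig : G|] ==> diffop_action A sig (p i) = p i"
 unfolding p_def by (rule dd1_equivariant) (auto intro: pd_closed pd_add pd_smult pd_mult)

lemma E_commutator:
 "[|d : carrier D; b : carrier A|] ==> Q.ad (J b) (E d) = E (brk d b)"
 unfolding Q.ad_def J_def by (simp add: brk_commutator E_diff E_simps)

lemma ad_p: "[|i < n; b : carrier A|] ==> Q.ad (J b) (E (p i)) = J (p i b)"
 using E_commutator[OF p_closed] p_brk by (simp add: J_def)

lemma J_y_comm: "[|i < n; a : carrier A|] ==> J a \<cdot> y i = y i \<cdot> J a"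
proof -
 assume i: "i < n" "a : carrier A"
 note c = uc[OF i(1)] wc w_nz i(2)
 have "J a \<cdot> y i = J (u i) \<cdot> (J a \<cdot> invQ (J w))"
 unfolding y_def using c J_comm[of a "u i"] by (simp add: Q.m_assoc[symmetric])
 also have "... = y i \<cdot> J a" unfolding y_def using c inv_J_comm[of w a] by (simp add: Q.m_assoc)
 finally show ?thesis .
qed

lemma y_comm: "[|i < n; j < n|] ==> y i \<cdot> y j = y j \<cdot> y i"
proof -
 assume ij: "i < n" "j < n"
 have 1: "invQ (J w) \<cdot> y j = y j \<cdot> invQ (J w)"
 by (rule Q.commute_inv) (use ij wc w_nz J_nz J_y_comm in auto)
 have c: "J (u i) : carrier QQ" "invQ (J w) : carrier QQ" "y j : carrier QQ" using uc wc w_nz ij by auto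
 have "y i \<cdot> y j = J (u i) \<cdot> (y j \<cdot> invQ (J w))"
 unfolding y_def[of i] 1[symmetric] using c by (simp add: Q.m_assoc)
 also have "... = y j \<cdot> y i" unfolding y_def[of i] using c J_y_comm[OF ij(2) uc[OF ij(1)]] by (simp add: Q.m_assoc[symmetric])
 finally show ?thesis .
qed

lemma fixed_in_div_subring:
 assumes "Q.div_subring T" "ALL k. \<forall>t\<in>T. k *. t : T" "!!i. i < n ==> y i : T" "c : fixed"
 shows "J c : T"
 using generation[OF assms(4) Q.division_algebra_axioms J_hom J_eq_zero assms(1,2)] assms(3) by (simp add: y_def)

text \<open>The centralizer of \<open>e\<close> is a skew subfield containing the coordinates, hence
  by the generation property all invariants.\<close>

lemma commutes_with_y_imp_fixed:
 assumes e: "e : carrier QQ" "!!i. i < n ==> y i \<cdot> e = e \<cdot> y i" and c: "c : fixed"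
 shows "J c \<cdot> e = e \<cdot> J c"
 using fixed_in_div_subring[OF Q.centralizer_div_subring[OF e(1)] _ c] e(2) by auto

text \<open>The centralizer of the coordinate functions consists of functions.\<close>

lemma commutes_with_y:
 assumes d: "d : carrier D" "!!i. i < n ==> y i \<cdot> E d = E d \<cdot> y i"
 shows "d = mu (d \<one>)"
proof -
 obtain r where r: "d : diffops A r" using d D_carrierE by blast
 have "d (c ** a) = c ** d a" if c: "c : fixed" and a: "a : carrier A" for c a
 proof -
 have cc: "c : carrier A" using c fixedD by blast
 have "E (mu c **\<^bsub>D\<^esub> d) = E (d **\<^bsub>D\<^esub> mu c)"
 using commutes_with_y_imp_fixed[OF E_closed[OF d(1)] d(2) c] d cc by (simp add: J_def E_simps)
 then have "mu c **\<^bsub>D\<^esub> d = d **\<^bsub>D\<^esub> mu c"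
 using D.frac_embed_inj d cc by (auto dest: inj_onD)
 then have "(mu c **\<^bsub>D\<^esub> d) a = (d **\<^bsub>D\<^esub> mu c) a" by simp
 then show ?thesis using a d cc by simp
 qed
 then show ?thesis using commutes_with_fixed[OF r] by blast
qed

lemma dl_closed [simp, intro]: "i < n ==> dl i : carrier QQ"
 unfolding dl_def using gc g_nz by auto

lemma ad_dl_J: "[|i < n; a : carrier A|] ==> Q.ad (J a) (dl i) = invQ (J g) \<cdot> J (p i a)"
proof -
 assume i: "i < n" "a : carrier A"
 have "Q.ad (J a) (invQ (J g)) = zQ" using inv_J_comm[OF gc g_nz i(2)] i gc g_nz by (simp add: Q.ad_eq_zero_iff)
 then show ?thesis unfolding dl_def using i gc g_nz ad_p[OF i] p_apply_closed[OF i] by (simp add: Q.ad_mult)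
qed

text \<open>The quotient rule is obtained from \<open>y j \<cdot> J w = J (u j)\<close>: the Leibniz
  rule is applied to the product, and multiplication by another \<open>J w\<close> leads to the
  relation \<open>pd_u\<close>.\<close>

lemma ad_y_dl:
 assumes ij: "i < n" "j < n"
 shows "Q.ad (y j) (dl i) = (if i = j then oneQ else zQ)"
proof -
 let ?P = "E (p i)" and ?Y = "y j" and ?W = "J w"
 note c = uc[OF ij(2)] wc w_nz
 have cl: "?P : carrier QQ" "?Y : carrier QQ" "?W : carrier QQ" "?W ~= zQ" using ij c J_nz by auto
 define Z where "Z = Q.ad ?Y ?P"
 have Zc: "Z : carrier QQ" using cl by (simp add: Z_def)
 have pdc: "pd i (u j) : carrier A" "pd i w : carrier A" using ij pd_closed u_fixed w_fixed fixedD(1) by auto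
 have "Q.ad (J (u j)) ?P = Z \<cdot> ?W +++ ?Y \<cdot> Q.ad ?W ?P"
 unfolding y_w[OF ij(2), symmetric] Z_def Q.ad_def using cl(1-3) by algebra
 then have "J (p i (u j)) = Z \<cdot> ?W +++ ?Y \<cdot> J (p i w)"
 using ad_p[OF ij(1)] c by simp
 then have "J (p i (u j)) \<cdot> ?W = Z \<cdot> ?W \<cdot> ?W +++ ?Y \<cdot> J (p i w) \<cdot> ?W"
 using Zc cl p_apply_closed[OF ij(1) wc] by (simp add: Q.l_distr)
 also have "?Y \<cdot> J (p i w) \<cdot> ?W = J (u j ** p i w)"
 using cl c p_apply_closed[OF ij(1) wc] J_comm[OF p_apply_closed[OF ij(1) wc] wc] y_w[OF ij(2)]
 by (simp add: Q.m_assoc J_simps) (simp add: Q.m_assoc[symmetric])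
 finally have e1: "J (p i (u j) ** w) = Z \<cdot> (?W \<cdot> ?W) +++ J (u j ** p i w)"
 using c p_apply_closed[OF ij(1)] Zc cl by (simp add: J_simps Q.m_assoc)
 have e2: "p i (u j) ** w = u j ** p i w +. (if i = j then g ** (w ** w) else \<zero>)"
 proof -
 have "p i (u j) ** w = (s ** s) ** (w ** pd i (u j))" "u j ** p i w = (s ** s) ** (u j ** pd i w)"
 using p_fixed[OF ij(1) u_fixed[OF ij(2)]] p_fixed[OF ij(1) w_fixed] pdc c sc by (simp_all add: m_ac)
 moreover have "w ** pd i (u j) = u j ** pd i w +. (if i = j then (w ** w) ** f else \<zero>)"
 by (rule eq_of_minus[OF pd_u[OF ij]]) (use c pdc in auto)
 ultimately show ?thesis using c pdc sc f_fixed fixedD(1)[OF f_fixed]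
 by (auto simp: r_distr g_def m_ac)
 qed
 have cc: "J (u j ** p i w) : carrier QQ" "Z \<cdot> (?W \<cdot> ?W) : carrier QQ" using Zc cl c p_apply_closed[OF ij(1)] by auto
 have "Z \<cdot> (?W \<cdot> ?W) +++ J (u j ** p i w) = (if i = j then J g else zQ) \<cdot> (?W \<cdot> ?W) +++ J (u j ** p i w)"
 proof -
 have "Z \<cdot> (?W \<cdot> ?W) +++ J (u j ** p i w) = J (u j ** p i w +. (if i = j then g ** (w ** w) else \<zero>))"
 unfolding e1[symmetric] e2 ..
 also have "... = J (u j ** p i w) +++ J (if i = j then g ** (w ** w) else \<zero>)"
 using c gc p_apply_closed[OF ij(1)] by (intro J_simps(3)) auto
 also have "J (if i = j then g ** (w ** w) else \<zero>) = (if i = j then J g else zQ) \<cdot> (?W \<cdot> ?W)"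
 using c gc cl by (simp add: J_simps J_zero)
 finally show ?thesis using cc gc cl by (simp add: Q.a_comm)
 qed
 then have "Z \<cdot> (?W \<cdot> ?W) = (if i = j then J g else zQ) \<cdot> (?W \<cdot> ?W)"
 using cc gc cl Q.add.right_cancel by auto
 then have Z: "Z = (if i = j then J g else zQ)"
 using Q.mult_right_cancel[of "?W \<cdot> ?W" Z "if i = j then J g else zQ"] cl Zc gc Q.mult_nonzero by auto
 have "Q.ad ?Y (invQ (J g)) = zQ"
 using Q.commute_inv[of "J g" ?Y] J_y_comm[OF ij(2) gc] gc g_nz J_nz cl by (simp add: Q.ad_eq_zero_iff)
 then have "Q.ad ?Y (dl i) = invQ (J g) \<cdot> Z"
 unfolding dl_def Z_def using cl gc g_nz by (simp add: Q.ad_mult)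
 then show ?thesis unfolding Z using gc g_nz J_nz by simp
qed

text \<open>The commutator of \<open>dl i\<close> and \<open>dl j\<close> commutes with every
  coordinate, since the commutators of both with the coordinates are scalars. Cleared of
  denominators it is a differential operator, therefore a multiplication; it kills the unit, so it
  is zero.\<close>

lemma dl_comm:
 assumes ij: "i < n" "j < n" shows "dl i \<cdot> dl j = dl j \<cdot> dl i"
proof -
 let ?F = "J g"
 have F: "?F : carrier QQ" "?F ~= zQ" using gc g_nz J_nz by auto
 define cub where "cub = ?F \<cdot> (?F \<cdot> ?F)"
 have cub: "cub : carrier QQ" "cub ~= zQ" using F Q.mult_nonzero by (auto simp: cub_def)
 \<comment> \<open>The cube of \<open>J g\<close> clears the denominators of
   \<open>dl i \<cdot> dl j\<close>. The second term of \<open>q\<close> is the price of moving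
   \<open>E (p i)\<close> past the inner inverse of \<open>J g\<close>.\<close>
 define q where "q i j = mu g **\<^bsub>D\<^esub> (p i **\<^bsub>D\<^esub> p j) \<ominus>\<^bsub>D\<^esub> mu (p i g) **\<^bsub>D\<^esub> p j" for i j
 have qc: "q i j : carrier D" if "i < n" "j < n" for i j using that gc by (simp add: q_def p_apply_closed)
 have q: "cub \<cdot> (dl i \<cdot> dl j) = E (q i j)" if ij: "i < n" "j < n" for i j
 proof -
 define P R h where "P = E (p i)" and "R = E (p j)" and "h = J (p i g)"
 have c: "P : carrier QQ" "R : carrier QQ" "h : carrier QQ" "invQ ?F : carrier QQ"
 using ij gc F p_apply_closed by (auto simp: P_def R_def h_def)
 have PF: "P \<cdot> ?F --- ?F \<cdot> P = h" using ad_p[OF ij(1) gc] by (simp add: Q.ad_def P_def h_def)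
 have FP: "?F \<cdot> P = P \<cdot> ?F --- h" unfolding PF[symmetric] using c(1) F(1) by algebra
 have hF: "h \<cdot> ?F = ?F \<cdot> h" unfolding h_def using J_comm gc p_apply_closed ij by blast
 have "?F \<cdot> P \<cdot> invQ ?F = P --- h \<cdot> invQ ?F"
 unfolding FP using c F by (simp add: a_minus_def Q.l_distr Q.l_minus)
 then have "?F \<cdot> (?F \<cdot> P \<cdot> invQ ?F) = ?F \<cdot> P --- h"
 using c F hF[symmetric] by (simp add: a_minus_def Q.r_distr Q.r_minus Q.m_assoc[symmetric])
 then have "?F \<cdot> (?F \<cdot> P \<cdot> invQ ?F) \<cdot> R = (?F \<cdot> P --- h) \<cdot> R" by simp
 also have "... = ?F \<cdot> (P \<cdot> R) --- h \<cdot> R" using c(1-3) F(1) by algebra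
 also have "... = E (q i j)" unfolding q_def P_def R_def h_def J_def
 using ij gc p_apply_closed by (simp add: E_diff E_simps)
 also have "?F \<cdot> (?F \<cdot> P \<cdot> invQ ?F) \<cdot> R = cub \<cdot> (dl i \<cdot> dl j)"
 unfolding cub_def dl_def P_def[symmetric] R_def[symmetric] using c F by (simp add: Q.m_assoc)
 finally show ?thesis by simp
 qed
 define e where "e = dl i \<cdot> dl j --- dl j \<cdot> dl i"
 have ec: "e : carrier QQ" using ij by (simp add: e_def)
 define d where "d = q i j \<ominus>\<^bsub>D\<^esub> q j i"
 have dc: "d : carrier D" using qc ij by (simp add: d_def)
 have ed: "cub \<cdot> e = E d"
 unfolding e_def d_def using q ij cub qc by (simp add: a_minus_def Q.r_distr Q.r_minus E_diff[unfolded a_minus_def])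
 have "y k \<cdot> E d = E d \<cdot> y k" if k: "k < n" for k
 proof -
 have "Q.ad (y k) e = zQ"
 unfolding e_def using ij k by (auto simp: Q.ad_diff Q.ad_mult ad_y_dl Q.a_comm)
 moreover have "Q.ad (y k) cub = zQ"
 proof -
 have "cub = J (g ** (g ** g))" using gc by (simp add: cub_def J_simps)
 then show ?thesis using J_y_comm[OF k, of "g ** (g ** g)"] gc k by (simp add: Q.ad_eq_zero_iff)
 qed
 ultimately have "Q.ad (y k) (E d) = zQ" unfolding ed[symmetric] using k cub ec by (simp add: Q.ad_mult)
 then show ?thesis using k dc by (simp add: Q.ad_eq_zero_iff)
 qed
 then have "d = mu (d \<one>)" using commutes_with_y[OF dc] by blast
 \<comment> \<open>Both terms of \<open>q i j\<close> end in \<open>p j\<close>, which kills the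
   unit.\<close>
 moreover have "d \<one> = \<zero>"
 proof -
 have "q i j \<one> = \<zero>" if "i < n" "j < n" for i j
 proof -
 have "p i \<zero> = \<zero>" using linear_endos_zero[OF D_linear[OF p_closed[OF that(1)]]] .
 then show ?thesis unfolding q_def using that gc p_apply_closed by (simp add: D_diff_apply p_one)
 qed
 then show ?thesis unfolding d_def using ij qc by (simp add: D_diff_apply)
 qed
 ultimately have "d = \<zero>\<^bsub>D\<^esub>" using algebra_hom_zero[OF calgebra_axioms D.calgebra_axioms mult_operator_hom] by simp
 then have "cub \<cdot> e = zQ" using ed algebra_hom_zero[OF D.calgebra_axioms Q.calgebra_axioms D.frac_embed_hom] by simp
 then have "e = zQ" using Q.no_zero_div[OF cub(1) ec] cub by blast
 then show ?thesis using ij by (simp add: e_def)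
qed

text \<open>The index is shifted by one so that the bottom level consists of zero. Commutators then
  descend all the way to zero, and inductions on the order start trivially.\<close>

definition dset where "dset r = (case r of 0 => {\<zero>\<^bsub>D\<^esub>} | Suc k => diffops A k)"

text \<open>Fractions of operators of order less than \<open>r\<close> whose left denominator is a function.\<close>

definition S where "S r = {q : carrier QQ. \<exists>a\<in>carrier A. a ~= \<zero> & (\<exists>d\<in>dset r. J a \<cdot> q = E d)}"

lemma dset_closed: "d : dset r ==> d : carrier D"
 by (cases r) (auto simp: dset_def intro: D_carrierI)

lemma dset_add: "[|d : dset r; e : dset r|] ==> d +.\<^bsub>D\<^esub> e : dset r"
 by (cases r) (auto simp: dset_def diffops_add)

lemma dset_mult: "[|d : dset r; e : diffops A k|] ==> d **\<^bsub>D\<^esub> e : dset (r + k)"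
 using diffops_mult D_carrierI by (cases r) (auto simp: dset_def zero_diffop split: nat.splits)

lemma dset_mult_left: "[|d : dset r; a : carrier A|] ==> mu a **\<^bsub>D\<^esub> d : dset r"
 using diffops_mult[of "mu a" 0 d] by (cases r) (auto simp: dset_def)

lemma dset_mono: "d : dset r ==> d : dset (Suc r)"
 by (cases r) (auto simp: dset_def zero_diffop[of 0, simplified] diffops_mono_Suc)

lemma dset_brk: "[|d : dset (Suc r); b : carrier A|] ==> brk d b : dset r"
 using brk_diffop[of d r b] by (cases r) (auto simp: dset_def brk_mult_operator)

lemma SI: "[|q : carrier QQ; a : carrier A; a ~= \<zero>; d : dset r; J a \<cdot> q = E d|] ==> q : S r"
 by (auto simp: S_def)

lemma SE:
 assumes "q : S r" obtains a d where "a : carrier A" "a ~= \<zero>" "d : dset r" "J a \<cdot> q = E d" "q : carrier QQ"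
 using assms by (auto simp: S_def)

lemma S_closed: "q : S r ==> q : carrier QQ"
 by (auto simp: S_def)

lemma S_mono: "q : S r ==> q : S (Suc r)"
 using dset_mono by (auto simp: S_def)

lemma S_mono_le: "[|q : S r; r <= k|] ==> q : S k"
 by (induct k) (auto simp: le_Suc_eq S_mono)

lemma S_zero: "q : S 0 \<longleftrightarrow> q = zQ"
proof
 assume "q : S 0"
 then obtain a where "a : carrier A" "a ~= \<zero>" "J a \<cdot> q = E \<zero>\<^bsub>D\<^esub>" "q : carrier QQ"
 by (auto simp: S_def dset_def)
 then show "q = zQ"
 using algebra_hom_zero[OF D.calgebra_axioms Q.calgebra_axioms D.frac_embed_hom] Q.no_zero_div[of "J a" q] J_nz by auto
next
 assume "q = zQ"
 then show "q : S 0"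
 using algebra_hom_zero[OF D.calgebra_axioms Q.calgebra_axioms D.frac_embed_hom]
 by (intro SI[of q \<one> "\<zero>\<^bsub>D\<^esub>"]) (auto simp: dset_def)
qed

lemma S_zero_mem: "zQ : S r"
 using S_mono_le[of "zQ" 0 r] S_zero by simp

lemma S_add: assumes "q : S r" "q' : S r" shows "q +++ q' : S r"
proof -
 obtain a d where a: "a : carrier A" "a ~= \<zero>" "d : dset r" "J a \<cdot> q = E d" "q : carrier QQ" using assms SE by blast
 obtain b e where b: "b : carrier A" "b ~= \<zero>" "e : dset r" "J b \<cdot> q' = E e" "q' : carrier QQ" using assms SE by blast
 have "J (a ** b) \<cdot> (q +++ q') = J b \<cdot> (J a \<cdot> q) +++ J a \<cdot> (J b \<cdot> q')"
 using a(1,5) b(1,5) J_comm[of a b] by (simp add: J_simps Q.r_distr Q.m_assoc[symmetric])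
 also have "... = E (mu b **\<^bsub>D\<^esub> d +.\<^bsub>D\<^esub> mu a **\<^bsub>D\<^esub> e)"
 unfolding a(4) b(4) using a(1) b(1) dset_closed[OF a(3)] dset_closed[OF b(3)] by (simp add: J_def E_simps)
 finally show ?thesis using a b no_zero_divisors[OF a(1) b(1)]
 by (intro SI[of _ "a ** b" "mu b **\<^bsub>D\<^esub> d +.\<^bsub>D\<^esub> mu a **\<^bsub>D\<^esub> e"]) (auto intro: dset_add dset_mult_left)
qed

lemma S_left: assumes "q : S r" "b : carrier A" shows "J b \<cdot> q : S r"
proof -
 obtain a d where a: "a : carrier A" "a ~= \<zero>" "d : dset r" "J a \<cdot> q = E d" "q : carrier QQ" using assms SE by blast
 have "J a \<cdot> (J b \<cdot> q) = J b \<cdot> (J a \<cdot> q)"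
 using a(1,5) assms(2) J_comm[of a b] by (simp add: Q.m_assoc[symmetric])
 also have "... = E (mu b **\<^bsub>D\<^esub> d)" unfolding a(4) using dset_closed[OF a(3)] assms by (simp add: J_def E_simps)
 finally show ?thesis using a assms by (intro SI[of _ a "mu b **\<^bsub>D\<^esub> d"]) (auto intro: dset_mult_left)
qed

lemma S_left_inv: assumes "q : S r" "b : carrier A" "b ~= \<zero>" shows "invQ (J b) \<cdot> q : S r"
proof -
 obtain a d where a: "a : carrier A" "a ~= \<zero>" "d : dset r" "J a \<cdot> q = E d" "q : carrier QQ" using assms SE by blast
 have "J (a ** b) \<cdot> (invQ (J b) \<cdot> q) = E d"
 using a assms J_nz by (simp add: J_simps Q.m_assoc)
 then show ?thesis using a assms no_zero_divisors[of a b] by (intro SI[of _ "a ** b" d]) auto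
qed

lemma S_smult: assumes "q : S r" shows "c *. q : S r"
 using S_left[OF assms, of "c \<odot> \<one>"] S_closed[OF assms] by (simp add: J_simps)

lemma S_minus: "q : S r ==> \<ominus>\<^bsub>QQ\<^esub> q : S r"
 using S_smult[of q r "- 1"] S_closed Q.smult_minus_left[of q 1] by auto

lemma S_diff: "[|q : S r; q' : S r|] ==> q --- q' : S r"
 by (simp add: a_minus_def S_add S_minus)

lemma S_E: "d : dset r ==> E d : S r"
 using dset_closed by (intro SI[of _ \<one> d]) (auto simp: J_simps)

lemma S_mult_E: assumes "q : S r" "e : diffops A k" shows "q \<cdot> E e : S (r + k)"
proof -
 obtain a d where a: "a : carrier A" "a ~= \<zero>" "d : dset r" "J a \<cdot> q = E d" "q : carrier QQ" using assms SE by blast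
 have ec: "e : carrier D" using assms D_carrierI by blast
 have "J a \<cdot> (q \<cdot> E e) = E (d **\<^bsub>D\<^esub> e)"
 using a ec dset_closed[OF a(3)] by (simp add: Q.m_assoc[symmetric] E_simps)
 then show ?thesis using a ec dset_mult[OF a(3) assms(2)] by (intro SI[of _ a "d **\<^bsub>D\<^esub> e"]) auto
qed

lemma ad_J_S: assumes "q : S (Suc r)" "b : carrier A" shows "Q.ad (J b) q : S r"
proof -
 obtain a d where a: "a : carrier A" "a ~= \<zero>" "d : dset (Suc r)" "J a \<cdot> q = E d" "q : carrier QQ" using assms SE by blast
 have dc: "d : carrier D" using dset_closed a by blast
 have "Q.ad (J b) (J a) = zQ" using J_comm assms a by (simp add: Q.ad_eq_zero_iff)
 then have "J a \<cdot> Q.ad (J b) q = Q.ad (J b) (J a \<cdot> q)" using a(1,5) assms(2) by (simp add: Q.ad_mult)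
 also have "... = E (brk d b)" unfolding a(4) by (rule E_commutator[OF dc assms(2)])
 finally show ?thesis using a assms dset_brk[OF a(3) assms(2)] by (intro SI[of _ a "brk d b"]) auto
qed

lemma mult_inv_right:
 assumes "q : carrier QQ" "b : carrier A" "b ~= \<zero>"
 shows "q \<cdot> invQ (J b) = invQ (J b) \<cdot> q --- invQ (J b) \<cdot> (Q.ad (J b) q \<cdot> invQ (J b))"
proof -
 define V where "V = invQ (J b)"
 have c: "J b : carrier QQ" "V : carrier QQ" "J b \<cdot> V = oneQ" "V \<cdot> J b = oneQ"
 using assms J_nz by (auto simp: V_def)
 have "V \<cdot> (Q.ad (J b) q \<cdot> V) = V \<cdot> q \<cdot> (J b \<cdot> V) --- (V \<cdot> J b) \<cdot> q \<cdot> V"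
 unfolding Q.ad_def using c(1,2) assms(1) by algebra
 also have "... = V \<cdot> q --- q \<cdot> V" unfolding c(3,4) using c assms by simp
 finally show ?thesis unfolding V_def[symmetric] using c(2) assms(1) by (simp only:) algebra
qed

text \<open>Moving a denominator from the right to the left produces a correction containing a
  commutator, which has a lower level; induction handles it.\<close>

lemma S_right_inv: "[|q : S r; b : carrier A; b ~= \<zero>|] ==> q \<cdot> invQ (J b) : S r"
proof (induct r arbitrary: q)
 case 0
 then show ?case by (simp add: S_zero)
next
 case (Suc r)
 have X: "Q.ad (J b) q \<cdot> invQ (J b) : S r" using Suc ad_J_S by blast
 show ?case unfolding mult_inv_right[OF S_closed[OF Suc(2)] Suc(3,4)]
 by (rule S_diff[OF S_left_inv[OF Suc(2,3,4)] S_left_inv[OF S_mono[OF X] Suc(3,4)]])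
qed

lemma ad_y_S: assumes "q : S (Suc r)" "i < n" shows "Q.ad (y i) q : S r"
proof -
 define V where "V = invQ (J w)"
 have c: "J w : carrier QQ" "V : carrier QQ" "J (u i) : carrier QQ" "q : carrier QQ"
 using assms wc w_nz J_nz S_closed uc by (auto simp: V_def)
 have qV: "q \<cdot> V --- V \<cdot> q = \<ominus>\<^bsub>QQ\<^esub> (V \<cdot> (Q.ad (J w) q \<cdot> V))"
 unfolding mult_inv_right[OF c(4) wc w_nz, folded V_def] using c Q.ad_closed[OF c(1,4)] by algebra
 have "Q.ad (y i) q = Q.ad (J (u i)) q \<cdot> V +++ J (u i) \<cdot> (q \<cdot> V --- V \<cdot> q)"
 unfolding y_def V_def[symmetric] Q.ad_def using c by algebra
 also have "... : S r" unfolding qV unfolding V_def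
 using ad_J_S[OF assms(1)] uc[OF assms(2)] wc w_nz by (intro S_add S_left S_minus S_left_inv S_right_inv) auto
 finally show ?thesis .
qed

lemma S_mult_dl: assumes "q : S r" "i < n" shows "q \<cdot> dl i : S (r + 1)"
proof -
 have "q \<cdot> invQ (J g) \<cdot> E (p i) : S (r + 1)"
 using S_mult_E[OF S_right_inv[OF assms(1) gc g_nz] p_diffop[OF assms(2)]] .
 then show ?thesis using S_closed[OF assms(1)] assms(2) gc g_nz by (simp add: dl_def Q.m_assoc)
qed

lemma S_mult_dl_pow: assumes "q : S r" "i < n" shows "q \<cdot> (dl i ^^^ (t::nat)) : S (r + t)"
proof (induct t)
 case 0 then show ?case using assms S_closed by simp
next
 case (Suc t)
 then have "q \<cdot> (dl i ^^^ t) \<cdot> dl i : S (r + t + 1)" using S_mult_dl assms(2) by blast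
 then show ?case using S_closed[OF assms(1)] assms(2) by (simp add: Q.m_assoc)
qed

lemma ad_y_dl_pow:
 assumes "i < n" shows "Q.ad (y i) (dl i ^^^ Suc t) = of_nat (Suc t) *. (dl i ^^^ t)"
proof (induct t)
 case 0 then show ?case using assms by (simp add: ad_y_dl)
next
 case (Suc t)
 have "Q.ad (y i) (dl i ^^^ Suc (Suc t)) =
 Q.ad (y i) (dl i ^^^ Suc t) \<cdot> dl i +++ dl i ^^^ Suc t \<cdot> Q.ad (y i) (dl i)"
 using assms unfolding Q.nat_pow_Suc[of _ "Suc t"] by (intro Q.ad_mult) auto
 also have "... = of_nat (Suc t) *. (dl i ^^^ Suc t) +++ 1 *. (dl i ^^^ Suc t)"
 unfolding Suc ad_y_dl[OF assms assms] using assms by simp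
 also have "... = of_nat (Suc (Suc t)) *. (dl i ^^^ Suc t)"
 using assms by (subst Q.smult_add_left[symmetric]) (auto simp del: Q.nat_pow_Suc simp: add.commute)
 finally show ?case .
qed

lemma ad_other_dl_pow:
 assumes "i < n" "j < n" "i ~= j" shows "Q.ad (y j) (dl i ^^^ (t::nat)) = zQ"
proof (induct t)
 case 0 then show ?case using assms by (simp add: Q.ad_eq_zero_iff)
next
 case (Suc t)
 then show ?case using assms by (simp add: Q.ad_mult ad_y_dl)
qed

text \<open>
 Integration with respect to \<open>dl i\<close>: an operator is recovered, up to an operator commuting with \<open>y i\<close>, from its
 commutator with \<open>y i\<close>.
\<close>

lemma S_subset_div_subring:
 assumes T: "Q.div_subring T" "ALL c. \<forall>t\<in>T. c *. t : T" and JT: "!!a. a : carrier A ==> J a : T"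
 and dlT: "!!i. i < n ==> dl i : T" and q: "q : S r"
 shows "q : T"
proof -
 have ops: "a +++ b : T" "a \<cdot> b : T" "\<ominus>\<^bsub>QQ\<^esub> a : T" "zQ : T" "oneQ : T" "a : carrier QQ"
 if "a : T" "b : T" for a b
 using T that by (auto simp: Q.div_subring_def)
 have T0: "zQ : T" using T by (auto simp: Q.div_subring_def)
 have yT: "y i : T" if "i < n" for i unfolding y_def using that JT uc wc w_nz J_nz Q.div_subring_inv[OF T(1)] ops by auto
 have adT: "Q.ad (y i) q : T" if "q : T" "i < n" for i q
 unfolding Q.ad_def a_minus_def using that yT ops by auto
 have powT: "dl i ^^^ (t::nat) : T" if "i < n" for i t
 proof (induct t)
 case 0 show ?case using ops(5)[OF dlT dlT] that by simp
 next
 case (Suc t) then show ?case using ops(2) dlT that by simp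
 qed
 \<comment> \<open>Induction on \<open>k\<close> for the operators that commute with all
   \<open>y j\<close> for \<open>j >= k\<close>. For \<open>k = 0\<close> they are fractions of
   functions; for \<open>k = n\<close> the condition is empty.\<close>
 have "ALL q r. q : S r & (\<forall>j<n. j >= k --> Q.ad (y j) q = zQ) --> q : T" if "k <= n" for k
 using that
 proof (induct k)
 case 0
 show ?case
 proof (intro allI impI)
 fix q r assume "q : S r & (\<forall>j<n. j >= 0 --> Q.ad (y j) q = zQ)"
 then have q: "q : S r" "!!j. j < n ==> Q.ad (y j) q = zQ" by auto
 obtain a d where a: "a : carrier A" "a ~= \<zero>" "d : dset r" "J a \<cdot> q = E d" "q : carrier QQ" using q SE by blast
 have dc: "d : carrier D" using a dset_closed by blast
 have "Q.ad (y j) (E d) = zQ" if "j < n" for j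
 unfolding a(4)[symmetric] using that a(1,5) q(2) J_y_comm[OF that a(1)] Q.ad_eq_zero_iff[of "y j" "J a"] by (simp add: Q.ad_mult)
 then have "d = mu (d \<one>)" using commutes_with_y[OF dc] dc by (simp add: Q.ad_eq_zero_iff)
 then have "J a \<cdot> q = J (d \<one>)" using a(4) by (simp add: J_def)
 then have "q = invQ (J a) \<cdot> J (d \<one>)" using a J_nz by (metis J_closed Q.mult_inv_cancel4)
 moreover have "J a : T" "J (d \<one>) : T" "J a ~= zQ" using JT a(1,2) dc J_nz by auto
 ultimately show "q : T" using Q.div_subring_inv[OF T(1)] ops(2) by simp
 qed
 next
 case (Suc k)
 then have k: "k < n" and IH: "!!q r. [|q : S r; \<forall>j<n. j >= k --> Q.ad (y j) q = zQ|] ==> q : T" by auto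
 define C where "C = {q : carrier QQ. \<forall>j<n. j >= Suc k --> Q.ad (y j) q = zQ}"
 have C_ad: "Q.ad (y k) q : C" if "q : C" for q
 proof -
 have qc: "q : carrier QQ" using that by (simp add: C_def)
 have "Q.ad (y j) (Q.ad (y k) q) = zQ" if j: "j < n" "Suc k <= j" for j
 proof -
 have "Q.ad (y j) (Q.ad (y k) q) = Q.ad (y k) (Q.ad (y j) q)"
 using Q.ad_comm[OF y_closed y_closed qc y_comm] j(1) k by blast
 also have "Q.ad (y j) q = zQ" using \<open>q : C\<close> j by (simp add: C_def)
 also have "Q.ad (y k) zQ = zQ" using k unfolding Q.ad_def by simp
 finally show ?thesis .
 qed
 then show ?thesis using qc k by (simp add: C_def)
 qed
 have C_diff: "q --- q' : C" if "q : C" "q' : C" for q q' using that by (auto simp: C_def Q.ad_diff)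
 have C_pow: "q \<cdot> (dl k ^^^ (t::nat)) : C" if "q : C" for q t
 using that k by (auto simp: C_def Q.ad_mult ad_other_dl_pow)
 have C_smult: "c *. q : C" if "q : C" for q c using that by (auto simp: C_def Q.ad_smult)
 \<comment> \<open>Integration by parts: the primitive of \<open>z \<cdot> (dl k ^^^ t)\<close> is
   sought as \<open>z \<cdot> (dl k ^^^ Suc t)\<close> divided by \<open>Suc t\<close>, with an
   error involving the commutator of \<open>z\<close>. That commutator has a lower level, so the
   error has a primitive by induction.\<close>
 have integ: "EX m r'. m : S r' & m : C & m : T & Q.ad (y k) m = z \<cdot> (dl k ^^^ t)"
 if "z : S r" "z : C" "z : T" for z r and t :: nat
 using that
 proof (induct r arbitrary: z t)
 case 0
 have z0: "zQ : C" unfolding C_def Q.ad_def by simp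
 have z: "z = zQ" using 0(1) by (simp only: S_zero)
 have "Q.ad (y k) zQ = zQ" using k unfolding Q.ad_def by simp
 also have "... = z \<cdot> (dl k ^^^ t)" unfolding z by (rule Q.l_null[OF Q.nat_pow_closed[OF dl_closed[OF k]], symmetric])
 finally show ?case using z0 S_zero_mem[of 0] T0 by (intro exI[of _ "zQ"] exI[of _ 0] conjI)
 next
 case (Suc r)
 have zc: "z : carrier QQ" using Suc S_closed by blast
 obtain m r' where m: "m : S r'" "m : C" "m : T" "Q.ad (y k) m = Q.ad (y k) z \<cdot> (dl k ^^^ Suc t)"
 using Suc(1)[OF ad_y_S[OF Suc(2) k] C_ad[OF Suc(3)] adT[OF Suc(4) k], of "Suc t"] by metis
 \<comment> \<open>The primitive \<open>m\<close> of the error term is subtracted before dividing by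
   \<open>Suc t\<close>.\<close>
 define v where "v = z \<cdot> (dl k ^^^ Suc t) --- m"
 have mc: "m : carrier QQ" using m S_closed by blast
 have vS: "v : S (max (Suc r + Suc t) r')"
 unfolding v_def using S_mult_dl_pow[OF Suc(2) k, of "Suc t"] m(1) by (intro S_diff) (auto intro: S_mono_le simp del: Q.nat_pow_Suc)
 have vC: "v : C" unfolding v_def by (rule C_diff[OF C_pow[OF Suc(3)] m(2)])
 have vT: "v : T" unfolding v_def a_minus_def by (rule ops(1)[OF ops(2)[OF Suc(4) powT[OF k]] ops(3)[OF m(3) m(3)]])
 define X where "X = z \<cdot> (dl k ^^^ t)"
 have Xc: "X : carrier QQ" using zc k by (simp add: X_def)
 have "Q.ad (y k) v = (Q.ad (y k) z \<cdot> (dl k ^^^ Suc t) +++ z \<cdot> (of_nat (Suc t) *. (dl k ^^^ t)))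
 \<ominus>\<^bsub>QQ\<^esub> Q.ad (y k) z \<cdot> (dl k ^^^ Suc t)"
 proof -
 define P where "P = dl k ^^^ Suc t"
 have P: "P : carrier QQ" "Q.ad (y k) P = of_nat (Suc t) *. (dl k ^^^ t)"
 unfolding P_def using k ad_y_dl_pow by auto
 show ?thesis unfolding v_def P_def[symmetric] using zc mc k P(1)
 by (simp add: Q.ad_diff Q.ad_mult m(4)[folded P_def] P(2) del: of_nat_Suc)
 qed
 also have "... = of_nat (Suc t) *. X"
 proof -
 have "(b +++ c) --- b = c" if "b : carrier QQ" "c : carrier QQ" for b c using that by algebra
 then show ?thesis using zc k by (simp add: X_def del: Q.nat_pow_Suc of_nat_Suc)
 qed
 finally have "Q.ad (y k) ((1 / of_nat (Suc t)) *. v) = X"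
 using vC k Xc by (simp add: Q.ad_smult C_def del: of_nat_Suc)
 then show ?case unfolding X_def using S_smult[OF vS] C_smult[OF vC] T(2)[rule_format, OF vT]
 by (intro exI[of _ "(1 / of_nat (Suc t)) *. v"] exI[of _ "max (Suc r + Suc t) r'"]) simp
 qed
 show ?case
 proof (intro allI impI)
 fix q r assume "q : S r & (\<forall>j<n. j >= Suc k --> Q.ad (y j) q = zQ)"
 then have "q : S r" "q : C" using S_closed by (auto simp: C_def)
 then show "q : T"
 proof (induct r arbitrary: q)
 case 0 then show ?case using T0 by (simp add: S_zero)
 next
 case (Suc r)
 have qc: "q : carrier QQ" using Suc S_closed by blast
 have ad: "Q.ad (y k) q : S r" "Q.ad (y k) q : C" using ad_y_S[OF Suc(2) k] C_ad[OF Suc(3)] by auto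
 then have "Q.ad (y k) q : T" by (rule Suc(1))
 from integ[OF ad this, of 0] obtain m r' where
 m: "m : S r'" "m : C" "m : T" "Q.ad (y k) m = Q.ad (y k) q" using qc k by auto
 have mc: "m : carrier QQ" using m S_closed by blast
 have d: "q --- m : S (max (Suc r) r')" "q --- m : C"
 using S_mono_le[OF Suc(2), of "max (Suc r) r'"] S_mono_le[OF m(1), of "max (Suc r) r'"] Suc(3) m(2) C_diff by (auto intro!: S_diff)
 \<comment> \<open>Subtracting the primitive makes the difference commute with \<open>y k\<close>
   too, so it falls under the case \<open>k\<close> of the outer induction, and \<open>m\<close>
   belongs to \<open>T\<close> by construction.\<close>
 have z: "Q.ad (y k) (q --- m) = zQ" using m qc mc k by (simp add: Q.ad_diff)
 have "\<forall>j<n. j >= k --> Q.ad (y j) (q --- m) = zQ"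
 proof (intro allI impI)
 fix j assume j: "j < n" "k <= j"
 show "Q.ad (y j) (q --- m) = zQ"
 proof (cases "j = k")
 case True then show ?thesis using z by simp
 next
 case False then show ?thesis using d(2) j by (simp add: C_def)
 qed
 qed
 then have "q --- m : T" by (rule IH[OF d(1)])
 then have "(q --- m) +++ m : T" by (rule ops(1)[OF _ m(3)])
 moreover have "(q --- m) +++ m = q" using qc mc by algebra
 ultimately show ?case by (simp only:)
 qed
 qed
 qed
 from this[of n, OF order_refl, rule_format, of q r] show ?thesis using q by auto
qed

end

section \<open>Stabilizers of finite dimensional right spaces\<close>

context division_algebra
begin

definition rspan :: "'a set => nat => (nat => 'a) => 'a set" where
 "rspan F m v = {(\<Oplus>i\<in>{..<m}. v i ** c i) | c. \<forall>i<m. c i : F}"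

text \<open>An injective endomorphism of a finite dimensional space is onto. In explicit form: the
  vectors \<open>z\<close>, \<open>q ** z\<close>, and so on are dependent over \<open>F\<close>,
  and from a relation between them \<open>inv q ** z\<close> is seen to lie in the space. Since the
  space contains 1, it contains its stabilizer.\<close>

lemma stabilizer_div_subring:
 assumes F: "div_subring F" and Fs: "ALL c. \<forall>t\<in>F. c \<odot> t : F" and v: "!!i. i < m ==> v i : carrier A"
 and one: "\<one> : rspan F m v"
 defines "T == {q : carrier A. \<forall>z\<in>rspan F m v. q ** z : rspan F m v}"
 shows "div_subring T" "ALL c. \<forall>t\<in>T. c \<odot> t : T" "T <= rspan F m v"
 and "!!q. [|q : carrier A; !!i. i < m ==> q ** v i : rspan F m v|] ==> q : T"
 and "!!z x. [|z : rspan F m v; x : F|] ==> z ** x : rspan F m v"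
 and "!!z x. [|z : rspan F m v; x : rspan F m v|] ==> z +. x : rspan F m v"
proof -
 let ?M = "rspan F m v"
 have Fc: "x : carrier A" if "x : F" for x using F that by (auto simp: div_subring_def)
 have Fo: "x +. y : F" "x ** y : F" if "x : F" "y : F" for x y using F that by (auto simp: div_subring_def)
 have F0: "\<zero> : F" "\<one> : F" using F by (auto simp: div_subring_def)
 have Mc: "z : carrier A" if "z : ?M" for z using that v Fc by (auto simp: rspan_def intro!: finsum_closed)
 show add: "z +. x : ?M" if zx: "z : ?M" "x : ?M" for z x
 proof -
 obtain c d where c: "\<forall>i<m. c i : F" "z = (\<Oplus>i\<in>{..<m}. v i ** c i)" and d: "\<forall>i<m. d i : F" "x = (\<Oplus>i\<in>{..<m}. v i ** d i)"
 using zx unfolding rspan_def by blast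
 have "(\<Oplus>i\<in>{..<m}. v i ** (c i +. d i)) = (\<Oplus>i\<in>{..<m}. v i ** c i +. v i ** d i)"
 using v c d Fc by (intro finsum_cong') (auto simp: r_distr)
 also have "... = z +. x" unfolding c(2) d(2) using v c d Fc by (intro finsum_addf) auto
 finally show ?thesis using c(1) d(1) Fo unfolding rspan_def by (auto intro!: exI[of _ "%i. c i +. d i"])
 qed
 show multF: "z ** x : ?M" if zx: "z : ?M" "x : F" for z x
 proof -
 obtain c where c: "\<forall>i<m. c i : F" "z = (\<Oplus>i\<in>{..<m}. v i ** c i)" using zx unfolding rspan_def by blast
 have "z ** x = (\<Oplus>i\<in>{..<m}. v i ** c i ** x)" unfolding c(2) using v c Fc that by (intro finsum_ldistr) auto
 also have "... = (\<Oplus>i\<in>{..<m}. v i ** (c i ** x))" using v c Fc that by (intro finsum_cong') (auto simp: m_assoc)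
 finally show ?thesis using c(1) that Fo unfolding rspan_def by (auto intro!: exI[of _ "%i. c i ** x"])
 qed
 have M0: "\<zero> : ?M" using multF[OF one F0(1)] by simp
 have smul: "c \<odot> z : ?M" if "z : ?M" for c z
 using multF[OF that, of "c \<odot> \<one>"] Fs F0 Mc[OF that] by simp
 show sT: "ALL c. \<forall>t\<in>T. c \<odot> t : T" using smul Mc by (auto simp: T_def)
 have sumM: "finsum A f I : ?M" if "finite I" "!!i. i : I ==> f i : ?M" for f and I :: "nat set"
 using that
 proof (induct set: finite)
 case empty then show ?case using M0 by simp
 next
 case (insert i I)
 then have "finsum A f (insert i I) = f i +. finsum A f I" using Mc by (intro finsum_insert) auto
 then show ?case using add insert by auto
 qed
 show "q : T" if q: "q : carrier A" "!!i. i < m ==> q ** v i : ?M" for q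
 proof -
 have "q ** z : ?M" if z: "z : ?M" for z
 proof -
 obtain c where c: "\<forall>i<m. c i : F" "z = (\<Oplus>i\<in>{..<m}. v i ** c i)" using z unfolding rspan_def by blast
 have "q ** z = (\<Oplus>i\<in>{..<m}. q ** (v i ** c i))" unfolding c(2) using v c Fc q by (intro finsum_rdistr) auto
 also have "... = (\<Oplus>i\<in>{..<m}. q ** v i ** c i)" using v c Fc q by (intro finsum_cong') (auto simp: m_assoc)
 also have "... : ?M" using c q multF by (intro sumM) auto
 finally show ?thesis .
 qed
 then show ?thesis using q by (simp add: T_def)
 qed
 show "T <= ?M"
 proof
 fix q assume "q : T"
 then have "q : carrier A" "q ** \<one> : ?M" using one by (auto simp: T_def)
 then show "q : ?M" by simp
 qed
 have inv_mem: "inv q ** z : ?M" if q: "q : T" "q ~= \<zero>" and z: "z : ?M" for q z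
 proof -
 have qc: "q : carrier A" using q by (simp add: T_def)
 have zc: "z : carrier A" using z Mc by blast
 have pow: "(q [^] (j::nat)) ** z : ?M" for j
 proof (induct j)
 case 0 show ?case using z zc by simp
 next
 case (Suc j)
 have "q [^] Suc j ** z = q ** (q [^] j ** z)" using qc zc nat_pow_Suc2[of q j] by (simp add: m_assoc)
 then show ?case using Suc q by (simp add: T_def)
 qed
 \<comment> \<open>If \<open>f 0\<close> is nonzero, \<open>z\<close> is \<open>q\<close> times an
   element of the space. If it is zero, a factor \<open>q\<close> cancels on the left and the
   relation becomes shorter.\<close>
 have key: "ALL f. (\<forall>j\<le>k. f j : F) & (\<exists>j\<le>k. f j ~= \<zero>) & (\<Oplus>j\<in>{..k}. (q [^] j) ** z ** f j) = \<zero> --> inv q ** z : ?M" for k :: nat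
 proof (induct k)
 case 0
 show ?case
 proof (intro allI impI)
 fix f :: "nat => 'a" assume "(\<forall>j\<le>0. f j : F) & (\<exists>j\<le>0. f j ~= \<zero>) & (\<Oplus>j\<in>{..0::nat}. (q [^] j) ** z ** f j) = \<zero>"
 then have "f 0 : F" "f 0 ~= \<zero>" "z ** f 0 = \<zero>" using zc Fc qc by auto
 then have "z = \<zero>" using no_zero_div[OF zc] Fc by blast
 then show "inv q ** z : ?M" using M0 qc q by simp
 qed
 next
 case (Suc k)
 show ?case
 proof (intro allI impI)
 fix f :: "nat => 'a"
 assume "(\<forall>j\<le>Suc k. f j : F) & (\<exists>j\<le>Suc k. f j ~= \<zero>) & (\<Oplus>j\<in>{..Suc k}. (q [^] j) ** z ** f j) = \<zero>"
 then have f: "!!j. j <= Suc k ==> f j : F" "\<exists>j\<le>Suc k. f j ~= \<zero>" "(\<Oplus>j\<in>{..Suc k}. (q [^] j) ** z ** f j) = \<zero>" by auto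
 define X where "X = (\<Oplus>j\<in>{..k}. (q [^] j) ** z ** f (Suc j))"
 have XM: "X : ?M" unfolding X_def by (rule sumM) (use f(1) pow multF in auto)
 have Xc: "X : carrier A" and f0: "f 0 : carrier A" using XM Mc f Fc by auto
 have fc: "f j : carrier A" if "j <= Suc k" for j using f Fc that by blast
 have "\<zero> = (\<Oplus>j\<in>{..k}. (q [^] Suc j) ** z ** f (Suc j)) +. (q [^] (0::nat)) ** z ** f 0"
 unfolding f(3)[symmetric] using qc zc fc by (intro finsum_Suc2) auto
 also have "(\<Oplus>j\<in>{..k}. (q [^] Suc j) ** z ** f (Suc j)) = (\<Oplus>j\<in>{..k}. q ** ((q [^] j) ** z ** f (Suc j)))"
 unfolding nat_pow_Suc2[OF qc] using qc zc fc by (intro finsum_cong') (auto simp: m_assoc)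
 also have "... = q ** X" unfolding X_def using qc zc fc by (intro finsum_rdistr[symmetric]) auto
 finally have e: "q ** X +. z ** f 0 = \<zero>" using zc by simp
 show "inv q ** z : ?M"
 proof (cases "f 0 = \<zero>")
 case True
 then have "q ** X = \<zero>" using e zc qc Xc by simp
 then have X0: "X = \<zero>" using no_zero_div[OF qc Xc] q by blast
 have "\<exists>j\<le>k. f (Suc j) ~= \<zero>" using f(2) True by (metis not0_implies_Suc Suc_le_mono)
 then show ?thesis using Suc[rule_format, of "%j. f (Suc j)"] X0 f(1) unfolding X_def by auto
 next
 case False
 have "z ** f 0 = \<ominus> (q ** X)" using e zc qc Xc f0 by (metis m_closed minus_equality a_comm)
 then have "z ** f 0 ** inv (f 0) = \<ominus> (q ** X) ** inv (f 0)" by simp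
 then have "z = q ** (\<ominus> X ** inv (f 0))" using zc f0 False qc Xc by (simp add: m_assoc l_minus r_minus)
 then have "inv q ** z = \<ominus> X ** inv (f 0)" using qc Xc f0 False q by simp
 also have "\<ominus> X = (- 1) \<odot> X" using Xc smult_minus_left[of X 1] by simp
 finally show ?thesis using multF[OF smul[OF XM] div_subring_inv[OF F _ False]] f(1) by simp
 qed
 qed
 qed
 \<comment> \<open>The \<open>m + 1\<close> vectors with exponents \<open>0\<close> to
   \<open>m\<close> lie in a space with \<open>m\<close> generators, so a relation exists.\<close>
 have "EX c. (\<forall>i\<in>{..<m}. c i : F) & (q [^] j) ** z = (\<Oplus>i\<in>{..<m}. v i ** c i)" for j :: nat
 using pow[of j] unfolding rspan_def by auto
 then have "EX f. (\<forall>j\<in>{..m}. f j : F) & (\<exists>j\<in>{..m}. f j ~= \<zero>) & (\<Oplus>j\<in>{..m}. (q [^] j) ** z ** f j) = \<zero>"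
 using v by (intro right_dependent[OF F one_neq_zero, of "{..<m}" "{..m}" v "%j. (q [^] j) ** z"]) auto
 then show ?thesis using key[of m] by auto
 qed
 show "div_subring T"
 proof (rule div_subringI)
 show "T <= carrier A" "\<one> : T" using Mc by (auto simp: T_def)
 show "x +. y : T" "x ** y : T" if "x : T" "y : T" for x y
 using that add Mc by (auto simp: T_def l_distr m_assoc)
 show "c \<odot> x : T" if "x : T" for c x using sT that by blast
 show "inv x : T" if "x : T" "x ~= \<zero>" for x using that inv_mem by (auto simp: T_def)
 qed
qed

end

section \<open>The invariants of Frac D(A)\<close>

context rational_galois
begin

abbreviation "qact sig == frac_action (diffop_action A sig)"

lemma qact:
 assumes "sig : G"
 shows "qact sig : algebra_hom QQ QQ" "!!d. d : carrier D ==> qact sig (E d) = E (diffop_action A sig d)"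
 "!!a. a : carrier A ==> qact sig (J a) = J (sig a)" "!!i. i < n ==> qact sig (y i) = y i" "!!i. i < n ==> qact sig (dl i) = dl i"
proof -
 note hs = G_hom[OF assms] G_bij[OF assms]
 note fa = D.frac_action_hom[OF act_hom[OF hs] act_bij[OF hs]]
 show h: "qact sig : algebra_hom QQ QQ" by (rule fa)
 show e: "qact sig (E d) = E (diffop_action A sig d)" if "d : carrier D" for d using fa(2) that by blast
 show j: "qact sig (J a) = J (sig a)" if "a : carrier A" for a
 unfolding J_def using e[of "mu a"] act_mult_operator[OF hs that] that by simp
 note i = algebra_hom_inv(2)[OF Q.calgebra_axioms Q.calgebra_axioms h Q.division_algebra_axioms Q.division_algebra_axioms]
 show "qact sig (y i) = y i" if "i < n" for i
 unfolding y_def using that uc wc w_nz J_nz j fixedD(2)[OF u_fixed assms] fixedD(2)[OF w_fixed assms] i by (simp add: algebra_homD[OF h])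
 show "qact sig (dl i) = dl i" if "i < n" for i
 unfolding dl_def using that gc g_nz J_nz j fixedD(2)[OF g_fixed assms] i e p_equivariant[OF that assms] by (simp add: algebra_homD[OF h])
qed

text \<open>The expansion of \<open>s ** a\<close> has traces as coefficients; these are invariant
  and so have images in \<open>F\<close>, where the image of \<open>s\<close> can also be
  inverted.\<close>

lemma J_in_rspan:
 assumes F: "Q.div_subring F" "ALL c. \<forall>t\<in>F. c *. t : F" "!!i. i < n ==> y i : F" and a: "a : carrier A"
 shows "J a : Q.rspan F m (%i. J (al i))"
proof -
 have Fm: "a \<cdot> b : F" if "a : F" "b : F" for a b using F that by (auto simp: Q.div_subring_def)
 have JF: "J c : F" if "c : fixed" for c
 using generation[OF that Q.division_algebra_axioms J_hom J_eq_zero F(1,2)] F(3) by (simp add: y_def)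
 have Js: "invQ (J s) : F" by (rule Q.div_subring_inv[OF F(1) JF[OF s_fixed] J_nz[OF sc s_nz]])
 define t where "t i = trace (be i ** a)" for i
 have t: "t i : fixed" "t i : carrier A" if "i < m" for i using bec a that trace_fixed by (auto simp: t_def)
 have "(\<Oplus>\<^bsub>QQ\<^esub>i\<in>{..<m}. J (al i) \<cdot> (J (t i) \<cdot> invQ (J s))) = (\<Oplus>\<^bsub>QQ\<^esub>i\<in>{..<m}. J (al i ** t i) \<cdot> invQ (J s))"
 using alc t s_nz by (intro Q.finsum_cong') (auto simp: J_simps Q.m_assoc)
 also have "... = (\<Oplus>\<^bsub>QQ\<^esub>i\<in>{..<m}. J (al i ** t i)) \<cdot> invQ (J s)"
 using alc t s_nz by (intro Q.finsum_ldistr[symmetric]) auto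
 also have "(\<Oplus>\<^bsub>QQ\<^esub>i\<in>{..<m}. J (al i ** t i)) = J (\<Oplus>i\<in>{..<m}. al i ** t i)"
 using alc t by (intro algebra_hom_finsum[OF calgebra_axioms Q.calgebra_axioms J_hom, symmetric]) auto
 also have "(\<Oplus>i\<in>{..<m}. al i ** t i) = a ** s" using expand[OF a] a by (simp add: t_def m_comm)
 also have "J (a ** s) \<cdot> invQ (J s) = J a" using a s_nz J_nz by (simp add: J_simps Q.m_assoc)
 finally show ?thesis unfolding Q.rspan_def using t JF Js Fm
 by (auto intro!: exI[of _ "%i. J (t i) \<cdot> invQ (J s)"])
qed

theorem invariants_isomorphic:
 "algebra_isomorphic (invariants QQ (qact ` G)) (weyl_field n)"
proof -
 have rel: "dl i \<cdot> y j --- y j \<cdot> dl i = (if i = j then oneQ else zQ)" if "i < n" "j < n" for i j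
 using ad_y_dl[OF that] by (simp add: Q.ad_def)
 have "EX Phi. Phi : algebra_hom (weyl_field n) QQ & inj_on Phi (carrier (weyl_field n)) & division_algebra (weyl_field n) &
 (\<forall>i<n. y i : Phi ` carrier (weyl_field n) & dl i : Phi ` carrier (weyl_field n)) &
 (ALL T. Q.div_subring T & (ALL c. \<forall>t\<in>T. c *. t : T) & (\<forall>i<n. y i : T & dl i : T) --> Phi ` carrier (weyl_field n) <= T)"
 by (rule weyl_field_embedding[OF Q.division_algebra_axioms]) (use rel y_comm dl_comm in auto)
 then obtain Phi where Phi: "Phi : algebra_hom (weyl_field n) QQ" "inj_on Phi (carrier (weyl_field n))" and W: "division_algebra (weyl_field n)"
 and yF: "\<forall>i<n. y i : Phi ` carrier (weyl_field n) & dl i : Phi ` carrier (weyl_field n)"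
 and FT: "ALL T. Q.div_subring T & (ALL c. \<forall>t\<in>T. c *. t : T) & (\<forall>i<n. y i : T & dl i : T) --> Phi ` carrier (weyl_field n) <= T"
 by - (elim exE conjE, rule that, assumption+)
 define F where "F = Phi ` carrier (weyl_field n)"
 note Fd = image_div_subring[OF W Q.division_algebra_axioms Phi(1), folded F_def]
 have Fc: "x : carrier QQ" if "x : F" for x using Fd that by (auto simp: Q.div_subring_def)
 have JF: "J c : F" if "c : fixed" for c
 by (rule fixed_in_div_subring[OF Fd _ that]) (use yF in \<open>auto simp: F_def\<close>)
 have JFinv: "invQ (J c) : F" if "c : fixed" "c ~= \<zero>" for c
 using Q.div_subring_inv[OF Fd(1) JF] that J_nz fixedD by blast
 have Fm: "a \<cdot> b : F" if "a : F" "b : F" for a b using Fd that by (auto simp: Q.div_subring_def)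
 define M where "M = Q.rspan F m (%i. J (al i))"
 have JM: "J a : M" if "a : carrier A" for a
 unfolding M_def by (rule J_in_rspan[OF Fd _ that]) (use yF in \<open>auto simp: F_def\<close>)
 define T where "T = {q : carrier QQ. \<forall>z\<in>M. q \<cdot> z : M}"
 have alc': "J (al i) : carrier QQ" if "i < m" for i using alc that by blast
 have "oneQ : M" using JM[of \<one>] by (simp add: J_simps)
 note st = Q.stabilizer_div_subring[OF Fd alc' this[unfolded M_def], folded M_def, folded T_def]
 have JT: "J a : T" if "a : carrier A" for a
 by (rule st(4)) (use that alc JM J_simps(2)[symmetric] in auto)
 \<comment> \<open>Moving \<open>dl j\<close> past \<open>J (al i)\<close> leaves
   \<open>J (p j (al i))\<close> times the inverse of \<open>J g\<close>. The first factor is a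
   function, hence in \<open>M\<close>, and the second lies in \<open>F\<close> because
   \<open>g\<close> is invariant.\<close>
 have dlT: "dl j : T" if j: "j < n" for j
 proof (rule st(4))
 fix i assume i: "i < m"
 note pc = p_apply_closed[OF j alc[OF i]]
 have e: "dl j \<cdot> J (al i) --- J (al i) \<cdot> dl j = J (p j (al i)) \<cdot> invQ (J g)"
 using ad_dl_J[OF j alc[OF i]] inv_J_comm[OF gc g_nz pc] by (simp add: Q.ad_def)
 have "dl j \<cdot> J (al i) = J (al i) \<cdot> dl j +++ J (p j (al i)) \<cdot> invQ (J g)"
 by (rule Q.eq_of_minus[OF e]) (use alc i j in auto)
 also have "... : M" using st(5,6) JM alc i pc yF j JFinv[OF g_fixed g_nz] by (auto simp: F_def)
 finally show "dl j \<cdot> J (al i) : M" .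
 qed (use j in auto)
 have QT: "q : T" if q: "q : carrier QQ" for q
 proof -
 have ET: "E d : T" if d: "d : carrier D" for d
 proof -
 obtain r where "d : diffops A r" using d D_carrierE by blast
 then have "E d : S (Suc r)" by (intro S_E) (simp add: dset_def)
 then show ?thesis using S_subset_div_subring[OF st(1,2) JT dlT] by blast
 qed
 obtain a b where ab: "a : carrier D" "b : carrier D - {\<zero>\<^bsub>D\<^esub>}" "q = E a \<cdot> invQ (E b)"
 using D.frac_quotientE[OF q] by metis
 then have "E b ~= zQ" using D.frac_embed_eq_zero by blast
 then have "invQ (E b) : T" using Q.div_subring_inv[OF st(1) ET] ab by blast
 then show ?thesis unfolding ab(3) using st(1) ET ab by (auto simp: Q.div_subring_def)
 qed
 \<comment> \<open>The fixed points of an automorphism form a skew subfield containing all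
   \<open>y i\<close> and \<open>dl i\<close>; minimality of \<open>F\<close> gives the
   inclusion.\<close>
 have fixF: "qact sig x = x" if "sig : G" "x : F" for sig x
 using FT[rule_format, OF conjI, OF fixed_points_div_subring(1)[OF Q.division_algebra_axioms qact(1)[OF that(1)]]]
 fixed_points_div_subring(2)[OF Q.division_algebra_axioms qact(1)[OF that(1)]] qact(4,5)[OF that(1)] that(2) by (auto simp: F_def)
 have inv_F: "q : F" if q: "q : carrier QQ" "\<forall>sig\<in>G. qact sig q = q" for q
 proof -
 obtain c where c: "\<forall>i<m. c i : F" "q = (\<Oplus>\<^bsub>QQ\<^esub>i\<in>{..<m}. J (al i) \<cdot> c i)"
 using QT[OF q(1)] st(3) by (auto simp: M_def Q.rspan_def)
 \<comment> \<open>The factor \<open>oneQ\<close> has no content; it gives the sum the shape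
   required for exchanging the order of summation with \<open>finsum_swap_mult\<close>.\<close>
 have qs: "q = oneQ \<cdot> (\<Oplus>\<^bsub>QQ\<^esub>i\<in>{..<m}. J (sig (al i)) \<cdot> c i)" if s: "sig : G" for sig
 proof -
 note H = algebra_homD[OF qact(1)[OF s]]
 have "q = qact sig (\<Oplus>\<^bsub>QQ\<^esub>i\<in>{..<m}. J (al i) \<cdot> c i)" using q s c(2) by simp
 also have "... = (\<Oplus>\<^bsub>QQ\<^esub>i\<in>{..<m}. qact sig (J (al i) \<cdot> c i))"
 using alc c Fc by (intro algebra_hom_finsum[OF Q.calgebra_axioms Q.calgebra_axioms qact(1)[OF s]]) auto
 also have "... = (\<Oplus>\<^bsub>QQ\<^esub>i\<in>{..<m}. J (sig (al i)) \<cdot> c i)"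
 using alc c Fc G_simps(1)[OF s] fixF[OF s] qact(3)[OF s] by (intro Q.finsum_cong') (auto simp: H(2))
 finally show ?thesis using q(1) by simp
 qed
 \<comment> \<open>Averaging: the coefficients \<open>c i\<close> are fixed by the group, so summing
   the conjugates of \<open>q\<close> replaces each \<open>al i\<close> by its trace, whose image is
   in \<open>F\<close>. The order of the group is invertible.\<close>
 have "of_nat (card G) *. q = (\<Oplus>\<^bsub>QQ\<^esub>sig\<in>G. 1 *. q)" using q(1) G_finite by (subst Q.finsum_smult_left) auto
 also have "... = (\<Oplus>\<^bsub>QQ\<^esub>sig\<in>G. oneQ \<cdot> (\<Oplus>\<^bsub>QQ\<^esub>i\<in>{..<m}. J (sig (al i)) \<cdot> c i))"
 proof (intro Q.finsum_cong' refl)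
 fix sig assume s: "sig : G"
 show "1 *. q = oneQ \<cdot> (\<Oplus>\<^bsub>QQ\<^esub>i\<in>{..<m}. J (sig (al i)) \<cdot> c i)" using qs[OF s] q(1) by simp
 qed (use alc c Fc G_simps(1) in \<open>auto intro!: Q.finsum_closed\<close>)
 also have "... = (\<Oplus>\<^bsub>QQ\<^esub>i\<in>{..<m}. (\<Oplus>\<^bsub>QQ\<^esub>sig\<in>G. oneQ \<cdot> J (sig (al i))) \<cdot> c i)"
 using alc c Fc G_simps(1) G_finite by (intro Q.finsum_swap_mult[symmetric]) auto
 also have "... = (\<Oplus>\<^bsub>QQ\<^esub>i\<in>{..<m}. J (trace (al i)) \<cdot> c i)"
 proof (intro Q.finsum_cong' refl)
 fix i assume i: "i : {..<m}"
 have "(\<Oplus>\<^bsub>QQ\<^esub>sig\<in>G. oneQ \<cdot> J (sig (al i))) = (\<Oplus>\<^bsub>QQ\<^esub>sig\<in>G. J (sig (al i)))"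
 using alc G_simps(1) i by (intro Q.finsum_cong') auto
 also have "... = J (trace (al i))" unfolding trace_def
 using alc G_simps(1) i G_finite by (intro algebra_hom_finsum[OF calgebra_axioms Q.calgebra_axioms J_hom, symmetric]) auto
 finally show "(\<Oplus>\<^bsub>QQ\<^esub>sig\<in>G. oneQ \<cdot> J (sig (al i))) \<cdot> c i = J (trace (al i)) \<cdot> c i" by simp
 qed (use alc c Fc in auto)
 also have "... : F" using c alc trace_fixed JF Fm by (intro Q.div_subring_finsum[OF Fd(1)]) auto
 finally have "(1 / of_nat (card G)) *. (of_nat (card G) *. q) : F" using Fd(2) by blast
 then show ?thesis using q(1) card_G_pos by simp
 qed
 have "{x : carrier QQ. \<forall>phi\<in>qact ` G. phi x = x} = Phi ` carrier (weyl_field n)"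
 using inv_F fixF Fc unfolding F_def by auto
 then have car: "carrier (invariants QQ (qact ` G)) = Phi ` carrier (weyl_field n)" by (simp add: invariants_def)
 define h where "h = inv_into (carrier (weyl_field n)) Phi"
 interpret W: division_algebra "weyl_field n" by (rule W)
 have h: "h (Phi x) = x" if "x : carrier (weyl_field n)" for x unfolding h_def by (rule inv_into_f_f[OF Phi(2) that])
 note H = algebra_homD[OF Phi(1)]
 have "h : algebra_iso (invariants QQ (qact ` G)) (weyl_field n)"
 unfolding algebra_iso_def ring_iso_def
 proof (intro CollectI conjI)
 show "h : ring_hom (invariants QQ (qact ` G)) (weyl_field n)"
 proof (rule ring_hom_memI)
 fix x y assume "x : carrier (invariants QQ (qact ` G))" "y : carrier (invariants QQ (qact ` G))"
 then obtain a b where ab: "a : carrier (weyl_field n)" "b : carrier (weyl_field n)" "x = Phi a" "y = Phi b"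
 unfolding car by blast
 show "h (x **\<^bsub>invariants QQ (qact ` G)\<^esub> y) = h x **\<^bsub>weyl_field n\<^esub> h y" "h (x +.\<^bsub>invariants QQ (qact ` G)\<^esub> y) = h x +.\<^bsub>weyl_field n\<^esub> h y"
 unfolding ab using ab(1,2) h[of "a **\<^bsub>weyl_field n\<^esub> b"] h[of "a +.\<^bsub>weyl_field n\<^esub> b"] by (auto simp: invariants_def H h)
 next
 show "h \<one>\<^bsub>invariants QQ (qact ` G)\<^esub> = \<one>\<^bsub>weyl_field n\<^esub>" using h[OF W.one_closed] by (simp add: invariants_def H)
 qed (auto simp: car h)
 show "bij_betw h (carrier (invariants QQ (qact ` G))) (carrier (weyl_field n))"
 unfolding h_def using bij_betw_inv_into[OF inj_on_imp_bij_betw[OF Phi(2)]] by (simp add: car)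
 show "ALL c. \<forall>x\<in>carrier (invariants QQ (qact ` G)). h (c \<odot>\<^bsub>invariants QQ (qact ` G)\<^esub> x) = c \<odot>\<^bsub>weyl_field n\<^esub> h x"
 proof (intro allI ballI)
 fix c x assume "x : carrier (invariants QQ (qact ` G))"
 then obtain a where a: "a : carrier (weyl_field n)" "x = Phi a" unfolding car by blast
 show "h (c \<odot>\<^bsub>invariants QQ (qact ` G)\<^esub> x) = c \<odot>\<^bsub>weyl_field n\<^esub> h x"
 using a h[of "c \<odot>\<^bsub>weyl_field n\<^esub> a"] by (simp add: invariants_def H h)
 qed
 qed
 then show ?thesis by (auto simp: algebra_isomorphic_def)
qed

end

section \<open>Derivations and algebraic independence\<close>

text \<open>An element on which a derivation does not vanish is transcendental over the constants of the derivation.\<close>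

locale field_derivation =
 fixes K :: "(complex, 'k) module" and Q :: "(complex, 'q) module" and h tht :: "'k => 'q"
 assumes K: "division_algebra K" and Q: "division_algebra Q"
 and K_comm: "[|x : carrier K; y : carrier K|] ==> x **\<^bsub>K\<^esub> y = y **\<^bsub>K\<^esub> x"
 and h: "h : algebra_hom K Q"
 and thtc: "x : carrier K ==> tht x : carrier Q"
 and tht_add: "[|x : carrier K; y : carrier K|] ==> tht (x +.\<^bsub>K\<^esub> y) = tht x +.\<^bsub>Q\<^esub> tht y"
 and tht_smult: "x : carrier K ==> tht (c \<odot>\<^bsub>K\<^esub> x) = c \<odot>\<^bsub>Q\<^esub> tht x"
 and tht_mult: "[|x : carrier K; y : carrier K|] ==> tht (x **\<^bsub>K\<^esub> y) = h x **\<^bsub>Q\<^esub> tht y +.\<^bsub>Q\<^esub> h y **\<^bsub>Q\<^esub> tht x"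
begin

sublocale K: division_algebra K by (rule K)
sublocale Q: division_algebra Q by (rule Q)
sublocale K: cring K by unfold_locales (rule K_comm)

lemmas h_simps = algebra_homD[OF h]

lemma tht_zero: "tht \<zero>\<^bsub>K\<^esub> = \<zero>\<^bsub>Q\<^esub>"
 using tht_smult[of "\<zero>\<^bsub>K\<^esub>" 0] thtc by simp

lemma tht_one: "tht \<one>\<^bsub>K\<^esub> = \<zero>\<^bsub>Q\<^esub>"
proof -
 have "tht \<one>\<^bsub>K\<^esub> +.\<^bsub>Q\<^esub> tht \<one>\<^bsub>K\<^esub> = tht \<one>\<^bsub>K\<^esub>" using tht_mult[of "\<one>\<^bsub>K\<^esub>" "\<one>\<^bsub>K\<^esub>"] thtc h_simps(4) by simp
 then show ?thesis using thtc by (metis K.one_closed Q.add.r_cancel_one)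
qed

lemma tht_finsum:
 "[|finite I; f : I \<rightarrow> carrier K|] ==> tht (finsum K f I) = (\<Oplus>\<^bsub>Q\<^esub>i\<in>I. tht (f i))"
proof (induct set: finite)
 case empty then show ?case by (simp add: tht_zero)
next
 case (insert i I)
 then show ?case using thtc by (simp add: tht_add Pi_def)
qed

definition constants where "constants = {x : carrier K. tht x = \<zero>\<^bsub>Q\<^esub>}"

lemma constants_closed: "x : constants ==> x : carrier K"
 by (simp add: constants_def)

lemma constants_smult: "x : constants ==> c \<odot>\<^bsub>K\<^esub> x : constants"
 by (simp add: constants_def tht_smult)

lemma constants_mult: "[|x : constants; y : constants|] ==> x **\<^bsub>K\<^esub> y : constants"
 using h_simps(1) by (simp add: constants_def tht_mult)

lemma constants_pow: "x : constants ==> x [^]\<^bsub>K\<^esub> (k::nat) : constants"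
proof (induct k)
 case 0 then show ?case by (simp add: constants_def tht_one)
next
 case (Suc k) then show ?case by (simp add: constants_mult)
qed

lemma constants_finprod: "[|finite I; !!i. i : I ==> f i : constants|] ==> finprod K f I : constants"
proof (induct set: finite)
 case empty then show ?case by (simp add: constants_def tht_one)
next
 case (insert i I)
 then show ?case using constants_closed by (simp add: constants_mult Pi_def)
qed

lemma constants_finsum: "[|finite I; !!i. i : I ==> f i : constants|] ==> finsum K f I : constants"
proof (induct set: finite)
 case empty then show ?case by (simp add: constants_def tht_zero)
next
 case (insert i I)
 then have "f i +.\<^bsub>K\<^esub> finsum K f I : constants" by (simp add: constants_def tht_add)
 then show ?case using insert constants_closed by (simp add: Pi_def)
qed

lemma tht_pow:
 assumes x: "x : carrier K"
 shows "tht (x [^]\<^bsub>K\<^esub> Suc k) = h (of_nat (Suc k) \<odot>\<^bsub>K\<^esub> (x [^]\<^bsub>K\<^esub> k)) **\<^bsub>Q\<^esub> tht x"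
proof (induct k)
 case 0 then show ?case using x h_simps thtc by simp
next
 case (Suc k)
 define X where "X = x [^]\<^bsub>K\<^esub> Suc k"
 have X: "X : carrier K" "h X : carrier Q" "h x : carrier Q" "tht x : carrier Q" using x h_simps thtc by (auto simp: X_def)
 have hX: "h x **\<^bsub>Q\<^esub> h (of_nat (Suc k) \<odot>\<^bsub>K\<^esub> (x [^]\<^bsub>K\<^esub> k)) = of_nat (Suc k) \<odot>\<^bsub>Q\<^esub> h X"
 proof -
 have "x **\<^bsub>K\<^esub> (of_nat (Suc k) \<odot>\<^bsub>K\<^esub> (x [^]\<^bsub>K\<^esub> k)) = of_nat (Suc k) \<odot>\<^bsub>K\<^esub> X"
 using x K_comm[of x "x [^]\<^bsub>K\<^esub> k"] by (simp add: X_def del: of_nat_Suc)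
 then show ?thesis using h_simps(2)[of x "of_nat (Suc k) \<odot>\<^bsub>K\<^esub> (x [^]\<^bsub>K\<^esub> k)"] h_simps(5)[OF X(1)] x by simp
 qed
 have "tht (x [^]\<^bsub>K\<^esub> Suc (Suc k)) = tht (X **\<^bsub>K\<^esub> x)" by (simp add: X_def)
 also have "... = h X **\<^bsub>Q\<^esub> tht x +.\<^bsub>Q\<^esub> h x **\<^bsub>Q\<^esub> (h (of_nat (Suc k) \<odot>\<^bsub>K\<^esub> (x [^]\<^bsub>K\<^esub> k)) **\<^bsub>Q\<^esub> tht x)"
 using Suc X x by (simp add: tht_mult X_def)
 also have "... = 1 \<odot>\<^bsub>Q\<^esub> (h X **\<^bsub>Q\<^esub> tht x) +.\<^bsub>Q\<^esub> of_nat (Suc k) \<odot>\<^bsub>Q\<^esub> (h X **\<^bsub>Q\<^esub> tht x)"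
 using X x h_simps(1) hX by (simp add: Q.m_assoc[symmetric] del: of_nat_Suc)
 also have "... = of_nat (Suc (Suc k)) \<odot>\<^bsub>Q\<^esub> (h X **\<^bsub>Q\<^esub> tht x)"
 using X by (subst Q.smult_add_left[symmetric]) auto
 also have "... = h (of_nat (Suc (Suc k)) \<odot>\<^bsub>K\<^esub> X) **\<^bsub>Q\<^esub> tht x" using X by (simp add: h_simps(5) del: of_nat_Suc)
 finally show ?case by (simp add: X_def)
qed

text \<open>Differentiating the relation treats the coefficients as constants, multiplies the
  \<open>k\<close>-th one by \<open>k\<close> and lowers the degree. Induction kills the
  coefficients with positive index in characteristic 0, and the constant term follows.\<close>

lemma transcendental_over_constants:
 assumes x: "x : carrier K" "tht x ~= \<zero>\<^bsub>Q\<^esub>"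
 shows "[|!!k. k <= (d::nat) ==> p k : constants; (\<Oplus>\<^bsub>K\<^esub>k\<in>{..d}. p k **\<^bsub>K\<^esub> x [^]\<^bsub>K\<^esub> k) = \<zero>\<^bsub>K\<^esub>; k <= d|] ==> p k = \<zero>\<^bsub>K\<^esub>"
proof (induct d arbitrary: p k)
 case 0
 then show ?case using constants_closed by simp
next
 case (Suc d)
 have pc: "p k : carrier K" if "k <= Suc d" for k using Suc that constants_closed by blast
 define S where "S = (\<Oplus>\<^bsub>K\<^esub>k\<in>{..d}. (of_nat (Suc k) \<odot>\<^bsub>K\<^esub> p (Suc k)) **\<^bsub>K\<^esub> x [^]\<^bsub>K\<^esub> k)"
 have Sc: "S : carrier K" unfolding S_def using pc x by (intro K.finsum_closed) auto
 have c1: "h (p k) : carrier Q" if "k <= Suc d" for k using pc[OF that] h_simps by blast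
 have t0: "tht (p k **\<^bsub>K\<^esub> x [^]\<^bsub>K\<^esub> k) = h (p k) **\<^bsub>Q\<^esub> tht (x [^]\<^bsub>K\<^esub> k)" if "k <= Suc d" for k
 using Suc(2)[OF that] pc[OF that] x h_simps(1) thtc by (simp add: tht_mult constants_def)
 have "\<zero>\<^bsub>Q\<^esub> = tht (\<Oplus>\<^bsub>K\<^esub>k\<in>{..Suc d}. p k **\<^bsub>K\<^esub> x [^]\<^bsub>K\<^esub> k)" using Suc by (simp add: tht_zero)
 also have "... = (\<Oplus>\<^bsub>Q\<^esub>k\<in>{..Suc d}. tht (p k **\<^bsub>K\<^esub> x [^]\<^bsub>K\<^esub> k))"
 using pc x by (intro tht_finsum) auto
 also have "... = (\<Oplus>\<^bsub>Q\<^esub>k\<in>{..d}. tht (p (Suc k) **\<^bsub>K\<^esub> x [^]\<^bsub>K\<^esub> (Suc k))) +.\<^bsub>Q\<^esub> tht (p 0 **\<^bsub>K\<^esub> x [^]\<^bsub>K\<^esub> (0::nat))"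
 using pc x thtc by (intro Q.finsum_Suc2) auto
 also have "tht (p 0 **\<^bsub>K\<^esub> x [^]\<^bsub>K\<^esub> (0::nat)) = \<zero>\<^bsub>Q\<^esub>" using Suc(2)[of 0] pc[of 0] by (simp add: constants_def)
 also have "(\<Oplus>\<^bsub>Q\<^esub>k\<in>{..d}. tht (p (Suc k) **\<^bsub>K\<^esub> x [^]\<^bsub>K\<^esub> (Suc k))) = (\<Oplus>\<^bsub>Q\<^esub>k\<in>{..d}. h ((of_nat (Suc k) \<odot>\<^bsub>K\<^esub> p (Suc k)) **\<^bsub>K\<^esub> x [^]\<^bsub>K\<^esub> k) **\<^bsub>Q\<^esub> tht x)"
 proof (intro Q.finsum_cong' refl)
 fix k assume k: "k : {..d}"
 have "tht (p (Suc k) **\<^bsub>K\<^esub> x [^]\<^bsub>K\<^esub> (Suc k)) = h (p (Suc k) **\<^bsub>K\<^esub> (of_nat (Suc k) \<odot>\<^bsub>K\<^esub> (x [^]\<^bsub>K\<^esub> k))) **\<^bsub>Q\<^esub> tht x"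
 proof -
 define Y where "Y = of_nat (Suc k) \<odot>\<^bsub>K\<^esub> (x [^]\<^bsub>K\<^esub> k)"
 have Y: "Y : carrier K" "h Y : carrier Q" "tht x : carrier Q" "p (Suc k) : carrier K" "h (p (Suc k)) : carrier Q"
 using x pc k h_simps(1) thtc by (auto simp: Y_def)
 show ?thesis using t0[of "Suc k"] tht_pow[OF x(1), of k] k Y unfolding Y_def[symmetric] by (simp add: h_simps(2) Q.m_assoc)
 qed
 also have "p (Suc k) **\<^bsub>K\<^esub> (of_nat (Suc k) \<odot>\<^bsub>K\<^esub> (x [^]\<^bsub>K\<^esub> k)) = (of_nat (Suc k) \<odot>\<^bsub>K\<^esub> p (Suc k)) **\<^bsub>K\<^esub> x [^]\<^bsub>K\<^esub> k"
 using k pc x by (simp del: of_nat_Suc)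
 finally show "tht (p (Suc k) **\<^bsub>K\<^esub> x [^]\<^bsub>K\<^esub> (Suc k)) = h ((of_nat (Suc k) \<odot>\<^bsub>K\<^esub> p (Suc k)) **\<^bsub>K\<^esub> x [^]\<^bsub>K\<^esub> k) **\<^bsub>Q\<^esub> tht x" .
 qed (use pc x h_simps(1) thtc in auto)
 also have "... = (\<Oplus>\<^bsub>Q\<^esub>k\<in>{..d}. h ((of_nat (Suc k) \<odot>\<^bsub>K\<^esub> p (Suc k)) **\<^bsub>K\<^esub> x [^]\<^bsub>K\<^esub> k)) **\<^bsub>Q\<^esub> tht x"
 using pc x h_simps(1) thtc by (intro Q.finsum_ldistr[symmetric]) auto
 also have "(\<Oplus>\<^bsub>Q\<^esub>k\<in>{..d}. h ((of_nat (Suc k) \<odot>\<^bsub>K\<^esub> p (Suc k)) **\<^bsub>K\<^esub> x [^]\<^bsub>K\<^esub> k)) = h S" unfolding S_def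
 using pc x by (intro algebra_hom_finsum[OF K.calgebra_axioms Q.calgebra_axioms h, symmetric]) auto
 finally have "h S **\<^bsub>Q\<^esub> tht x = \<zero>\<^bsub>Q\<^esub>" using Sc h_simps(1) thtc x by simp
 then have "h S = \<zero>\<^bsub>Q\<^esub>" using Q.no_zero_div[of "h S" "tht x"] Sc h_simps(1) thtc x by blast
 then have "S = \<zero>\<^bsub>K\<^esub>" using algebra_hom_inv(1)[OF K.calgebra_axioms Q.calgebra_axioms h K Q Sc] by blast
 then have "of_nat (Suc k) \<odot>\<^bsub>K\<^esub> p (Suc k) = \<zero>\<^bsub>K\<^esub>" if "k <= d" for k
 using Suc(1)[of "%k. of_nat (Suc k) \<odot>\<^bsub>K\<^esub> p (Suc k)" k] that constants_smult Suc(2) unfolding S_def by blast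
 then have z: "p (Suc k) = \<zero>\<^bsub>K\<^esub>" if "k <= d" for k
 using that pc[of "Suc k"] K.smult_eq_zero[of "p (Suc k)" "of_nat (Suc k)"] by (auto simp del: of_nat_Suc)
 have "\<zero>\<^bsub>K\<^esub> = (\<Oplus>\<^bsub>K\<^esub>k\<in>{..d}. p (Suc k) **\<^bsub>K\<^esub> x [^]\<^bsub>K\<^esub> (Suc k)) +.\<^bsub>K\<^esub> p 0 **\<^bsub>K\<^esub> x [^]\<^bsub>K\<^esub> (0::nat)"
 unfolding Suc(3)[symmetric] using pc x by (intro K.finsum_Suc2) auto
 also have "(\<Oplus>\<^bsub>K\<^esub>k\<in>{..d}. p (Suc k) **\<^bsub>K\<^esub> x [^]\<^bsub>K\<^esub> (Suc k)) = (\<Oplus>\<^bsub>K\<^esub>k\<in>{..d}. \<zero>\<^bsub>K\<^esub>)"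
 using z x by (intro K.finsum_cong') auto
 finally have "p 0 = \<zero>\<^bsub>K\<^esub>" using pc[of 0] by simp
 then show ?case using z Suc(4) by (cases k) auto
qed

text \<open>Collecting a relation by powers of \<open>x\<close> leaves coefficients that are
  polynomials in \<open>B\<close>, hence constants of the derivation. They all vanish, and
  independence of \<open>B\<close> applies to each.\<close>

lemma independent_insert:
 assumes B: "alg_independent K B" "!!b. b : B ==> tht b = \<zero>\<^bsub>Q\<^esub>" and x: "x : carrier K" "tht x ~= \<zero>\<^bsub>Q\<^esub>"
 shows "alg_independent K (insert x B)"
proof -
 have fB: "finite B" "B <= carrier K" and indB: "!!E c. [|finite E; E <= (B \<rightarrow>\<^sub>E (UNIV :: nat set));
 (\<Oplus>\<^bsub>K\<^esub>e\<in>E. c e \<odot>\<^bsub>K\<^esub> (\<Otimes>\<^bsub>K\<^esub>b\<in>B. b [^]\<^bsub>K\<^esub> e b)) = \<zero>\<^bsub>K\<^esub>|] ==> \<forall>e\<in>E. c e = 0"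
 using B(1) by (auto simp: alg_independent_def)
 have xB: "x \<notin> B" using B x by blast
 have bc: "b : constants" if "b : B" for b using that fB B by (auto simp: constants_def)
 show ?thesis unfolding alg_independent_def
 proof (intro conjI allI impI)
 fix E :: "('k => nat) set" and c
 assume "finite E & E <= (insert x B \<rightarrow>\<^sub>E UNIV) & (\<Oplus>\<^bsub>K\<^esub>e\<in>E. c e \<odot>\<^bsub>K\<^esub> (\<Otimes>\<^bsub>K\<^esub>b\<in>insert x B. b [^]\<^bsub>K\<^esub> e b)) = \<zero>\<^bsub>K\<^esub>"
 then have E: "finite E" "E <= (insert x B \<rightarrow>\<^sub>E UNIV)" and s0: "(\<Oplus>\<^bsub>K\<^esub>e\<in>E. c e \<odot>\<^bsub>K\<^esub> (\<Otimes>\<^bsub>K\<^esub>b\<in>insert x B. b [^]\<^bsub>K\<^esub> e b)) = \<zero>\<^bsub>K\<^esub>" by auto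
 define mon where "mon e = (\<Otimes>\<^bsub>K\<^esub>b\<in>B. b [^]\<^bsub>K\<^esub> e b)" for e :: "'k => nat"
 have monL: "mon e : constants" for e unfolding mon_def using fB bc constants_pow by (intro constants_finprod) auto
 have monc: "mon e : carrier K" for e using monL constants_closed by blast
 \<comment> \<open>A bound for the exponents of \<open>x\<close>; inserting 0 gives the maximum a
   meaning when \<open>E\<close> is empty.\<close>
 define d where "d = Max (insert 0 ((%e. e x) ` E))"
 have dE: "e x <= d" if "e : E" for e unfolding d_def using E(1) that by (intro Max_ge) auto
 define Ek where "Ek k = {e : E. e x = k}" for k
 define p where "p k = (\<Oplus>\<^bsub>K\<^esub>e\<in>Ek k. c e \<odot>\<^bsub>K\<^esub> mon e)" for k
 have pL: "p k : constants" for k unfolding p_def using E monL by (intro constants_finsum constants_smult) (auto simp: Ek_def)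
 have "(\<Oplus>\<^bsub>K\<^esub>e\<in>E. c e \<odot>\<^bsub>K\<^esub> (\<Otimes>\<^bsub>K\<^esub>b\<in>insert x B. b [^]\<^bsub>K\<^esub> e b)) = (\<Oplus>\<^bsub>K\<^esub>e\<in>(\<Union>k\<in>{..d}. Ek k). (c e \<odot>\<^bsub>K\<^esub> mon e) **\<^bsub>K\<^esub> x [^]\<^bsub>K\<^esub> e x)"
 proof (intro K.finsum_cong')
 show "E = (\<Union>k\<in>{..d}. Ek k)" using dE by (auto simp: Ek_def)
 fix e
 have "(\<Otimes>\<^bsub>K\<^esub>b\<in>insert x B. b [^]\<^bsub>K\<^esub> e b) = x [^]\<^bsub>K\<^esub> e x **\<^bsub>K\<^esub> mon e" unfolding mon_def
 using fB xB x by (intro K.finprod_insert) auto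
 then show "c e \<odot>\<^bsub>K\<^esub> (\<Otimes>\<^bsub>K\<^esub>b\<in>insert x B. b [^]\<^bsub>K\<^esub> e b) = (c e \<odot>\<^bsub>K\<^esub> mon e) **\<^bsub>K\<^esub> x [^]\<^bsub>K\<^esub> e x"
 using x monc K_comm[of "mon e" "x [^]\<^bsub>K\<^esub> e x"] by simp
 qed (use x monc in auto)
 also have "... = (\<Oplus>\<^bsub>K\<^esub>k\<in>{..d}. \<Oplus>\<^bsub>K\<^esub>e\<in>Ek k. (c e \<odot>\<^bsub>K\<^esub> mon e) **\<^bsub>K\<^esub> x [^]\<^bsub>K\<^esub> e x)"
 using E x monc by (intro K.add.finprod_UN_disjoint) (auto simp: Ek_def pairwise_def disjnt_def)
 also have "... = (\<Oplus>\<^bsub>K\<^esub>k\<in>{..d}. p k **\<^bsub>K\<^esub> x [^]\<^bsub>K\<^esub> k)"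
 proof (intro K.finsum_cong' refl)
 fix k
 have "(\<Oplus>\<^bsub>K\<^esub>e\<in>Ek k. (c e \<odot>\<^bsub>K\<^esub> mon e) **\<^bsub>K\<^esub> x [^]\<^bsub>K\<^esub> e x) = (\<Oplus>\<^bsub>K\<^esub>e\<in>Ek k. (c e \<odot>\<^bsub>K\<^esub> mon e) **\<^bsub>K\<^esub> x [^]\<^bsub>K\<^esub> k)"
 using x monc by (intro K.finsum_cong') (auto simp: Ek_def)
 also have "... = p k **\<^bsub>K\<^esub> x [^]\<^bsub>K\<^esub> k" unfolding p_def
 using E x monc by (intro K.finsum_ldistr[symmetric]) (auto simp: Ek_def)
 finally show "(\<Oplus>\<^bsub>K\<^esub>e\<in>Ek k. (c e \<odot>\<^bsub>K\<^esub> mon e) **\<^bsub>K\<^esub> x [^]\<^bsub>K\<^esub> e x) = p k **\<^bsub>K\<^esub> x [^]\<^bsub>K\<^esub> k" .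
 qed (use pL constants_closed x in auto)
 finally have p0: "p k = \<zero>\<^bsub>K\<^esub>" if "k <= d" for k using transcendental_over_constants[OF x, of d p k] pL s0 that by simp
 show "\<forall>e\<in>E. c e = 0"
 proof
 fix e0 assume e0: "e0 : E"
 define k where "k = e0 x"
 \<comment> \<open>Exponent vectors with the same exponent of \<open>x\<close> are determined by
   their restriction to \<open>B\<close>, so the vanishing of \<open>p k\<close> is a relation for
   \<open>B\<close> with unchanged coefficients.\<close>
 define rho where "rho e = restrict e B" for e :: "'k => nat"
 have bk: "(rho e)(x := k) = e" if "e : Ek k" for e
 proof
 fix z show "((rho e)(x := k)) z = e z"
 using that E(2) xB by (auto simp: Ek_def rho_def PiE_def extensional_def subset_iff)
 qed
 have inj: "inj_on rho (Ek k)" by (rule inj_on_inverseI[of _ "%e. e(x := k)"]) (rule bk)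
 have mrho: "mon (rho e) = mon e" for e unfolding mon_def rho_def using fB by (intro K.finprod_cong') auto
 have "(\<Oplus>\<^bsub>K\<^esub>e\<in>rho ` Ek k. c (e(x := k)) \<odot>\<^bsub>K\<^esub> mon e) = (\<Oplus>\<^bsub>K\<^esub>e\<in>Ek k. c ((rho e)(x := k)) \<odot>\<^bsub>K\<^esub> mon (rho e))"
 using monc inj by (intro K.finsum_reindex) auto
 also have "... = p k" unfolding p_def using bk monc by (intro K.finsum_cong') (auto simp: mrho)
 also have "... = \<zero>\<^bsub>K\<^esub>" using p0 dE[OF e0] by (simp add: k_def)
 finally have "\<forall>e\<in>rho ` Ek k. c (e(x := k)) = 0"
 unfolding mon_def using E(1) by (intro indB) (auto simp: Ek_def rho_def)
 then show "c e0 = 0" using e0 bk[of e0] by (force simp: Ek_def k_def)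
 qed
 qed (use fB x in auto)
qed

end

section \<open>The transcendence degree of the function field\<close>

context rational_galois
begin

sublocale K: ore_domain A by (rule ore_domain)

abbreviation "KK == frac_algebra A"

sublocale KK: division_algebra KK by (rule K.frac_division_algebra)

text \<open>The embedding of the function field into Frac D(A), where its elements can be
  differentiated by commutators with \<open>dl i\<close>.\<close>

definition hh where "hh = frac_lift J QQ"

lemma hh_hom: "hh : algebra_hom KK QQ"
 unfolding hh_def by (rule K.frac_lift_hom[OF Q.division_algebra_axioms J_hom J_eq_zero])

lemmas hh_simps = algebra_homD[OF hh_hom]

lemma hh_embed: "a : carrier A ==> hh (K.frac_embed a) = J a"
 unfolding hh_def by (rule K.frac_lift_embed[OF Q.division_algebra_axioms J_hom J_eq_zero])

lemma hh_eq_zero: "[|z : carrier KK; hh z = zQ|] ==> z = \<zero>\<^bsub>KK\<^esub>"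
 unfolding hh_def by (rule K.frac_lift_eq_zero[OF Q.division_algebra_axioms J_hom J_eq_zero])

text \<open>Multiplying numerator and denominator by the cofactor of the norm makes the denominator
  invariant. This matters because invariants lie in every skew subfield with scalars that contains
  the coordinates.\<close>

lemma KK_quotient:
 assumes "z : carrier KK"
 shows "EX a c. a : carrier A & c : fixed & c ~= \<zero> & hh z = J a \<cdot> invQ (J c)"
proof -
 obtain a s where s: "a : carrier A" "s : carrier A - {\<zero>}" "z = K.frac_embed a **\<^bsub>KK\<^esub> inv\<^bsub>KK\<^esub> (K.frac_embed s)"
 using K.frac_quotientE[OF assms] by metis
 then have sn: "s : carrier A" "s ~= \<zero>" by auto
 have es: "K.frac_embed s : carrier KK" "K.frac_embed s ~= \<zero>\<^bsub>KK\<^esub>"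
 using sn algebra_homD(1)[OF K.frac_embed_hom] K.frac_embed_eq_zero by blast+
 have hz: "hh z = J a \<cdot> invQ (J s)" unfolding s(3)
 using s(1) sn es algebra_homD(1)[OF K.frac_embed_hom] algebra_hom_inv(2)[OF KK.calgebra_axioms Q.calgebra_axioms hh_hom KK.division_algebra_axioms Q.division_algebra_axioms es]
 by (simp add: hh_simps(2) hh_embed)
 obtain b where b: "b : carrier A" "s ** b : fixed" "s ** b ~= \<zero>" using norm_exists[OF sn] .
 have b0: "b ~= \<zero>" using b(3) sn by auto
 have "J (a ** b) \<cdot> invQ (J (s ** b)) = J a \<cdot> (J b \<cdot> invQ (J s \<cdot> J b))"
 using s(1) sn b b0 J_nz Q.mult_nonzero by (simp add: J_simps Q.m_assoc)
 also have "... = hh z" unfolding hz using s(1) sn b b0 J_nz by (simp add: Q.inv_mult')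
 finally have "hh z = J (a ** b) \<cdot> invQ (J (s ** b))" by (rule sym)
 moreover have "a ** b : carrier A" using s(1) b(1) by simp
 ultimately show ?thesis using b(2,3) by (intro exI[of _ "a ** b"] exI[of _ "s ** b"] conjI)
qed

text \<open>In Frac D(A) centralizers are skew subfields: the image of the function field
  centralizes the functions, hence also itself.\<close>

lemma KK_comm: assumes "x : carrier KK" "z : carrier KK" shows "x **\<^bsub>KK\<^esub> z = z **\<^bsub>KK\<^esub> x"
proof -
 have Jc: "J a : {q : carrier QQ. q \<cdot> J b = J b \<cdot> q}" if "a : carrier A" "b : carrier A" for a b using that J_comm by auto
 have gen: "hh x : T" if T: "Q.div_subring T" "!!a. a : carrier A ==> J a : T" and x: "x : carrier KK" for T x
 proof -
 obtain a c where ac: "a : carrier A" "c : fixed" "c ~= \<zero>" "hh x = J a \<cdot> invQ (J c)" using KK_quotient[OF x] by blast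
 have cc: "c : carrier A" by (rule fixedD(1)[OF ac(2)])
 have "invQ (J c) : T" by (rule Q.div_subring_inv[OF T(1) T(2)[OF cc] J_nz[OF cc ac(3)]])
 then show ?thesis unfolding ac(4) using T(1) T(2)[OF ac(1)] by (simp add: Q.div_subring_def)
 qed
 have 1: "hh x \<cdot> J b = J b \<cdot> hh x" if "b : carrier A" for b
 using gen[OF Q.centralizer_div_subring(1)[of "J b"] Jc assms(1)] that by auto
 have "hh z \<cdot> hh x = hh x \<cdot> hh z"
 using gen[OF Q.centralizer_div_subring(1)[of "hh x"] _ assms(2)] 1 hh_simps(1)[OF assms(1)] by auto
 then have "hh (x **\<^bsub>KK\<^esub> z) = hh (z **\<^bsub>KK\<^esub> x)" using assms by (simp add: hh_simps(2))
 then show ?thesis using algebra_hom_inj_on[OF KK.calgebra_axioms Q.calgebra_axioms hh_hom hh_eq_zero] assms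
 by (auto dest: inj_onD)
qed

abbreviation "HH == hh ` carrier KK"

lemmas HH = image_div_subring[OF KK.division_algebra_axioms Q.division_algebra_axioms hh_hom]

lemma HH_comm: "[|x : HH; z : HH|] ==> x \<cdot> z = z \<cdot> x"
proof -
 assume "x : HH" "z : HH"
 then obtain a b where ab: "x = hh a" "z = hh b" "a : carrier KK" "b : carrier KK" by (elim imageE)
 show "x \<cdot> z = z \<cdot> x"
 unfolding ab(1,2) hh_simps(2)[OF ab(3,4), symmetric] hh_simps(2)[OF ab(4,3), symmetric] KK_comm[OF ab(3,4)] ..
qed

lemma HH_closed: "x : HH ==> x : carrier QQ" using hh_simps(1) by auto

lemma J_HH: "a : carrier A ==> J a : HH"
 using hh_embed algebra_homD(1)[OF K.frac_embed_hom] by (metis imageI)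

lemma HH_ops: "[|a : HH; b : HH|] ==> a \<cdot> b : HH" "[|a : HH; b : HH|] ==> a +++ b : HH" "a : HH ==> \<ominus>\<^bsub>QQ\<^esub> a : HH"
 "[|a : HH; a ~= zQ|] ==> invQ a : HH" "zQ : HH" "oneQ : HH"
 using HH(1) Q.div_subring_inv[OF HH(1)] by (auto simp: Q.div_subring_def)

lemma y_HH: "i < n ==> y i : HH"
 unfolding y_def using J_HH uc wc w_nz J_nz HH_ops by metis

lemma HH_subset:
 assumes T: "Q.div_subring T" "!!a. a : carrier A ==> J a : T" shows "HH <= T"
proof
 fix q assume "q : HH"
 then obtain a c where ac: "a : carrier A" "c : fixed" "c ~= \<zero>" "q = J a \<cdot> invQ (J c)" using KK_quotient by blast
 have cc: "c : carrier A" by (rule fixedD(1)[OF ac(2)])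
 have "invQ (J c) : T" by (rule Q.div_subring_inv[OF T(1) T(2)[OF cc] J_nz[OF cc ac(3)]])
 then show "q : T" unfolding ac(4) using T(1) T(2)[OF ac(1)] by (simp add: Q.div_subring_def)
qed

text \<open>By the product and quotient rules the elements of the function field that
  \<open>dl i\<close> maps into it form a skew subfield, and it contains the functions.\<close>

lemma ad_dl_HH: assumes "i < n" "q : HH" shows "Q.ad q (dl i) : HH"
proof -
 define T where "T = {q : HH. Q.ad q (dl i) : HH}"
 have TD: "q : HH" "q : carrier QQ" "Q.ad q (dl i) : HH" if "q : T" for q using that HH_closed unfolding T_def by blast+
 note d = dl_closed[OF assms(1)]
 have "Q.div_subring T"
 proof (rule Q.div_subringI)
 show "T <= carrier QQ" using TD by blast
 have "Q.ad oneQ (dl i) = zQ" using d by (simp add: Q.ad_eq_zero_iff)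
 then show "oneQ : T" using HH_ops by (simp add: T_def)
 fix p assume p: "p : T"
 note P = TD[OF p]
 have "Q.ad (c *. p) (dl i) = c *. Q.ad p (dl i)" for c
 unfolding Q.ad_def a_minus_def using d P(2) by (simp add: Q.smult_add_right Q.smult_minus_right)
 then show "c *. p : T" for c using HH(2)[rule_format, OF P(1), of c] HH(2)[rule_format, OF P(3), of c] unfolding T_def by simp
 show "invQ p : T" if nz: "p ~= zQ"
 proof -
 define V where "V = invQ p"
 have V: "V : carrier QQ" "V \<cdot> p = oneQ" "p \<cdot> V = oneQ" "V : HH" using P nz HH_ops(4) by (auto simp: V_def)
 have "\<ominus>\<^bsub>QQ\<^esub> (V \<cdot> Q.ad p (dl i) \<cdot> V) = (V \<cdot> p) \<cdot> dl i \<cdot> V --- V \<cdot> dl i \<cdot> (p \<cdot> V)"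
 unfolding Q.ad_def using V(1) P(2) d by algebra
 also have "... = Q.ad V (dl i)" unfolding V(2,3) Q.ad_def using V(1) d by simp
 finally show ?thesis using HH_ops(1,3) V(4) P(3) unfolding T_def V_def[symmetric] by (metis (mono_tags, lifting) mem_Collect_eq)
 qed
 fix q assume q: "q : T"
 note R = TD[OF q]
 have "Q.ad (p +++ q) (dl i) = Q.ad p (dl i) +++ Q.ad q (dl i)" unfolding Q.ad_def using d P(2) R(2) by algebra
 then show "p +++ q : T" using P R HH_ops(2) unfolding T_def by simp
 have "Q.ad (p \<cdot> q) (dl i) = Q.ad p (dl i) \<cdot> q +++ p \<cdot> Q.ad q (dl i)" unfolding Q.ad_def using d P(2) R(2) by algebra
 then show "p \<cdot> q : T" using P R HH_ops(1,2) unfolding T_def by simp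
 qed
 moreover have "J a : T" if a: "a : carrier A" for a
 proof -
 have "invQ (J g) \<cdot> J (p i a) : HH"
 by (rule HH_ops(1)[OF HH_ops(4)[OF J_HH[OF gc] J_nz[OF gc g_nz]] J_HH[OF p_apply_closed[OF assms(1) a]]])
 then show ?thesis using ad_dl_J[OF assms(1) a] J_HH[OF a] by (simp add: T_def)
 qed
 ultimately have "HH <= T" by (rule HH_subset)
 then show ?thesis using assms(2) TD(3) by blast
qed

text \<open>With fewer than \<open>n\<close> elements in \<open>B\<close>, a nonzero combination of
  the \<open>n\<close> partial derivatives annihilates \<open>B\<close>. It does not annihilate some
  coordinate, which could then be added to \<open>B\<close>, contradicting maximality.\<close>

lemma dimension_lower:
 assumes B: "transcendence_basis KK B" shows "n <= card B"
proof (rule ccontr)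
 assume "\<not> n <= card B"
 have B1: "alg_independent KK B" "finite B" "B <= carrier KK" using B by (auto simp: transcendence_basis_def alg_independent_def)
 have "EX c. (\<forall>j\<in>{..<n}. c j : HH) & (\<exists>j\<in>{..<n}. c j ~= zQ) & (\<forall>b\<in>B. (\<Oplus>\<^bsub>QQ\<^esub>j\<in>{..<n}. Q.ad (hh b) (dl j) \<cdot> c j) = zQ)"
 by (rule Q.underdetermined_system[OF HH(1) Q.one_neq_zero B1(2)]) (use \<open>\<not> n <= card B\<close> ad_dl_HH B1(3) in auto)
 then obtain c where c: "\<forall>j\<in>{..<n}. c j : HH" "\<exists>j\<in>{..<n}. c j ~= zQ" "\<forall>b\<in>B. (\<Oplus>\<^bsub>QQ\<^esub>j\<in>{..<n}. Q.ad (hh b) (dl j) \<cdot> c j) = zQ"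
 by - (elim exE conjE, rule that, assumption+)
 \<comment> \<open>The combination of the partial derivatives with the solution of the linear system
   as coefficients. The commutator of \<open>dl j\<close> with \<open>hh z\<close> is the
   \<open>j\<close>-th partial derivative of \<open>z\<close>.\<close>
 define tht where "tht z = (\<Oplus>\<^bsub>QQ\<^esub>j\<in>{..<n}. Q.ad (hh z) (dl j) \<cdot> c j)" for z
 have cc: "c j : HH" "c j : carrier QQ" if "j < n" for j using c(1) HH_closed that by auto
 have hc: "hh z : carrier QQ" "hh z : HH" if "z : carrier KK" for z using that hh_simps(1) by auto
 interpret F: field_derivation KK QQ hh tht
 proof
 show "x **\<^bsub>KK\<^esub> z = z **\<^bsub>KK\<^esub> x" if "x : carrier KK" "z : carrier KK" for x z using KK_comm that .
 show "hh : algebra_hom KK QQ" by (rule hh_hom)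
 fix x assume x: "x : carrier KK"
 show "tht x : carrier QQ" unfolding tht_def using cc hc x by (intro Q.finsum_closed) auto
 show "tht (k \<odot>\<^bsub>KK\<^esub> x) = k *. tht x" for k
 proof -
 have "tht (k \<odot>\<^bsub>KK\<^esub> x) = (\<Oplus>\<^bsub>QQ\<^esub>j\<in>{..<n}. k *. (Q.ad (hh x) (dl j) \<cdot> c j))" unfolding tht_def
 proof (intro Q.finsum_cong' refl)
 fix j assume j: "j : {..<n}"
 have "Q.ad (k *. hh x) (dl j) = k *. Q.ad (hh x) (dl j)"
 unfolding Q.ad_def a_minus_def using j hc x by (simp add: Q.smult_add_right Q.smult_minus_right)
 then show "Q.ad (hh (k \<odot>\<^bsub>KK\<^esub> x)) (dl j) \<cdot> c j = k *. (Q.ad (hh x) (dl j) \<cdot> c j)"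
 using j hc x cc by (simp add: hh_simps(5))
 qed (use cc hc x in auto)
 also have "... = k *. tht x" unfolding tht_def using cc hc x by (intro Q.smult_finsum[symmetric]) auto
 finally show ?thesis .
 qed
 fix z assume z: "z : carrier KK"
 show "tht (x +.\<^bsub>KK\<^esub> z) = tht x +++ tht z"
 proof -
 have "tht (x +.\<^bsub>KK\<^esub> z) = (\<Oplus>\<^bsub>QQ\<^esub>j\<in>{..<n}. Q.ad (hh x) (dl j) \<cdot> c j +++ Q.ad (hh z) (dl j) \<cdot> c j)" unfolding tht_def
 proof (intro Q.finsum_cong' refl)
 fix j assume j: "j : {..<n}"
 show "Q.ad (hh (x +.\<^bsub>KK\<^esub> z)) (dl j) \<cdot> c j = Q.ad (hh x) (dl j) \<cdot> c j +++ Q.ad (hh z) (dl j) \<cdot> c j"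
 unfolding hh_simps(3)[OF x z] Q.ad_def using hc(1)[OF x] hc(1)[OF z] dl_closed[of j] cc(2)[of j] j unfolding lessThan_iff by algebra
 qed (use cc hc x z in auto)
 also have "... = tht x +++ tht z" unfolding tht_def using cc hc x z by (intro Q.finsum_addf) auto
 finally show ?thesis .
 qed
 show "tht (x **\<^bsub>KK\<^esub> z) = hh x \<cdot> tht z +++ hh z \<cdot> tht x"
 proof -
 have "tht (x **\<^bsub>KK\<^esub> z) = (\<Oplus>\<^bsub>QQ\<^esub>j\<in>{..<n}. hh x \<cdot> (Q.ad (hh z) (dl j) \<cdot> c j) +++ hh z \<cdot> (Q.ad (hh x) (dl j) \<cdot> c j))" unfolding tht_def
 proof (intro Q.finsum_cong' refl)
 fix j assume "j : {..<n}"
 then have j: "j < n" by simp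
 note a = hc(1)[OF x] hc(1)[OF z] dl_closed[OF j] cc(2)[OF j]
 have "Q.ad (hh x \<cdot> hh z) (dl j) = Q.ad (hh x) (dl j) \<cdot> hh z +++ hh x \<cdot> Q.ad (hh z) (dl j)"
 unfolding Q.ad_def using a(1-3) by algebra
 also have "Q.ad (hh x) (dl j) \<cdot> hh z = hh z \<cdot> Q.ad (hh x) (dl j)"
 by (rule HH_comm[OF ad_dl_HH[OF j hc(2)[OF x]] hc(2)[OF z]])
 finally show "Q.ad (hh (x **\<^bsub>KK\<^esub> z)) (dl j) \<cdot> c j = hh x \<cdot> (Q.ad (hh z) (dl j) \<cdot> c j) +++ hh z \<cdot> (Q.ad (hh x) (dl j) \<cdot> c j)"
 unfolding hh_simps(2)[OF x z] using a by (simp add: Q.l_distr Q.m_assoc Q.a_comm)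
 qed (use cc hc x z in auto)
 also have "... = (\<Oplus>\<^bsub>QQ\<^esub>j\<in>{..<n}. hh x \<cdot> (Q.ad (hh z) (dl j) \<cdot> c j)) +++ (\<Oplus>\<^bsub>QQ\<^esub>j\<in>{..<n}. hh z \<cdot> (Q.ad (hh x) (dl j) \<cdot> c j))"
 using cc hc x z by (intro Q.finsum_addf) auto
 also have "... = hh x \<cdot> tht z +++ hh z \<cdot> tht x"
 unfolding tht_def using cc hc x z by (intro arg_cong2[of _ _ _ _ "add QQ"] Q.finsum_rdistr[symmetric]) auto
 finally show ?thesis .
 qed
 qed
 obtain j where j: "j < n" "c j ~= zQ" using c(2) by auto
 obtain x where x: "x : carrier KK" "hh x = y j" using y_HH[OF j(1)] by (metis imageE)
 \<comment> \<open>By duality of coordinates and derivatives only the coefficient \<open>c j\<close>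
   survives.\<close>
 have "tht x = (\<Oplus>\<^bsub>QQ\<^esub>i\<in>{..<n}. if j = i then c i else zQ)" unfolding tht_def x(2)
 using cc j by (intro Q.finsum_cong') (auto simp: ad_y_dl)
 also have "... = c j" using cc j by (intro Q.add.finprod_singleton) auto
 finally have nz: "tht x ~= zQ" using j by simp
 have "alg_independent KK (insert x B)"
 by (rule F.independent_insert[OF B1(1) _ x(1) nz]) (use c(3) in \<open>auto simp: tht_def\<close>)
 moreover have "x \<notin> B" using nz c(3) by (auto simp: tht_def)
 ultimately show False using B x(1) by (auto simp: transcendence_basis_def)
qed


abbreviation "Pol == Q.filt (y ` {..<n})"

lemma y_image: "y ` {..<n} <= carrier QQ" by auto

lemma Pol_HH: "x : Pol N ==> x : HH"
proof (induct rule: Q.filt_induct[OF y_image, consumes 1, case_names zero step])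
 case zero then show ?case by (rule HH_ops)
next
 case (step ws x c)
 have "set ws <= y ` {..<n} ==> Q.wprod ws : HH" for ws
 by (induct ws) (auto simp: HH_ops y_HH)
 from this[OF step(1)] have "c *. Q.wprod ws : HH" by (rule HH(2)[rule_format])
 then show ?case by (rule HH_ops(2)[OF _ step(4)])
qed

lemma HH_swap:
 assumes "a : HH" "b : HH" "c : HH" "d : HH"
 shows "(a \<cdot> b) \<cdot> (c \<cdot> d) = (a \<cdot> c) \<cdot> (b \<cdot> d)"
proof -
 note k = assms[THEN HH_closed]
 have "(a \<cdot> b) \<cdot> (c \<cdot> d) = a \<cdot> ((b \<cdot> c) \<cdot> d)" using k by (simp add: Q.m_assoc)
 also have "b \<cdot> c = c \<cdot> b" by (rule HH_comm[OF assms(2,3)])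
 finally show ?thesis using k by (simp add: Q.m_assoc)
qed

text \<open>The field of rational functions in the coordinates, as a subset of the function field:
  some nonzero polynomial in \<open>y\<close> serves as denominator. \<open>Pol N\<close> consists
  of the polynomials of degree at most \<open>N\<close>.\<close>

definition F0 where "F0 = {q : HH. EX N. \<exists>r\<in>Pol N. r ~= zQ & r \<cdot> q : Pol N}"

lemma F0_div_subring: "Q.div_subring F0" "ALL c. \<forall>q\<in>F0. c *. q : F0" "!!i. i < n ==> y i : F0"
proof -
 note fm = Q.filt_mult[OF y_image] and fa = Q.filt_add[OF y_image] and mono = Q.filt_mono[OF y_image]
 have F0I: "q : F0" if "q : HH" "r : Pol N" "r ~= zQ" "r \<cdot> q : Pol N" for q r N using that by (auto simp: F0_def)
 show sm: "ALL c. \<forall>q\<in>F0. c *. q : F0"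
 proof (intro allI ballI)
 fix c q assume "q : F0"
 then obtain N r where r: "q : HH" "r : Pol N" "r ~= zQ" "r \<cdot> q : Pol N" by (auto simp: F0_def)
 then have "r \<cdot> (c *. q) = c *. (r \<cdot> q)" using HH_closed Pol_HH by simp
 then show "c *. q : F0" using r HH(2) Q.filt_smult[OF y_image r(4)] by (intro F0I[OF _ r(2,3)]) auto
 qed
 have oneP: "oneQ : Pol N" for N by (rule Q.filt_one[OF y_image])
 show "y i : F0" if "i < n" for i
 using that Q.filt_gen[OF y_image, of "y i" 0] by (intro F0I[OF y_HH oneP[of "Suc 0"]]) auto
 show "Q.div_subring F0"
 proof (rule Q.div_subringI)
 show "F0 <= carrier QQ" using HH_closed by (auto simp: F0_def)
 show "oneQ : F0" using oneP[of 0] HH_ops by (intro F0I[of _ "oneQ" 0]) auto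
 show "c *. p : F0" if "p : F0" for c p using sm that by blast
 fix p assume "p : F0"
 then obtain N r where r: "p : HH" "r : Pol N" "r ~= zQ" "r \<cdot> p : Pol N" by (auto simp: F0_def)
 have rc: "p : carrier QQ" "r : carrier QQ" "r : HH" using r(1) HH_closed Pol_HH[OF r(2)] by auto
 show "invQ p : F0" if nz: "p ~= zQ"
 using rc nz r Q.mult_nonzero[of r p] HH_ops(4)[OF r(1) nz] by (intro F0I[of _ "r \<cdot> p" N]) (auto simp: Q.m_assoc)
 fix q assume "q : F0"
 then obtain M t where t: "q : HH" "t : Pol M" "t ~= zQ" "t \<cdot> q : Pol M" by (auto simp: F0_def)
 have tc: "q : carrier QQ" "t : carrier QQ" "t : HH" using t(1) HH_closed Pol_HH[OF t(2)] by auto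
 have rt: "r \<cdot> t : Pol (N + M)" "r \<cdot> t ~= zQ" using fm[OF r(2) t(2)] Q.mult_nonzero[of r t] rc tc r(3) t(3) by auto
 have "(r \<cdot> t) \<cdot> (p \<cdot> q) : Pol (N + M)"
 unfolding HH_swap[OF rc(3) tc(3) r(1) t(1)] by (rule fm[OF r(4) t(4)])
 then show "p \<cdot> q : F0" by (intro F0I[OF HH_ops(1)[OF r(1) t(1)] rt])
 have "(r \<cdot> t) \<cdot> (p +++ q) = (r \<cdot> t) \<cdot> (p \<cdot> oneQ) +++ r \<cdot> (t \<cdot> q)"
 using rc(1,2) tc(1,2) by (simp add: Q.r_distr Q.m_assoc)
 also have "... : Pol (N + M)"
 unfolding HH_swap[OF rc(3) tc(3) r(1) HH_ops(6)] using tc by (intro fa fm[OF r(4)] fm[OF r(2) t(4)]) (simp add: t(2))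
 finally show "p +++ q : F0" by (intro F0I[OF HH_ops(2)[OF r(1) t(1)] rt])
 qed
qed

lemma common_denominator:
 "[|finite C; C <= F0|] ==> EX N. \<exists>r\<in>Pol N. r ~= zQ & (\<forall>c\<in>C. r \<cdot> c : Pol N)"
proof (induct set: finite)
 case empty
 then show ?case using Q.filt_one[OF y_image] by (intro exI[of _ 0] bexI[of _ "oneQ"]) auto
next
 case (insert p C)
 then obtain M t where t: "t : Pol M" "t ~= zQ" "\<forall>c\<in>C. t \<cdot> c : Pol M" by auto
 obtain N r where r: "p : HH" "r : Pol N" "r ~= zQ" "r \<cdot> p : Pol N" using insert by (auto simp: F0_def)
 have k: "p : carrier QQ" "r : carrier QQ" "t : carrier QQ" "r : HH" "t : HH" using r(1) HH_closed Pol_HH[OF r(2)] Pol_HH[OF t(1)] by auto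
 note fm = Q.filt_mult[OF y_image]
 have "(r \<cdot> t) \<cdot> c : Pol (N + M)" if "c : insert p C" for c
 proof (cases "c = p")
 case True
 have "(r \<cdot> t) \<cdot> (p \<cdot> oneQ) : Pol (N + M)"
 unfolding HH_swap[OF k(4,5) r(1) HH_ops(6)] using k by (intro fm[OF r(4)]) (simp add: t(1))
 then show ?thesis using True k by simp
 next
 case False
 then have "c : C" using that by simp
 then have "t \<cdot> c : Pol M" "c : carrier QQ" using t(3) insert(4) HH_closed by (auto simp: F0_def)
 then show ?thesis using fm[OF r(2)] k by (simp add: Q.m_assoc)
 qed
 moreover have "r \<cdot> t ~= zQ" using Q.mult_nonzero k r(3) t(2) by blast
 ultimately show ?case using fm[OF r(2) t(1)] by blast
qed

text \<open>The function field is spanned over \<open>F0\<close> by \<open>m\<close> elements. Up to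
  a power of one denominator, monomials in \<open>B\<close> with exponents below \<open>M\<close>
  have polynomial coefficients of degree linear in \<open>M\<close>, so they lie in a space of
  dimension of order \<open>M ^ n\<close>. There are \<open>M ^ card B\<close> of them, too many if
  \<open>card B > n\<close>.\<close>

lemma dimension_upper:
 assumes B: "alg_independent KK B" shows "card B <= n"
proof (rule ccontr)
 assume "\<not> card B <= n"
 then have nB: "Suc n <= card B" by simp
 have fB: "finite B" "B <= carrier KK" using B by (auto simp: alg_independent_def)
 define v where "v i = J (al i)" for i
 have vH: "v i : HH" "v i : carrier QQ" if "i < m" for i using that alc J_HH by (auto simp: v_def)
 have JM: "J a : Q.rspan F0 m v" if "a : carrier A" for a
 unfolding v_def using J_in_rspan[OF F0_div_subring(1,2) F0_div_subring(3) that] by (simp add: eta_contract_eq)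
 have one: "oneQ : Q.rspan F0 m v" using JM[of \<one>] J_simps(4) by simp
 note st = Q.stabilizer_div_subring[OF F0_div_subring(1,2) vH(2) one]
 have HM: "EX c. (\<forall>k<m. c k : F0) & q = (\<Oplus>\<^bsub>QQ\<^esub>k\<in>{..<m}. v k \<cdot> c k)" if q: "q : HH" for q
 proof -
 obtain a c where a: "a : carrier A" "c : fixed" "c ~= \<zero>" "q = J a \<cdot> invQ (J c)" using KK_quotient q by blast
 have "J c : F0" by (rule fixed_in_div_subring[OF F0_div_subring(1,2) _ a(2)]) (use F0_div_subring(3) in simp)
 then have i: "invQ (J c) : F0" using Q.div_subring_inv[OF F0_div_subring(1)] J_nz[OF fixedD(1)[OF a(2)] a(3)] by blast
 then have "q : Q.rspan F0 m v" unfolding a(4) using st(5) JM[OF a(1)] i by auto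
 then show ?thesis unfolding Q.rspan_def by blast
 qed
 \<comment> \<open>The matrix over \<open>F0\<close> of multiplication by each element of
   \<open>B\<close>, with respect to the spanning family \<open>v\<close>.\<close>
 have ex: "\<forall>x\<in>B \<times> {..<m}. EX c. (\<forall>k<m. c k : F0) & hh (fst x) \<cdot> v (snd x) = (\<Oplus>\<^bsub>QQ\<^esub>k\<in>{..<m}. v k \<cdot> c k)"
 using HM HH_ops(1) vH(1) fB by auto
 obtain cf where cf0: "\<forall>x\<in>B \<times> {..<m}. (\<forall>k<m. cf x k : F0) & hh (fst x) \<cdot> v (snd x) = (\<Oplus>\<^bsub>QQ\<^esub>k\<in>{..<m}. v k \<cdot> cf x k)"
 using bchoice[OF ex] by - (elim exE, rule that)
 note cf = bspec[OF cf0, THEN conjunct1, rule_format] bspec[OF cf0, THEN conjunct2]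
 obtain c1 where c1: "\<forall>k<m. c1 k : F0" "oneQ = (\<Oplus>\<^bsub>QQ\<^esub>k\<in>{..<m}. v k \<cdot> c1 k)" using HM[OF HH_ops(6)] by blast
 \<comment> \<open>All matrix entries together with the coordinates of 1: a finite set, so one
   denominator \<open>r\<close> clears all of them.\<close>
 define C where "C = (%(x, k). cf x k) ` ((B \<times> {..<m}) \<times> {..<m}) \<union> c1 ` {..<m}"
 have C: "finite C" "C <= F0" using fB cf c1 by (auto simp: C_def)
 obtain N r where r: "r : Pol N" "r ~= zQ" "\<forall>c\<in>C. r \<cdot> c : Pol N"
 using common_denominator[OF C] by - (elim exE bexE conjE, rule that, assumption+)
 have rH: "r : HH" "r : carrier QQ" using Pol_HH[OF r(1)] HH_closed by auto
 have F0H: "c : HH" "c : carrier QQ" if "c : F0" for c using that HH_closed by (auto simp: F0_def)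
 have Pc: "x : carrier QQ" "x : HH" if "x : Pol M" for x M using that Pol_HH HH_closed by auto
 define W where "W t = Q.rspan (Pol (N * t)) m v" for t
 have WI: "(\<Oplus>\<^bsub>QQ\<^esub>k\<in>{..<m}. v k \<cdot> c k) : W t" if "!!k. k < m ==> c k : Pol (N * t)" for c t
 using that unfolding W_def Q.rspan_def by blast
 have WE: "EX c. (\<forall>k<m. c k : Pol (N * t)) & z = (\<Oplus>\<^bsub>QQ\<^esub>k\<in>{..<m}. v k \<cdot> c k)" if "z : W t" for z t
 using that unfolding W_def Q.rspan_def by blast
 have Wc: "z : carrier QQ" if z: "z : W t" for z t
 proof -
 obtain c where c: "\<forall>k<m. c k : Pol (N * t)" "z = (\<Oplus>\<^bsub>QQ\<^esub>k\<in>{..<m}. v k \<cdot> c k)" using WE[OF z] by blast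
 then show ?thesis using vH Pc by (auto intro!: Q.finsum_closed)
 qed
 have Wadd: "z +++ x : W t" if zx: "z : W t" "x : W t" for z x t
 proof -
 obtain c where c: "\<forall>k<m. c k : Pol (N * t)" "z = (\<Oplus>\<^bsub>QQ\<^esub>k\<in>{..<m}. v k \<cdot> c k)" using WE[OF zx(1)] by blast
 obtain d where d: "\<forall>k<m. d k : Pol (N * t)" "x = (\<Oplus>\<^bsub>QQ\<^esub>k\<in>{..<m}. v k \<cdot> d k)" using WE[OF zx(2)] by blast
 have cc: "c k : carrier QQ" "d k : carrier QQ" if "k < m" for k using c(1) d(1) Pc that by auto
 have "z +++ x = (\<Oplus>\<^bsub>QQ\<^esub>k\<in>{..<m}. v k \<cdot> c k +++ v k \<cdot> d k)"
 unfolding c(2) d(2) using vH cc by (intro Q.finsum_addf[symmetric]) auto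
 also have "... = (\<Oplus>\<^bsub>QQ\<^esub>k\<in>{..<m}. v k \<cdot> (c k +++ d k))"
 using vH cc by (intro Q.finsum_cong') (auto simp: Q.r_distr)
 also have "... : W t" using c(1) d(1) Q.filt_add[OF y_image] by (intro WI) auto
 finally show ?thesis .
 qed
 have Wsum: "finsum QQ f I : W t" if "finite I" "!!i. i : I ==> f i : W t" for f t and I :: "nat set"
 using that
 proof (induct set: finite)
 case empty
 have "(\<Oplus>\<^bsub>QQ\<^esub>k\<in>{..<m}. v k \<cdot> zQ) = (\<Oplus>\<^bsub>QQ\<^esub>k\<in>{..<m}. zQ)" using vH by (intro Q.finsum_cong') auto
 then show ?case using WI[of "%_. zQ" t, OF Q.filt_zero[OF y_image]] by simp
 next
 case (insert i I)
 then have "finsum QQ f (insert i I) = f i +++ finsum QQ f I" using Wc by (intro Q.finsum_insert) auto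
 then show ?case using Wadd insert by auto
 qed
 have step: "(r \<cdot> q) \<cdot> z : W (Suc t)"
 if q: "q : HH" "!!i. i < m ==> (r \<cdot> q) \<cdot> v i : W 1" and z: "z : W t" for q z t
 proof -
 obtain c where c: "\<forall>k<m. c k : Pol (N * t)" "z = (\<Oplus>\<^bsub>QQ\<^esub>k\<in>{..<m}. v k \<cdot> c k)" using WE[OF z] by blast
 have cc: "c k : carrier QQ" if "k < m" for k using c(1) Pc that by auto
 have rq: "r \<cdot> q : carrier QQ" using rH q(1) HH_closed by auto
 have "(r \<cdot> q) \<cdot> z = (\<Oplus>\<^bsub>QQ\<^esub>k\<in>{..<m}. (r \<cdot> q) \<cdot> (v k \<cdot> c k))"
 unfolding c(2) using vH cc rq by (intro Q.finsum_rdistr) auto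
 also have "... = (\<Oplus>\<^bsub>QQ\<^esub>k\<in>{..<m}. ((r \<cdot> q) \<cdot> v k) \<cdot> c k)"
 using vH cc rq Q.m_assoc[OF rq] by (intro Q.finsum_cong') auto
 also have "... : W (Suc t)"
 proof (rule Wsum)
 fix i assume "i : {..<m}"
 then have i: "i < m" by simp
 obtain d where d: "\<forall>k<m. d k : Pol (N * 1)" "(r \<cdot> q) \<cdot> v i = (\<Oplus>\<^bsub>QQ\<^esub>k\<in>{..<m}. v k \<cdot> d k)" using WE[OF q(2)[OF i]] by blast
 have dc: "d k : carrier QQ" if "k < m" for k using d(1) Pc that by auto
 have "(\<Oplus>\<^bsub>QQ\<^esub>k\<in>{..<m}. v k \<cdot> d k) \<cdot> c i = (\<Oplus>\<^bsub>QQ\<^esub>k\<in>{..<m}. (v k \<cdot> d k) \<cdot> c i)"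
 using vH dc cc[OF i] by (intro Q.finsum_ldistr) auto
 also have "... = (\<Oplus>\<^bsub>QQ\<^esub>k\<in>{..<m}. v k \<cdot> (d k \<cdot> c i))"
 using vH dc cc[OF i] by (intro Q.finsum_cong') (auto simp: Q.m_assoc)
 also have "... : W (Suc t)"
 proof (rule WI)
 fix k assume "k < m"
 then show "d k \<cdot> c i : Pol (N * Suc t)" using Q.filt_mult[OF y_image, of "d k" "N * 1" "c i" "N * t"] d(1) c(1) i by simp
 qed
 finally show "((r \<cdot> q) \<cdot> v i) \<cdot> c i : W (Suc t)" unfolding d(2) .
 qed simp
 finally show ?thesis .
 qed
 have rsum: "r \<cdot> (\<Oplus>\<^bsub>QQ\<^esub>k\<in>{..<m}. v k \<cdot> c k) : W 1" if c: "!!k. k < m ==> c k : F0 & r \<cdot> c k : Pol N" for c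
 proof -
 have cc: "c k : carrier QQ" "c k : HH" if "k < m" for k using c[OF that] F0H by auto
 have "r \<cdot> (\<Oplus>\<^bsub>QQ\<^esub>k\<in>{..<m}. v k \<cdot> c k) = (\<Oplus>\<^bsub>QQ\<^esub>k\<in>{..<m}. r \<cdot> (v k \<cdot> c k))"
 using vH cc rH by (intro Q.finsum_rdistr) auto
 also have "... = (\<Oplus>\<^bsub>QQ\<^esub>k\<in>{..<m}. v k \<cdot> (r \<cdot> c k))"
 proof (intro Q.finsum_cong' refl)
 fix k assume "k : {..<m}"
 then have k: "k < m" by simp
 show "r \<cdot> (v k \<cdot> c k) = v k \<cdot> (r \<cdot> c k)"
 using HH_comm[OF rH(1) vH(1)[OF k]] rH vH[OF k] cc[OF k] by (simp add: Q.m_assoc[symmetric])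
 qed (use vH cc rH in auto)
 also have "... : W 1" using c by (intro WI) simp
 finally show ?thesis .
 qed
 \<comment> \<open>Each multiplication by an element of \<open>B\<close> costs one power of
   \<open>r\<close> and raises the degree of the coefficients by \<open>N\<close>;
   \<open>U t\<close> collects what is reached at cost \<open>t\<close>.\<close>
 define U where "U t = {z : HH. (r ^^^ t) \<cdot> z : W t}" for t :: nat
 have rp: "r ^^^ t : HH" for t :: nat by (induct t) (auto simp: HH_ops rH)
 have Ustep: "q \<cdot> z : U (Suc t)" if q: "q : HH" "!!i. i < m ==> (r \<cdot> q) \<cdot> v i : W 1" and z: "z : U t" for q z t
 proof -
 have zH: "z : HH" using z by (simp add: U_def)
 have "(r ^^^ Suc t) \<cdot> (q \<cdot> z) = (r \<cdot> (r ^^^ t)) \<cdot> (q \<cdot> z)"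
 using HH_comm[OF rp rH(1)] by simp
 also have "... = (r \<cdot> q) \<cdot> ((r ^^^ t) \<cdot> z)" by (rule HH_swap[OF rH(1) rp q(1) zH])
 also have "... : W (Suc t)" by (rule step[OF q]) (use z in \<open>auto simp: U_def\<close>)
 finally show ?thesis using HH_ops(1)[OF q(1) zH] by (simp add: U_def)
 qed
 have U1: "oneQ : U 1"
 proof -
 have "r \<cdot> oneQ : W 1" unfolding c1(2) using rsum[of c1] c1(1) r(3) by (auto simp: C_def)
 then show ?thesis using rH HH_ops by (simp add: U_def)
 qed
 \<comment> \<open>The unit is itself an admissible multiplier for \<open>Ustep\<close>, which makes
   the sets \<open>U t\<close> increasing.\<close>
 have rv: "(r \<cdot> oneQ) \<cdot> v i : W 1" if i: "i < m" for i
 proof -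
 have "(\<Oplus>\<^bsub>QQ\<^esub>k\<in>{..<m}. v k \<cdot> (if i = k then r else zQ)) = (\<Oplus>\<^bsub>QQ\<^esub>k\<in>{..<m}. if i = k then v k \<cdot> r else zQ)"
 using vH rH by (intro Q.finsum_cong') auto
 also have "... = v i \<cdot> r" using i vH rH by (intro Q.add.finprod_singleton) auto
 also have "... = (r \<cdot> oneQ) \<cdot> v i" using HH_comm[OF rH(1) vH(1)[OF i]] rH by simp
 finally show ?thesis using WI[of "%k. if i = k then r else zQ" 1] r(1) Q.filt_zero[OF y_image] by simp
 qed
 have Umono1: "z : U t ==> z : U (Suc t)" for z t
 using Ustep[OF HH_ops(6) rv, of z t] HH_closed[of z] unfolding U_def by simp
 have Umono: "z : U t ==> t <= t' ==> z : U t'" for z t t'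
 by (induct t') (auto simp: le_Suc_eq Umono1)
 have Ub: "hh b \<cdot> z : U (Suc t)" if b: "b : B" and z: "z : U t" for b z t
 proof (rule Ustep[OF _ _ z])
 show "hh b : HH" using b fB by auto
 fix i assume i: "i < m"
 have x: "(b, i) : B \<times> {..<m}" using b i by simp
 have "r \<cdot> (\<Oplus>\<^bsub>QQ\<^esub>k\<in>{..<m}. v k \<cdot> cf (b, i) k) : W 1"
 by (rule rsum) (use cf(1)[OF x] r(3) x in \<open>auto simp: C_def\<close>)
 then show "(r \<cdot> hh b) \<cdot> v i : W 1"
 using cf(2)[OF x] rH vH[OF i] b fB hh_simps(1) by (auto simp: Q.m_assoc)
 qed
 interpret KC: cring KK by unfold_locales (rule KK_comm)
 have bpow: "hh (b [^]\<^bsub>KK\<^esub> k) \<cdot> z : U (t + k)" if b: "b : B" and z: "z : U t" for b z t and k :: nat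
 proof (induct k)
 case 0
 then show ?case using z HH_closed[of z] hh_simps(4) by (simp add: U_def)
 next
 case (Suc k)
 have bc: "b : carrier KK" using b fB by auto
 have zc: "z : carrier QQ" using z HH_closed by (auto simp: U_def)
 have "hh (b [^]\<^bsub>KK\<^esub> Suc k) \<cdot> z = hh b \<cdot> (hh (b [^]\<^bsub>KK\<^esub> k) \<cdot> z)"
 using bc zc hh_simps(1) KK_comm[of "b [^]\<^bsub>KK\<^esub> k" b] by (simp add: hh_simps(2) Q.m_assoc)
 then show ?case using Ub[OF b Suc] by simp
 qed
 define mon where "mon e = (\<Otimes>\<^bsub>KK\<^esub>b\<in>B. b [^]\<^bsub>KK\<^esub> e b)" for e :: "_ => nat"
 have monc: "mon e : carrier KK" for e unfolding mon_def using fB by (intro KC.finprod_closed) auto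
 have monU: "hh (\<Otimes>\<^bsub>KK\<^esub>b\<in>B'. b [^]\<^bsub>KK\<^esub> e b) : U (1 + sum e B')" if "B' <= B" for B' and e :: "_ => nat"
 using finite_subset[OF that fB(1)] that
 proof (induct set: finite)
 case empty then show ?case using U1 hh_simps(4) by simp
 next
 case (insert b B')
 have "(\<Otimes>\<^bsub>KK\<^esub>b\<in>insert b B'. b [^]\<^bsub>KK\<^esub> e b) = b [^]\<^bsub>KK\<^esub> e b **\<^bsub>KK\<^esub> (\<Otimes>\<^bsub>KK\<^esub>b\<in>B'. b [^]\<^bsub>KK\<^esub> e b)"
 using insert fB by (intro KC.finprod_insert) auto
 moreover have "(\<Otimes>\<^bsub>KK\<^esub>b\<in>B'. b [^]\<^bsub>KK\<^esub> e b) : carrier KK" "b : carrier KK" using insert fB by (auto intro!: KC.finprod_closed)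
 ultimately have "hh (\<Otimes>\<^bsub>KK\<^esub>b\<in>insert b B'. b [^]\<^bsub>KK\<^esub> e b) = hh (b [^]\<^bsub>KK\<^esub> e b) \<cdot> hh (\<Otimes>\<^bsub>KK\<^esub>b\<in>B'. b [^]\<^bsub>KK\<^esub> e b)"
 by (simp add: hh_simps(2))
 then show ?case using bpow[of b _ "1 + sum e B'" "e b"] insert by (simp add: add.commute add.left_commute)
 qed
 \<comment> \<open>\<open>k0\<close> is chosen so that \<open>N * t + 1 <= k0 * M\<close>, and
   \<open>M\<close> so that it exceeds \<open>m * k0 ^ n\<close>. The dimension bound
   \<open>m * (k0 * M) ^ n\<close> is then below \<open>M ^ Suc n\<close>.\<close>
 define k0 M where "k0 = N * (1 + card B) + 1" and "M = m * k0 ^ n + 1"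
 \<comment> \<open>One step accounts for writing 1 in terms of \<open>v\<close>, and at most
   \<open>card B * M\<close> steps for the exponents.\<close>
 define t where "t = 1 + card B * M"
 define Ex where "Ex = (B \<rightarrow>\<^sub>E {..<M})"
 have fE: "finite Ex" "card Ex = M ^ card B" using fB by (auto simp: Ex_def finite_PiE card_PiE)
 have inW: "(r ^^^ t) \<cdot> hh (mon e) : W t" if e: "e : Ex" for e
 proof -
 have "e b <= M" if "b : B" for b using e that by (auto simp: Ex_def PiE_def Pi_def intro: less_imp_le)
 then have "1 + sum e B <= t" unfolding t_def using sum_bounded_above[of B e M] by simp
 then have "hh (mon e) : U t" using monU[OF order_refl, of e] Umono unfolding mon_def by blast
 then show ?thesis by (simp add: U_def)
 qed
 have comm: "x \<cdot> z --- z \<cdot> x : Pol 0" if xz: "x : y ` {..<n}" "z : y ` {..<n}" for x z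
 proof -
 have "x \<cdot> z --- z \<cdot> x = zQ" using xz y_comm by auto
 then show ?thesis using Q.filt_zero[OF y_image] by simp
 qed
 have "EX S. finite S & S <= Pol (N * t) & card S <= (N * t + 1) ^ card (y ` {..<n}) & Pol (N * t) <= Q.lspan S"
 by (rule Q.filt_finite_span[OF y_image comm]) auto
 then obtain S where S: "finite S" "S <= Pol (N * t)" "card S <= (N * t + 1) ^ card (y ` {..<n})" "Pol (N * t) <= Q.lspan S"
 by - (elim exE conjE, rule that, assumption+)
 define V where "V = (%(k, x). v k \<cdot> x) ` ({..<m} \<times> S)"
 have Sc: "S <= carrier QQ" using S(2) Pc by blast
 have V: "finite V" "V <= carrier QQ" using S Sc vH by (auto simp: V_def)
 have WV: "z : Q.lspan V" if z: "z : W t" for z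
 proof -
 obtain c where c: "\<forall>k<m. c k : Pol (N * t)" "z = (\<Oplus>\<^bsub>QQ\<^esub>k\<in>{..<m}. v k \<cdot> c k)" using WE[OF z] by blast
 have cV: "v k \<cdot> c k : Q.lspan V" if k: "k < m" for k
 proof (rule Q.lspan_mult_left[of _ S])
 show "c k : Q.lspan S" using c S(4) k by blast
 fix x assume "x : S"
 then show "v k \<cdot> x : Q.lspan V" using k V by (intro Q.lspan_incl) (auto simp: V_def)
 qed (use Sc V vH k in auto)
 have fs: "finsum QQ f I : Q.lspan V" if "finite I" "!!i. i : I ==> f i : Q.lspan V" for f and I :: "nat set"
 using that
 proof (induct set: finite)
 case empty then show ?case by (simp add: Q.lspan_zero)
 next
 case (insert i I)
 then have "finsum QQ f (insert i I) = f i +++ finsum QQ f I" using Q.lspan_closed[OF _ V(2)] by (intro Q.finsum_insert) auto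
 then show ?case using Q.lspan_add[OF _ _ V(2)] insert by auto
 qed
 show ?thesis unfolding c(2) by (rule fs) (use cV in auto)
 qed
 have M1: "M >= 1" by (simp add: M_def)
 have "card V <= m * card S" unfolding V_def using card_image_le[of "{..<m} \<times> S"] S(1) by (metis card_cartesian_product card_lessThan finite_SigmaI finite_lessThan)
 also have "... <= m * (N * t + 1) ^ n"
 proof -
 have "card (y ` {..<n}) <= n" using card_image_le[of "{..<n}" y] by simp
 then have "(N * t + 1) ^ card (y ` {..<n}) <= (N * t + 1) ^ n" by (intro power_increasing) auto
 then show ?thesis using S(3) by (intro mult_left_mono) auto
 qed
 also have "N * t + 1 <= k0 * M"
 proof -
 have "N * t + 1 = N * 1 + N * card B * M + 1" by (simp add: t_def algebra_simps)
 also have "... <= N * M + N * card B * M + M" using M1 by (intro add_mono mult_left_mono) auto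
 also have "... = k0 * M" by (simp add: k0_def algebra_simps)
 finally show ?thesis .
 qed
 then have "m * (N * t + 1) ^ n <= m * (k0 * M) ^ n" by (intro mult_left_mono power_mono) auto
 also have "m * (k0 * M) ^ n = (m * k0 ^ n) * M ^ n" by (simp add: power_mult_distrib)
 also have "... < M * M ^ n" using M1 by (intro mult_strict_right_mono) (auto simp: M_def)
 also have "... = M ^ Suc n" by simp
 also have "... <= M ^ card B" using nB M1 by (intro power_increasing) auto
 finally have "card V < card Ex" using fE by simp
 then obtain f where f: "\<exists>e\<in>Ex. f e ~= 0" "(\<Oplus>\<^bsub>QQ\<^esub>e\<in>Ex. f e *. ((r ^^^ t) \<cdot> hh (mon e))) = zQ"
 using Q.linear_dependence[OF V fE(1), of "%e. (r ^^^ t) \<cdot> hh (mon e)"] inW WV by blast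
 define X where "X = (\<Oplus>\<^bsub>KK\<^esub>e\<in>Ex. f e \<odot>\<^bsub>KK\<^esub> mon e)"
 have Xc: "X : carrier KK" unfolding X_def using monc by (intro KK.finsum_closed) auto
 have rtc: "r ^^^ t : carrier QQ" using rp HH_closed by blast
 have "(r ^^^ t) \<cdot> hh X = (r ^^^ t) \<cdot> (\<Oplus>\<^bsub>QQ\<^esub>e\<in>Ex. hh (f e \<odot>\<^bsub>KK\<^esub> mon e))"
 unfolding X_def using monc fE(1) by (subst algebra_hom_finsum[OF KK.calgebra_axioms Q.calgebra_axioms hh_hom]) auto
 also have "... = (\<Oplus>\<^bsub>QQ\<^esub>e\<in>Ex. (r ^^^ t) \<cdot> hh (f e \<odot>\<^bsub>KK\<^esub> mon e))"
 using monc rtc fE(1) hh_simps(1) by (intro Q.finsum_rdistr) auto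
 also have "... = (\<Oplus>\<^bsub>QQ\<^esub>e\<in>Ex. f e *. ((r ^^^ t) \<cdot> hh (mon e)))"
 using monc rtc hh_simps(1) by (intro Q.finsum_cong') (auto simp: hh_simps(5))
 finally have "(r ^^^ t) \<cdot> hh X = zQ" using f(2) by simp
 moreover have "r ^^^ t ~= zQ"
 proof (induct t)
 case (Suc t) then show ?case using Q.mult_nonzero[of "r ^^^ t" r] rH r(2) by simp
 qed simp
 ultimately have "X = \<zero>\<^bsub>KK\<^esub>" using Q.no_zero_div[OF rtc hh_simps(1)[OF Xc]] hh_eq_zero[OF Xc] by blast
 moreover have "finite Ex & Ex <= (B \<rightarrow>\<^sub>E UNIV)" using fE by (auto simp: Ex_def PiE_def)
 ultimately have "\<forall>e\<in>Ex. f e = 0" using B unfolding alg_independent_def X_def mon_def by blast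
 then show False using f(1) by blast
qed

lemma dimension_eq: "transcendence_basis KK B ==> card B = n"
 using dimension_lower dimension_upper by (auto simp: transcendence_basis_def intro: antisym)

end

section \<open>Polynomial functions and regular maps\<close>

lemma poly_functions_uminus: "f : poly_functions m ==> (%p. - f p) : poly_functions m"
 using poly_functions.mult[OF poly_functions.const[of "-1"]] by simp

lemma poly_functions_diff: "[|f : poly_functions m; g : poly_functions m|] ==> (%p. f p - g p) : poly_functions m"
 using poly_functions.add[OF _ poly_functions_uminus] by simp

lemma poly_functions_power: "f : poly_functions m ==> (%p. f p ^ N) : poly_functions m"
 by (induct N) (auto intro: poly_functions.const[of 1] poly_functions.mult)

lemma poly_functions_compose:
 assumes "f : poly_functions k" "!!i. i < k ==> \<exists>h\<in>poly_functions m. \<forall>p\<in>X. phi p i = h p"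
 shows "\<exists>h\<in>poly_functions m. \<forall>p\<in>X. f (phi p) = h p"
 using assms(1)
proof induct
 case (const c) then show ?case by (intro bexI[OF _ poly_functions.const[of c]]) simp
next
 case (coord i) then show ?case using assms(2) by blast
next
 case (add f g)
 then obtain h h' where "h : poly_functions m" "h' : poly_functions m" "\<forall>p\<in>X. f (phi p) = h p" "\<forall>p\<in>X. g (phi p) = h' p" by blast
 then show ?case by (intro bexI[OF _ poly_functions.add[of h _ h']]) auto
next
 case (mult f g)
 then obtain h h' where "h : poly_functions m" "h' : poly_functions m" "\<forall>p\<in>X. f (phi p) = h p" "\<forall>p\<in>X. g (phi p) = h' p" by blast
 then show ?case by (intro bexI[OF _ poly_functions.mult[of h _ h']]) auto
qed

text \<open>Polynomials are given as functions on points, so the partial derivative is the analytic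
  one in the \<open>i\<close>-th variable. The algebraic rules for derivations are later inherited
  from analysis.\<close>

lemma poly_functions_deriv:
 assumes "P : poly_functions k"
 shows "\<exists>P'\<in>poly_functions k. ALL z. ((%t. P (z(i := t))) has_field_derivative P' z) (at (z i))"
 using assms
proof induct
 case (const c) then show ?case by (intro bexI[OF _ poly_functions.const[of 0]]) auto
next
 case (coord j)
 show ?case by (intro bexI[OF _ poly_functions.const[of "if i = j then 1 else 0"]]) auto
next
 case (add f g)
 then obtain f' g' where d: "f' : poly_functions k" "g' : poly_functions k"
 "ALL z. ((%t. f (z(i := t))) has_field_derivative f' z) (at (z i))" "ALL z. ((%t. g (z(i := t))) has_field_derivative g' z) (at (z i))" by blast
 have h: "((%t. f (z(i := t)) + g (z(i := t))) has_field_derivative f' z + g' z) (at (z i))" for z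
 by (rule DERIV_add[OF d(3)[rule_format, of z] d(4)[rule_format, of z]])
 show ?case by (intro bexI[OF _ poly_functions.add[OF d(1,2)]] allI h)
next
 case (mult f g)
 then obtain f' g' where d: "f' : poly_functions k" "g' : poly_functions k"
 "ALL z. ((%t. f (z(i := t))) has_field_derivative f' z) (at (z i))" "ALL z. ((%t. g (z(i := t))) has_field_derivative g' z) (at (z i))" by blast
 have h: "((%t. f (z(i := t)) * g (z(i := t))) has_field_derivative f' z * g z + g' z * f z) (at (z i))" for z
 using DERIV_mult[OF d(3)[rule_format, of z] d(4)[rule_format, of z]] by simp
 show ?case by (intro bexI[OF _ poly_functions.add[OF poly_functions.mult[OF d(1) mult(3)] poly_functions.mult[OF d(2) mult(1)]]] allI h)
qed

lemma DERIV_eventually_nonzero: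
 assumes "(f has_field_derivative D) (at x)" "f x ~= (0::complex)"
 shows "\<forall>\<^sub>F t in nhds x. f t ~= 0"
proof -
 have "(f \<longlongrightarrow> f x) (nhds x)" using DERIV_isCont[OF assms(1)] by (simp add: isCont_def tendsto_at_iff_tendsto_nhds)
 then show ?thesis using assms(2) by (rule tendsto_imp_eventually_ne)
qed

lemma open_principal:
 assumes "zariski_open_in m X U" "X <= affine_space m" "p0 : U"
 shows "\<exists>s\<in>poly_functions m. s p0 ~= 0 & (\<forall>p\<in>X. s p ~= 0 --> p : U)"
proof -
 obtain S where S: "S <= poly_functions m" "U = X - {p : affine_space m. \<forall>f\<in>S. f p = 0}"
 using assms(1) by (auto simp: zariski_open_in_def zariski_closed_def)
 then obtain f where "f : S" "f p0 ~= 0" using assms(2,3) by auto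
 then show ?thesis using S by (intro bexI[of _ f]) auto
qed

text \<open>Multiplying the local denominators of all components with equations that cut out the
  complement of the domain gives one polynomial \<open>a\<close>. Where it does not vanish, the
  point lies in \<open>U\<close> and every component has denominator \<open>a\<close>.\<close>

lemma regular_principal:
 assumes U: "zariski_open_in m X U" "X <= affine_space m" "p0 : U" and phi: "regular_map m U k V phi"
 shows "EX a f. a : poly_functions m & a p0 ~= 0 & (\<forall>i<k. f i : poly_functions m) &
 (\<forall>p\<in>X. a p ~= 0 --> p : U & (\<forall>i<k. phi p i * a p = f i p))"
proof -
 have UX: "U <= X" using U(1) by (auto simp: zariski_open_in_def)
 have loc: "EX a f. a : poly_functions m & f : poly_functions m & a p0 ~= 0 & (\<forall>p\<in>U. a p ~= 0 --> phi p i * a p = f p)" if "i < k" for i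
 proof -
 have "regular_on m U (%p. phi p i)" using phi that by (auto simp: regular_map_def)
 then obtain W f g where W: "zariski_open_in m U W" "p0 : W" "f : poly_functions m" "g : poly_functions m"
 "\<forall>q\<in>W. g q ~= 0 & phi q i = f q / g q" unfolding regular_on_def using U(3) by blast
 obtain s where s: "s : poly_functions m" "s p0 ~= 0" "\<forall>p\<in>U. s p ~= 0 --> p : W"
 using open_principal[OF W(1) _ W(2)] UX U(2) by blast
 show ?thesis
 by (rule exI[of _ "%p. s p * g p"], rule exI[of _ "%p. s p * f p"]) (use s W poly_functions.mult in auto)
 qed
 have "k' <= k ==> EX a f. a : poly_functions m & a p0 ~= 0 & (\<forall>i<k'. f i : poly_functions m) &
 (\<forall>p\<in>X. a p ~= 0 --> p : U & (\<forall>i<k'. phi p i * a p = f i p))" for k'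
 proof (induct k')
 case 0
 then show ?case using open_principal[OF U] by auto
 next
 case (Suc k')
 then obtain a f where a: "a : poly_functions m" "a p0 ~= 0" "\<forall>i<k'. f i : poly_functions m"
 "\<forall>p\<in>X. a p ~= 0 --> p : U & (\<forall>i<k'. phi p i * a p = f i p)" by auto
 obtain b g where b: "b : poly_functions m" "g : poly_functions m" "b p0 ~= 0" "\<forall>p\<in>U. b p ~= 0 --> phi p k' * b p = g p"
 using loc[of k'] Suc(2) by auto
 show ?case
 by (rule exI[of _ "%p. a p * b p"], rule exI[of _ "%i. if i = k' then (%p. a p * g p) else (%p. f i p * b p)"])
 (use a b poly_functions.mult in \<open>auto simp: less_Suc_eq\<close>)
 qed
 then show ?thesis by blast
qed

section \<open>Coordinate rings of irreducible varieties\<close>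

locale irreducible_variety =
 fixes m :: nat and X :: "point set"
 assumes irr: "irreducible_affine_variety m X"
begin

abbreviation "OX == coordinate_ring m X"

lemma X_subset: "X <= affine_space m"
 using irr by (auto simp: irreducible_affine_variety_def zariski_closed_def)

lemma poly_zero_product:
 assumes "f : poly_functions m" "g : poly_functions m" "\<forall>p\<in>X. f p * g p = 0"
 shows "(\<forall>p\<in>X. f p = 0) \<or> (\<forall>p\<in>X. g p = 0)"
proof -
 have "zariski_closed m {p : affine_space m. h p = 0}" if "h : poly_functions m" for h
 unfolding zariski_closed_def using that by (intro exI[of _ "{h}"]) auto
 moreover have "X <= {p : affine_space m. f p = 0} \<union> {p : affine_space m. g p = 0}" using assms(3) X_subset by auto
 ultimately have "X <= {p : affine_space m. f p = 0} \<or> X <= {p : affine_space m. g p = 0}"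
 using irr assms(1,2) unfolding irreducible_affine_variety_def zariski_irreducible_def by blast
 then show ?thesis by auto
qed

lemma O_mem: "x : carrier OX \<longleftrightarrow> x : extensional X & (\<exists>f\<in>poly_functions m. \<forall>p\<in>X. x p = f p)"
proof
 assume "x : extensional X & (\<exists>f\<in>poly_functions m. \<forall>p\<in>X. x p = f p)"
 then obtain f where f: "x : extensional X" "f : poly_functions m" "\<forall>p\<in>X. x p = f p" by blast
 then have "x = restrict f X" by (intro extensionalityI[of x X]) auto
 then show "x : carrier OX" using f by (auto simp: coordinate_ring_def)
qed (auto simp: coordinate_ring_def)

lemma O_polyE: "x : carrier OX ==> \<exists>f\<in>poly_functions m. \<forall>p\<in>X. x p = f p"
 by (simp add: O_mem)

lemma O_restrict [simp, intro]: "f : poly_functions m ==> restrict f X : carrier OX"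
 by (auto simp: O_mem)

lemma O_apply [simp]:
 assumes "p : X"
 shows "(x **\<^bsub>OX\<^esub> y) p = x p * y p" "(x +.\<^bsub>OX\<^esub> y) p = x p + y p" "\<one>\<^bsub>OX\<^esub> p = 1" "\<zero>\<^bsub>OX\<^esub> p = 0" "(c \<odot>\<^bsub>OX\<^esub> x) p = c * x p"
 using assms by (auto simp: coordinate_ring_def)

lemma O_eqI: "[|x : carrier OX; y : carrier OX; !!p. p : X ==> x p = y p|] ==> x = y"
 by (rule extensionalityI[of x X]) (auto simp: O_mem)

lemma O_closed [simp, intro]:
 shows "[|x : carrier OX; y : carrier OX|] ==> x **\<^bsub>OX\<^esub> y : carrier OX" "[|x : carrier OX; y : carrier OX|] ==> x +.\<^bsub>OX\<^esub> y : carrier OX"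
 "\<one>\<^bsub>OX\<^esub> : carrier OX" "\<zero>\<^bsub>OX\<^esub> : carrier OX" "x : carrier OX ==> c \<odot>\<^bsub>OX\<^esub> x : carrier OX"
proof -
 show "x **\<^bsub>OX\<^esub> y : carrier OX" "x +.\<^bsub>OX\<^esub> y : carrier OX" if xy: "x : carrier OX" "y : carrier OX"
 proof -
 obtain f g where "f : poly_functions m" "g : poly_functions m" "\<forall>p\<in>X. x p = f p" "\<forall>p\<in>X. y p = g p" using xy[THEN O_polyE] by blast
 moreover then have "x **\<^bsub>OX\<^esub> y = restrict (%p. f p * g p) X" "x +.\<^bsub>OX\<^esub> y = restrict (%p. f p + g p) X"
 by (auto simp: coordinate_ring_def intro!: restrict_ext)
 ultimately show "x **\<^bsub>OX\<^esub> y : carrier OX" "x +.\<^bsub>OX\<^esub> y : carrier OX"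
 using poly_functions.mult[of f m g] poly_functions.add[of f m g] by auto
 qed
 show "\<one>\<^bsub>OX\<^esub> : carrier OX" "\<zero>\<^bsub>OX\<^esub> : carrier OX" using poly_functions.const[of _ m] by (auto simp: O_mem coordinate_ring_def)
 show "c \<odot>\<^bsub>OX\<^esub> x : carrier OX" if x: "x : carrier OX"
 proof -
 obtain f where "f : poly_functions m" "\<forall>p\<in>X. x p = f p" using O_polyE[OF x] by blast
 moreover then have "c \<odot>\<^bsub>OX\<^esub> x = restrict (%p. c * f p) X" by (auto simp: coordinate_ring_def intro!: restrict_ext)
 ultimately show ?thesis using poly_functions.mult[OF poly_functions.const[of c], of f m] by auto
 qed
qed

lemma O_neg: assumes x: "x : carrier OX" shows "(-1) \<odot>\<^bsub>OX\<^esub> x +.\<^bsub>OX\<^esub> x = \<zero>\<^bsub>OX\<^esub>"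
 using x by (intro O_eqI) auto

lemma O_ring: "ring OX"
proof (rule ringI)
 show "abelian_group OX"
 proof (rule abelian_groupI)
 show "\<exists>y\<in>carrier OX. y +.\<^bsub>OX\<^esub> x = \<zero>\<^bsub>OX\<^esub>" if "x : carrier OX" for x using that O_neg by blast
 qed (auto intro!: O_eqI simp: algebra_simps)
 show "monoid OX" by (rule monoidI) (auto intro!: O_eqI simp: algebra_simps)
qed (auto intro!: O_eqI simp: algebra_simps)

sublocale domain_algebra OX
proof -
 interpret ring OX by (rule O_ring)
 show "domain_algebra OX"
 proof
 show "\<one>\<^bsub>OX\<^esub> ~= \<zero>\<^bsub>OX\<^esub>"
 proof
 assume "\<one>\<^bsub>OX\<^esub> = \<zero>\<^bsub>OX\<^esub>"
 moreover obtain p where "p : X" using irr by (auto simp: irreducible_affine_variety_def zariski_irreducible_def)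
 ultimately show False using O_apply(3,4)[of p] by simp
 qed
 fix x y assume xy: "x : carrier OX" "y : carrier OX" and z: "x **\<^bsub>OX\<^esub> y = \<zero>\<^bsub>OX\<^esub>"
 obtain f g where f: "f : poly_functions m" "g : poly_functions m" "\<forall>p\<in>X. x p = f p" "\<forall>p\<in>X. y p = g p" using xy[THEN O_polyE] by blast
 have "\<forall>p\<in>X. f p * g p = 0" using f(3,4) arg_cong[OF z, of "%h. h p" for p] by (metis O_apply(1,4))
 then have "(\<forall>p\<in>X. x p = 0) \<or> (\<forall>p\<in>X. y p = 0)" using poly_zero_product[OF f(1,2)] f(3,4) by simp
 then show "x = \<zero>\<^bsub>OX\<^esub> \<or> y = \<zero>\<^bsub>OX\<^esub>" using O_eqI[OF xy(1)] O_eqI[OF xy(2)] by auto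
 qed (auto intro!: O_eqI simp: algebra_simps)
qed

lemma O_minus_apply [simp]:
 assumes "p : X" "x : carrier OX" "y : carrier OX" shows "(x \<ominus>\<^bsub>OX\<^esub> y) p = x p - y p"
proof -
 have "\<ominus>\<^bsub>OX\<^esub> y = (-1) \<odot>\<^bsub>OX\<^esub> y" using O_neg[OF assms(3)] assms(3) by (intro minus_equality) auto
 then show ?thesis using assms by (simp add: a_minus_def)
qed

lemma O_diffop_ore_domain: "ore_domain (diffop_algebra OX)"
proof -
 define Gam where "Gam = (%i. \<lambda>p\<in>X. p i) ` {..<m}"
 have Gam: "finite Gam" "Gam <= carrier OX" using poly_functions.coord by (auto simp: Gam_def)
 have "EX N. restrict f X : filt Gam N" if "f : poly_functions m" for f
 using that
 proof induct
 case (const c)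
 have "restrict (%p. c) X = c \<odot>\<^bsub>OX\<^esub> \<one>\<^bsub>OX\<^esub>" by (auto simp: coordinate_ring_def)
 then show ?case using filt_smult[OF Gam(2) filt_one[OF Gam(2)]] by metis
 next
 case (coord i)
 then have "restrict (%p. p i) X : Gam" unfolding Gam_def by blast
 then show ?case using filt_gen[OF Gam(2), of _ 0] by blast
 next
 case (add f g)
 then obtain N M where "restrict f X : filt Gam N" "restrict g X : filt Gam M" by blast
 then have "restrict f X : filt Gam (N + M)" "restrict g X : filt Gam (N + M)" using filt_mono[OF Gam(2)] by auto
 then have "restrict f X +.\<^bsub>OX\<^esub> restrict g X : filt Gam (N + M)" by (rule filt_add[OF Gam(2)])
 moreover have "restrict f X +.\<^bsub>OX\<^esub> restrict g X = restrict (%p. f p + g p) X" by (auto simp: coordinate_ring_def)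
 ultimately show ?case by metis
 next
 case (mult f g)
 then obtain N M where "restrict f X : filt Gam N" "restrict g X : filt Gam M" by blast
 then have "restrict f X **\<^bsub>OX\<^esub> restrict g X : filt Gam (N + M)" by (rule filt_mult[OF Gam(2)])
 moreover have "restrict f X **\<^bsub>OX\<^esub> restrict g X = restrict (%p. f p * g p) X" by (auto simp: coordinate_ring_def)
 ultimately show ?case by metis
 qed
 then have gen: "\<forall>x\<in>carrier OX. EX N. x : filt Gam N" by (auto simp: coordinate_ring_def)
 show ?thesis by (rule diffop_algebra_ore_domain[OF Gam]) (use gen in blast)
qed

end

section \<open>Derivations along rational coordinates\<close>

text \<open>A birational map to affine space in polynomial form: \<open>phi\<close> has components
  \<open>fs i\<close> over \<open>a\<close> where \<open>a\<close> is nonzero, and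
  \<open>psi\<close> has components \<open>F j\<close> over \<open>b\<close> where \<open>b\<close>
  is nonzero. The point \<open>y0\<close> ensures that the two domains meet.\<close>

locale principal_birational = irreducible_variety m X for m X +
 fixes k :: nat and phi psi :: "point => point" and a b :: "point => complex" and fs F :: "nat => point => complex" and y0 :: point
 assumes a: "a : poly_functions m" and fs: "i < k ==> fs i : poly_functions m"
 and b: "b : poly_functions k" and F: "j < m ==> F j : poly_functions k"
 and y0: "y0 : X" "a y0 ~= 0" "b (phi y0) ~= 0"
 and phi_eq: "[|p : X; a p ~= 0; i < k|] ==> phi p i * a p = fs i p"
 and phi_aff: "[|p : X; a p ~= 0|] ==> phi p : affine_space k"
 and psi_eq: "[|q : affine_space k; b q ~= 0; j < m|] ==> psi q j * b q = F j q"
 and psi_X: "[|q : affine_space k; b q ~= 0|] ==> psi q : X"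
 and psiphi: "[|p : X; a p ~= 0|] ==> psi (phi p) = p"
 and phipsi: "[|q : affine_space k; b q ~= 0|] ==> phi (psi q) = q"
begin

definition good where "good p \<longleftrightarrow> p : X & a p ~= 0 & b (phi p) ~= 0"

lemma good_y0: "good y0" using y0 by (simp add: good_def)

text \<open>Substituting quotients with denominator \<open>a\<close> into a polynomial is cleared by
  a power of \<open>a\<close>. All large exponents are allowed, so finitely many polynomials can
  later share one exponent.\<close>

lemma pull:
 assumes "P : poly_functions k"
 shows "EX N. \<forall>M\<ge>N. \<exists>p\<in>poly_functions m. \<forall>y\<in>X. a y ~= 0 --> P (phi y) * a y ^ M = p y"
 using assms
proof induct
 case (const c)
 have "\<exists>p\<in>poly_functions m. \<forall>y\<in>X. a y ~= 0 --> c * a y ^ M = p y" for M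
 by (rule bexI[OF _ poly_functions.mult[OF poly_functions.const[of c] poly_functions_power[OF a, of M]]]) simp
 then show ?case by blast
next
 case (coord i)
 have "\<exists>p\<in>poly_functions m. \<forall>y\<in>X. a y ~= 0 --> phi y i * a y ^ M = p y" if M: "M >= 1" for M
 proof (intro bexI ballI impI)
 show "(%y. fs i y * a y ^ (M - 1)) : poly_functions m" using fs[OF coord] poly_functions_power[OF a] by (rule poly_functions.mult)
 fix y assume "y : X" "a y ~= 0"
 then show "phi y i * a y ^ M = fs i y * a y ^ (M - 1)" using phi_eq[OF _ _ coord, symmetric] M by (simp add: power_eq_if)
 qed
 then show ?case by blast
next
 case (add f g)
 then obtain N N' where N: "\<forall>M\<ge>N. \<exists>p\<in>poly_functions m. \<forall>y\<in>X. a y ~= 0 --> f (phi y) * a y ^ M = p y"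
 "\<forall>M\<ge>N'. \<exists>p\<in>poly_functions m. \<forall>y\<in>X. a y ~= 0 --> g (phi y) * a y ^ M = p y" by blast
 have "\<exists>p\<in>poly_functions m. \<forall>y\<in>X. a y ~= 0 --> (f (phi y) + g (phi y)) * a y ^ M = p y" if M: "M >= max N N'" for M
 proof -
 have M': "N <= M" "N' <= M" using M by auto
 obtain p where "p : poly_functions m" "\<forall>y\<in>X. a y ~= 0 --> f (phi y) * a y ^ M = p y" using N(1)[rule_format, OF M'(1)] by blast
 moreover obtain q where "q : poly_functions m" "\<forall>y\<in>X. a y ~= 0 --> g (phi y) * a y ^ M = q y" using N(2)[rule_format, OF M'(2)] by blast
 ultimately show ?thesis by (intro bexI[OF _ poly_functions.add[of p m q]]) (auto simp: distrib_right)
 qed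
 then show ?case by blast
next
 case (mult f g)
 then obtain N N' where N: "\<forall>M\<ge>N. \<exists>p\<in>poly_functions m. \<forall>y\<in>X. a y ~= 0 --> f (phi y) * a y ^ M = p y"
 "\<forall>M\<ge>N'. \<exists>p\<in>poly_functions m. \<forall>y\<in>X. a y ~= 0 --> g (phi y) * a y ^ M = p y" by blast
 have "\<exists>p\<in>poly_functions m. \<forall>y\<in>X. a y ~= 0 --> (f (phi y) * g (phi y)) * a y ^ M = p y" if M: "M >= N + N'" for M
 proof -
 have M': "N' <= M - N" "M = N + (M - N)" using M by auto
 obtain p where p: "p : poly_functions m" "\<forall>y\<in>X. a y ~= 0 --> f (phi y) * a y ^ N = p y" using N(1) by blast
 obtain q where q: "q : poly_functions m" "\<forall>y\<in>X. a y ~= 0 --> g (phi y) * a y ^ (M - N) = q y" using N(2) M'(1) by blast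
 have h: "(f (phi y) * g (phi y)) * a y ^ M = p y * q y" if "y : X" "a y ~= 0" for y
 proof -
 have "a y ^ M = a y ^ N * a y ^ (M - N)" using M'(2) power_add[of "a y" N "M - N"] by simp
 then have "(f (phi y) * g (phi y)) * a y ^ M = (f (phi y) * a y ^ N) * (g (phi y) * a y ^ (M - N))" by (simp only: mult_ac)
 then show ?thesis using p(2) q(2) that by simp
 qed
 show ?thesis by (rule bexI[OF _ poly_functions.mult[OF p(1) q(1)]]) (simp add: h)
 qed
 then show ?case by blast
qed

lemma near:
 assumes y: "good y" and i: "i < k"
 shows "\<forall>\<^sub>F t in nhds (phi y i). (phi y)(i := t) : affine_space k & b ((phi y)(i := t)) ~= 0"
proof -
 obtain b' where "ALL z. ((%t. b (z(i := t))) has_field_derivative b' z) (at (z i))" using poly_functions_deriv[OF b] by blast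
 then have d: "((%t. b ((phi y)(i := t))) has_field_derivative b' (phi y)) (at (phi y i))" by blast
 have "phi y : affine_space k" using phi_aff y by (auto simp: good_def)
 then have "(phi y)(i := t) : affine_space k" for t using i by (auto simp: affine_space_def PiE_def extensional_def)
 then show ?thesis using DERIV_eventually_nonzero[OF d] y by (simp add: good_def)
qed

text \<open>The derivative of \<open>c\<close> at \<open>y\<close> by the \<open>i\<close>-th
  rational coordinate: that coordinate of \<open>phi y\<close> moves while the others stay, and
  \<open>psi\<close> leads back to \<open>X\<close>. It is an ordinary complex derivative in one
  variable.\<close>

definition ddir where "ddir i c y e0 \<longleftrightarrow> ((%t. c (psi ((phi y)(i := t)))) has_field_derivative e0) (at (phi y i))"

lemma ddir_cong:
 assumes "ddir i c y e0" "good y" "i < k" "!!p. p : X ==> c p = c' p" shows "ddir i c' y e0"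
proof -
 have ev: "\<forall>\<^sub>F t in nhds (phi y i). c (psi ((phi y)(i := t))) = c' (psi ((phi y)(i := t)))"
 using near[OF assms(2,3)] by eventually_elim (use assms(4) psi_X in auto)
 then show ?thesis using assms(1) DERIV_cong_ev[OF refl ev refl] by (simp add: ddir_def)
qed

lemma psiphi_good: "good y ==> psi ((phi y)(i := phi y i)) = y"
 using psiphi by (simp add: good_def)

lemma ddir_const: "ddir i (%p. c) y 0" by (simp add: ddir_def)

lemma ddir_add: "[|ddir i c y e0; ddir i c' y e1|] ==> ddir i (%p. c p + c' p) y (e0 + e1)"
 unfolding ddir_def by (rule DERIV_add)

lemma ddir_mult: "[|ddir i c y e0; ddir i c' y e1; good y|] ==> ddir i (%p. c p * c' p) y (e0 * c' y + e1 * c y)"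
 unfolding ddir_def using DERIV_mult[of "%t. c (psi ((phi y)(i := t)))" e0 "phi y i" UNIV "%t. c' (psi ((phi y)(i := t)))" e1] psiphi_good[of y i] by simp

lemma ddir_unique: "[|ddir i c y e0; ddir i c y e1|] ==> e0 = e1"
 unfolding ddir_def by (rule DERIV_unique)

text \<open>The components of \<open>psi\<close> are quotients, so their partial derivatives have
  the square of \<open>b\<close> as denominator. Pulled back to \<open>X\<close> and cleared of
  powers of \<open>a\<close>, they share the denominator \<open>f\<close>.\<close>

lemma denominator_exists:
 "\<exists>f\<in>poly_functions m. (\<forall>y\<in>X. a y ~= 0 --> (f y ~= 0 \<longleftrightarrow> b (phi y) ~= 0)) &
 (\<forall>i<k. \<forall>j<m. \<exists>r\<in>poly_functions m. ALL y. good y --> ddir i (%p. p j) y (r y / f y))"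
proof -
 have "\<exists>b'\<in>poly_functions k. ALL z. ((%t. b (z(i := t))) has_field_derivative b' z) (at (z i))" for i
 by (rule poly_functions_deriv[OF b])
 then obtain b' where b': "!!i. b' i : poly_functions k" "!!i z. ((%t. b (z(i := t))) has_field_derivative b' i z) (at (z i))" by metis
 have exF: "EX F'. F' : poly_functions k & (ALL z. ((%t. F j (z(i := t))) has_field_derivative F' z) (at (z i)))" if "j < m" for i j
 using poly_functions_deriv[OF F[OF that]] by (simp only: Bex_def)
 define F' where "F' i j = (SOME F'. F' : poly_functions k & (ALL z. ((%t. F j (z(i := t))) has_field_derivative F' z) (at (z i))))" for i j
 have F': "F' i j : poly_functions k" "!!z. ((%t. F j (z(i := t))) has_field_derivative F' i j z) (at (z i))" if "j < m" for i j
 using someI_ex[OF exF[OF that, of i], folded F'_def] by auto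
 \<comment> \<open>Numerator of the quotient rule for \<open>F j\<close> over
   \<open>b\<close>.\<close>
 define P where "P i j z = F' i j z * b z - F j z * b' i z" for i j z
 have Pp: "P i j : poly_functions k" if "j < m" for i j
 unfolding P_def using poly_functions_diff[OF poly_functions.mult[OF F'(1)[OF that] b] poly_functions.mult[OF F[OF that] b'(1)]] by simp
 have exN: "EX N. \<forall>M\<ge>N. \<exists>p\<in>poly_functions m. \<forall>y\<in>X. a y ~= 0 --> P i j (phi y) * a y ^ M = p y" if "j < m" for i j by (rule pull[OF Pp[OF that]])
 define N where "N i j = (SOME N. \<forall>M\<ge>N. \<exists>p\<in>poly_functions m. \<forall>y\<in>X. a y ~= 0 --> P i j (phi y) * a y ^ M = p y)" for i j
 have N: "\<exists>p\<in>poly_functions m. \<forall>y\<in>X. a y ~= 0 --> P i j (phi y) * a y ^ M = p y" if "j < m" "M >= N i j" for i j M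
 by (rule someI_ex[OF exN[OF that(1), of i], folded N_def, rule_format, OF that(2)])
 define N1 where "N1 = (\<Sum>(i, j)\<in>{..<k} \<times> {..<m}. N i j)"
 have N1: "N i j <= N1" if "i < k" "j < m" for i j
 unfolding N1_def using member_le_sum[of "(i, j)" "{..<k} \<times> {..<m}" "%(i, j). N i j"] that by auto
 obtain N0 be where be: "be : poly_functions m" "\<forall>y\<in>X. a y ~= 0 --> (b (phi y) * b (phi y)) * a y ^ N0 = be y"
 using pull[OF poly_functions.mult[OF b b]] by blast
 \<comment> \<open>The power \<open>N1\<close> of \<open>a\<close> makes all pulled-back numerators
   polynomial at once, and \<open>be\<close> is the pullback of the square of \<open>b\<close>, made
   polynomial by the power \<open>N0\<close>. The numerator therefore becomes
   \<open>p y * a y ^ N0\<close>.\<close>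
 define f where "f y = a y ^ N1 * be y" for y
 have fp: "f : poly_functions m" unfolding f_def by (rule poly_functions.mult[OF poly_functions_power[OF a] be(1)])
 show ?thesis
 proof (rule bexI[OF _ fp], intro conjI ballI allI impI)
 fix y assume "y : X" "a y ~= 0"
 then show "f y ~= 0 \<longleftrightarrow> b (phi y) ~= 0" using be(2) by (auto simp: f_def simp flip: be(2)[rule_format])
 next
 fix i j assume i: "i < k" and j: "j < m"
 obtain p where p: "p : poly_functions m" "\<forall>y\<in>X. a y ~= 0 --> P i j (phi y) * a y ^ N1 = p y" using N[OF j N1[OF i j]] by blast
 show "\<exists>r\<in>poly_functions m. ALL y. good y --> ddir i (%p. p j) y (r y / f y)"
 proof (intro bexI allI impI)
 show "(%y. p y * a y ^ N0) : poly_functions m" by (rule poly_functions.mult[OF p(1) poly_functions_power[OF a]])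
 fix y assume y: "good y"
 let ?z = "phi y"
 have yX: "y : X" "a y ~= 0" "b ?z ~= 0" using y by (auto simp: good_def)
 have "((%t. F j (?z(i := t)) / b (?z(i := t))) has_field_derivative P i j ?z / (b ?z * b ?z)) (at (?z i))"
 proof -
 have "((%t. F j (?z(i := t))) has_field_derivative F' i j ?z) (at (?z i))" by (rule F'(2)[OF j])
 moreover have "((%t. b (?z(i := t))) has_field_derivative b' i ?z) (at (?z i))" by (rule b'(2))
 moreover have "b (?z(i := ?z i)) ~= 0" using yX(3) by simp
 ultimately show ?thesis by (rule DERIV_divide[THEN DERIV_cong]) (simp add: P_def)
 qed
 moreover have ev: "\<forall>\<^sub>F t in nhds (?z i). F j (?z(i := t)) / b (?z(i := t)) = psi (?z(i := t)) j"
 using near[OF y i] by eventually_elim (use psi_eq[OF _ _ j, symmetric] in auto)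
 ultimately have "ddir i (%p. p j) y (P i j ?z / (b ?z * b ?z))"
 unfolding ddir_def using DERIV_cong_ev[OF refl ev refl] by simp
 moreover have "P i j ?z / (b ?z * b ?z) = p y * a y ^ N0 / f y"
 using yX p(2) be(2) by (simp add: f_def flip: p(2)[rule_format] be(2)[rule_format])
 ultimately show "ddir i (%p. p j) y (p y * a y ^ N0 / f y)" by simp
 qed
 qed
qed

text \<open>The difference times \<open>a\<close> and \<open>f\<close> vanishes on all of
  \<open>X\<close>, while \<open>a\<close> and \<open>f\<close> do not vanish at \<open>y0\<close>.
  By irreducibility the difference is zero.\<close>

lemma good_dense:
 assumes "c : carrier OX" "c' : carrier OX" "!!y. good y ==> c y = c' y" shows "c = c'"
proof -
 obtain f where f: "f : poly_functions m" "\<forall>y\<in>X. a y ~= 0 --> (f y ~= 0 \<longleftrightarrow> b (phi y) ~= 0)" using denominator_exists by blast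
 obtain g where g: "g : poly_functions m" "\<forall>p\<in>X. c p = g p" using O_polyE[OF assms(1)] by blast
 obtain g' where g': "g' : poly_functions m" "\<forall>p\<in>X. c' p = g' p" using O_polyE[OF assms(2)] by blast
 have "\<forall>p\<in>X. (g p - g' p) * (a p * f p) = 0" using assms(3) f(2) g(2) g'(2) unfolding good_def by auto
 then have "(\<forall>p\<in>X. g p - g' p = 0) \<or> (\<forall>p\<in>X. a p * f p = 0)"
 by (rule poly_zero_product[OF poly_functions_diff[OF g(1) g'(1)] poly_functions.mult[OF a f(1)]])
 moreover have "a y0 * f y0 ~= 0" using y0 f(2) by auto
 ultimately show ?thesis using y0(1) g(2) g'(2) by (intro O_eqI[OF assms(1,2)]) auto
qed

definition uu where "uu i = restrict (fs i) X"
definition ww where "ww = restrict a X"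

lemma uw: "i < k ==> uu i : carrier OX" "ww : carrier OX" "ww ~= \<zero>\<^bsub>OX\<^esub>"
proof -
 show "i < k ==> uu i : carrier OX" "ww : carrier OX" using fs a by (auto simp: uu_def ww_def)
 show "ww ~= \<zero>\<^bsub>OX\<^esub>"
 proof
 assume "ww = \<zero>\<^bsub>OX\<^esub>"
 then have "ww y0 = \<zero>\<^bsub>OX\<^esub> y0" by (rule arg_cong)
 then show False using y0 by (simp add: ww_def)
 qed
qed

text \<open>Once \<open>f\<close> clears the denominators on the coordinate functions, the Leibniz
  rule clears them on every regular function. Values of the derivations are determined at good
  points, so the rules of calculus pass to the coordinate ring by density.\<close>

lemma derivations_exist:
 "EX f pd. f : carrier OX & f ~= \<zero>\<^bsub>OX\<^esub> & (\<forall>i<k. \<forall>c\<in>carrier OX. pd i c : carrier OX &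
 (ALL l. pd i (l \<odot>\<^bsub>OX\<^esub> c) = l \<odot>\<^bsub>OX\<^esub> pd i c) &
 (\<forall>c'\<in>carrier OX. pd i (c +.\<^bsub>OX\<^esub> c') = pd i c +.\<^bsub>OX\<^esub> pd i c' &
 pd i (c **\<^bsub>OX\<^esub> c') = c **\<^bsub>OX\<^esub> pd i c' +.\<^bsub>OX\<^esub> c' **\<^bsub>OX\<^esub> pd i c)) &
 (\<forall>i<k. \<forall>j<k. ww **\<^bsub>OX\<^esub> pd i (uu j) \<ominus>\<^bsub>OX\<^esub> uu j **\<^bsub>OX\<^esub> pd i ww = (if i = j then (ww **\<^bsub>OX\<^esub> ww) **\<^bsub>OX\<^esub> f else \<zero>\<^bsub>OX\<^esub>))"
proof -
 obtain f where f: "f : poly_functions m" "\<forall>y\<in>X. a y ~= 0 --> (f y ~= 0 \<longleftrightarrow> b (phi y) ~= 0)"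
 "\<forall>i<k. \<forall>j<m. \<exists>r\<in>poly_functions m. ALL y. good y --> ddir i (%p. p j) y (r y / f y)" using denominator_exists by blast
 have gX: "y : X" "f y ~= 0" "a y ~= 0" if "good y" for y using that f(2) by (auto simp: good_def)
 \<comment> \<open>\<open>R i c r\<close> says that \<open>r\<close> is \<open>f\<close> times the
   \<open>i\<close>-th derivative of \<open>c\<close> at every good point.\<close>
 define R where "R i c r \<longleftrightarrow> (ALL y. good y --> ddir i c y (r y / f y))" for i c r
 have RI: "R i c r" if "!!y. good y ==> ddir i c y (r y / f y)" for i c r using that by (simp add: R_def)
 have RD: "ddir i c y (r y / f y)" if "R i c r" "good y" for i c r y using that by (simp add: R_def)
 have Rpoly: "\<exists>r\<in>poly_functions m. R i c r" if i: "i < k" and c: "c : poly_functions m" for i c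
 using c
 proof induct
 case (const c) show ?case by (intro bexI[OF _ poly_functions.const[of 0]] RI) (simp add: ddir_const)
 next
 case (coord j) then show ?case using f(3) i by (auto simp: R_def)
 next
 case (add c c')
 then obtain r r' where r: "r : poly_functions m" "R i c r" "r' : poly_functions m" "R i c' r'" by blast
 show ?case by (intro bexI[OF _ poly_functions.add[OF r(1,3)]] RI) (use ddir_add RD[OF r(2)] RD[OF r(4)] in \<open>simp add: add_divide_distrib\<close>)
 next
 case (mult c c')
 then obtain r r' where r: "r : poly_functions m" "R i c r" "r' : poly_functions m" "R i c' r'" by blast
 show ?case
 proof (intro bexI[OF _ poly_functions.add[OF poly_functions.mult[OF r(1) mult(3)] poly_functions.mult[OF r(3) mult(1)]]] RI)
 fix y assume y: "good y"
 show "ddir i (%p. c p * c' p) y ((r y * c' y + r' y * c y) / f y)"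
 using ddir_mult[OF RD[OF r(2) y] RD[OF r(4) y] y] by (simp add: add_divide_distrib)
 qed
 qed
 have RC: "EX r. r : carrier OX & R i c r" if i: "i < k" and c: "c : carrier OX" for i c
 proof -
 obtain g where g: "g : poly_functions m" "\<forall>p\<in>X. c p = g p" using O_polyE[OF c] by blast
 obtain r where r: "r : poly_functions m" "R i g r" using Rpoly[OF i g(1)] by blast
 have "R i c (restrict r X)"
 proof (rule RI)
 fix y assume y: "good y"
 have "ddir i c y (r y / f y)" by (rule ddir_cong[OF RD[OF r(2) y] y i]) (use g(2) in simp)
 then show "ddir i c y (restrict r X y / f y)" using gX(1)[OF y] by simp
 qed
 then show ?thesis using r(1) by blast
 qed
 define pd where "pd i c = (SOME r. r : carrier OX & R i c r)" for i c
 have pd: "pd i c : carrier OX" "R i c (pd i c)" if "i < k" "c : carrier OX" for i c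
 using someI_ex[OF RC[OF that]] by (auto simp: pd_def)
 \<comment> \<open>Uniqueness of complex derivatives fixes the value of \<open>pd i c\<close> at
   good points, and density fixes it everywhere.\<close>
 have pd_eqI: "pd i c = r" if i: "i < k" "c : carrier OX" and r: "r : carrier OX" "!!y. good y ==> ddir i c y (r y / f y)" for i c r
 proof (rule good_dense[OF pd(1)[OF i] r(1)])
 fix y assume y: "good y"
 show "pd i c y = r y" using ddir_unique[OF RD[OF pd(2)[OF i] y] r(2)[OF y]] gX(2)[OF y] by simp
 qed
 define ff where "ff = restrict f X"
 have ff: "ff : carrier OX" "!!y. y : X ==> ff y = f y" using f(1) by (auto simp: ff_def)
 have ff0: "ff ~= \<zero>\<^bsub>OX\<^esub>" using ff(2)[OF y0(1)] O_apply(4)[OF y0(1)] gX(2)[OF good_y0] by auto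
 have sm: "pd i (l \<odot>\<^bsub>OX\<^esub> c) = l \<odot>\<^bsub>OX\<^esub> pd i c" if i: "i < k" and c: "c : carrier OX" for i c l
 proof (rule pd_eqI[OF i])
 fix y assume y: "good y"
 have "ddir i (%p. l * c p) y (0 * c y + (pd i c y / f y) * l)" by (rule ddir_mult[OF ddir_const RD[OF pd(2)[OF i c] y] y])
 from ddir_cong[OF this y i, of "l \<odot>\<^bsub>OX\<^esub> c"] show "ddir i (l \<odot>\<^bsub>OX\<^esub> c) y ((l \<odot>\<^bsub>OX\<^esub> pd i c) y / f y)" using gX(1)[OF y] by (simp add: mult.commute)
 qed (use c pd(1)[OF i c] in auto)
 have ad: "pd i (c +.\<^bsub>OX\<^esub> c') = pd i c +.\<^bsub>OX\<^esub> pd i c'" "pd i (c **\<^bsub>OX\<^esub> c') = c **\<^bsub>OX\<^esub> pd i c' +.\<^bsub>OX\<^esub> c' **\<^bsub>OX\<^esub> pd i c"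
 if i: "i < k" and c: "c : carrier OX" "c' : carrier OX" for i c c'
 proof -
 show "pd i (c +.\<^bsub>OX\<^esub> c') = pd i c +.\<^bsub>OX\<^esub> pd i c'"
 proof (rule pd_eqI[OF i])
 fix y assume y: "good y"
 from ddir_cong[OF ddir_add[OF RD[OF pd(2)[OF i c(1)] y] RD[OF pd(2)[OF i c(2)] y]] y i, of "c +.\<^bsub>OX\<^esub> c'"]
 show "ddir i (c +.\<^bsub>OX\<^esub> c') y ((pd i c +.\<^bsub>OX\<^esub> pd i c') y / f y)" using gX(1)[OF y] by (simp add: add_divide_distrib)
 qed (use c pd(1)[OF i] in auto)
 show "pd i (c **\<^bsub>OX\<^esub> c') = c **\<^bsub>OX\<^esub> pd i c' +.\<^bsub>OX\<^esub> c' **\<^bsub>OX\<^esub> pd i c"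
 proof (rule pd_eqI[OF i])
 fix y assume y: "good y"
 from ddir_cong[OF ddir_mult[OF RD[OF pd(2)[OF i c(1)] y] RD[OF pd(2)[OF i c(2)] y] y] y i, of "c **\<^bsub>OX\<^esub> c'"]
 show "ddir i (c **\<^bsub>OX\<^esub> c') y ((c **\<^bsub>OX\<^esub> pd i c' +.\<^bsub>OX\<^esub> c' **\<^bsub>OX\<^esub> pd i c) y / f y)" using gX(1)[OF y]
 by (simp add: add_divide_distrib algebra_simps)
 qed (use c pd(1)[OF i] in auto)
 qed
 \<comment> \<open>Along the \<open>i\<close>-th curve \<open>uu j\<close> is the
   \<open>j\<close>-th coordinate times \<open>ww\<close>, because \<open>phi\<close> inverts
   \<open>psi\<close> there. The \<open>j\<close>-th coordinate has derivative 1 or 0, and the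
   product rule gives the relation.\<close>
 have puw: "ww **\<^bsub>OX\<^esub> pd i (uu j) \<ominus>\<^bsub>OX\<^esub> uu j **\<^bsub>OX\<^esub> pd i ww = (if i = j then (ww **\<^bsub>OX\<^esub> ww) **\<^bsub>OX\<^esub> ff else \<zero>\<^bsub>OX\<^esub>)"
 if i: "i < k" and j: "j < k" for i j
 proof (rule good_dense)
 fix y assume y: "good y"
 note yX = gX[OF y]
 define e0 where "e0 = pd i ww y / f y"
 have w: "ddir i ww y e0" unfolding e0_def by (rule RD[OF pd(2)[OF i uw(2)] y])
 have e1: "((%t. ((phi y)(i := t)) j) has_field_derivative (if i = j then 1 else 0)) (at (phi y i))" by auto
 have wy: "ww (psi ((phi y)(i := phi y i))) = a y" using psiphi_good[OF y] yX(1) by (simp add: ww_def)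
 have "((%t. ((phi y)(i := t)) j * ww (psi ((phi y)(i := t)))) has_field_derivative (if i = j then 1 else 0) * a y + e0 * phi y j) (at (phi y i))"
 using DERIV_mult[OF e1 w[unfolded ddir_def]] wy by simp
 moreover have ev: "\<forall>\<^sub>F t in nhds (phi y i). ((phi y)(i := t)) j * ww (psi ((phi y)(i := t))) = uu j (psi ((phi y)(i := t)))"
 proof -
 have "\<forall>\<^sub>F t in nhds (phi y i). ww (psi ((phi y)(i := t))) ~= 0"
 by (rule DERIV_eventually_nonzero[OF w[unfolded ddir_def]]) (use wy yX(3) in simp)
 then show ?thesis using near[OF y i]
 proof eventually_elim
 case (elim t)
 let ?q = "(phi y)(i := t)"
 have "psi ?q : X" "phi (psi ?q) = ?q" using psi_X phipsi elim by auto
 then show ?case using phi_eq[of "psi ?q" j] j elim by (simp add: ww_def uu_def)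
 qed
 qed
 ultimately have "ddir i (uu j) y ((if i = j then 1 else 0) * a y + e0 * phi y j)"
 unfolding ddir_def using DERIV_cong_ev[OF refl ev refl] by simp
 then have "pd i (uu j) y / f y = (if i = j then 1 else 0) * a y + e0 * phi y j"
 using ddir_unique[OF RD[OF pd(2)[OF i uw(1)[OF j]] y]] by simp
 then have "pd i (uu j) y = ((if i = j then 1 else 0) * a y + e0 * phi y j) * f y" using yX(2) by (simp add: divide_eq_eq)
 moreover have "pd i ww y = e0 * f y" using yX(2) by (simp add: e0_def)
 moreover have "uu j y = phi y j * a y" using phi_eq[OF yX(1,3) j] yX(1) by (simp add: uu_def)
 ultimately show "(ww **\<^bsub>OX\<^esub> pd i (uu j) \<ominus>\<^bsub>OX\<^esub> uu j **\<^bsub>OX\<^esub> pd i ww) y = (if i = j then (ww **\<^bsub>OX\<^esub> ww) **\<^bsub>OX\<^esub> ff else \<zero>\<^bsub>OX\<^esub>) y"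
 using yX(1) uw i j pd(1) ff(2) by (simp add: ww_def algebra_simps)
 qed (use uw i j pd(1) ff in auto)
 show ?thesis by (rule exI[of _ ff], rule exI[of _ pd]) (use ff ff0 pd(1) sm ad puw in auto)
qed

text \<open>On good points the inverse map recovers each coordinate of \<open>X\<close> as the
  quotient of \<open>F j\<close> and \<open>b\<close> evaluated at \<open>phi\<close>, that is, as a
  rational expression in the fractions of \<open>uu i\<close> by \<open>ww\<close>.\<close>

lemma coordinates_generate:
 fixes Q :: "(complex, 'q) module"
 assumes Q: "division_algebra Q" and J: "J : algebra_hom OX Q" and inj: "!!c. [|c : carrier OX; J c = \<zero>\<^bsub>Q\<^esub>|] ==> c = \<zero>\<^bsub>OX\<^esub>"
 and T: "ring.div_subring Q T" "ALL l. \<forall>t\<in>T. l \<odot>\<^bsub>Q\<^esub> t : T" and uT: "!!i. i < k ==> J (uu i) **\<^bsub>Q\<^esub> inv\<^bsub>Q\<^esub> (J ww) : T"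
 and c: "c : carrier OX"
 shows "J c : T"
proof -
 interpret Q: division_algebra Q by (rule Q)
 note H = algebra_homD[OF J]
 have ops: "!!s t. [|s : T; t : T|] ==> s +.\<^bsub>Q\<^esub> t : T" "!!s t. [|s : T; t : T|] ==> s **\<^bsub>Q\<^esub> t : T" "\<one>\<^bsub>Q\<^esub> : T"
 using T(1) by (auto simp: Q.div_subring_def)
 have nz: "q ~= \<zero>\<^bsub>OX\<^esub>" if "ALL y. good y --> q y ~= 0" for q using that good_y0 y0(1) by auto
 have Jnz: "J q ~= \<zero>\<^bsub>Q\<^esub>" if "q : carrier OX" "q ~= \<zero>\<^bsub>OX\<^esub>" for q using inj that by blast
 have comm: "J p **\<^bsub>Q\<^esub> J q = J q **\<^bsub>Q\<^esub> J p" if "p : carrier OX" "q : carrier OX" for p q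
 using H(2)[OF that] H(2)[OF that(2,1)] m_comm[OF that] by simp
 have icomm: "inv\<^bsub>Q\<^esub> (J p) **\<^bsub>Q\<^esub> J q = J q **\<^bsub>Q\<^esub> inv\<^bsub>Q\<^esub> (J p)" if "p : carrier OX" "q : carrier OX" "p ~= \<zero>\<^bsub>OX\<^esub>" for p q
 by (rule Q.commute_inv) (use that H(1) Jnz comm in auto)
 \<comment> \<open>A polynomial in \<open>phi\<close> is represented by a fraction of regular
   functions at good points, together with the membership in \<open>T\<close> of the image of this
   fraction; sums and products preserve this.\<close>
 define ok where "ok P \<longleftrightarrow> (\<exists>p\<in>carrier OX. \<exists>q\<in>carrier OX. (ALL y. good y --> q y ~= 0 & P (phi y) * q y = p y) & J p **\<^bsub>Q\<^esub> inv\<^bsub>Q\<^esub> (J q) : T)" for P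
 have okI: "ok P" if "p : carrier OX" "q : carrier OX" "!!y. good y ==> q y ~= 0 & P (phi y) * q y = p y" "J p **\<^bsub>Q\<^esub> inv\<^bsub>Q\<^esub> (J q) : T" for P p q
 unfolding ok_def using that by blast
 have ok: "ok P" if "P : poly_functions k" for P
 using that
 proof induct
 case (const c)
 show ?case
 proof (rule okI[of "c \<odot>\<^bsub>OX\<^esub> \<one>\<^bsub>OX\<^esub>" "\<one>\<^bsub>OX\<^esub>"])
 show "J (c \<odot>\<^bsub>OX\<^esub> \<one>\<^bsub>OX\<^esub>) **\<^bsub>Q\<^esub> inv\<^bsub>Q\<^esub> (J \<one>\<^bsub>OX\<^esub>) : T"
 using T(2) ops(3) by (simp add: H(4,5))
 qed (auto simp: good_def)
 next
 case (coord i)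
 show ?case by (rule okI[OF uw(1)[OF coord] uw(2) _ uT[OF coord]]) (use phi_eq coord in \<open>auto simp: good_def uu_def ww_def\<close>)
 next
 case (add P1 P2)
 then obtain p q p' q' where pq: "p : carrier OX" "q : carrier OX" "ALL y. good y --> q y ~= 0 & P1 (phi y) * q y = p y" "J p **\<^bsub>Q\<^esub> inv\<^bsub>Q\<^esub> (J q) : T"
 "p' : carrier OX" "q' : carrier OX" "ALL y. good y --> q' y ~= 0 & P2 (phi y) * q' y = p' y" "J p' **\<^bsub>Q\<^esub> inv\<^bsub>Q\<^esub> (J q') : T"
 unfolding ok_def by blast
 have n: "q ~= \<zero>\<^bsub>OX\<^esub>" "q' ~= \<zero>\<^bsub>OX\<^esub>" using nz pq(3,7) by auto
 have k: "J p : carrier Q" "J q : carrier Q" "J p' : carrier Q" "J q' : carrier Q" "inv\<^bsub>Q\<^esub> (J q) : carrier Q" "inv\<^bsub>Q\<^esub> (J q') : carrier Q"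
 "J q ~= \<zero>\<^bsub>Q\<^esub>" "J q' ~= \<zero>\<^bsub>Q\<^esub>" using pq(1,2,5,6) H(1) Jnz n by auto
 show ?case
 proof (rule okI[of "p **\<^bsub>OX\<^esub> q' +.\<^bsub>OX\<^esub> p' **\<^bsub>OX\<^esub> q" "q **\<^bsub>OX\<^esub> q'"])
 have "J (p **\<^bsub>OX\<^esub> q' +.\<^bsub>OX\<^esub> p' **\<^bsub>OX\<^esub> q) **\<^bsub>Q\<^esub> inv\<^bsub>Q\<^esub> (J (q **\<^bsub>OX\<^esub> q')) =
 (J p **\<^bsub>Q\<^esub> J q' +.\<^bsub>Q\<^esub> J p' **\<^bsub>Q\<^esub> J q) **\<^bsub>Q\<^esub> (inv\<^bsub>Q\<^esub> (J q') **\<^bsub>Q\<^esub> inv\<^bsub>Q\<^esub> (J q))"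
 using pq(1,2,5,6) k by (simp add: H(2,3) Q.inv_mult')
 also have "... = J p **\<^bsub>Q\<^esub> (J q' **\<^bsub>Q\<^esub> inv\<^bsub>Q\<^esub> (J q')) **\<^bsub>Q\<^esub> inv\<^bsub>Q\<^esub> (J q) +.\<^bsub>Q\<^esub> J p' **\<^bsub>Q\<^esub> (J q **\<^bsub>Q\<^esub> inv\<^bsub>Q\<^esub> (J q')) **\<^bsub>Q\<^esub> inv\<^bsub>Q\<^esub> (J q)"
 using k by (simp add: Q.l_distr Q.m_assoc)
 also have "... = J p **\<^bsub>Q\<^esub> inv\<^bsub>Q\<^esub> (J q) +.\<^bsub>Q\<^esub> J p' **\<^bsub>Q\<^esub> inv\<^bsub>Q\<^esub> (J q')"
 unfolding icomm[OF pq(6,2) n(2), symmetric] using k by (simp add: Q.m_assoc)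
 finally show "J (p **\<^bsub>OX\<^esub> q' +.\<^bsub>OX\<^esub> p' **\<^bsub>OX\<^esub> q) **\<^bsub>Q\<^esub> inv\<^bsub>Q\<^esub> (J (q **\<^bsub>OX\<^esub> q')) : T" using ops(1)[OF pq(4,8)] by simp
 fix y assume y: "good y"
 then have "y : X" by (simp add: good_def)
 then show "(q **\<^bsub>OX\<^esub> q') y ~= 0 & (P1 (phi y) + P2 (phi y)) * (q **\<^bsub>OX\<^esub> q') y = (p **\<^bsub>OX\<^esub> q' +.\<^bsub>OX\<^esub> p' **\<^bsub>OX\<^esub> q) y"
 using pq(3)[rule_format, OF y] pq(7)[rule_format, OF y] by (auto simp: algebra_simps simp flip: pq(3)[rule_format, OF y, THEN conjunct2] pq(7)[rule_format, OF y, THEN conjunct2])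
 qed (use pq in auto)
 next
 case (mult P1 P2)
 then obtain p q p' q' where pq: "p : carrier OX" "q : carrier OX" "ALL y. good y --> q y ~= 0 & P1 (phi y) * q y = p y" "J p **\<^bsub>Q\<^esub> inv\<^bsub>Q\<^esub> (J q) : T"
 "p' : carrier OX" "q' : carrier OX" "ALL y. good y --> q' y ~= 0 & P2 (phi y) * q' y = p' y" "J p' **\<^bsub>Q\<^esub> inv\<^bsub>Q\<^esub> (J q') : T"
 unfolding ok_def by blast
 have n: "q ~= \<zero>\<^bsub>OX\<^esub>" "q' ~= \<zero>\<^bsub>OX\<^esub>" using nz pq(3,7) by auto
 have k: "J p : carrier Q" "J q : carrier Q" "J p' : carrier Q" "J q' : carrier Q" "inv\<^bsub>Q\<^esub> (J q) : carrier Q" "inv\<^bsub>Q\<^esub> (J q') : carrier Q"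
 "J q ~= \<zero>\<^bsub>Q\<^esub>" "J q' ~= \<zero>\<^bsub>Q\<^esub>" using pq(1,2,5,6) H(1) Jnz n by auto
 show ?case
 proof (rule okI[of "p **\<^bsub>OX\<^esub> p'" "q' **\<^bsub>OX\<^esub> q"])
 have "J (p **\<^bsub>OX\<^esub> p') **\<^bsub>Q\<^esub> inv\<^bsub>Q\<^esub> (J (q' **\<^bsub>OX\<^esub> q)) = J p **\<^bsub>Q\<^esub> (J p' **\<^bsub>Q\<^esub> inv\<^bsub>Q\<^esub> (J q)) **\<^bsub>Q\<^esub> inv\<^bsub>Q\<^esub> (J q')"
 using pq(1,2,5,6) k by (simp add: H(2,3) Q.inv_mult' Q.m_assoc)
 also have "... = (J p **\<^bsub>Q\<^esub> inv\<^bsub>Q\<^esub> (J q)) **\<^bsub>Q\<^esub> (J p' **\<^bsub>Q\<^esub> inv\<^bsub>Q\<^esub> (J q'))"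
 unfolding icomm[OF pq(2,5) n(1), symmetric] using k by (simp add: Q.m_assoc)
 finally show "J (p **\<^bsub>OX\<^esub> p') **\<^bsub>Q\<^esub> inv\<^bsub>Q\<^esub> (J (q' **\<^bsub>OX\<^esub> q)) : T" using ops(2)[OF pq(4,8)] by simp
 fix y assume y: "good y"
 then have "y : X" by (simp add: good_def)
 then show "(q' **\<^bsub>OX\<^esub> q) y ~= 0 & (P1 (phi y) * P2 (phi y)) * (q' **\<^bsub>OX\<^esub> q) y = (p **\<^bsub>OX\<^esub> p') y"
 using pq(3)[rule_format, OF y] pq(7)[rule_format, OF y] by (auto simp flip: pq(3)[rule_format, OF y, THEN conjunct2] pq(7)[rule_format, OF y, THEN conjunct2])
 qed (use pq in auto)
 qed
 have "J (restrict g X) : T" if "g : poly_functions m" for g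
 using that
 proof induct
 case (const c)
 have "restrict (%p. c) X = c \<odot>\<^bsub>OX\<^esub> \<one>\<^bsub>OX\<^esub>" by (auto simp: coordinate_ring_def)
 then show ?case using T(2) ops(3) by (simp add: H(4,5))
 next
 case (coord j)
 obtain p q where pq: "p : carrier OX" "q : carrier OX" "ALL y. good y --> q y ~= 0 & F j (phi y) * q y = p y" "J p **\<^bsub>Q\<^esub> inv\<^bsub>Q\<^esub> (J q) : T"
 using ok[OF F[OF coord]] unfolding ok_def by blast
 obtain p' q' where pq': "p' : carrier OX" "q' : carrier OX" "ALL y. good y --> q' y ~= 0 & b (phi y) * q' y = p' y" "J p' **\<^bsub>Q\<^esub> inv\<^bsub>Q\<^esub> (J q') : T"
 using ok[OF b] unfolding ok_def by blast
 define x where "x = restrict (%p. p j) X"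
 have xc: "x : carrier OX" using poly_functions.coord[OF coord] by (simp add: x_def)
 have p'y: "p' y ~= 0" if "good y" for y using pq'(3)[rule_format, OF that] that by (auto simp: good_def)
 have n: "q ~= \<zero>\<^bsub>OX\<^esub>" "q' ~= \<zero>\<^bsub>OX\<^esub>" "p' ~= \<zero>\<^bsub>OX\<^esub>" using nz pq(3) pq'(3) p'y by auto
 \<comment> \<open>The equation of \<open>X\<close>-coordinates
   \<open>y j * b (phi y) = F j (phi y)\<close> with denominators cleared. The element
   \<open>p'\<close> represents \<open>b\<close> and is nonzero at good points, so it can be
   inverted afterwards.\<close>
 have "x **\<^bsub>OX\<^esub> (p' **\<^bsub>OX\<^esub> q) = p **\<^bsub>OX\<^esub> q'"
 proof (rule good_dense)
 fix y assume y: "good y"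
 then have yX: "y : X" "a y ~= 0" "b (phi y) ~= 0" by (auto simp: good_def)
 have e: "y j * b (phi y) = F j (phi y)" using psi_eq[OF phi_aff[OF yX(1,2)] yX(3) coord] psiphi[OF yX(1,2)] by simp
 have "y j * ((b (phi y) * q' y) * q y) = (y j * b (phi y)) * q y * q' y" by (simp only: mult_ac)
 then have "y j * ((b (phi y) * q' y) * q y) = (F j (phi y) * q y) * q' y" unfolding e .
 then show "(x **\<^bsub>OX\<^esub> (p' **\<^bsub>OX\<^esub> q)) y = (p **\<^bsub>OX\<^esub> q') y" using pq(3) pq'(3) y yX(1) by (simp add: x_def)
 qed (use xc pq(1,2) pq'(1,2) in auto)
 from arg_cong[OF this, of J] have e: "J x **\<^bsub>Q\<^esub> (J p' **\<^bsub>Q\<^esub> J q) = J p **\<^bsub>Q\<^esub> J q'" using xc pq(1,2) pq'(1,2) by (simp add: H(2))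
 have k: "J x : carrier Q" "J p : carrier Q" "J q : carrier Q" "J p' : carrier Q" "J q' : carrier Q" "inv\<^bsub>Q\<^esub> (J q) : carrier Q" "inv\<^bsub>Q\<^esub> (J p') : carrier Q"
 "J q ~= \<zero>\<^bsub>Q\<^esub>" "J p' ~= \<zero>\<^bsub>Q\<^esub>" "J q' ~= \<zero>\<^bsub>Q\<^esub>" "inv\<^bsub>Q\<^esub> (J q') : carrier Q" using xc pq(1,2) pq'(1,2) H(1) Jnz n by auto
 have iq: "inv\<^bsub>Q\<^esub> (J q') ~= \<zero>\<^bsub>Q\<^esub>"
 proof
 assume "inv\<^bsub>Q\<^esub> (J q') = \<zero>\<^bsub>Q\<^esub>"
 then have "\<one>\<^bsub>Q\<^esub> = \<zero>\<^bsub>Q\<^esub>" using Q.r_inv'[OF k(5,10)] Q.r_null[OF k(5)] by (simp only:)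
 then show False using Q.one_neq_zero by blast
 qed
 have "J x = J x **\<^bsub>Q\<^esub> (J p' **\<^bsub>Q\<^esub> J q) **\<^bsub>Q\<^esub> (inv\<^bsub>Q\<^esub> (J q) **\<^bsub>Q\<^esub> inv\<^bsub>Q\<^esub> (J p'))" using k by (simp add: Q.m_assoc)
 also have "... = J p **\<^bsub>Q\<^esub> (J q' **\<^bsub>Q\<^esub> inv\<^bsub>Q\<^esub> (J q)) **\<^bsub>Q\<^esub> inv\<^bsub>Q\<^esub> (J p')" unfolding e using k by (simp add: Q.m_assoc)
 also have "... = (J p **\<^bsub>Q\<^esub> inv\<^bsub>Q\<^esub> (J q)) **\<^bsub>Q\<^esub> (J q' **\<^bsub>Q\<^esub> inv\<^bsub>Q\<^esub> (J p'))"
 unfolding icomm[OF pq(2) pq'(2) n(1), symmetric] using k by (simp add: Q.m_assoc)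
 also have "J q' **\<^bsub>Q\<^esub> inv\<^bsub>Q\<^esub> (J p') = inv\<^bsub>Q\<^esub> (J p' **\<^bsub>Q\<^esub> inv\<^bsub>Q\<^esub> (J q'))"
 proof (rule Q.inv_char[symmetric])
 show "(J p' **\<^bsub>Q\<^esub> inv\<^bsub>Q\<^esub> (J q')) **\<^bsub>Q\<^esub> (J q' **\<^bsub>Q\<^esub> inv\<^bsub>Q\<^esub> (J p')) = \<one>\<^bsub>Q\<^esub>" "(J q' **\<^bsub>Q\<^esub> inv\<^bsub>Q\<^esub> (J p')) **\<^bsub>Q\<^esub> (J p' **\<^bsub>Q\<^esub> inv\<^bsub>Q\<^esub> (J q')) = \<one>\<^bsub>Q\<^esub>"
 using k by (simp_all add: Q.m_assoc)
 qed (use k in auto)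
 finally show ?case unfolding x_def[symmetric]
 using ops(2)[OF pq(4) Q.div_subring_inv[OF T(1) pq'(4) Q.mult_nonzero[OF k(4) k(11) k(9) iq]]] by simp
 next
 case (add g h)
 have e: "restrict (%p. g p + h p) X = restrict g X +.\<^bsub>OX\<^esub> restrict h X" by (auto simp: coordinate_ring_def)
 show ?case unfolding e H(3)[OF O_restrict[OF add(1)] O_restrict[OF add(3)]] by (rule ops(1)[OF add(2,4)])
 next
 case (mult g h)
 have e: "restrict (%p. g p * h p) X = restrict g X **\<^bsub>OX\<^esub> restrict h X" by (auto simp: coordinate_ring_def)
 show ?case unfolding e H(2)[OF O_restrict[OF mult(1)] O_restrict[OF mult(3)]] by (rule ops(2)[OF mult(2,4)])
 qed
 then show ?thesis using c by (auto simp: coordinate_ring_def)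
qed

end

section \<open>The group acting on the coordinate ring\<close>

context irreducible_variety
begin

text \<open>Restricting the action to the coordinate ring makes equality of the operators extensional.\<close>

definition sg :: "(point => point) => (point => complex) => (point => complex)" where
 "sg g = restrict (function_action X g) (carrier OX)"

lemma sg_apply [simp]: "[|x : carrier OX; p : X|] ==> sg g x p = x (inv_into X g p)"
 by (simp add: sg_def function_action_def compose_def)

lemma automorphism_inv:
 assumes "g : variety_automorphisms m X" "p : X"
 shows "g p : X" "inv_into X g p : X" "g (inv_into X g p) = p" "!!q. [|q : X; g q = p|] ==> inv_into X g p = q"
proof -
 have b: "bij_betw g X X" using assms(1) by (auto simp: variety_automorphisms_def Bij_def)
 show "g p : X" using b assms(2) by (auto simp: bij_betw_def)
 show "inv_into X g p : X" "g (inv_into X g p) = p" using b assms(2) by (auto simp: bij_betw_def inv_into_into f_inv_into_f)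
 show "inv_into X g p = q" if "q : X" "g q = p" for q using b that by (auto simp: bij_betw_def intro: inv_into_f_eq)
qed

lemma sg_closed:
 assumes g: "g : variety_automorphisms m X" and x: "x : carrier OX" shows "sg g x : carrier OX"
proof -
 obtain f where f: "f : poly_functions m" "\<forall>p\<in>X. x p = f p" using O_polyE[OF x] by blast
 have "\<exists>h\<in>poly_functions m. \<forall>p\<in>X. inv_into X g p i = h p" if "i < m" for i
 using g that by (auto simp: variety_automorphisms_def polynomial_map_def)
 then obtain h where h: "h : poly_functions m" "\<forall>p\<in>X. f (inv_into X g p) = h p"
 using poly_functions_compose[OF f(1), of m X "inv_into X g"] by blast
 have "sg g x = restrict h X"
 unfolding sg_def function_action_def compose_def using x f(2) h(2) automorphism_inv(2)[OF g] by (auto intro!: restrict_ext)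
 then show ?thesis using h(1) by simp
qed

lemma sg_hom: assumes g: "g : variety_automorphisms m X" shows "sg g : algebra_hom OX OX"
 by (rule algebra_homI) (auto intro!: O_eqI sg_closed[OF g] simp: automorphism_inv[OF g])

context
 fixes G assumes fin: "finite G" and sub: "subgroup G (BijGroup X)" and aut: "G <= variety_automorphisms m X"
begin

lemma galois: "galois_algebra OX (sg ` G)"
proof unfold_locales
 have gA: "g : variety_automorphisms m X" if "g : G" for g using that aut by blast
 have gB: "g : Bij X" if "g : G" for g using gA[OF that] by (auto simp: variety_automorphisms_def)
 have ext: "sig = tau" if "sig : extensional (carrier OX)" "tau : extensional (carrier OX)"
 "!!x. x : carrier OX ==> sig x : carrier OX & tau x : carrier OX & (\<forall>p\<in>X. sig x p = tau x p)" for sig tau :: "(point => complex) => (point => complex)"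
 by (rule extensionalityI[OF that(1,2)], rule O_eqI) (use that(3) in auto)
 have se: "sg g : extensional (carrier OX)" for g by (simp add: sg_def)
 show "finite (sg ` G)" using fin by simp
 show "sig : algebra_hom OX OX" "sig : extensional (carrier OX)" if "sig : sg ` G" for sig using that sg_hom gA se by auto
 show "(\<lambda>x\<in>carrier OX. x) : sg ` G"
 proof
 have one: "(\<lambda>x\<in>X. x) : G" using subgroup.one_closed[OF sub] by (simp add: BijGroup_def)
 then show "(\<lambda>x\<in>X. x) : G" .
 show "(\<lambda>x\<in>carrier OX. x) = sg (\<lambda>x\<in>X. x)"
 by (rule ext) (use se sg_closed[OF gA[OF one]] automorphism_inv(4)[OF gA[OF one]] in auto)
 qed
 show "compose (carrier OX) sig tau : sg ` G" if st: "sig : sg ` G" "tau : sg ` G" for sig tau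
 proof -
 obtain g h where gh: "g : G" "h : G" "sig = sg g" "tau = sg h" using st by blast
 have c: "compose X g h : G" using subgroup.m_closed[OF sub gh(1,2)] gB[OF gh(1)] gB[OF gh(2)] by (simp add: BijGroup_def)
 have "compose (carrier OX) (sg g) (sg h) = sg (compose X g h)"
 proof (rule ext)
 fix x assume x: "x : carrier OX"
 have hx: "sg h x : carrier OX" by (rule sg_closed[OF gA[OF gh(2)] x])
 have "sg g (sg h x) p = sg (compose X g h) x p" if p: "p : X" for p
 proof -
 note i = automorphism_inv(2,3)[OF gA[OF gh(1)] p]
 note j = automorphism_inv(2,3)[OF gA[OF gh(2)] i(1)]
 have "inv_into X (compose X g h) p = inv_into X h (inv_into X g p)"
 by (rule automorphism_inv(4)[OF gA[OF c] p j(1)]) (use i j in \<open>simp add: compose_def\<close>)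
 then show ?thesis using x hx p i(1) by simp
 qed
 then show "compose (carrier OX) (sg g) (sg h) x : carrier OX & sg (compose X g h) x : carrier OX &
 (\<forall>p\<in>X. compose (carrier OX) (sg g) (sg h) x p = sg (compose X g h) x p)"
 using x sg_closed[OF gA[OF gh(1)] hx] sg_closed[OF gA[OF c] x] by (simp add: compose_def)
 qed (use se in auto)
 then show ?thesis unfolding gh(3,4) using c by blast
 qed
 show "\<exists>tau\<in>sg ` G. \<forall>x\<in>carrier OX. tau (sig x) = x" if s: "sig : sg ` G" for sig
 proof -
 obtain g where g: "g : G" "sig = sg g" using s by blast
 define g' where "g' = (\<lambda>x\<in>X. inv_into X g x)"
 have g': "g' : G" using subgroup.m_inv_closed[OF sub g(1)] inv_BijGroup[OF gB[OF g(1)]] by (simp add: g'_def)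
 have "sg g' (sg g x) = x" if x: "x : carrier OX" for x
 proof (rule O_eqI)
 have gx: "sg g x : carrier OX" by (rule sg_closed[OF gA[OF g(1)] x])
 then show "sg g' (sg g x) : carrier OX" by (rule sg_closed[OF gA[OF g']])
 fix p assume p: "p : X"
 have gp: "g p : X" by (rule automorphism_inv(1)[OF gA[OF g(1)] p])
 have "inv_into X g' p = g p"
 by (rule automorphism_inv(4)[OF gA[OF g'] p gp]) (use gp automorphism_inv(4)[OF gA[OF g(1)] gp p] in \<open>simp add: g'_def\<close>)
 moreover have "inv_into X g (g p) = p" by (rule automorphism_inv(4)[OF gA[OF g(1)] gp p refl])
 ultimately show "sg g' (sg g x) p = x p" using x gx p gp by simp
 qed (rule x)
 then show ?thesis unfolding g(2) using g' by blast
 qed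
qed

text \<open>The induced action moves the members of a fraction class, which are pairs of operators
  on the coordinate ring; on these, the restricted and the unrestricted action on functions agree,
  also in the choice of preimages.\<close>

lemma invariants_sg:
 "invariants (frac_algebra (diffop_algebra OX)) (frac_diffop_action m X ` G) =
 invariants (frac_algebra (diffop_algebra OX)) ((%sig. frac_action (diffop_action OX sig)) ` sg ` G)"
proof -
 interpret GA: galois_algebra OX "sg ` G" by (rule galois)
 have act: "diffop_action OX (function_action X g) d = diffop_action OX (sg g) d" if g: "g : G" and d: "d : carrier (diffop_algebra OX)" for g d
 unfolding diffop_action_def
 proof (rule restrict_ext)
 fix f assume f: "f : carrier OX"
 have i: "inv_into (carrier OX) (function_action X g) f = inv_into (carrier OX) (sg g) f"
 unfolding inv_into_def sg_def by (rule arg_cong[of _ _ Eps]) (auto simp: fun_eq_iff)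
 have "f : sg g ` carrier OX" using GA.G_bij[of "sg g"] g f by (auto simp: bij_betw_def)
 then have "inv_into (carrier OX) (sg g) f : carrier OX" by (rule inv_into_into)
 then have "d (inv_into (carrier OX) (sg g) f) : carrier OX" using D_apply_closed d by blast
 then show "function_action X g (d (inv_into (carrier OX) (function_action X g) f)) = sg g (d (inv_into (carrier OX) (sg g) f))"
 unfolding i by (simp add: sg_def)
 qed
 have "frac_diffop_action m X g x = frac_action (diffop_action OX (sg g)) x" if g: "g : G" and x: "x : carrier (frac_algebra (diffop_algebra OX))" for g x
 proof -
 have "x <= carrier (diffop_algebra OX) \<times> carrier (diffop_algebra OX)" using x by (auto simp: frac_algebra_def frac_class_def)
 then show ?thesis unfolding frac_diffop_action_def frac_action_def using act[OF g] by (intro image_cong refl) auto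
 qed
 then have e: "{x : carrier (frac_algebra (diffop_algebra OX)). \<forall>phi\<in>frac_diffop_action m X ` G. phi x = x} =
 {x : carrier (frac_algebra (diffop_algebra OX)). \<forall>phi\<in>(%sig. frac_action (diffop_action OX sig)) ` sg ` G. phi x = x}" by auto
 show ?thesis unfolding invariants_def e ..
qed

end

end

section \<open>From the quotient variety to the ring of invariants\<close>

theorem theorem1p3:
  fixes m n k :: nat and X Y :: "point set" and G :: "(point \<Rightarrow> point) set"
  assumes "irreducible_affine_variety m X" and "has_dimension m X n"
    and "finite G" and "subgroup G (BijGroup X)" and "G \<subseteq> variety_automorphisms m X"
    and "is_quotient_variety m X G k Y" and "rational_variety k Y"
  shows "algebra_isomorphic
           (invariants (frac_algebra (diffop_algebra (coordinate_ring m X)))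
              (frac_diffop_action m X ` G))
           (weyl_field n)"
proof -
 interpret X: irreducible_variety m X by unfold_locales (rule assms(1))
 obtain qm where Yirr: "irreducible_affine_variety k Y" and iso: "(%f. compose X f qm) : algebra_iso (coordinate_ring k Y)
 (invariants (coordinate_ring m X) (function_action X ` G))" using assms(6) by (auto simp: is_quotient_variety_def)
 interpret Y: irreducible_variety k Y by unfold_locales (rule Yirr)
 obtain d U V phi psi where bir: "zariski_open_in k Y U" "U ~= {}" "zariski_open_in d (affine_space d) V"
 "regular_map k U d V phi" "regular_map d V k U psi" "\<forall>p\<in>U. psi (phi p) = p" "\<forall>q\<in>V. phi (psi q) = q"
 using assms(7) unfolding rational_variety_def birational_def by blast
 then obtain p0 where p0: "p0 : U" by blast
 have maps: "!!p. p : U ==> phi p : V" "!!q. q : V ==> psi q : U" "U <= Y" "V <= affine_space d"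
 using bir(1,3,4,5) by (auto simp: regular_map_def zariski_open_in_def)
 obtain a fs where a: "a : poly_functions k" "a p0 ~= 0" "\<forall>i<d. fs i : poly_functions k"
 "\<forall>p\<in>Y. a p ~= 0 --> p : U & (\<forall>i<d. phi p i * a p = fs i p)" using regular_principal[OF bir(1) Y.X_subset p0 bir(4)] by blast
 obtain b F where b: "b : poly_functions d" "b (phi p0) ~= 0" "\<forall>j<k. F j : poly_functions d"
 "\<forall>q\<in>affine_space d. b q ~= 0 --> q : V & (\<forall>j<k. psi q j * b q = F j q)" using regular_principal[OF bir(3) order_refl maps(1)[OF p0] bir(5)] by blast
 \<comment> \<open>The nonvanishing of \<open>a\<close> around \<open>p0\<close> and of
   \<open>b\<close> around \<open>phi p0\<close> cuts the birational map down to principal open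
   sets.\<close>
 interpret B: principal_birational k Y d phi psi a b fs F p0
 by unfold_locales (use a b maps bir(6,7) p0 in auto)
 obtain f pd where f: "f : carrier Y.OX" "f ~= \<zero>\<^bsub>Y.OX\<^esub>" and pd0: "\<forall>i<d. \<forall>c\<in>carrier Y.OX. pd i c : carrier Y.OX &
 (ALL l. pd i (l \<odot>\<^bsub>Y.OX\<^esub> c) = l \<odot>\<^bsub>Y.OX\<^esub> pd i c) &
 (\<forall>c'\<in>carrier Y.OX. pd i (c +.\<^bsub>Y.OX\<^esub> c') = pd i c +.\<^bsub>Y.OX\<^esub> pd i c' &
 pd i (c **\<^bsub>Y.OX\<^esub> c') = c **\<^bsub>Y.OX\<^esub> pd i c' +.\<^bsub>Y.OX\<^esub> c' **\<^bsub>Y.OX\<^esub> pd i c)"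
 "\<forall>i<d. \<forall>j<d. B.ww **\<^bsub>Y.OX\<^esub> pd i (B.uu j) \<ominus>\<^bsub>Y.OX\<^esub> B.uu j **\<^bsub>Y.OX\<^esub> pd i B.ww = (if i = j then (B.ww **\<^bsub>Y.OX\<^esub> B.ww) **\<^bsub>Y.OX\<^esub> f else \<zero>\<^bsub>Y.OX\<^esub>)"
 using B.derivations_exist by - (elim exE conjE, rule that, assumption+)
 note pd = pd0(1)[rule_format, THEN conjunct1] pd0(1)[rule_format, THEN conjunct2, THEN conjunct1, rule_format]
 pd0(1)[rule_format, THEN conjunct2, THEN conjunct2, rule_format, THEN conjunct1]
 pd0(1)[rule_format, THEN conjunct2, THEN conjunct2, rule_format, THEN conjunct2] pd0(2)[rule_format]
 interpret GA: galois_algebra X.OX "X.sg ` G" by (rule X.galois[OF assms(3-5)])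
 obtain mm :: nat and al be s where co: "al : {..<mm} \<rightarrow> carrier X.OX" "be : {..<mm} \<rightarrow> carrier X.OX" "s : GA.fixed" "s ~= \<zero>\<^bsub>X.OX\<^esub>"
 "\<forall>sig\<in>X.sg ` G. (\<Oplus>\<^bsub>X.OX\<^esub>i\<in>{..<mm}. al i **\<^bsub>X.OX\<^esub> sig (be i)) = (if sig = (\<lambda>x\<in>carrier X.OX. x) then s else \<zero>\<^bsub>X.OX\<^esub>)"
 using GA.galois_coordinates_exist by blast
 define tau where "tau f = compose X f qm" for f :: "point => complex"
 have fx: "carrier (invariants X.OX (function_action X ` G)) = GA.fixed"
 unfolding GA.fixed_def by (auto simp: invariants_def X.sg_def)
 have ti: "tau : ring_hom Y.OX (invariants X.OX (function_action X ` G))" "bij_betw tau (carrier Y.OX) GA.fixed"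
 "!!c x. x : carrier Y.OX ==> tau (c \<odot>\<^bsub>Y.OX\<^esub> x) = c \<odot>\<^bsub>X.OX\<^esub> tau x"
 using iso unfolding algebra_iso_def ring_iso_def fx tau_def[abs_def, symmetric] by (auto simp: invariants_def)
 have tauf: "tau c : GA.fixed" if "c : carrier Y.OX" for c using ti(2) that by (auto simp: bij_betw_def)
 have tau: "tau : algebra_hom Y.OX X.OX"
 using ring_hom_mult[OF ti(1)] ring_hom_add[OF ti(1)] ring_hom_one[OF ti(1)] ti(3) tauf GA.fixedD(1)
 by (intro algebra_homI) (auto simp: invariants_def)
 note H = algebra_homD[OF tau]
 \<comment> \<open>The derivations live on \<open>Y\<close>; conjugation with \<open>tau\<close>
   carries them to the invariants.\<close>
 define taui where "taui = inv_into (carrier Y.OX) tau"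
 have taui: "taui (tau c) = c" if "c : carrier Y.OX" for c unfolding taui_def using ti(2) that by (auto simp: bij_betw_def)
 have fixE: "EX c'. c' : carrier Y.OX & c = tau c'" if "c : GA.fixed" for c using ti(2) that by (auto simp: bij_betw_def)
 have tau0: "tau \<zero>\<^bsub>Y.OX\<^esub> = \<zero>\<^bsub>X.OX\<^esub>" by (rule algebra_hom_zero[OF Y.calgebra_axioms X.calgebra_axioms tau])
 have taunz: "c = \<zero>\<^bsub>Y.OX\<^esub>" if "c : carrier Y.OX" "tau c = \<zero>\<^bsub>X.OX\<^esub>" for c using taui[OF that(1)] taui[OF Y.zero_closed] that(2) tau0 by simp
 have taum: "tau (c \<ominus>\<^bsub>Y.OX\<^esub> c') = tau c \<ominus>\<^bsub>X.OX\<^esub> tau c'" if "c : carrier Y.OX" "c' : carrier Y.OX" for c c'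
 by (rule algebra_hom_minus[OF Y.calgebra_axioms X.calgebra_axioms tau that])
 have gen: "ALL (Q :: (complex, (((point => complex) => point => complex) \<times> ((point => complex) => point => complex)) set) module) J T.
 division_algebra Q & J : algebra_hom X.OX Q & (\<forall>a\<in>carrier X.OX. J a = \<zero>\<^bsub>Q\<^esub> --> a = \<zero>\<^bsub>X.OX\<^esub>) & ring.div_subring Q T &
 (ALL k. \<forall>t\<in>T. k \<odot>\<^bsub>Q\<^esub> t : T) & (\<forall>i<d. J (tau (B.uu i)) **\<^bsub>Q\<^esub> inv\<^bsub>Q\<^esub> (J (tau B.ww)) : T) --> J c : T"
 if c: "c : GA.fixed" for c
 proof (intro allI impI)
 obtain e where e: "e : carrier Y.OX" "c = tau e" using fixE c by blast
 fix Q :: "(complex, (((point => complex) => point => complex) \<times> ((point => complex) => point => complex)) set) module" and J T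
 assume A: "division_algebra Q & J : algebra_hom X.OX Q & (\<forall>a\<in>carrier X.OX. J a = \<zero>\<^bsub>Q\<^esub> --> a = \<zero>\<^bsub>X.OX\<^esub>) & ring.div_subring Q T &
 (ALL k. \<forall>t\<in>T. k \<odot>\<^bsub>Q\<^esub> t : T) & (\<forall>i<d. J (tau (B.uu i)) **\<^bsub>Q\<^esub> inv\<^bsub>Q\<^esub> (J (tau B.ww)) : T)"
 have "J (tau e) : T"
 proof (rule B.coordinates_generate[where J = "%x. J (tau x)" and Q = Q and T = T and c = e])
 show "(%x. J (tau x)) : algebra_hom Y.OX Q" using A by (intro algebra_hom_compose[OF tau]) simp
 show "x = \<zero>\<^bsub>Y.OX\<^esub>" if "x : carrier Y.OX" "J (tau x) = \<zero>\<^bsub>Q\<^esub>" for x using taunz[OF that(1)] A H(1)[OF that(1)] that(2) by simp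
 show "J (tau (B.uu i)) **\<^bsub>Q\<^esub> inv\<^bsub>Q\<^esub> (J (tau B.ww)) : T" if "i < d" for i using A that by simp
 qed (use A e in simp_all)
 then show "J c : T" unfolding e(2) .
 qed
 have R: "rational_galois X.OX (X.sg ` G) mm al be s d (%i. tau (B.uu i)) (tau B.ww) (tau f) (%i c. tau (pd i (taui c)))"
 proof (intro rational_galois.intro galois_coordinates.intro galois_coordinates_axioms.intro rational_galois_axioms.intro)
 show "galois_algebra X.OX (X.sg ` G)" by (rule GA.galois_algebra_axioms)
 show "al i : carrier X.OX" "be i : carrier X.OX" if "i < mm" for i using co(1,2) that by auto
 show "s : GA.fixed" "s ~= \<zero>\<^bsub>X.OX\<^esub>" by (rule co)+
 show "(\<Oplus>\<^bsub>X.OX\<^esub>i\<in>{..<mm}. al i **\<^bsub>X.OX\<^esub> sig (be i)) = (if sig = (\<lambda>x\<in>carrier X.OX. x) then s else \<zero>\<^bsub>X.OX\<^esub>)" if "sig : X.sg ` G" for sig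
 using co(5) that by blast
 show "ore_domain (diffop_algebra X.OX)" by (rule X.O_diffop_ore_domain)
 show "tau (B.uu i) : GA.fixed" if "i < d" for i using tauf B.uw(1) that by blast
 show "tau B.ww : GA.fixed" "tau f : GA.fixed" using tauf B.uw(2) f(1) by auto
 show "tau B.ww ~= \<zero>\<^bsub>X.OX\<^esub>" "tau f ~= \<zero>\<^bsub>X.OX\<^esub>" using taunz B.uw(2,3) f by auto
 show "tau (pd i (taui c)) : GA.fixed" if "i < d" "c : GA.fixed" for i c
 using fixE[OF that(2)] taui pd(1)[OF that(1)] tauf by auto
 show "tau (pd i (taui (c +.\<^bsub>X.OX\<^esub> c'))) = tau (pd i (taui c)) +.\<^bsub>X.OX\<^esub> tau (pd i (taui c'))"
 "tau (pd i (taui (c **\<^bsub>X.OX\<^esub> c'))) = c **\<^bsub>X.OX\<^esub> tau (pd i (taui c')) +.\<^bsub>X.OX\<^esub> c' **\<^bsub>X.OX\<^esub> tau (pd i (taui c))"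
 if i: "i < d" and c: "c : GA.fixed" "c' : GA.fixed" for i c c'
 proof -
 obtain e e' where e: "e : carrier Y.OX" "c = tau e" "e' : carrier Y.OX" "c' = tau e'" using fixE c by blast
 show "tau (pd i (taui (c +.\<^bsub>X.OX\<^esub> c'))) = tau (pd i (taui c)) +.\<^bsub>X.OX\<^esub> tau (pd i (taui c'))"
 proof -
 have "taui (tau e +.\<^bsub>X.OX\<^esub> tau e') = e +.\<^bsub>Y.OX\<^esub> e'" unfolding H(3)[OF e(1,3), symmetric] using e(1,3) by (simp add: taui)
 then show ?thesis unfolding e(2,4) using e(1,3) i by (simp add: taui pd(1,3) H(3))
 qed
 show "tau (pd i (taui (c **\<^bsub>X.OX\<^esub> c'))) = c **\<^bsub>X.OX\<^esub> tau (pd i (taui c')) +.\<^bsub>X.OX\<^esub> c' **\<^bsub>X.OX\<^esub> tau (pd i (taui c))"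
 proof -
 have "taui (tau e **\<^bsub>X.OX\<^esub> tau e') = e **\<^bsub>Y.OX\<^esub> e'" unfolding H(2)[OF e(1,3), symmetric] using e(1,3) by (simp add: taui)
 then show ?thesis unfolding e(2,4) using e(1,3) i by (simp add: taui pd(1,4) H(2,3))
 qed
 qed
 show "tau (pd i (taui (l \<odot>\<^bsub>X.OX\<^esub> c))) = l \<odot>\<^bsub>X.OX\<^esub> tau (pd i (taui c))" if i: "i < d" and c: "c : GA.fixed" for i c l
 proof -
 obtain e where e: "e : carrier Y.OX" "c = tau e" using fixE c by blast
 have "taui (l \<odot>\<^bsub>X.OX\<^esub> tau e) = l \<odot>\<^bsub>Y.OX\<^esub> e" unfolding H(5)[OF e(1), symmetric] using e(1) by (simp add: taui)
 then show ?thesis unfolding e(2) using e(1) i by (simp add: taui pd(1,2) H(5))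
 qed
 show "tau B.ww **\<^bsub>X.OX\<^esub> tau (pd i (taui (tau (B.uu j)))) \<ominus>\<^bsub>X.OX\<^esub> tau (B.uu j) **\<^bsub>X.OX\<^esub> tau (pd i (taui (tau B.ww))) =
 (if i = j then (tau B.ww **\<^bsub>X.OX\<^esub> tau B.ww) **\<^bsub>X.OX\<^esub> tau f else \<zero>\<^bsub>X.OX\<^esub>)" if ij: "i < d" "j < d" for i j
 proof -
 note u = B.uw(1)[OF ij(2)] B.uw(2) pd(1)[OF ij(1)]
 have "tau B.ww **\<^bsub>X.OX\<^esub> tau (pd i (taui (tau (B.uu j)))) \<ominus>\<^bsub>X.OX\<^esub> tau (B.uu j) **\<^bsub>X.OX\<^esub> tau (pd i (taui (tau B.ww))) =
 tau (B.ww **\<^bsub>Y.OX\<^esub> pd i (B.uu j) \<ominus>\<^bsub>Y.OX\<^esub> B.uu j **\<^bsub>Y.OX\<^esub> pd i B.ww)"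
 using u by (simp add: taui taum H(2))
 also have "... = (if i = j then (tau B.ww **\<^bsub>X.OX\<^esub> tau B.ww) **\<^bsub>X.OX\<^esub> tau f else \<zero>\<^bsub>X.OX\<^esub>)"
 unfolding pd(5)[OF ij] using u f by (simp add: H(2) tau0)
 finally show ?thesis .
 qed
 show "ALL (Q :: (complex, (((point => complex) => point => complex) \<times> ((point => complex) => point => complex)) set) module) J T.
 division_algebra Q & J : algebra_hom X.OX Q & (\<forall>a\<in>carrier X.OX. J a = \<zero>\<^bsub>Q\<^esub> --> a = \<zero>\<^bsub>X.OX\<^esub>) & ring.div_subring Q T &
 (ALL k. \<forall>t\<in>T. k \<odot>\<^bsub>Q\<^esub> t : T) & (\<forall>i<d. J (tau (B.uu i)) **\<^bsub>Q\<^esub> inv\<^bsub>Q\<^esub> (J (tau B.ww)) : T) --> J c : T"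
 if c: "c : GA.fixed" for c by (rule gen[OF c])
 qed
 obtain B where B: "transcendence_basis (frac_algebra X.OX) B" "card B = n"
 using assms(2) by (auto simp: has_dimension_def function_field_def)
 \<comment> \<open>\<open>d\<close> comes from rationality of the quotient and \<open>n\<close> from
   a transcendence basis of the function field of \<open>X\<close>; any such basis has
   \<open>d\<close> elements.\<close>
 have "n = d" using rational_galois.dimension_eq[OF R B(1)] B(2) by simp
 then show ?thesis using rational_galois.invariants_isomorphic[OF R] X.invariants_sg[OF assms(3-5)] by simp
qed

end
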